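(* Let $\ell\ge 1$ be an integer. The following two sets are in one-to-one correspondence: (1) Artinian local $F$-algebras $R$ of length $\ell(R)=\ell$, up to isomorphism of $F$-algebras; (2) equivalence classes of $\mathbb{G}_a^{\ell-1}$-structures on $\mathbb{P}^{\ell-1}$. The correspondence sends $R$ to the action of $\mathbb{G}_a^{\ell-1}$ on $\mathbb{P}(R)\cong\mathbb{P}^{\ell-1}$ obtained by exponentiating the multiplication action of the maximal ideal $m_R$ on $R$.
   Context: The base field is $F=\overline{\mathbb{Q}}$. For a connected linear algebraic group $\mathbb{G}$, a $\mathbb{G}$-variety is a variety $X$ with a fixed left $\mathbb{G}$-action such that the stabilizer of a generic point is trivial and the orbit of a generic point is dense. A $\mathbb{G}$-structure on a variety $Y$ is a $\mathbb{G}$-action making $Y$ a $\mathbb{G}$-variety. Two $\mathbb{G}$-varieties $X_1,X_2$ are equivalent if there are $\alpha\in\mathrm{Aut}(\mathbb{G})$ and an isomorphism of varieties $j:X_1\to X_2$ with $j(g\cdot x)=\alpha(g)\cdot j(x)$. If $R$ is an Artinian local $F$-algebra of length $\ell$ and $S_1,\dots,S_{\ell-1}$ is an $F$-basis of its maximal ideal $m_R$, then $(x_1,\dots,x_{\ell-1})\in\mathbb{G}_a^{\ell-1}$ acts on $R$ by multiplication by $\exp(x_1S_1+\dots+x_{\ell-1}S_{\ell-1})$, hence on the projective space $\mathbb{P}(R)$ of lines in $R$.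
   Formalization: Artinian local F-algebras are taken to be finite-dimensional over F; otherwise F(t), of length 1 and not isomorphic to F, would be a counterexample, and P(R) would not be isomorphic to P^{ℓ-1}. *)

theory Defs
  imports "HOL-Algebra.Algebraic_Closure_Type" "HOL-Library.Extended_Nat"
begin

type_synonym Qbar = "rat alg_closure"

text \<open>Coordinate vectors: a vector of the \<open>k\<close>-dimensional space is a sequence vanishing from
  index \<open>k\<close> on.\<close>

type_synonym coords = "nat \<Rightarrow> Qbar"

definition coord_space :: "nat \<Rightarrow> coords set" where
  "coord_space k = {v. \<forall>i\<ge>k. v i = 0}"


section \<open>Varieties and morphisms\<close>

text \<open>A variety is recorded by its closed points, its Zariski topology and its sheaf of regular
  functions; \<open>regular M U f\<close> only concerns the values of \<open>f\<close> on \<open>U\<close>. A morphism is a continuous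
  map along which regular functions pull back to regular functions.\<close>

record 'p variety =
  points :: "'p set"
  zopen :: "'p set \<Rightarrow> bool"
  regular :: "'p set \<Rightarrow> ('p \<Rightarrow> Qbar) \<Rightarrow> bool"

definition morphism :: "'p variety \<Rightarrow> 'q variety \<Rightarrow> ('p \<Rightarrow> 'q) \<Rightarrow> bool" where
  "morphism M N \<theta> \<longleftrightarrow>
     \<theta> ` points M \<subseteq> points N \<and>
     (\<forall>V. zopen N V \<longrightarrow>
        zopen M {p \<in> points M. \<theta> p \<in> V} \<and>
        (\<forall>f. regular N V f \<longrightarrow> regular M {p \<in> points M. \<theta> p \<in> V} (\<lambda>p. f (\<theta> p))))"

definition variety_iso :: "'p variety \<Rightarrow> 'q variety \<Rightarrow> ('p \<Rightarrow> 'q) \<Rightarrow> bool" where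
  "variety_iso M N \<theta> \<longleftrightarrow>
     morphism M N \<theta> \<and>
     (\<exists>\<psi>. morphism N M \<psi> \<and> (\<forall>p\<in>points M. \<psi> (\<theta> p) = p) \<and> (\<forall>q\<in>points N. \<theta> (\<psi> q) = q))"

lemma morphism_id: "morphism M M (\<lambda>p. p)"
  if "\<And>U. zopen M U \<Longrightarrow> U \<subseteq> points M"
proof -
  have "{p \<in> points M. p \<in> V} = V" if "zopen M V" for V
    using that \<open>\<And>U. zopen M U \<Longrightarrow> U \<subseteq> points M\<close> by blast
  then show ?thesis
    by (auto simp: morphism_def)
qed

lemma morphism_comp:
  assumes f: "morphism M N f" and g: "morphism N K g"
  shows "morphism M K (\<lambda>p. g (f p))"
proof -
  have sub: "f ` points M \<subseteq> points N" "g ` points N \<subseteq> points K"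
    using f g by (auto simp: morphism_def)
  have eq: "{p \<in> points M. f p \<in> {q \<in> points N. g q \<in> V}} = {p \<in> points M. g (f p) \<in> V}" for V
    using sub by auto
  have f': "zopen M {p \<in> points M. f p \<in> V}"
    "regular N V h \<Longrightarrow> regular M {p \<in> points M. f p \<in> V} (\<lambda>p. h (f p))" if "zopen N V" for V h
    using f that by (simp_all add: morphism_def)
  have g': "zopen N {q \<in> points N. g q \<in> V}"
    "regular K V h \<Longrightarrow> regular N {q \<in> points N. g q \<in> V} (\<lambda>q. h (g q))" if "zopen K V" for V h
    using g that by (simp_all add: morphism_def)
  show ?thesis
    unfolding morphism_def
  proof (intro conjI allI impI)
    show "(\<lambda>p. g (f p)) ` points M \<subseteq> points K"
      using sub by auto
  next
    fix V assume V: "zopen K V"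
    show "zopen M {p \<in> points M. g (f p) \<in> V}"
      using f'(1)[OF g'(1)[OF V]] by (simp only: eq)
    fix h assume "regular K V h"
    then show "regular M {p \<in> points M. g (f p) \<in> V} (\<lambda>p. h (g (f p)))"
      using f'(2)[OF g'(1)[OF V] g'(2)[OF V]] by (simp only: eq)
  qed
qed

lemma variety_iso_comp:
  assumes "variety_iso M N f" and "variety_iso N K g"
  shows "variety_iso M K (\<lambda>p. g (f p))"
proof -
  obtain f' g' where f': "morphism N M f'" "\<forall>p\<in>points M. f' (f p) = p" "\<forall>q\<in>points N. f (f' q) = q"
    and g': "morphism K N g'" "\<forall>p\<in>points N. g' (g p) = p" "\<forall>q\<in>points K. g (g' q) = q"
    and fg: "morphism M N f" "morphism N K g"
    using assms by (auto simp: variety_iso_def)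
  have "f ` points M \<subseteq> points N" "g' ` points K \<subseteq> points N"
    using fg g' by (auto simp: morphism_def)
  then show ?thesis
    unfolding variety_iso_def
    using morphism_comp[OF fg] morphism_comp[OF g'(1) f'(1)] f' g'
    by (intro conjI exI[of _ "\<lambda>r. f' (g' r)"]) (auto simp: image_subset_iff)
qed

definition dense_in :: "'p variety \<Rightarrow> 'p set \<Rightarrow> bool" where
  "dense_in M S \<longleftrightarrow> (\<forall>U. zopen M U \<and> U \<noteq> {} \<longrightarrow> U \<inter> S \<noteq> {})"

definition generically :: "'p variety \<Rightarrow> ('p \<Rightarrow> bool) \<Rightarrow> bool" where
  "generically M P \<longleftrightarrow> (\<exists>U. zopen M U \<and> dense_in M U \<and> (\<forall>p\<in>U. P p))"

text \<open>Common construction of affine space, projective space and their product. The set \<open>reps p\<close>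
  consists of the coordinate vectors representing \<open>p\<close>, and \<open>H d\<close> of the polynomial functions
  that are homogeneous of degree \<open>d\<close> in the projective coordinates. Closed sets are the zero
  loci, and regular functions are locally quotients of two elements of the same \<open>H d\<close>.\<close>

definition coord_open :: "'p set \<Rightarrow> ('p \<Rightarrow> 'c set) \<Rightarrow> (nat \<Rightarrow> ('c \<Rightarrow> Qbar) set) \<Rightarrow> 'p set \<Rightarrow> bool" where
  "coord_open P reps H U \<longleftrightarrow>
     (\<exists>T \<subseteq> (\<Union>d. H d). U = P - {p \<in> P. \<forall>f\<in>T. \<forall>v\<in>reps p. f v = 0})"

definition coord_variety :: "'p set \<Rightarrow> ('p \<Rightarrow> 'c set) \<Rightarrow> (nat \<Rightarrow> ('c \<Rightarrow> Qbar) set) \<Rightarrow> 'p variety" where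
  "coord_variety P reps H =
     \<lparr> points = P,
       zopen = coord_open P reps H,
       regular = (\<lambda>U f. \<forall>p\<in>U. \<exists>W d g h.
          coord_open P reps H W \<and> p \<in> W \<and> W \<subseteq> U \<and> g \<in> H d \<and> h \<in> H d \<and>
          (\<forall>q\<in>W. \<forall>v\<in>reps q. h v \<noteq> 0 \<and> f q = g v / h v)) \<rparr>"

definition monom_fun :: "nat \<Rightarrow> (nat \<Rightarrow> nat) \<Rightarrow> coords \<Rightarrow> Qbar" where
  "monom_fun k a v = (\<Prod>i<k. v i ^ a i)"

definition polys :: "nat \<Rightarrow> (coords \<Rightarrow> Qbar) set" where
  "polys m = {f. \<exists>A c. finite A \<and> f = (\<lambda>x. \<Sum>a\<in>A. c a * monom_fun m a x)}"

definition forms :: "nat \<Rightarrow> nat \<Rightarrow> (coords \<Rightarrow> Qbar) set" where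
  "forms k d = {f. \<exists>A c. finite A \<and> (\<forall>a\<in>A. (\<Sum>i<k. a i) = d) \<and>
                   f = (\<lambda>v. \<Sum>a\<in>A. c a * monom_fun k a v)}"

text \<open>Polynomials in \<open>m + k\<close> variables, homogeneous of degree \<open>d\<close> in the last \<open>k\<close> of them.\<close>

definition mixed_forms :: "nat \<Rightarrow> nat \<Rightarrow> nat \<Rightarrow> (coords \<times> coords \<Rightarrow> Qbar) set" where
  "mixed_forms m k d = {f. \<exists>A c. finite A \<and> (\<forall>(a, b)\<in>A. (\<Sum>i<k. b i) = d) \<and>
     f = (\<lambda>(x, v). \<Sum>(a, b)\<in>A. c a b * monom_fun m a x * monom_fun k b v)}"

definition line :: "coords \<Rightarrow> coords set" where
  "line v = {(\<lambda>i. c * v i) | c. True}"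

definition proj_points :: "nat \<Rightarrow> coords set set" where
  "proj_points n = line ` (coord_space (Suc n) - {\<lambda>_. 0})"

definition affine :: "nat \<Rightarrow> coords variety" where
  "affine m = coord_variety (coord_space m) (\<lambda>x. {x}) (\<lambda>_. polys m)"

definition proj :: "nat \<Rightarrow> coords set variety" where
  "proj n = coord_variety (proj_points n) (\<lambda>L. L - {\<lambda>_. 0}) (forms (Suc n))"

definition affine_proj :: "nat \<Rightarrow> nat \<Rightarrow> (coords \<times> coords set) variety" where
  "affine_proj m n = coord_variety (coord_space m \<times> proj_points n)
     (\<lambda>(x, L). {x} \<times> (L - {\<lambda>_. 0})) (mixed_forms m (Suc n))"


section \<open>Actions of vector groups on projective space\<close>

abbreviation vadd :: "coords \<Rightarrow> coords \<Rightarrow> coords" where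
  "vadd x y \<equiv> (\<lambda>i. x i + y i)"

text \<open>The group variety of \<open>\<G>\<^sub>a\<^sup>m\<close> is \<open>affine m\<close>, with group law \<open>vadd\<close>.\<close>

definition Ga_aut :: "nat \<Rightarrow> (coords \<Rightarrow> coords) \<Rightarrow> bool" where
  "Ga_aut m \<alpha> \<longleftrightarrow> variety_iso (affine m) (affine m) \<alpha> \<and>
     (\<forall>x\<in>coord_space m. \<forall>y\<in>coord_space m. \<alpha> (vadd x y) = vadd (\<alpha> x) (\<alpha> y))"

text \<open>The \<open>\<G>\<^sub>a\<^sup>m\<close>-structures on projective \<open>n\<close>-space. As group schemes in characteristic zero are
  reduced, a stabilizer is trivial as soon as its group of closed points is.
  The values of \<open>act\<close> off \<open>coord_space m\<close> and \<open>proj_points n\<close> are unconstrained; they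
  are ignored by the equivalence \<open>Ga_equiv\<close> below.\<close>

definition Ga_structures :: "nat \<Rightarrow> nat \<Rightarrow> (coords \<Rightarrow> coords set \<Rightarrow> coords set) set" where
  "Ga_structures m n = {act.
     morphism (affine_proj m n) (proj n) (\<lambda>(x, L). act x L) \<and>
     (\<forall>L\<in>points (proj n). act (\<lambda>_. 0) L = L) \<and>
     (\<forall>x\<in>coord_space m. \<forall>y\<in>coord_space m. \<forall>L\<in>points (proj n).
        act (vadd x y) L = act x (act y L)) \<and>
     generically (proj n) (\<lambda>L. {x \<in> coord_space m. act x L = L} = {\<lambda>_. 0}) \<and>
     generically (proj n) (\<lambda>L. dense_in (proj n) ((\<lambda>x. act x L) ` coord_space m))}"

definition Ga_equiv :: "nat \<Rightarrow> nat \<Rightarrow>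
    ((coords \<Rightarrow> coords set \<Rightarrow> coords set) \<times> (coords \<Rightarrow> coords set \<Rightarrow> coords set)) set" where
  "Ga_equiv m n = {(act1, act2). act1 \<in> Ga_structures m n \<and> act2 \<in> Ga_structures m n \<and>
     (\<exists>\<alpha> j. Ga_aut m \<alpha> \<and> variety_iso (proj n) (proj n) j \<and>
        (\<forall>x\<in>coord_space m. \<forall>L\<in>points (proj n). j (act1 x L) = act2 (\<alpha> x) (j L)))}"


lemma points_affine: "points (affine m) = coord_space m"
  by (simp add: affine_def coord_variety_def)

lemma zopen_subset_affine: "U \<subseteq> points (affine m)" if "zopen (affine m) U"
  using that by (auto simp: affine_def coord_variety_def coord_open_def)

lemma zopen_subset_proj: "U \<subseteq> points (proj n)" if "zopen (proj n) U"
  using that by (auto simp: proj_def coord_variety_def coord_open_def)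

lemma equiv_Ga: "equiv (Ga_structures m n) (Ga_equiv m n)"
proof (rule equivI)
  show "Ga_equiv m n \<subseteq> Ga_structures m n \<times> Ga_structures m n"
    by (auto simp: Ga_equiv_def)
  have i: "variety_iso M M (\<lambda>p. p)" if "\<And>U. zopen M U \<Longrightarrow> U \<subseteq> points M" for M :: "'p variety"
    unfolding variety_iso_def using morphism_id[OF that] by auto
  show "refl_on (Ga_structures m n) (Ga_equiv m n)"
  proof (rule refl_onI)
    fix a assume "a \<in> Ga_structures m n"
    moreover have "Ga_aut m (\<lambda>x. x)"
      unfolding Ga_aut_def using i[of "affine m"] zopen_subset_affine by auto
    moreover have "variety_iso (proj n) (proj n) (\<lambda>x. x)"
      using i[of "proj n"] zopen_subset_proj by auto
    ultimately show "(a, a) \<in> Ga_equiv m n"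
      unfolding Ga_equiv_def by blast
  qed
  show "trans (Ga_equiv m n)"
  proof (rule transI)
    fix a b c assume "(a, b) \<in> Ga_equiv m n" "(b, c) \<in> Ga_equiv m n"
    then obtain f j g k where st: "a \<in> Ga_structures m n" "c \<in> Ga_structures m n"
      and f: "Ga_aut m f" and g: "Ga_aut m g"
      and j: "variety_iso (proj n) (proj n) j" and k: "variety_iso (proj n) (proj n) k"
      and e1: "\<forall>x\<in>coord_space m. \<forall>L\<in>points (proj n). j (a x L) = b (f x) (j L)"
      and e2: "\<forall>x\<in>coord_space m. \<forall>L\<in>points (proj n). k (b x L) = c (g x) (k L)"
      unfolding Ga_equiv_def by blast
    have fm: "f x \<in> coord_space m" if "x \<in> coord_space m" for x
      using f that by (auto simp: Ga_aut_def variety_iso_def morphism_def points_affine)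
    have jm: "j L \<in> points (proj n)" if "L \<in> points (proj n)" for L
      using j that by (auto simp: variety_iso_def morphism_def)
    have "Ga_aut m (\<lambda>x. g (f x))"
      using f g variety_iso_comp[of "affine m" "affine m" f "affine m" g] fm
      unfolding Ga_aut_def by simp
    moreover have "\<forall>x\<in>coord_space m. \<forall>L\<in>points (proj n). k (j (a x L)) = c (g (f x)) (k (j L))"
      using e1 e2 fm jm by simp
    ultimately show "(a, c) \<in> Ga_equiv m n"
      using st variety_iso_comp[OF j k] unfolding Ga_equiv_def
      by (intro CollectI case_prodI conjI exI[of _ "\<lambda>x. g (f x)"] exI[of _ "\<lambda>L. k (j L)"]) simp_all
  qed
  show "sym (Ga_equiv m n)"
  proof (rule symI)
    fix a b assume "(a, b) \<in> Ga_equiv m n"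
    then obtain f j where st: "a \<in> Ga_structures m n" "b \<in> Ga_structures m n"
      and f: "Ga_aut m f" and j: "variety_iso (proj n) (proj n) j"
      and e: "\<forall>x\<in>coord_space m. \<forall>L\<in>points (proj n). j (a x L) = b (f x) (j L)"
      unfolding Ga_equiv_def by blast
    obtain f' where f': "morphism (affine m) (affine m) f'"
      "\<forall>x\<in>coord_space m. f' (f x) = x" "\<forall>x\<in>coord_space m. f (f' x) = x"
      using f by (auto simp: Ga_aut_def variety_iso_def points_affine)
    obtain j' where j': "morphism (proj n) (proj n) j'"
      "\<forall>L\<in>points (proj n). j' (j L) = L" "\<forall>L\<in>points (proj n). j (j' L) = L"
      using j by (auto simp: variety_iso_def)
    have f'm: "f' x \<in> coord_space m" if "x \<in> coord_space m" for x
      using f' that by (auto simp: morphism_def points_affine)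
    have j'm: "j' L \<in> points (proj n)" if "L \<in> points (proj n)" for L
      using j' that by (auto simp: morphism_def)
    have am: "a x L \<in> points (proj n)" if "x \<in> coord_space m" "L \<in> points (proj n)" for x L
      using st(1) that
      by (auto simp: Ga_structures_def morphism_def affine_proj_def proj_def coord_variety_def)
    have ji: "variety_iso (proj n) (proj n) j'"
      using j j' by (auto simp: variety_iso_def)
    have add: "f' (vadd x y) = vadd (f' x) (f' y)" if "x \<in> coord_space m" "y \<in> coord_space m" for x y
    proof -
      have "f (vadd (f' x) (f' y)) = vadd x y"
        using f f' f'm that by (auto simp: Ga_aut_def)
      moreover have "vadd (f' x) (f' y) \<in> coord_space m"
        using f'm[OF that(1)] f'm[OF that(2)] by (auto simp: coord_space_def)
      ultimately show ?thesis using f'(2) by metis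
    qed
    have fi: "Ga_aut m f'"
      using f f' add by (auto simp: Ga_aut_def variety_iso_def points_affine)
    have "j' (b x L) = a (f' x) (j' L)" if "x \<in> coord_space m" "L \<in> points (proj n)" for x L
    proof -
      have "j (a (f' x) (j' L)) = b x L"
        using e f' j' f'm[OF that(1)] j'm[OF that(2)] that by simp
      then show ?thesis using j'(2) am f'm[OF that(1)] j'm[OF that(2)] by metis
    qed
    then show "(b, a) \<in> Ga_equiv m n"
      unfolding Ga_equiv_def using st fi ji by blast
  qed
qed


section \<open>Artinian local algebras\<close>

definition artinian :: "('a, 'b) ring_scheme \<Rightarrow> bool" where
  "artinian R \<longleftrightarrow> (\<nexists>I :: nat \<Rightarrow> 'a set. \<forall>n. ideal (I n) R \<and> I (Suc n) \<subset> I n)"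

definition local_ring :: "('a, 'b) ring_scheme \<Rightarrow> bool" where
  "local_ring R \<longleftrightarrow> cring R \<and> (\<exists>!I. maximalideal I R)"

definition max_ideal :: "('a, 'b) ring_scheme \<Rightarrow> 'a set" where
  "max_ideal R = (THE I. maximalideal I R)"

definition ring_length :: "('a, 'b) ring_scheme \<Rightarrow> enat" where
  "ring_length R = Sup {enat n | n. \<exists>I :: nat \<Rightarrow> 'a set.
     (\<forall>i\<le>n. ideal (I i) R) \<and> (\<forall>i<n. I i \<subset> I (Suc i))}"

text \<open>The copy of the base field inside an algebra, over which the notions of dimension, span and
  independence from \<^theory>\<open>HOL-Algebra.Embedded_Algebras\<close> are taken.\<close>

definition scalars :: "(Qbar, 'a) module \<Rightarrow> 'a set" where
  "scalars R = {c \<odot>\<^bsub>R\<^esub> \<one>\<^bsub>R\<^esub> | c. True}"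

text \<open>Artinian local algebras are understood to be finite-dimensional over the base field. This
  excludes, for example, proper field extensions, which have length \<open>1\<close>; it amounts to the
  maximal ideal having a basis of \<open>l - 1\<close> elements.\<close>

definition artinian_local_algebras :: "nat \<Rightarrow> (Qbar, 'a) module set" where
  "artinian_local_algebras l = {R.
     algebra (ring_of_type_algebra :: Qbar ring) R \<and>
     artinian R \<and> local_ring R \<and>
     ring.finite_dimension R (scalars R) (carrier R) \<and>
     ring_length R = enat l}"

definition algebra_iso_rel :: "nat \<Rightarrow> ((Qbar, 'a) module \<times> (Qbar, 'a) module) set" where
  "algebra_iso_rel l = {(R, R'). R \<in> artinian_local_algebras l \<and> R' \<in> artinian_local_algebras l \<and>
     (\<exists>h \<in> ring_iso R R'. \<forall>c. \<forall>r\<in>carrier R. h (c \<odot>\<^bsub>R\<^esub> r) = c \<odot>\<^bsub>R'\<^esub> h r)}"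

lemma equiv_algebra_iso: "equiv (artinian_local_algebras l) (algebra_iso_rel l)"
proof (rule equivI)
  show "algebra_iso_rel l \<subseteq> artinian_local_algebras l \<times> artinian_local_algebras l"
    by (auto simp: algebra_iso_rel_def)
  show "refl_on (artinian_local_algebras l) (algebra_iso_rel l)"
  proof (rule refl_onI)
    fix R :: "(Qbar, 'b) module" assume "R \<in> artinian_local_algebras l"
    moreover have "id \<in> ring_iso R R"
      by (auto simp: ring_iso_def ring_hom_def)
    ultimately show "(R, R) \<in> algebra_iso_rel l"
      unfolding algebra_iso_rel_def by (intro CollectI case_prodI conjI bexI[of _ id]) simp_all
  qed
  show "trans (algebra_iso_rel l)"
  proof (rule transI)
    fix R R' R'' :: "(Qbar, 'b) module"
    assume "(R, R') \<in> algebra_iso_rel l" "(R', R'') \<in> algebra_iso_rel l"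
    then obtain f g where al: "R \<in> artinian_local_algebras l" "R'' \<in> artinian_local_algebras l"
      and f: "f \<in> ring_iso R R'" "\<forall>c. \<forall>r\<in>carrier R. f (c \<odot>\<^bsub>R\<^esub> r) = c \<odot>\<^bsub>R'\<^esub> f r"
      and g: "g \<in> ring_iso R' R''" "\<forall>c. \<forall>r\<in>carrier R'. g (c \<odot>\<^bsub>R'\<^esub> r) = c \<odot>\<^bsub>R''\<^esub> g r"
      by (auto simp: algebra_iso_rel_def)
    have "\<forall>r\<in>carrier R. f r \<in> carrier R'"
      using f(1) by (auto simp: ring_iso_def ring_hom_def)
    then show "(R, R'') \<in> algebra_iso_rel l"
      using al f(2) g(2) ring_iso_set_trans[OF f(1) g(1)] unfolding algebra_iso_rel_def
      by (intro CollectI case_prodI conjI bexI[of _ "g \<circ> f"]) simp_all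
  qed
  show "sym (algebra_iso_rel l)"
  proof (rule symI)
    fix R R' :: "(Qbar, 'b) module"
    assume "(R, R') \<in> algebra_iso_rel l"
    then obtain f where al: "R \<in> artinian_local_algebras l" "R' \<in> artinian_local_algebras l"
      and f: "f \<in> ring_iso R R'" "\<forall>c. \<forall>r\<in>carrier R. f (c \<odot>\<^bsub>R\<^esub> r) = c \<odot>\<^bsub>R'\<^esub> f r"
      by (auto simp: algebra_iso_rel_def)
    have alg: "algebra (ring_of_type_algebra :: Qbar ring) R"
      using al by (simp add: artinian_local_algebras_def)
    then have ring: "ring R"
      by (rule cring.axioms(1)[OF algebra.axioms(2)])
    have bij: "bij_betw f (carrier R) (carrier R')"
      using f(1) by (simp add: ring_iso_def)
    let ?g = "inv_into (carrier R) f"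
    have g: "?g \<in> ring_iso R' R"
      using ring_iso_set_sym[OF ring f(1)] .
    have "?g (c \<odot>\<^bsub>R'\<^esub> r) = c \<odot>\<^bsub>R\<^esub> ?g r" if "r \<in> carrier R'" for c r
    proof -
      have s: "?g r \<in> carrier R" "f (?g r) = r"
        using bij that by (auto simp: bij_betw_def inv_into_into f_inv_into_f)
      then have "f (c \<odot>\<^bsub>R\<^esub> ?g r) = c \<odot>\<^bsub>R'\<^esub> r"
        using f(2) by simp
      moreover have "c \<odot>\<^bsub>R\<^esub> ?g r \<in> carrier R"
        using module.smult_closed[OF algebra.axioms(1)[OF alg], of c "?g r"] s
        by (simp add: ring_of_type_algebra_def)
      ultimately show ?thesis
        using bij by (metis bij_betw_inv_into_left)
    qed
    then show "(R', R) \<in> algebra_iso_rel l"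
      using al g unfolding algebra_iso_rel_def
      by (intro CollectI case_prodI conjI bexI[of _ ?g]) simp_all
  qed
qed

definition max_ideal_basis :: "(Qbar, 'a) module \<Rightarrow> 'a list \<Rightarrow> bool" where
  "max_ideal_basis R S \<longleftrightarrow>
     ring.independent R (scalars R) S \<and> ring.Span R (scalars R) S = max_ideal R"

text \<open>Linear coordinates on an algebra; they induce the identification of \<open>\<P>(R)\<close> with
  projective \<open>(l - 1)\<close>-space.\<close>

definition linear_coords :: "nat \<Rightarrow> (Qbar, 'a) module \<Rightarrow> ('a \<Rightarrow> coords) \<Rightarrow> bool" where
  "linear_coords l R \<psi> \<longleftrightarrow>
     bij_betw \<psi> (carrier R) (coord_space l) \<and>
     (\<forall>r\<in>carrier R. \<forall>s\<in>carrier R. \<psi> (r \<oplus>\<^bsub>R\<^esub> s) = vadd (\<psi> r) (\<psi> s)) \<and>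
     (\<forall>c. \<forall>r\<in>carrier R. \<psi> (c \<odot>\<^bsub>R\<^esub> r) = (\<lambda>i. c * \<psi> r i))"

text \<open>The exponential series of a nilpotent element, summed over its finitely many nonzero
  powers.\<close>

definition nilpotent_exp :: "(Qbar, 'a) module \<Rightarrow> 'a \<Rightarrow> 'a" where
  "nilpotent_exp R s =
     (\<Oplus>\<^bsub>R\<^esub> k \<in> {k :: nat. s [^]\<^bsub>R\<^esub> k \<noteq> \<zero>\<^bsub>R\<^esub>}. inverse (fact k) \<odot>\<^bsub>R\<^esub> (s [^]\<^bsub>R\<^esub> k))"

text \<open>Multiplication by \<open>exp (x\<^sub>1 S\<^sub>1 + \<dots>)\<close> on lines of \<open>R\<close>, transported along \<open>\<psi>\<close>.\<close>

definition exp_action ::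
    "(Qbar, 'a) module \<Rightarrow> 'a list \<Rightarrow> ('a \<Rightarrow> coords) \<Rightarrow> coords \<Rightarrow> coords set \<Rightarrow> coords set" where
  "exp_action R S \<psi> x L =
     (\<lambda>v. \<psi> (nilpotent_exp R (\<Oplus>\<^bsub>R\<^esub> i \<in> {..<length S}. x i \<odot>\<^bsub>R\<^esub> (S ! i))
              \<otimes>\<^bsub>R\<^esub> inv_into (carrier R) \<psi> v)) ` L"

end

theory Submission
  imports Defs "HOL-Computational_Algebra.Polynomial" "HOL-Library.Function_Algebras"
    "HOL-Library.Countable_Set"
begin

text \<open>Polynomial rings are factorial, so a morphism \<open>\<A>\<^sup>m \<times> \<P>\<^sup>n \<rightarrow> \<P>\<^sup>n\<close> is given by a single tuple of
  polynomials without common factor. Hence every automorphism of \<open>\<P>\<^sup>n\<close> is linear, and every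
  action of the vector group on \<open>\<P>\<^sup>n\<close> lifts to a linear representation. If \<open>v\<^sub>0\<close> spans a generic
  line, it is a cyclic vector of this representation, so evaluation at \<open>v\<^sub>0\<close> identifies the commutant
  with the whole coordinate space and turns the latter into a commutative algebra. Polynomial
  one-parameter groups in this algebra are exponentials of nilpotent elements, and triviality of
  the stabilizer makes their derivatives a basis of a maximal ideal; thus the action is an
  exponential action. An equivalence of two exponential actions is linear, may be assumed to send
  unit to unit, and on comparing derivatives respects multiplication, that is, it is an
  isomorphism of algebras. Conversely, the algebras with linear coordinates that are local are
  exactly those whose nilpotent elements have codimension one; their length is their dimension.\<close>

section \<open>Factorial subdomains and Gauss's lemma\<close>

text \<open>Varieties are given by closed points and regular functions only, so unique factorization
  takes the place of divisors and line bundles. What it yields is a tuple of polynomials on the cone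
  that a priori is neither homogeneous nor linear. The scalars by which composites of such tuples
  may differ from the identity are controlled by one principle: a polynomial in one variable without
  zeros over an algebraically closed field is constant. It is applied along lines of the cone that
  miss the origin; joining all vectors by such lines takes at least two homogeneous coordinates,
  hence \<open>n = 0\<close> is treated apart. Factoriality is stated for subsets of a domain
  because the number of variables changes during the induction. On the way back, density of the
  orbit needs the exponential to be onto the unipotent elements, and the length of the algebra needs
  a composition series with one-dimensional steps. Since algebras have their carriers in a given
  infinite type, every algebra built on a coordinate space is copied into that type, which is
  possible because the field of algebraic numbers is countable.\<close>

definition subdomain :: "'a::idom set \<Rightarrow> bool" where
  "subdomain A \<longleftrightarrow> 1 \<in> A \<and> (\<forall>x\<in>A. \<forall>y\<in>A. x - y \<in> A \<and> x * y \<in> A)"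

definition dvd_in :: "'a::idom set \<Rightarrow> 'a \<Rightarrow> 'a \<Rightarrow> bool" where
  "dvd_in A a b \<longleftrightarrow> (\<exists>c\<in>A. b = a * c)"

definition prime_in :: "'a::idom set \<Rightarrow> 'a \<Rightarrow> bool" where
  "prime_in A p \<longleftrightarrow> p \<in> A \<and> p \<noteq> 0 \<and> \<not> dvd_in A p 1 \<and>
     (\<forall>a\<in>A. \<forall>b\<in>A. dvd_in A p (a * b) \<longrightarrow> dvd_in A p a \<or> dvd_in A p b)"

text \<open>Products of primes, not of irreducibles. The index counts the prime factors and serves
  as the measure in later inductions.\<close>

inductive prime_product :: "'a::idom set \<Rightarrow> nat \<Rightarrow> 'a \<Rightarrow> bool" for A where
  unit: "u \<in> A \<Longrightarrow> dvd_in A u 1 \<Longrightarrow> prime_product A 0 u"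
| prime: "prime_in A p \<Longrightarrow> prime_product A n f \<Longrightarrow> prime_product A (Suc n) (p * f)"

text \<open>In a domain, existence of factorizations into primes already amounts to unique
  factorization.\<close>

definition factorial_in :: "'a::idom set \<Rightarrow> bool" where
  "factorial_in A \<longleftrightarrow> subdomain A \<and> (\<forall>f\<in>A. f \<noteq> 0 \<longrightarrow> (\<exists>n. prime_product A n f))"

definition polys_over :: "'a::idom set \<Rightarrow> 'a poly set" where
  "polys_over A = {q. \<forall>i. coeff q i \<in> A}"

lemma subdomainD:
  assumes "subdomain A"
  shows "0 \<in> A" "1 \<in> A" "x \<in> A \<Longrightarrow> y \<in> A \<Longrightarrow> x + y \<in> A" "x \<in> A \<Longrightarrow> - x \<in> A"
    "x \<in> A \<Longrightarrow> y \<in> A \<Longrightarrow> x - y \<in> A" "x \<in> A \<Longrightarrow> y \<in> A \<Longrightarrow> x * y \<in> A"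
proof -
  have d: "x - y \<in> A" if "x \<in> A" "y \<in> A" for x y using assms that by (auto simp: subdomain_def)
  show one: "1 \<in> A" using assms by (auto simp: subdomain_def)
  show z: "0 \<in> A" using d[OF one one] by simp
  have n: "- x \<in> A" if "x \<in> A" for x using d[OF z that] by simp
  show "x \<in> A \<Longrightarrow> - x \<in> A" by (rule n)
  show "x \<in> A \<Longrightarrow> y \<in> A \<Longrightarrow> x - y \<in> A" by (rule d)
  show "x \<in> A \<Longrightarrow> y \<in> A \<Longrightarrow> x + y \<in> A" using d[of x "- y"] n[of y] by simp
  show "x \<in> A \<Longrightarrow> y \<in> A \<Longrightarrow> x * y \<in> A" using assms by (auto simp: subdomain_def)
qed

lemma subdomain_sum: "subdomain A \<Longrightarrow> (\<And>i. i \<in> I \<Longrightarrow> f i \<in> A) \<Longrightarrow> sum f I \<in> A"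
  by (induction I rule: infinite_finite_induct) (auto simp: subdomainD)

lemma prime_product_in: "subdomain A \<Longrightarrow> prime_product A n f \<Longrightarrow> f \<in> A"
  by (rotate_tac, induction rule: prime_product.induct) (auto simp: prime_in_def subdomainD)

lemma prime_product_mult:
  assumes A: "subdomain A" and f: "prime_product A m f" and g: "prime_product A n g"
  shows "prime_product A (m + n) (f * g)"
  using f
proof (induction rule: prime_product.induct)
  case (unit u)
  from g show ?case
  proof (induction rule: prime_product.induct)
    case (unit w)
    from \<open>dvd_in A u 1\<close> \<open>dvd_in A w 1\<close> obtain u' w' where "u' \<in> A" "1 = u * u'" "w' \<in> A" "1 = w * w'"
      by (auto simp: dvd_in_def)
    then have "1 = u * w * (u' * w')" by (metis mult.assoc mult.left_commute mult.right_neutral)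
    then have "dvd_in A (u * w) 1"
      using A \<open>u' \<in> A\<close> \<open>w' \<in> A\<close> unfolding dvd_in_def by (blast intro: subdomainD)
    then show ?case using unit A \<open>u \<in> A\<close> by (simp add: prime_product.unit subdomainD)
  next
    case (prime p n f)
    then show ?case by (metis add_Suc_right mult.left_commute prime_product.prime)
  qed
next
  case (prime p n f)
  then show ?case by (simp add: mult.assoc prime_product.prime)
qed

lemma polys_over_subdomain:
  assumes "subdomain A" shows "subdomain (polys_over A)"
  unfolding subdomain_def[of "polys_over A"]
  using assms by (auto simp: polys_over_def coeff_mult coeff_1 intro!: subdomainD subdomain_sum)

lemma polys_over_simps:
  assumes "subdomain A"
  shows "a \<in> A \<Longrightarrow> f \<in> polys_over A \<Longrightarrow> smult a f \<in> polys_over A"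
    "a \<in> A \<Longrightarrow> monom a n \<in> polys_over A" "a \<in> A \<Longrightarrow> [:a:] \<in> polys_over A"
  using assms by (auto simp: polys_over_def subdomainD coeff_pCons split: nat.splits)

lemma const_dvd_in_polys_over:
  assumes A: "subdomain A"
  shows "dvd_in (polys_over A) [:p:] f \<longleftrightarrow> (\<forall>i. dvd_in A p (coeff f i))"
proof
  assume "dvd_in (polys_over A) [:p:] f"
  then show "\<forall>i. dvd_in A p (coeff f i)"
    by (auto simp: dvd_in_def polys_over_def)
next
  assume r: "\<forall>i. dvd_in A p (coeff f i)"
  then obtain c where c: "\<And>i. c i \<in> A" "\<And>i. coeff f i = p * c i"
    unfolding dvd_in_def by metis
  define g where "g = (\<Sum>i\<le>degree f. monom (c i) i)"
  have "f = (\<Sum>i\<le>degree f. monom (coeff f i) i)"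
    by (simp add: poly_as_sum_of_monoms)
  also have "\<dots> = [:p:] * g"
    by (simp add: g_def c(2) sum_distrib_left smult_monom)
  finally have "f = [:p:] * g" .
  moreover have "g \<in> polys_over A"
    unfolding g_def by (intro subdomain_sum polys_over_subdomain polys_over_simps A c)
  ultimately show "dvd_in (polys_over A) [:p:] f" unfolding dvd_in_def by blast
qed

lemma dvd_in_add: "subdomain A \<Longrightarrow> dvd_in A p a \<Longrightarrow> dvd_in A p b \<Longrightarrow> dvd_in A p (a + b)"
  unfolding dvd_in_def by (metis distrib_left subdomainD(3))

lemma dvd_in_diff: "subdomain A \<Longrightarrow> dvd_in A p a \<Longrightarrow> dvd_in A p b \<Longrightarrow> dvd_in A p (a - b)"
  unfolding dvd_in_def by (metis right_diff_distrib subdomainD(5))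

lemma dvd_in_mult: "subdomain A \<Longrightarrow> dvd_in A p a \<Longrightarrow> b \<in> A \<Longrightarrow> dvd_in A p (a * b)"
  unfolding dvd_in_def by (metis mult.assoc subdomainD(6))

lemma dvd_in_sum:
  "subdomain A \<Longrightarrow> (\<And>i. i \<in> I \<Longrightarrow> dvd_in A p (f i)) \<Longrightarrow> dvd_in A p (sum f I)"
proof (induction I rule: infinite_finite_induct)
  case (insert x F)
  then show ?case by (simp add: dvd_in_add)
qed (auto simp: dvd_in_def intro: bexI[of _ 0] subdomainD)

text \<open>The first prime \<open>q\<close> of \<open>a\<close> divides \<open>p\<close> or
  \<open>b\<close>. If it divides \<open>p\<close>, the two are associates and \<open>b\<close> is a
  unit times the remaining factors; otherwise \<open>q\<close> is cancelled and the induction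
  continues. The strict drop \<open>j < n\<close> makes repeated division by primes
  terminate.\<close>

lemma prime_product_cancel:
  assumes A: "subdomain A" and p: "prime_in A p"
    and "prime_product A n a" "a = p * b" "b \<in> A"
  shows "\<exists>j<n. prime_product A j b"
  using assms(3-)
proof (induction arbitrary: b rule: prime_product.induct)
  case (unit u)
  then have "dvd_in A p 1" using A
    unfolding dvd_in_def by (metis mult.assoc subdomainD(6))
  then show ?case using p by (auto simp: prime_in_def)
next
  case (prime q n a)
  have p0: "p \<noteq> 0" using p by (auto simp: prime_in_def)
  have aA: "a \<in> A" using prime_product_in[OF A] prime by blast
  have q: "q \<in> A" "q \<noteq> 0" using prime by (auto simp: prime_in_def)
  have "dvd_in A q (p * b)" unfolding dvd_in_def using prime.prems(1) aA by (intro bexI[of _ a]) simp_all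
  then consider c where "c \<in> A" "p = q * c" | c where "c \<in> A" "b = q * c"
    using prime p unfolding prime_in_def dvd_in_def by metis
  then show ?case
  proof cases
    case 1
    then have "dvd_in A p q \<or> dvd_in A p c"
      using p q unfolding prime_in_def dvd_in_def
      by (metis A mult.right_neutral subdomainD(2))
    moreover have "\<not> dvd_in A p c"
    proof
      assume "dvd_in A p c"
      then obtain e where "e \<in> A" "c = p * e" by (auto simp: dvd_in_def)
      then have "p * 1 = p * (q * e)" using 1 by (simp add: mult.left_commute)
      then have "1 = q * e" using p0 by (metis mult_cancel_left)
      then show False using prime(1) \<open>e \<in> A\<close> unfolding prime_in_def dvd_in_def by blast
    qed
    ultimately obtain e where e: "e \<in> A" "q = p * e" by (auto simp: dvd_in_def)
    then have "p * 1 = p * (e * c)" using 1(2) by (metis mult.assoc mult.right_neutral)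
    then have ec: "1 = e * c" using p0 by (metis mult_cancel_left)
    then have cu: "dvd_in A e 1" using 1 unfolding dvd_in_def by blast
    have "p * b = p * (e * a)" using prime.prems(1) e(2) by (metis mult.assoc)
    then have "b = e * a" using p0 by (metis mult_cancel_left)
    then have "prime_product A (0 + n) b"
      using prime_product_mult[OF A prime_product.unit[OF e(1) cu] prime(2)] by simp
    then show ?thesis by auto
  next
    case 2
    then have "q * a = q * (p * c)" using prime by (simp add: mult.left_commute)
    then have "a = p * c" using q by (metis mult_cancel_left)
    then obtain j where "j < n" "prime_product A j c" using prime.IH 2 by blast
    then show ?thesis using 2 prime(1) by (metis Suc_mono prime_product.prime)
  qed
qed

text \<open>Gauss: if \<open>p\<close> divides neither \<open>f\<close> nor \<open>g\<close>, let
  \<open>i\<close> and \<open>j\<close> be the least indices of coefficients not divisible by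
  \<open>p\<close>. Modulo \<open>p\<close>, the coefficient of index \<open>i + j\<close> in the
  product is the product of these two.\<close>

lemma prime_in_const_poly:
  assumes A: "subdomain A" and p: "prime_in A p"
  shows "prime_in (polys_over A) [:p:]"
proof -
  have 1: "\<not> dvd_in (polys_over A) [:p:] 1"
    using p by (auto simp: const_dvd_in_polys_over[OF A] prime_in_def coeff_1 intro!: exI[of _ 0])
  have "dvd_in (polys_over A) [:p:] f \<or> dvd_in (polys_over A) [:p:] g"
    if f: "f \<in> polys_over A" and g: "g \<in> polys_over A" and fg: "dvd_in (polys_over A) [:p:] (f * g)" for f g
  proof (rule ccontr)
    assume n: "\<not> ?thesis"
    define i where "i = (LEAST i. \<not> dvd_in A p (coeff f i))"
    define j where "j = (LEAST j. \<not> dvd_in A p (coeff g j))"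
    have ni: "\<not> dvd_in A p (coeff f i)" and nj: "\<not> dvd_in A p (coeff g j)"
      unfolding i_def j_def using n by (metis (mono_tags, lifting) const_dvd_in_polys_over[OF A] LeastI)+
    have li: "dvd_in A p (coeff f k)" if "k < i" for k
      using that unfolding i_def by (blast dest: not_less_Least)
    have lj: "dvd_in A p (coeff g k)" if "k < j" for k
      using that unfolding j_def by (blast dest: not_less_Least)
    have c: "coeff f k \<in> A" "coeff g k \<in> A" for k using f g by (auto simp: polys_over_def)
    have "dvd_in A p (\<Sum>k\<in>{..i+j}-{i}. coeff f k * coeff g (i + j - k))"
    proof (intro dvd_in_sum A)
      fix k assume "k \<in> {..i+j} - {i}"
      then consider "k < i" | "i + j - k < j" by force
      then show "dvd_in A p (coeff f k * coeff g (i + j - k))"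
        by cases (metis A c dvd_in_mult li, metis A c dvd_in_mult lj mult.commute)
    qed
    moreover have "coeff (f * g) (i + j) =
        coeff f i * coeff g j + (\<Sum>k\<in>{..i+j}-{i}. coeff f k * coeff g (i + j - k))"
      unfolding coeff_mult by (subst sum.remove[of _ i]) auto
    ultimately have "dvd_in A p (coeff f i * coeff g j)"
      using fg[unfolded const_dvd_in_polys_over[OF A], rule_format, of "i + j"] dvd_in_diff[OF A, of p]
      by (metis add_diff_cancel_right')
    then show False using p c ni nj unfolding prime_in_def by blast
  qed
  with 1 p show ?thesis unfolding prime_in_def[of "polys_over A"]
    by (auto simp: prime_in_def[of A] polys_over_simps[OF A])
qed

text \<open>Every prime of the constant \<open>a\<close> divides one of the two factors, by
  primality of prime constants, and is removed from it. This brings a factorization found over the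
  fraction field back to \<open>A\<close> without introducing that field.\<close>

lemma cancel_prime_product:
  assumes A: "subdomain A" and a: "prime_product A n a"
    and "f \<in> polys_over A" "q \<in> polys_over A" "r \<in> polys_over A" "smult a f = q * r"
  shows "\<exists>a1\<in>A. \<exists>a2\<in>A. \<exists>q1\<in>polys_over A. \<exists>r1\<in>polys_over A.
    f = q1 * r1 \<and> q = smult a1 q1 \<and> r = smult a2 r1"
  using a assms(3-)
proof (induction arbitrary: q r rule: prime_product.induct)
  case (unit u)
  then obtain w where w: "w \<in> A" "1 = u * w" by (auto simp: dvd_in_def)
  have "f = q * smult w r"
    using w unit by (metis mult.commute mult_smult_right smult_1_left smult_smult)
  moreover have "r = smult u (smult w r)" using w by (metis smult_1_left smult_smult)
  ultimately show ?case
    using unit(1,4,5) w(1) A subdomainD(2)[OF A] polys_over_simps(1)[OF A w(1) unit(5)]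
    by (metis smult_1_left)
next
  case (prime p n a)
  have const_mult: "[:p:] * g = smult p g" for g by simp
  have pp: "prime_in (polys_over A) [:p:]" by (rule prime_in_const_poly[OF A prime(1)])
  have aA: "a \<in> A" using prime_product_in[OF A prime(2)] .
  have pA: "p \<in> A" "p \<noteq> 0" using prime(1) by (auto simp: prime_in_def)
  have "q * r = [:p:] * smult a f" using prime by (simp add: mult.commute)
  then have "dvd_in (polys_over A) [:p:] (q * r)"
    using prime aA A unfolding dvd_in_def by (blast intro: polys_over_simps)
  then consider q' where "q' \<in> polys_over A" "q = smult p q'" | r' where "r' \<in> polys_over A" "r = smult p r'"
    using pp[unfolded prime_in_def] prime.prems(2,3) const_mult unfolding dvd_in_def by metis
  then show ?case
  proof cases
    case 1
    then have "smult p (smult a f) = smult p (q' * r)" using prime by simp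
    then have "smult a f = q' * r" using pA by (metis smult_cancel)
    from prime.IH[OF prime(4) 1(1) prime(6) this] show ?thesis
      using 1 pA A by (metis smult_smult subdomainD(6))
  next
    case 2
    then have "smult p (smult a f) = smult p (q * r')" using prime by simp
    then have "smult a f = q * r'" using pA by (metis smult_cancel)
    from prime.IH[OF prime(4) prime(5) 2(1) this] show ?thesis
      using 2 pA A by (metis smult_smult subdomainD(6))
  qed
qed

text \<open>Euclidean division over the fraction field with denominators cleared: \<open>a\<close>
  is a product of copies of the leading coefficient of \<open>g\<close>. The bound \<open>n\<close>
  on the degree, rather than the degree itself, lets the zero polynomial start the
  induction.\<close>

lemma pseudo_division:
  assumes A: "subdomain A" and g: "g \<in> polys_over A" "g \<noteq> 0"
  shows "f \<in> polys_over A \<Longrightarrow> (\<And>i. i \<ge> n \<Longrightarrow> coeff f i = 0) \<Longrightarrow>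
    \<exists>a\<in>A. \<exists>q\<in>polys_over A. \<exists>r\<in>polys_over A.
      a \<noteq> 0 \<and> smult a f = g * q + r \<and> (r = 0 \<or> degree r < degree g)"
proof (induction n arbitrary: f)
  case 0
  then have "f = 0" by (simp add: poly_eq_iff)
  then show ?case using A polys_over_subdomain[OF A]
    by (intro bexI[of _ "1 :: 'a"] bexI[of _ "0 :: 'a poly"]) (auto simp: subdomainD)
next
  case (Suc n)
  let ?P = "polys_over A"
  have P: "subdomain ?P" by (rule polys_over_subdomain[OF A])
  show ?case
  proof (cases "n < degree g")
    case True
    then have "degree f < degree g" using Suc(3)
      by (meson degree_le le_less_trans not_less_eq_eq order_less_le_trans linorder_not_less)
    moreover have "1 \<in> A" "0 \<in> ?P" "smult 1 f = g * 0 + f" using A P by (auto simp: subdomainD)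
    ultimately show ?thesis using Suc(2) one_neq_zero by blast
  next
    case False
    define c where "c = lead_coeff g"
    have c: "c \<in> A" "c \<noteq> 0" using g by (auto simp: c_def polys_over_def)
    have fn: "coeff f n \<in> A" using Suc(2) by (auto simp: polys_over_def)
    define m where "m = monom (coeff f n) (n - degree g)"
    have m: "m \<in> ?P" using fn A by (simp add: m_def polys_over_simps)
    define f' where "f' = smult c f - m * g"
    have f': "f' \<in> ?P"
      using c Suc(2) m g P A by (simp add: f'_def polys_over_simps subdomainD)
    have z: "coeff f' i = 0" if "i \<ge> n" for i
    proof (cases "i = n")
      case True
      then show ?thesis using False by (simp add: f'_def m_def coeff_monom_mult c_def)
    next
      case ne: False
      then have "coeff f i = 0" "coeff g (i - (n - degree g)) = 0"
        using that Suc(3)[of i] False by (auto intro: coeff_eq_0)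
      then show ?thesis using that by (simp add: f'_def m_def coeff_monom_mult)
    qed
    obtain a q r where h: "a \<in> A" "q \<in> ?P" "r \<in> ?P" "a \<noteq> 0" "smult a f' = g * q + r"
      "r = 0 \<or> degree r < degree g"
      using Suc.IH[OF f' z] by blast
    have "smult (a * c) f = g * (q + smult a m) + r"
      using h(5) by (simp add: f'_def smult_diff_right algebra_simps)
    moreover have "q + smult a m \<in> ?P" "a * c \<in> A" "a * c \<noteq> 0"
      using h c m A P by (auto simp: polys_over_simps subdomainD)
    ultimately show ?thesis using h by blast
  qed
qed

text \<open>Gauss: the ideal generated by \<open>f\<close> and \<open>g\<close> contains a nonzero element \<open>r\<close> of minimal degree,
  which divides \<open>f\<close> and \<open>g\<close> up to constants from \<open>A\<close>; constants can be cancelled prime by prime.\<close>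

lemma irreducible_imp_prime_in:
  assumes fA: "factorial_in A" and f: "f \<in> polys_over A" "degree f > 0"
    and irr: "\<And>g h. g \<in> polys_over A \<Longrightarrow> h \<in> polys_over A \<Longrightarrow> f = g * h \<Longrightarrow>
      dvd_in (polys_over A) g 1 \<or> dvd_in (polys_over A) h 1"
  shows "prime_in (polys_over A) f"
proof -
  let ?P = "polys_over A"
  have A: "subdomain A" using fA by (simp add: factorial_in_def)
  have P: "subdomain ?P" by (rule polys_over_subdomain[OF A])
  have f0: "f \<noteq> 0" using f by auto
  have unit_deg: "degree g = 0" if "dvd_in ?P g 1" for g
    using that unfolding dvd_in_def by (metis degree_mult_eq degree_1 add_is_0 mult_eq_0_iff one_neq_zero)
  have const_mult: "[:p:] * g = smult p g" for p and g :: "'a poly" by simp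
  have nu: "\<not> dvd_in ?P f 1" using unit_deg f by force
  have fact: "\<exists>n. prime_product A n a" if "a \<in> A" "a \<noteq> 0" for a
    using fA that by (auto simp: factorial_in_def)
  \<comment> \<open>A constant factor on the left can be cancelled: its primes are split between
    \<open>f\<close> and \<open>w\<close>, and the part taken from \<open>f\<close> is a unit
    because \<open>f\<close> is irreducible of positive degree.\<close>
  have cancel: "dvd_in ?P f h" if c: "a \<in> A" "a \<noteq> 0" "h \<in> ?P" "w \<in> ?P" "smult a h = f * w" for a h w
  proof -
    obtain a1 a2 q1 r1 where *: "a1 \<in> A" "a2 \<in> A" "q1 \<in> ?P" "r1 \<in> ?P" "h = q1 * r1" "f = smult a1 q1"
      using cancel_prime_product[OF A _ c(3) f(1) c(4,5)] fact[OF c(1,2)] by metis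
    have "f = [:a1:] * q1" unfolding const_mult by (rule *(6))
    then have "dvd_in ?P [:a1:] 1 \<or> dvd_in ?P q1 1"
      by (rule irr[OF polys_over_simps(3)[OF A *(1)] *(3)])
    moreover have "degree q1 \<noteq> 0" using *(6) f by (auto split: if_splits)
    ultimately have "dvd_in ?P [:a1:] 1" using unit_deg[of q1] by argo
    then obtain b where b: "b \<in> ?P" "1 = smult a1 b" by (auto simp: dvd_in_def)
    have "q1 = f * b" using *(6) b(2)
      by (metis mult.commute mult_smult_left mult_smult_right mult_1)
    then show ?thesis using * b P unfolding dvd_in_def
      by (metis mult.assoc subdomainD(6))
  qed
  have "dvd_in ?P f g \<or> dvd_in ?P f h" if g: "g \<in> ?P" and h: "h \<in> ?P" and fgh: "dvd_in ?P f (g * h)" for g h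
  proof (rule disjCI)
    assume ng: "\<not> dvd_in ?P f h"
    define I where "I = {u * f + v * h | u v. u \<in> ?P \<and> v \<in> ?P}"
    have IP: "e \<in> ?P" if "e \<in> I" for e
      using that f(1) h P by (auto simp: I_def subdomainD)
    have "f = 1 * f + 0 * h" "h = 0 * f + 1 * h" by simp_all
    then have fI: "f \<in> I" and hI: "h \<in> I"
      unfolding I_def using subdomainD(1,2)[OF P] by blast+
    obtain r where r: "r \<in> I" "r \<noteq> 0" and rmin: "\<And>s. s \<in> I \<Longrightarrow> s \<noteq> 0 \<Longrightarrow> degree r \<le> degree s"
      using ex_has_least_nat[of "\<lambda>e. e \<in> I \<and> e \<noteq> 0" f degree] fI f0 by blast
    have div: "\<exists>a\<in>A. \<exists>q\<in>?P. a \<noteq> 0 \<and> smult a e = q * r" if e: "e \<in> I" for e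
    proof -
      obtain a q s where *: "a \<in> A" "q \<in> ?P" "s \<in> ?P" "a \<noteq> 0" "smult a e = r * q + s"
        "s = 0 \<or> degree s < degree r"
        using pseudo_division[OF A IP[OF r(1)] r(2) IP[OF e], of "Suc (degree e)"] by (metis Suc_le_lessD coeff_eq_0)
      from e r(1) obtain u v u' v' where uv: "u \<in> ?P" "v \<in> ?P" "u' \<in> ?P" "v' \<in> ?P"
        "e = u * f + v * h" "r = u' * f + v' * h" by (auto simp: I_def)
      have "s = (smult a u - q * u') * f + (smult a v - q * v') * h"
      proof -
        have "s = smult a e - r * q" using *(5) by (simp add: algebra_simps)
        then show ?thesis by (simp add: uv(5,6) smult_add_right algebra_simps)
      qed
      moreover have "smult a u - q * u' \<in> ?P" "smult a v - q * v' \<in> ?P"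
        using uv * P A by (auto simp: subdomainD polys_over_simps)
      ultimately have "s \<in> I" by (auto simp: I_def)
      then have "s = 0" using rmin *(6) by fastforce
      then show ?thesis using * by (metis add.right_neutral mult.commute)
    qed
    obtain a q where aq: "a \<in> A" "q \<in> ?P" "a \<noteq> 0" "smult a f = q * r" using div[OF fI] by blast
    obtain a1 a2 q1 r1 where *: "a1 \<in> A" "a2 \<in> A" "q1 \<in> ?P" "r1 \<in> ?P" "f = q1 * r1" "q = smult a1 q1" "r = smult a2 r1"
      using cancel_prime_product[OF A _ f(1) aq(2) IP[OF r(1)] aq(4)] fact[OF aq(1,3)] by metis
    have a2: "a2 \<noteq> 0" using * r(2) by auto
    consider "dvd_in ?P q1 1" | "dvd_in ?P r1 1" using irr * by blast
    then show "dvd_in ?P f g"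
    proof cases
      \<comment> \<open>Here \<open>r\<close> agrees with \<open>f\<close> up to constants, so
        \<open>f\<close> divides \<open>h\<close> after cancelling, against the assumption.\<close>
      case 1
      then obtain b where b: "b \<in> ?P" "1 = q1 * b" by (auto simp: dvd_in_def)
      have r1: "r1 = f * b" using *(5) b(2) by (metis mult.assoc mult.commute mult_1)
      obtain c q' where cq: "c \<in> A" "q' \<in> ?P" "c \<noteq> 0" "smult c h = q' * r" using div[OF hI] by blast
      have "smult c h = f * (smult a2 (b * q'))"
        using cq(4) *(7) r1 by (simp add: algebra_simps)
      moreover have "smult a2 (b * q') \<in> ?P"
        using b(1) cq(2) *(2) by (intro polys_over_simps(1)[OF A] subdomainD(6)[OF P])
      ultimately have "dvd_in ?P f h" using cancel[OF cq(1,3) h] by blast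
      with ng show ?thesis by simp
    next
      \<comment> \<open>Here \<open>r\<close> is a constant \<open>k\<close> lying in the ideal of
        \<open>f\<close> and \<open>h\<close>; multiplied by \<open>g\<close> it becomes a multiple
        of \<open>f\<close>.\<close>
      case 2
      then have "degree r1 = 0" by (rule unit_deg)
      then have "degree r = 0" using * by simp
      then obtain k where k: "r = [:k:]" using degree_eq_zeroE by blast
      have "k \<in> A" using IP[OF r(1)] k unfolding polys_over_def by (metis coeff_pCons_0 mem_Collect_eq)
      from r(1) obtain u v where uv: "u \<in> ?P" "v \<in> ?P" "r = u * f + v * h" by (auto simp: I_def)
      obtain w where w: "w \<in> ?P" "g * h = f * w" using fgh by (auto simp: dvd_in_def)
      have "smult k g = r * g" using k by simp
      also have "\<dots> = f * (u * g) + v * (g * h)" using uv by (simp add: algebra_simps)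
      also have "\<dots> = f * (u * g + v * w)" using w by (simp add: algebra_simps)
      finally have "smult k g = f * (u * g + v * w)" .
      moreover have "u * g + v * w \<in> ?P"
        using uv w g by (intro subdomainD(3,6)[OF P])
      moreover have "k \<noteq> 0" using k r by auto
      ultimately show ?thesis using cancel[OF \<open>k \<in> A\<close> _ g] by blast
    qed
  qed
  then show ?thesis using f nu f0 by (auto simp: prime_in_def)
qed

text \<open>Prime constants are split off first; their number is bounded through the leading
  coefficient. A polynomial without prime constant factors is then factored by induction on the
  degree, since every proper factorization lowers the degree of both factors.\<close>

lemma factorial_in_polys_over:
  assumes fA: "factorial_in A"
  shows "factorial_in (polys_over A)"
proof -
  let ?P = "polys_over A"
  have A: "subdomain A" using fA by (simp add: factorial_in_def)
  have P: "subdomain ?P" by (rule polys_over_subdomain[OF A])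
  have const: "prime_product ?P n [:a:]" if "prime_product A n a" for n a
    using that
  proof (induction rule: prime_product.induct)
    case (unit u)
    then obtain w where "w \<in> A" "1 = u * w" by (auto simp: dvd_in_def)
    then have "1 = [:u:] * [:w:]" by (simp add: one_pCons mult.commute)
    then have "dvd_in ?P [:u:] 1" using \<open>w \<in> A\<close> A unfolding dvd_in_def by (blast intro: polys_over_simps)
    then show ?case using unit A by (intro prime_product.unit) (auto simp: polys_over_simps)
  next
    case (prime p n f)
    have "[:p * f:] = [:p:] * [:f:]" by simp
    then show ?case using prime prime_in_const_poly[OF A] by (metis prime_product.prime)
  qed
  have prim: "\<exists>n. prime_product ?P n f"
    if "f \<in> ?P" "f \<noteq> 0" "degree f < d" "\<And>p. prime_in A p \<Longrightarrow> \<not> dvd_in ?P [:p:] f" for f d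
    using that
  proof (induction d arbitrary: f)
    case (Suc d)
    \<comment> \<open>A factor of degree 0 is a constant; a prime occurring in it would be a prime
      constant dividing \<open>f\<close>, so it is a unit.\<close>
    have constf: "dvd_in ?P g 1" if "g \<in> ?P" "h \<in> ?P" "f = g * h" "degree g = 0" for g h
    proof -
      obtain a where a: "g = [:a:]" using degree_eq_zeroE[OF \<open>degree g = 0\<close>] by blast
      have "a \<in> A" using that a unfolding polys_over_def by (metis coeff_pCons_0 mem_Collect_eq)
      moreover have "a \<noteq> 0" using a that Suc by auto
      ultimately obtain n where "prime_product A n a" using fA by (auto simp: factorial_in_def)
      then show ?thesis
      proof cases
        case unit
        then obtain w where "w \<in> A" "1 = a * w" by (auto simp: dvd_in_def)
        then have "1 = [:a:] * [:w:]" by (simp add: one_pCons mult.commute)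
        then show ?thesis using a \<open>w \<in> A\<close> A unfolding dvd_in_def by (blast intro: polys_over_simps)
      next
        case (prime p n b)
        then have "b \<in> A" using prime_product_in[OF A] by blast
        have "f = [:p:] * (smult b h)" using a that prime by (simp add: mult.commute)
        then have "dvd_in ?P [:p:] f" using \<open>b \<in> A\<close> that A
          unfolding dvd_in_def by (blast intro: polys_over_simps)
        then show ?thesis using Suc prime by blast
      qed
    qed
    show ?case
    proof (cases "degree f = 0")
      case True
      have "dvd_in ?P f 1" using constf[of f 1] True Suc P by (simp add: subdomainD)
      then show ?thesis using Suc prime_product.unit by blast
    next
      case False
      show ?thesis
      proof (cases "prime_in ?P f")
        case True
        have "prime_product ?P (Suc 0) (f * 1)"
          by (intro prime_product.prime True prime_product.unit)
            (use P in \<open>auto simp: subdomainD dvd_in_def\<close>)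
        then show ?thesis by auto
      next
        case np: False
        then obtain g h where gh: "g \<in> ?P" "h \<in> ?P" "f = g * h" "\<not> dvd_in ?P g 1" "\<not> dvd_in ?P h 1"
          using irreducible_imp_prime_in[OF fA] Suc False by (meson not_gr_zero)
        have "degree g \<noteq> 0" "degree h \<noteq> 0"
          using gh constf[of g h] constf[of h g] by (auto simp: mult.commute)
        moreover have gh0: "g \<noteq> 0" "h \<noteq> 0" using gh Suc by auto
        ultimately have "degree g < d" "degree h < d"
          using Suc(4) gh degree_mult_eq[of g h] by auto
        moreover have "\<not> dvd_in ?P [:p:] g" "\<not> dvd_in ?P [:p:] h" if "prime_in A p" for p
          using Suc(5)[OF that] gh dvd_in_mult[OF P, of "[:p:]" g h] dvd_in_mult[OF P, of "[:p:]" h g]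
          by (auto simp: mult.commute)
        ultimately show ?thesis
          using Suc.IH[of g] Suc.IH[of h] gh gh0 prime_product_mult[OF P] by metis
      qed
    qed
  qed simp
  have "\<exists>n. prime_product ?P n f" if "prime_product A k (lead_coeff f)" "f \<in> ?P" "f \<noteq> 0" for f k
    using that
  proof (induction k arbitrary: f rule: less_induct)
    case (less k)
    show ?case
    proof (cases "\<exists>p. prime_in A p \<and> dvd_in ?P [:p:] f")
      case False
      then show ?thesis using prim[of f "Suc (degree f)"] less by blast
    next
      case True
      then obtain p g where p: "prime_in A p" "g \<in> ?P" "f = smult p g"
        by (auto simp: dvd_in_def)
      have p0: "p \<noteq> 0" using p by (auto simp: prime_in_def)
      have lc: "lead_coeff f = p * lead_coeff g" using p p0 by simp
      have lcA: "lead_coeff g \<in> A" using p by (auto simp: polys_over_def)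
      obtain j where "j < k" "prime_product A j (lead_coeff g)"
        using prime_product_cancel[OF A p(1) less(2) lc lcA] by blast
      then obtain n where "prime_product ?P n g" using less(1) p less(4) by auto
      then have "prime_product ?P (Suc n) ([:p:] * g)"
        using prime_in_const_poly[OF A p(1)] by (rule prime_product.prime[rotated])
      then show ?thesis using p by auto
    qed
  qed
  then show ?thesis using P fA unfolding factorial_in_def
    by (metis (no_types, lifting) leading_coeff_neq_0 polys_over_def mem_Collect_eq)
qed

text \<open>Common primes are divided out one at a time. Each division removes a prime from the
  nonzero entry \<open>g k\<close>, so the process stops.\<close>

lemma coprime_tuple:
  assumes fA: "factorial_in A" and g: "\<And>i. i \<in> I \<Longrightarrow> g i \<in> A" and "k \<in> I" "g k \<noteq> 0"
  shows "\<exists>c\<in>A. \<exists>g'. c \<noteq> 0 \<and> (\<forall>i\<in>I. g' i \<in> A \<and> g i = c * g' i) \<and>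
    (\<forall>p. prime_in A p \<longrightarrow> (\<exists>i\<in>I. \<not> dvd_in A p (g' i)))"
proof -
  have A: "subdomain A" using fA by (simp add: factorial_in_def)
  have "\<exists>c\<in>A. \<exists>g'. c \<noteq> 0 \<and> (\<forall>i\<in>I. g' i \<in> A \<and> g i = c * g' i) \<and>
    (\<forall>p. prime_in A p \<longrightarrow> (\<exists>i\<in>I. \<not> dvd_in A p (g' i)))"
    if "prime_product A n (g k)" "\<forall>i\<in>I. g i \<in> A" "g k \<noteq> 0" for n g
    using that
  proof (induction n arbitrary: g rule: less_induct)
    case (less n)
    show ?case
    proof (cases "\<exists>p. prime_in A p \<and> (\<forall>i\<in>I. dvd_in A p (g i))")
      case False
      then show ?thesis using less A by (intro bexI[of _ 1] exI[of _ g]) (auto simp: subdomainD)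
    next
      case True
      then obtain p g1 where p: "prime_in A p" and g1: "\<And>i. i \<in> I \<Longrightarrow> g1 i \<in> A \<and> g i = p * g1 i"
        unfolding dvd_in_def by metis
      have p0: "p \<noteq> 0" using p by (auto simp: prime_in_def)
      have "g1 k \<in> A" "g k = p * g1 k" using g1 \<open>k \<in> I\<close> by auto
      then obtain j where j: "j < n" "prime_product A j (g1 k)"
        using prime_product_cancel[OF A p less(2)] by blast
      moreover have "g1 k \<noteq> 0" using less(4) g1[OF \<open>k \<in> I\<close>] by auto
      ultimately obtain c g' where "c \<in> A" "c \<noteq> 0" "\<forall>i\<in>I. g' i \<in> A \<and> g1 i = c * g' i"
        "\<forall>p. prime_in A p \<longrightarrow> (\<exists>i\<in>I. \<not> dvd_in A p (g' i))"
        using less(1)[OF j(1), of g1] j(2) g1 by blast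
      then show ?thesis using p p0 g1 A
        by (intro bexI[of _ "p * c"] exI[of _ g']) (auto simp: prime_in_def subdomainD mult.assoc)
    qed
  qed
  then show ?thesis using assms fA by (auto simp: factorial_in_def)
qed

text \<open>By the cross relations \<open>g k\<close> divides every \<open>h k * g i\<close>, and
  coprimality turns this into \<open>g k\<close> dividing \<open>h k\<close>; the quotient is the
  factor \<open>c\<close>.\<close>

lemma proportional_to_coprime_tuple:
  assumes fA: "factorial_in A" and g: "\<And>i. i \<in> I \<Longrightarrow> g i \<in> A" and h: "\<And>i. i \<in> I \<Longrightarrow> h i \<in> A"
    and k: "k \<in> I" "g k \<noteq> 0"
    and cross: "\<And>i j. i \<in> I \<Longrightarrow> j \<in> I \<Longrightarrow> g i * h j = g j * h i"
    and coprime: "\<And>p. prime_in A p \<Longrightarrow> \<exists>i\<in>I. \<not> dvd_in A p (g i)"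
  shows "\<exists>c\<in>A. \<forall>i\<in>I. h i = c * g i"
proof -
  have A: "subdomain A" using fA by (simp add: factorial_in_def)
  \<comment> \<open>A tuple without common prime behaves as if its greatest common divisor were 1:
    the primes of \<open>a\<close> are removed one by one, each of them missing some
    \<open>g i\<close> and hence dividing \<open>b\<close>.\<close>
  have "dvd_in A a b" if "prime_product A n a" "b \<in> A" "\<And>i. i \<in> I \<Longrightarrow> dvd_in A a (b * g i)" for n a b
    using that
  proof (induction arbitrary: b rule: prime_product.induct)
    case (unit u)
    then obtain w where w: "w \<in> A" "1 = u * w" by (auto simp: dvd_in_def)
    then have "b = u * (w * b)" by (metis mult.assoc mult_1)
    then show ?case using w unit A unfolding dvd_in_def by (metis subdomainD(6))
  next
    case (prime p n a)
    have aA: "a \<in> A" using prime_product_in[OF A prime(2)] .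
    have p: "p \<in> A" "p \<noteq> 0" using prime(1) by (auto simp: prime_in_def)
    obtain i where i: "i \<in> I" "\<not> dvd_in A p (g i)" using coprime[OF prime(1)] by blast
    obtain e where "e \<in> A" "b * g i = p * a * e" using prime(5)[OF i(1)] by (auto simp: dvd_in_def)
    then have "dvd_in A p (b * g i)" using aA A unfolding dvd_in_def by (metis mult.assoc subdomainD(6))
    then have "dvd_in A p b" using prime(1,4) i g unfolding prime_in_def by blast
    then obtain b' where b': "b' \<in> A" "b = p * b'" by (auto simp: dvd_in_def)
    have "dvd_in A a (b' * g j)" if j: "j \<in> I" for j
    proof -
      obtain e where e: "e \<in> A" "b * g j = p * a * e" using prime(5)[OF j] by (auto simp: dvd_in_def)
      then have "p * (b' * g j) = p * (a * e)" using b' by (simp add: mult.assoc)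
      then have "b' * g j = a * e" using p by (metis mult_cancel_left)
      then show ?thesis using e unfolding dvd_in_def by blast
    qed
    then obtain e where "e \<in> A" "b' = a * e" using prime.IH[OF b'(1)] by (auto simp: dvd_in_def)
    then show ?case using b' unfolding dvd_in_def by (metis mult.assoc)
  qed
  moreover obtain n where "prime_product A n (g k)" using fA k g by (auto simp: factorial_in_def)
  moreover have "dvd_in A (g k) (h k * g i)" if "i \<in> I" for i
    using cross[OF k(1) that] h[OF that] unfolding dvd_in_def by (metis mult.commute)
  ultimately obtain c where c: "c \<in> A" "h k = g k * c" using h[OF k(1)] unfolding dvd_in_def by blast
  have "h i = c * g i" if "i \<in> I" for i
  proof -
    have "g k * h i = g k * (c * g i)" using cross[OF k(1) that] c(2) by (simp add: mult_ac)
    then show ?thesis using k by (metis mult_cancel_left)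
  qed
  then show ?thesis using c by blast
qed

text \<open>Serves to pass from univariate polynomials with coefficients in a ring of polynomial
  functions to polynomial functions in one more variable.\<close>

lemma factorial_in_iso:
  assumes fA: "factorial_in A" and inj: "inj_on \<phi> A" and img: "\<phi> ` A = B"
    and one: "\<phi> 1 = 1" and diff: "\<And>x y. x \<in> A \<Longrightarrow> y \<in> A \<Longrightarrow> \<phi> (x - y) = \<phi> x - \<phi> y"
    and mult: "\<And>x y. x \<in> A \<Longrightarrow> y \<in> A \<Longrightarrow> \<phi> (x * y) = \<phi> x * \<phi> y"
  shows "factorial_in B"
proof -
  have A: "subdomain A" using fA by (simp add: factorial_in_def)
  have B: "subdomain B"
    unfolding subdomain_def using img one diff mult subdomainD[OF A]
    by (auto simp: image_iff) metis+
  have inB: "\<phi> x \<in> B" if "x \<in> A" for x using img that by blast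
  have zero: "\<phi> 0 = 0" using diff[of 0 0] subdomainD(1)[OF A] by simp
  have dvd: "dvd_in B (\<phi> x) (\<phi> y) \<longleftrightarrow> dvd_in A x y" if "x \<in> A" "y \<in> A" for x y
  proof -
    have "\<phi> y = \<phi> x * \<phi> c \<longleftrightarrow> y = x * c" if "c \<in> A" for c
      using mult[of x c] inj that \<open>x \<in> A\<close> \<open>y \<in> A\<close> subdomainD(6)[OF A] by (metis inj_onD)
    then show ?thesis unfolding dvd_in_def using img by (metis imageE inB)
  qed
  have prime: "prime_in B (\<phi> p)" if "prime_in A p" for p
  proof -
    have pA: "p \<in> A" "p \<noteq> 0" using that by (auto simp: prime_in_def)
    have "\<phi> p \<noteq> 0" using inj pA subdomainD(1)[OF A] zero by (metis inj_onD)
    moreover have "\<not> dvd_in B (\<phi> p) 1"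
      using dvd[OF pA(1) subdomainD(2)[OF A]] that one by (simp add: prime_in_def)
    moreover have "dvd_in B (\<phi> p) a \<or> dvd_in B (\<phi> p) b"
      if ab: "a \<in> B" "b \<in> B" "dvd_in B (\<phi> p) (a * b)" for a b
    proof -
      obtain x y where xy: "x \<in> A" "y \<in> A" "a = \<phi> x" "b = \<phi> y" using ab img by blast
      then have "dvd_in A p (x * y)" using ab(3) dvd[OF pA(1)] mult subdomainD(6)[OF A] by metis
      then show ?thesis using \<open>prime_in A p\<close> xy dvd[OF pA(1)] unfolding prime_in_def by metis
    qed
    ultimately show ?thesis using inB pA unfolding prime_in_def by blast
  qed
  have "prime_product B n (\<phi> f)" if "prime_product A n f" for n f
    using that
  proof (induction rule: prime_product.induct)
    case (unit u)
    then have "dvd_in B (\<phi> u) 1" using dvd[OF _ subdomainD(2)[OF A]] one by simp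
    then show ?case using unit inB by (intro prime_product.unit) auto
  next
    case (prime p n f)
    have "\<phi> (p * f) = \<phi> p * \<phi> f"
      using mult prime(1) prime_product_in[OF A prime(2)] by (simp add: prime_in_def)
    then show ?case using prime \<open>\<And>p. prime_in A p \<Longrightarrow> prime_in B (\<phi> p)\<close> by (simp add: prime_product.prime)
  qed
  then show ?thesis using B fA img zero unfolding factorial_in_def by (metis (no_types, lifting) imageE)
qed

section \<open>Rings of polynomial functions\<close>

definition monspan :: "('i \<Rightarrow> 'c \<Rightarrow> Qbar) \<Rightarrow> 'i set \<Rightarrow> ('c \<Rightarrow> Qbar) set" where
  "monspan \<mu> I = {f. \<exists>A c. finite A \<and> A \<subseteq> I \<and> f = (\<lambda>x. \<Sum>a\<in>A. c a * \<mu> a x)}"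

lemma monspan_zero: "(\<lambda>x. 0) \<in> monspan \<mu> I"
  unfolding monspan_def by (intro CollectI exI[of _ "{}"]) simp

lemma monspan_single: "a \<in> I \<Longrightarrow> (\<lambda>x. c * \<mu> a x) \<in> monspan \<mu> I"
  unfolding monspan_def by (intro CollectI exI[of _ "{a}"] exI[of _ "\<lambda>_. c"]) simp

lemma monspan_add:
  assumes "f \<in> monspan \<mu> I" "g \<in> monspan \<mu> I"
  shows "(\<lambda>x. f x + g x) \<in> monspan \<mu> I"
proof -
  obtain A c B d where A: "finite A" "A \<subseteq> I" "f = (\<lambda>x. \<Sum>a\<in>A. c a * \<mu> a x)"
    and B: "finite B" "B \<subseteq> I" "g = (\<lambda>x. \<Sum>a\<in>B. d a * \<mu> a x)"
    using assms unfolding monspan_def by blast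
  have "(\<Sum>a\<in>A. c a * \<mu> a x) = (\<Sum>a\<in>A \<union> B. (if a \<in> A then c a else 0) * \<mu> a x)" for x
    using A B by (intro sum.mono_neutral_cong_left) auto
  moreover have "(\<Sum>a\<in>B. d a * \<mu> a x) = (\<Sum>a\<in>A \<union> B. (if a \<in> B then d a else 0) * \<mu> a x)" for x
    using A B by (intro sum.mono_neutral_cong_left) auto
  ultimately have "(\<lambda>x. f x + g x) =
      (\<lambda>x. \<Sum>a\<in>A \<union> B. ((if a \<in> A then c a else 0) + (if a \<in> B then d a else 0)) * \<mu> a x)"
    using A B by (simp add: sum.distrib distrib_right)
  then show ?thesis unfolding monspan_def using A(1,2) B(1,2)
    by (intro CollectI exI[of _ "A \<union> B"] exI conjI) auto
qed

lemma monspan_sum: "(\<And>i. i \<in> J \<Longrightarrow> f i \<in> monspan \<mu> I) \<Longrightarrow> (\<lambda>x. \<Sum>i\<in>J. f i x) \<in> monspan \<mu> I"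
  by (induction J rule: infinite_finite_induct) (auto simp: monspan_zero intro: monspan_add)

lemma monspan_induct [consumes 1, case_names zero add]:
  assumes "f \<in> monspan \<mu> I" and zero: "P (\<lambda>x. 0)"
    and add: "\<And>a c g. a \<in> I \<Longrightarrow> P g \<Longrightarrow> P (\<lambda>x. c * \<mu> a x + g x)"
  shows "P f"
proof -
  obtain A c where A: "finite A" "A \<subseteq> I" "f = (\<lambda>x. \<Sum>a\<in>A. c a * \<mu> a x)"
    using assms unfolding monspan_def by blast
  from A(1,2) have "P (\<lambda>x. \<Sum>a\<in>A. c a * \<mu> a x)"
    by (induction A rule: finite_induct) (use zero add in auto)
  then show ?thesis using A by simp
qed

lemma monspan_scale:
  assumes "f \<in> monspan \<mu> I" shows "(\<lambda>x. k * f x) \<in> monspan \<mu> I"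
  using assms
proof (induction rule: monspan_induct)
  case zero
  then show ?case using monspan_zero by simp
next
  case (add a c g)
  then show ?case using monspan_add[OF monspan_single[of a I "k * c" \<mu>]] by (simp add: algebra_simps)
qed

lemma monspan_mult:
  assumes "f \<in> monspan \<mu> I" "g \<in> monspan \<nu> J"
    and e: "\<And>a b. a \<in> I \<Longrightarrow> b \<in> J \<Longrightarrow> e a b \<in> K"
    and mult: "\<And>a b x. a \<in> I \<Longrightarrow> b \<in> J \<Longrightarrow> \<mu> a x * \<nu> b x = \<kappa> (e a b) x"
  shows "(\<lambda>x. f x * g x) \<in> monspan \<kappa> K"
  using assms(1)
proof (induction rule: monspan_induct)
  case zero
  then show ?case using monspan_zero by simp
next
  case (add a c f)
  have "(\<lambda>x. \<mu> a x * g x) \<in> monspan \<kappa> K"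
    using assms(2)
  proof (induction rule: monspan_induct)
    case zero
    then show ?case using monspan_zero by simp
  next
    case (add b d h)
    have "(\<lambda>x. \<mu> a x * (d * \<nu> b x + h x)) = (\<lambda>x. d * \<kappa> (e a b) x + \<mu> a x * h x)"
      using mult[OF \<open>a \<in> I\<close> add(1)] by (auto simp: algebra_simps)
    then show ?case using monspan_add[OF monspan_single[OF e[OF \<open>a \<in> I\<close> add(1)]] add(2)] by simp
  qed
  from monspan_add[OF monspan_scale[OF this, of c] add(2)]
  show ?case by (simp add: algebra_simps)
qed

lemma polys_monspan: "polys m = monspan (monom_fun m) UNIV"
  by (auto simp: polys_def monspan_def)

lemma forms_monspan: "forms k d = monspan (monom_fun k) {a. (\<Sum>i<k. a i) = d}"
  unfolding forms_def monspan_def by (intro Collect_cong ex_cong1) auto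

lemma mixed_forms_monspan:
  "mixed_forms m k d = monspan (\<lambda>(a, b) (x, v). monom_fun m a x * monom_fun k b v)
     {(a, b). (\<Sum>i<k. b i) = d}" (is "_ = monspan ?\<mu> ?I")
proof -
  have 1: "(\<lambda>(x, v). \<Sum>(a, b)\<in>A. c a b * monom_fun m a x * monom_fun k b v) =
      (\<lambda>p. \<Sum>ab\<in>A. (case ab of (a, b) \<Rightarrow> c a b) * ?\<mu> ab p)" for A c
    by (auto simp: fun_eq_iff case_prod_beta mult.assoc)
  have 2: "(\<lambda>p. \<Sum>ab\<in>A. c ab * ?\<mu> ab p) =
      (\<lambda>(x, v). \<Sum>(a, b)\<in>A. c (a, b) * monom_fun m a x * monom_fun k b v)" for A c
    by (auto simp: fun_eq_iff case_prod_beta mult.assoc)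
  show ?thesis
  proof (intro Set.set_eqI iffI)
    fix f assume "f \<in> mixed_forms m k d"
    then show "f \<in> monspan ?\<mu> ?I" unfolding mixed_forms_def monspan_def 1 by blast
  next
    fix f assume "f \<in> monspan ?\<mu> ?I"
    then obtain A c where "finite A" "A \<subseteq> ?I" "f = (\<lambda>p. \<Sum>ab\<in>A. c ab * ?\<mu> ab p)"
      unfolding monspan_def by blast
    then show "f \<in> mixed_forms m k d"
      unfolding mixed_forms_def 2
      by (intro CollectI exI[of _ A] exI[of _ "\<lambda>a b. c (a, b)"]) auto
  qed
qed

lemma monom_fun_mult: "monom_fun k a v * monom_fun k b v = monom_fun k (\<lambda>i. a i + b i) v"
  by (simp add: monom_fun_def prod.distrib power_add)

lemma monom_fun_zero: "monom_fun k (\<lambda>_. 0) v = 1"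
  by (simp add: monom_fun_def)

lemma monom_fun_var: "i < k \<Longrightarrow> monom_fun k (\<lambda>j. if j = i then 1 else 0) v = v i"
proof -
  assume "i < k"
  then have "(\<Prod>j<k. v j ^ (if j = i then 1 else 0)) = (\<Prod>j<k. if j = i then v i else 1)"
    by (intro prod.cong) auto
  then show ?thesis using \<open>i < k\<close> by (simp add: monom_fun_def)
qed

lemma mixed_forms_closed:
  shows mixed_forms_const: "(\<lambda>_. c) \<in> mixed_forms m k 0"
    and mixed_forms_x: "i < m \<Longrightarrow> (\<lambda>p. fst p i) \<in> mixed_forms m k 0"
    and mixed_forms_v: "j < k \<Longrightarrow> (\<lambda>p. snd p j) \<in> mixed_forms m k 1"
    and mixed_forms_zero: "(\<lambda>_. 0) \<in> mixed_forms m k d"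
    and mixed_forms_add: "f \<in> mixed_forms m k d \<Longrightarrow> g \<in> mixed_forms m k d \<Longrightarrow>
      (\<lambda>p. f p + g p) \<in> mixed_forms m k d"
    and mixed_forms_mult: "f \<in> mixed_forms m k d \<Longrightarrow> g \<in> mixed_forms m k e \<Longrightarrow>
      (\<lambda>p. f p * g p) \<in> mixed_forms m k (d + e)"
proof -
  let ?\<mu> = "\<lambda>(a, b) (x, v). monom_fun m a x * monom_fun k b v"
  have "(\<lambda>p. c * ?\<mu> (\<lambda>_. 0, \<lambda>_. 0) p) \<in> mixed_forms m k 0"
    unfolding mixed_forms_monspan by (rule monspan_single) simp
  then show "(\<lambda>_. c) \<in> mixed_forms m k 0" by (simp add: monom_fun_zero case_prod_beta)
  show "(\<lambda>p. fst p i) \<in> mixed_forms m k 0" if "i < m"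
  proof -
    have "(\<lambda>p. 1 * ?\<mu> (\<lambda>j. if j = i then 1 else 0, \<lambda>_. 0) p) \<in> mixed_forms m k 0"
      unfolding mixed_forms_monspan by (rule monspan_single) simp
    then show ?thesis using that by (simp add: monom_fun_zero monom_fun_var case_prod_beta)
  qed
  show "(\<lambda>p. snd p j) \<in> mixed_forms m k 1" if "j < k"
  proof -
    have "(\<lambda>p. 1 * ?\<mu> (\<lambda>_. 0, \<lambda>i. if i = j then 1 else 0) p) \<in> mixed_forms m k 1"
      unfolding mixed_forms_monspan by (rule monspan_single) (use that in \<open>simp add: sum.delta\<close>)
    then show ?thesis using that by (simp add: monom_fun_zero monom_fun_var case_prod_beta)
  qed
  show "(\<lambda>_. 0) \<in> mixed_forms m k d" unfolding mixed_forms_monspan by (rule monspan_zero)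
  show "(\<lambda>p. f p + g p) \<in> mixed_forms m k d" if "f \<in> mixed_forms m k d" "g \<in> mixed_forms m k d"
    using that unfolding mixed_forms_monspan by (rule monspan_add)
  show "(\<lambda>p. f p * g p) \<in> mixed_forms m k (d + e)"
    if "f \<in> mixed_forms m k d" "g \<in> mixed_forms m k e"
    using that unfolding mixed_forms_monspan
    by (rule monspan_mult[where e = "\<lambda>(a, b) (a', b'). (\<lambda>i. a i + a' i, \<lambda>i. b i + b' i)"])
      (auto simp: sum.distrib monom_fun_mult[symmetric] mult_ac)
qed

lemma forms_closed:
  shows forms_const: "(\<lambda>_. c) \<in> forms k 0"
    and forms_var: "j < k \<Longrightarrow> (\<lambda>v. v j) \<in> forms k 1"
    and forms_zero: "(\<lambda>_. 0) \<in> forms k d"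
    and forms_add: "f \<in> forms k d \<Longrightarrow> g \<in> forms k d \<Longrightarrow> (\<lambda>v. f v + g v) \<in> forms k d"
    and forms_mult: "f \<in> forms k d \<Longrightarrow> g \<in> forms k e \<Longrightarrow> (\<lambda>v. f v * g v) \<in> forms k (d + e)"
proof -
  have "(\<lambda>v. c * monom_fun k (\<lambda>_. 0) v) \<in> forms k 0"
    unfolding forms_monspan by (rule monspan_single) simp
  then show "(\<lambda>_. c) \<in> forms k 0" by (simp add: monom_fun_zero)
  show "(\<lambda>v. v j) \<in> forms k 1" if "j < k"
  proof -
    have "(\<lambda>v. 1 * monom_fun k (\<lambda>i. if i = j then 1 else 0) v) \<in> forms k 1"
      unfolding forms_monspan by (rule monspan_single) (use that in \<open>simp add: sum.delta\<close>)
    then show ?thesis using that by (simp add: monom_fun_var)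
  qed
  show "(\<lambda>_. 0) \<in> forms k d" unfolding forms_monspan by (rule monspan_zero)
  show "(\<lambda>v. f v + g v) \<in> forms k d" if "f \<in> forms k d" "g \<in> forms k d"
    using that unfolding forms_monspan by (rule monspan_add)
  show "(\<lambda>v. f v * g v) \<in> forms k (d + e)" if "f \<in> forms k d" "g \<in> forms k e"
    using that unfolding forms_monspan
    by (rule monspan_mult[where e = "\<lambda>a a' i. a i + a' i"]) (auto simp: sum.distrib monom_fun_mult)
qed

lemma polys_closed:
  shows polys_const: "(\<lambda>_. c) \<in> polys k"
    and polys_var: "j < k \<Longrightarrow> (\<lambda>v. v j) \<in> polys k"
    and polys_add: "f \<in> polys k \<Longrightarrow> g \<in> polys k \<Longrightarrow> (\<lambda>v. f v + g v) \<in> polys k"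
    and polys_mult: "f \<in> polys k \<Longrightarrow> g \<in> polys k \<Longrightarrow> (\<lambda>v. f v * g v) \<in> polys k"
proof -
  have "(\<lambda>v. c * monom_fun k (\<lambda>_. 0) v) \<in> polys k"
    unfolding polys_monspan by (rule monspan_single) simp
  then show "(\<lambda>_. c) \<in> polys k" by (simp add: monom_fun_zero)
  show "(\<lambda>v. v j) \<in> polys k" if "j < k"
  proof -
    have "(\<lambda>v. 1 * monom_fun k (\<lambda>i. if i = j then 1 else 0) v) \<in> polys k"
      unfolding polys_monspan by (rule monspan_single) simp
    then show ?thesis using that by (simp add: monom_fun_var)
  qed
  show "(\<lambda>v. f v + g v) \<in> polys k" if "f \<in> polys k" "g \<in> polys k"
    using that unfolding polys_monspan by (rule monspan_add)
  show "(\<lambda>v. f v * g v) \<in> polys k" if "f \<in> polys k" "g \<in> polys k"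
    using that unfolding polys_monspan
    by (rule monspan_mult[where e = "\<lambda>a a' i. a i + a' i"]) (auto simp: monom_fun_mult)
qed

lemma polys_sum: "(\<And>i. i \<in> J \<Longrightarrow> f i \<in> polys k) \<Longrightarrow> (\<lambda>x. \<Sum>i\<in>J. f i x) \<in> polys k"
  unfolding polys_monspan by (rule monspan_sum)

lemma polys_prod: "(\<And>i. i \<in> J \<Longrightarrow> f i \<in> polys k) \<Longrightarrow> (\<lambda>x. \<Prod>i\<in>J. f i x) \<in> polys k"
  by (induction J rule: infinite_finite_induct) (auto intro: polys_const polys_mult)

lemma polys_power: "f \<in> polys k \<Longrightarrow> (\<lambda>x. f x ^ n) \<in> polys k"
  by (induction n) (auto intro: polys_const polys_mult)

lemma polys_scale: "f \<in> polys k \<Longrightarrow> (\<lambda>x. c * f x) \<in> polys k"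
  by (rule polys_mult[OF polys_const])

lemma polys_diff: "f \<in> polys k \<Longrightarrow> g \<in> polys k \<Longrightarrow> (\<lambda>x. f x - g x) \<in> polys k"
  using polys_add[OF _ polys_scale[of g k "-1"], of f] by simp

lemma mixed_forms_sum:
  "(\<And>i. i \<in> J \<Longrightarrow> f i \<in> mixed_forms m k d) \<Longrightarrow> (\<lambda>x. \<Sum>i\<in>J. f i x) \<in> mixed_forms m k d"
  unfolding mixed_forms_monspan by (rule monspan_sum)

lemma forms_sum: "(\<And>i. i \<in> J \<Longrightarrow> f i \<in> forms k d) \<Longrightarrow> (\<lambda>x. \<Sum>i\<in>J. f i x) \<in> forms k d"
  unfolding forms_monspan by (rule monspan_sum)

text \<open>\<open>C d\<close> stands for the functions of degree \<open>d\<close> and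
  \<open>w\<close> for the degree of what is substituted; a constant family \<open>C\<close> covers
  ungraded polynomials.\<close>

lemma monom_fun_subst:
  assumes one: "(\<lambda>_. 1) \<in> C 0"
    and mult: "\<And>f g d e. f \<in> C d \<Longrightarrow> g \<in> C e \<Longrightarrow> (\<lambda>p. f p * g p) \<in> C (d + e)"
    and g: "\<And>i. i < k \<Longrightarrow> g i \<in> C w"
  shows "(\<lambda>p. monom_fun k a (\<lambda>i. g i p)) \<in> C (w * (\<Sum>i<k. a i))"
proof -
  have pow: "(\<lambda>p. f p ^ n) \<in> C (w * n)" if "f \<in> C w" for f n
    by (induction n) (use one mult[OF that] in auto)
  have "(\<lambda>p. \<Prod>i<k'. g i p ^ a i) \<in> C (w * (\<Sum>i<k'. a i))" if "k' \<le> k" for k'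
    using that
  proof (induction k')
    case (Suc k')
    then show ?case using mult[OF Suc.IH pow[OF g], of k' "a k'"]
      by (simp add: mult.commute distrib_left)
  qed (use one in simp)
  from this[of k] show ?thesis by (simp add: monom_fun_def)
qed

lemma forms_subst:
  assumes f: "f \<in> forms k d"
    and zero: "\<And>d. (\<lambda>_. 0) \<in> C d" and const: "\<And>c. (\<lambda>_. c) \<in> C 0"
    and add: "\<And>f g d. f \<in> C d \<Longrightarrow> g \<in> C d \<Longrightarrow> (\<lambda>p. f p + g p) \<in> C d"
    and mult: "\<And>f g d e. f \<in> C d \<Longrightarrow> g \<in> C e \<Longrightarrow> (\<lambda>p. f p * g p) \<in> C (d + e)"
    and g: "\<And>i. i < k \<Longrightarrow> g i \<in> C 1"
  shows "(\<lambda>p. f (\<lambda>i. g i p)) \<in> C d"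
  using f unfolding forms_monspan
proof (induction rule: monspan_induct)
  case zero
  then show ?case by (rule assms(2))
next
  case (add a c f)
  have "(\<lambda>p. monom_fun k a (\<lambda>i. g i p)) \<in> C (1 * (\<Sum>i<k. a i))"
    by (rule monom_fun_subst) (use const mult g in auto)
  then show ?case using mult[OF const[of c]] add assms(4) by simp
qed

lemma polys_subst:
  assumes f: "f \<in> polys k" and g: "\<And>i. i < k \<Longrightarrow> g i \<in> polys m"
  shows "(\<lambda>x. f (\<lambda>i. g i x)) \<in> polys m"
  using f unfolding polys_monspan[of k]
proof (induction rule: monspan_induct)
  case zero
  then show ?case by (rule polys_const)
next
  case (add a c f)
  have "(\<lambda>p. monom_fun k a (\<lambda>i. g i p)) \<in> (\<lambda>_. polys m) (1 * (\<Sum>i<k. a i))"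
    by (rule monom_fun_subst) (use polys_const polys_mult g in auto)
  then show ?case using add polys_scale polys_add by simp
qed

lemma polys_cong:
  assumes "f \<in> polys k" "\<And>i. i < k \<Longrightarrow> v i = w i" shows "f v = f w"
  using assms(1) unfolding polys_monspan
proof (induction rule: monspan_induct)
  case (add a c g)
  moreover have "monom_fun k a v = monom_fun k a w"
    using assms(2) by (simp add: monom_fun_def)
  ultimately show ?case by simp
qed simp

lemma forms_polys: "f \<in> forms k d \<Longrightarrow> f \<in> polys k"
  unfolding forms_def polys_def by auto

lemma polys_mono: "k \<le> l \<Longrightarrow> polys k \<subseteq> polys l"
proof
  fix f assume "k \<le> l" "f \<in> polys k"
  then show "f \<in> polys l"
    using polys_subst[where f = f and g = "\<lambda>i x. x i" and k = k and m = l] polys_var by force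
qed

text \<open>Restriction to a line reduces questions on several variables to univariate polynomials,
  which an infinite field separates.\<close>

lemma polys_line:
  assumes "f \<in> polys k" shows "\<exists>p. \<forall>t. f (\<lambda>i. a i + t * b i) = poly p t"
  using assms unfolding polys_monspan
proof (induction rule: monspan_induct)
  case zero
  show ?case by (intro exI[of _ 0]) simp
next
  case (add e c g)
  then obtain p where "\<forall>t. g (\<lambda>i. a i + t * b i) = poly p t" by blast
  then show ?case
    by (intro exI[of _ "smult c (\<Prod>i<k. [:a i, b i:] ^ e i) + p"]) (simp add: monom_fun_def poly_prod)
qed

text \<open>A polynomial is identified with the function it defines; since the field is infinite,
  this loses nothing.\<close>

typedef mpoly = "{f. \<exists>k. f \<in> polys k}" morphisms ev Abs_mpoly
  using polys_const by blast

setup_lifting type_definition_mpoly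

lemma mpoly_eqI: "(\<And>x. ev p x = ev q x) \<Longrightarrow> p = q"
  by (simp add: ev_inject[symmetric] fun_eq_iff)

lemma polys_ex_add: "\<exists>k. f \<in> polys k \<Longrightarrow> \<exists>k. g \<in> polys k \<Longrightarrow> \<exists>k. f \<in> polys k \<and> g \<in> polys k"
  by (meson nat_le_linear polys_mono subsetD)

instantiation mpoly :: idom
begin

lift_definition zero_mpoly :: mpoly is "\<lambda>_. 0" using polys_const by blast
lift_definition one_mpoly :: mpoly is "\<lambda>_. 1" using polys_const by blast
lift_definition plus_mpoly :: "mpoly \<Rightarrow> mpoly \<Rightarrow> mpoly" is "\<lambda>f g x. f x + g x"
  using polys_ex_add polys_add by meson
lift_definition minus_mpoly :: "mpoly \<Rightarrow> mpoly \<Rightarrow> mpoly" is "\<lambda>f g x. f x - g x"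
  using polys_ex_add polys_diff by meson
lift_definition times_mpoly :: "mpoly \<Rightarrow> mpoly \<Rightarrow> mpoly" is "\<lambda>f g x. f x * g x"
  using polys_ex_add polys_mult by meson
lift_definition uminus_mpoly :: "mpoly \<Rightarrow> mpoly" is "\<lambda>f x. - f x"
proof -
  fix f assume "\<exists>k. f \<in> polys k"
  then obtain k where "f \<in> polys k" by blast
  from polys_scale[OF this, of "-1"] show "\<exists>k. (\<lambda>x. - f x) \<in> polys k" by auto
qed

lemmas ev_simps [simp] = zero_mpoly.rep_eq one_mpoly.rep_eq plus_mpoly.rep_eq minus_mpoly.rep_eq
  times_mpoly.rep_eq uminus_mpoly.rep_eq

instance
proof
  fix a b :: mpoly
  assume "a \<noteq> 0" "b \<noteq> 0"
  then obtain x y where x: "ev a x \<noteq> 0" and y: "ev b y \<noteq> 0"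
    using mpoly_eqI[of a 0] mpoly_eqI[of b 0] by auto
  obtain k l where k: "ev a \<in> polys k" and l: "ev b \<in> polys l" using ev[of a] ev[of b] by blast
  \<comment> \<open>Along the line from \<open>x\<close> to \<open>y\<close> both restrictions are
    nonzero polynomials, as seen at \<open>t = 0\<close> and \<open>t = 1\<close>; their product
    therefore has a value different from 0.\<close>
  obtain p where p: "\<And>t. ev a (\<lambda>i. x i + t * (y i - x i)) = poly p t"
    using polys_line[OF k, of x "\<lambda>i. y i - x i"] by blast
  obtain q where q: "\<And>t. ev b (\<lambda>i. x i + t * (y i - x i)) = poly q t"
    using polys_line[OF l, of x "\<lambda>i. y i - x i"] by blast
  have "p \<noteq> 0" "q \<noteq> 0" using p[of 0] q[of 1] x y by auto
  then obtain t where "poly (p * q) t \<noteq> 0"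
    using poly_all_0_iff_0[of "p * q"] by auto
  then have "ev (a * b) (\<lambda>i. x i + t * (y i - x i)) \<noteq> 0"
    by (simp add: times_mpoly.rep_eq p q)
  then show "a * b \<noteq> 0" by (metis zero_mpoly.rep_eq)
next
  have "ev 0 x \<noteq> ev 1 x" for x by simp
  then show "(0 :: mpoly) \<noteq> 1" by metis
qed (rule mpoly_eqI; simp add: algebra_simps)+

end

definition mp :: "nat \<Rightarrow> mpoly set" where "mp k = {p. ev p \<in> polys k}"

lift_definition Var :: "nat \<Rightarrow> mpoly" is "\<lambda>i x. x i"
  using polys_var lessI by blast

lemmas [simp] = Var.rep_eq

lemma ev_Abs_mpoly: "f \<in> polys k \<Longrightarrow> ev (Abs_mpoly f) = f"
  by (subst Abs_mpoly_inverse) auto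

lemma Abs_mpoly_in_mp: "f \<in> polys k \<Longrightarrow> Abs_mpoly f \<in> mp k"
  by (simp add: mp_def ev_Abs_mpoly)

lemma ev_prod [simp]: "ev (prod f A) x = (\<Prod>i\<in>A. ev (f i) x)"
  by (induction A rule: infinite_finite_induct) auto

lemma subdomain_mp: "subdomain (mp k)"
  by (auto simp: subdomain_def mp_def one_mpoly.rep_eq minus_mpoly.rep_eq times_mpoly.rep_eq
      intro: polys_const polys_diff polys_mult)

lemma ev_poly: "ev (poly q p) x = poly (map_poly (\<lambda>c. ev c x) q) (ev p x)"
  by (induction q) (simp_all add: map_poly_pCons)

lemma ev_power [simp]: "ev (p ^ n) x = ev p x ^ n"
  by (induction n) auto

text \<open>The coefficients do not involve variable \<open>k\<close>, so that variable may take any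
  value \<open>t\<close> while they stay fixed, and a univariate polynomial vanishing on an infinite
  field is zero.\<close>

lemma polys_over_mp_inj:
  assumes q: "q \<in> polys_over (mp k)" and z: "poly q (Var k) = 0" shows "q = 0"
proof -
  have "ev (coeff q i) x = 0" for i x
  proof -
    have "poly (map_poly (\<lambda>c. ev c x) q) t = 0" for t
    proof -
      have "map_poly (\<lambda>c. ev c (x(k := t))) q = map_poly (\<lambda>c. ev c x) q"
        using q by (intro poly_eqI)
          (auto simp: coeff_map_poly polys_over_def mp_def intro: polys_cong)
      then show ?thesis using ev_poly[of q "Var k" "x(k := t)"] z by simp
    qed
    then have "map_poly (\<lambda>c. ev c x) q = 0" using poly_all_0_iff_0 by blast
    then show ?thesis using coeff_map_poly[of "\<lambda>c. ev c x" q i] by simp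
  qed
  then have "coeff q i = 0" for i by (intro mpoly_eqI) simp
  then show ?thesis by (simp add: poly_eq_iff)
qed

lemma polys_over_mp_surj:
  assumes "f \<in> polys (Suc k)"
  shows "\<exists>q\<in>polys_over (mp k). ev (poly q (Var k)) = f"
  using assms unfolding polys_monspan[of "Suc k"]
proof (induction rule: monspan_induct)
  case zero
  then show ?case
    by (intro bexI[of _ 0]) (auto simp: polys_over_def zero_mpoly.rep_eq mp_def polys_const)
next
  case (add a c g)
  then obtain q where q: "q \<in> polys_over (mp k)" "ev (poly q (Var k)) = g" by blast
  have P: "(\<lambda>x. c * monom_fun k a x) \<in> polys k"
    unfolding polys_monspan by (rule monspan_single) simp
  define r where "r = monom (Abs_mpoly (\<lambda>x. c * monom_fun k a x)) (a k)"
  have "r \<in> polys_over (mp k)"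
    unfolding r_def by (intro polys_over_simps subdomain_mp Abs_mpoly_in_mp P)
  then have "r + q \<in> polys_over (mp k)"
    using q by (intro subdomainD polys_over_subdomain subdomain_mp)
  moreover have "ev (poly (r + q) (Var k)) = (\<lambda>x. c * monom_fun (Suc k) a x + g x)"
    using ev_Abs_mpoly[OF P] by (simp add: r_def poly_monom fun_eq_iff q(2) monom_fun_def mult_ac)
  ultimately show ?case by blast
qed

text \<open>Induction on the number of variables: evaluation at \<open>Var k\<close> identifies
  univariate polynomials over \<open>mp k\<close> with \<open>mp (Suc k)\<close>. For
  \<open>k = 0\<close> all nonzero elements are units.\<close>

lemma factorial_in_mp: "factorial_in (mp k)"
proof (induction k)
  case 0
  have "prime_product (mp 0) 0 f" if "f \<in> mp 0" "f \<noteq> 0" for f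
  proof -
    define c where "c = ev f (\<lambda>_. 0)"
    have f: "ev f x = c" for x
      using that unfolding c_def mp_def by (auto intro: polys_cong)
    then have c: "c \<noteq> 0" using that mpoly_eqI[of f 0] by auto
    have i: "(\<lambda>_. inverse c) \<in> polys 0" by (rule polys_const)
    have "f * Abs_mpoly (\<lambda>_. inverse c) = 1"
      by (rule mpoly_eqI) (simp add: f ev_Abs_mpoly[OF i] c)
    then show ?thesis using that Abs_mpoly_in_mp[OF i]
      by (intro prime_product.unit) (auto simp: dvd_in_def intro: bexI[rotated])
  qed
  then show ?case using subdomain_mp by (auto simp: factorial_in_def)
next
  case (Suc k)
  show ?case
  proof (rule factorial_in_iso[OF factorial_in_polys_over[OF Suc], of "\<lambda>q. poly q (Var k)"])
    show "inj_on (\<lambda>q. poly q (Var k)) (polys_over (mp k))"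
    proof (rule inj_onI)
      fix p q assume "p \<in> polys_over (mp k)" "q \<in> polys_over (mp k)" "poly p (Var k) = poly q (Var k)"
      then have "p - q = 0"
        by (intro polys_over_mp_inj subdomainD polys_over_subdomain subdomain_mp) auto
      then show "p = q" by simp
    qed
    show "(\<lambda>q. poly q (Var k)) ` polys_over (mp k) = mp (Suc k)"
    proof (intro Set.set_eqI iffI)
      fix p assume "p \<in> mp (Suc k)"
      then obtain q where "q \<in> polys_over (mp k)" "ev (poly q (Var k)) = ev p"
        using polys_over_mp_surj[of "ev p" k] by (auto simp: mp_def)
      then show "p \<in> (\<lambda>q. poly q (Var k)) ` polys_over (mp k)" by (auto simp: ev_inject)
    next
      fix p assume "p \<in> (\<lambda>q. poly q (Var k)) ` polys_over (mp k)"
      then obtain q where q: "q \<in> polys_over (mp k)" "p = poly q (Var k)" by blast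
      have c: "coeff q i \<in> mp (Suc k)" for i
        using q polys_mono[of k "Suc k"] by (auto simp: polys_over_def mp_def)
      have v: "Var k ^ i \<in> mp (Suc k)" for i
      proof -
        have "ev (Var k ^ i) = (\<lambda>x. x k ^ i)" by auto
        then show ?thesis by (simp add: mp_def polys_power polys_var)
      qed
      have "(\<Sum>i\<le>degree q. coeff q i * Var k ^ i) \<in> mp (Suc k)"
        by (intro subdomain_sum[OF subdomain_mp] subdomainD(6)[OF subdomain_mp] c v)
      then show "p \<in> mp (Suc k)" using q by (simp add: poly_altdef)
    qed
  qed auto
qed

text \<open>The affine and the homogeneous coordinates are laid out in one vector, affine ones
  first, so that functions on a product become elements of one factorial ring. Entries beyond the
  two blocks are ignored.\<close>

definition split_coords :: "nat \<Rightarrow> nat \<Rightarrow> coords \<Rightarrow> coords \<times> coords" where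
  "split_coords m k z = (\<lambda>i. if i < m then z i else 0, \<lambda>i. if i < k then z (m + i) else 0)"

definition join_coords :: "nat \<Rightarrow> coords \<Rightarrow> coords \<Rightarrow> coords" where
  "join_coords m x v = (\<lambda>i. if i < m then x i else v (i - m))"

lemma split_join:
  "x \<in> coord_space m \<Longrightarrow> v \<in> coord_space k \<Longrightarrow> split_coords m k (join_coords m x v) = (x, v)"
  by (auto simp: split_coords_def join_coords_def coord_space_def fun_eq_iff)

lemma split_coords_in: "fst (split_coords m k z) \<in> coord_space m" "snd (split_coords m k z) \<in> coord_space k"
  by (auto simp: split_coords_def coord_space_def)

lemma mixed_forms_flatten:
  assumes "f \<in> mixed_forms m k d" shows "(\<lambda>z. f (split_coords m k z)) \<in> polys (m + k)"
  using assms unfolding mixed_forms_monspan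
proof (induction rule: monspan_induct)
  case zero
  then show ?case by (rule polys_const)
next
  case (add ab c g)
  obtain a b where ab: "ab = (a, b)" by fastforce
  have "(\<lambda>z. monom_fun m a (\<lambda>i. if i < m then z i else 0)) \<in> polys (m + k)"
    unfolding monom_fun_def by (intro polys_prod polys_power) (auto intro: polys_var)
  moreover have "(\<lambda>z. monom_fun k b (\<lambda>i. if i < k then z (m + i) else 0)) \<in> polys (m + k)"
    unfolding monom_fun_def by (intro polys_prod polys_power) (auto intro: polys_var)
  ultimately show ?case using add(2)
    by (auto simp: ab split_coords_def intro!: polys_add polys_mult polys_const)
qed

section \<open>Morphisms to projective space\<close>

definition smul :: "Qbar \<Rightarrow> coords \<Rightarrow> coords" (infixr \<open>*\<^sub>c\<close> 75) where
  "c *\<^sub>c v = (\<lambda>i. c * v i)"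

lemma smul_apply [simp]: "(c *\<^sub>c v) i = c * v i" by (simp add: smul_def)

lemma smul_simps [simp]: "1 *\<^sub>c v = v" "0 *\<^sub>c v = 0" "c *\<^sub>c 0 = 0" "a *\<^sub>c b *\<^sub>c v = (a * b) *\<^sub>c v"
  by (auto simp: fun_eq_iff)

lemma smul_eq_0_iff: "c *\<^sub>c v = 0 \<longleftrightarrow> c = 0 \<or> v = 0"
  by (auto simp: fun_eq_iff)

lemma coord_space_closed:
  "0 \<in> coord_space k" "v \<in> coord_space k \<Longrightarrow> w \<in> coord_space k \<Longrightarrow> v + w \<in> coord_space k"
  "v \<in> coord_space k \<Longrightarrow> c *\<^sub>c v \<in> coord_space k" "v \<in> coord_space k \<Longrightarrow> - v \<in> coord_space k"
  "v \<in> coord_space k \<Longrightarrow> w \<in> coord_space k \<Longrightarrow> v - w \<in> coord_space k"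
  by (auto simp: coord_space_def)

lemma coord_space_eqI:
  "v \<in> coord_space k \<Longrightarrow> w \<in> coord_space k \<Longrightarrow> (\<And>i. i < k \<Longrightarrow> v i = w i) \<Longrightarrow> v = w"
proof
  fix i
  assume "v \<in> coord_space k" "w \<in> coord_space k" "\<And>i. i < k \<Longrightarrow> v i = w i"
  then show "v i = w i" by (cases "i < k") (auto simp: coord_space_def)
qed

lemma coord_space_nonzero:
  assumes "v \<in> coord_space k" "v \<noteq> 0" shows "\<exists>i<k. v i \<noteq> 0"
  using coord_space_eqI[OF assms(1) coord_space_closed(1)] assms(2) by auto

definition unit_vec :: "nat \<Rightarrow> coords" where "unit_vec i = (\<lambda>j. if j = i then 1 else 0)"

lemma unit_vec_in: "i < k \<Longrightarrow> unit_vec i \<in> coord_space k"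
  by (auto simp: unit_vec_def coord_space_def)

lemma sum_coords_apply: "(sum f A :: coords) i = (\<Sum>j\<in>A. f j i)"
  by (induction A rule: infinite_finite_induct) auto

lemma coord_space_expand: "v \<in> coord_space k \<Longrightarrow> v = (\<Sum>j<k. v j *\<^sub>c unit_vec j)"
  by (rule ext) (auto simp: sum_coords_apply unit_vec_def coord_space_def if_distrib cong: if_cong)

lemma zero_coords: "(\<lambda>_. 0) = (0 :: coords)" by auto

lemma line_def': "line v = {c *\<^sub>c v | c. True}"
  by (simp add: line_def smul_def)

lemma in_line: "v \<in> line v"
  unfolding line_def' by (auto intro: exI[of _ 1])

lemma line_smul: "c \<noteq> 0 \<Longrightarrow> line (c *\<^sub>c v) = line v"
proof -
  assume c: "c \<noteq> 0"
  have "a *\<^sub>c v = (a / c) *\<^sub>c c *\<^sub>c v" for a using c by simp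
  then show ?thesis unfolding line_def' by (blast intro: smul_simps(4))
qed

lemma line_eqD: "line v = line w \<Longrightarrow> \<exists>c. w = c *\<^sub>c v"
  using in_line[of w] by (auto simp: line_def')

lemma line_of_mem: "w \<in> line v \<Longrightarrow> w \<noteq> 0 \<Longrightarrow> line w = line v"
proof -
  assume "w \<in> line v" "w \<noteq> 0"
  then obtain c where c: "w = c *\<^sub>c v" by (auto simp: line_def')
  then have "c \<noteq> 0" using \<open>w \<noteq> 0\<close> by auto
  then show ?thesis using line_smul c by simp
qed

lemma line_in_proj: "v \<in> coord_space (Suc n) \<Longrightarrow> v \<noteq> 0 \<Longrightarrow> line v \<in> proj_points n"
  unfolding proj_points_def zero_coords by (rule imageI) simp

lemma proj_points_cases:
  assumes "L \<in> proj_points n" obtains v where "v \<in> coord_space (Suc n)" "v \<noteq> 0" "L = line v"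
proof -
  from assms obtain v where "v \<in> coord_space (Suc n) - {\<lambda>_. 0}" "L = line v"
    unfolding proj_points_def by (rule imageE)
  then show thesis using that[of v] unfolding zero_coords by simp
qed

lemma line_coord_space: "v \<in> coord_space k \<Longrightarrow> line v \<subseteq> coord_space k"
  unfolding line_def' using coord_space_closed by blast

lemma points_simps [simp]:
  "points (coord_variety P reps H) = P" "points (affine m) = coord_space m"
  "points (proj n) = proj_points n" "points (affine_proj m n) = coord_space m \<times> proj_points n"
  by (simp_all add: coord_variety_def affine_def proj_def affine_proj_def)

lemma zopen_coord [simp]: "zopen (coord_variety P reps H) = coord_open P reps H"
  by (simp add: coord_variety_def)

lemma coord_open_iff:
  "coord_open P reps H U \<longleftrightarrow>
    U \<subseteq> P \<and> (\<forall>p\<in>U. \<exists>d. \<exists>f\<in>H d. (\<exists>v\<in>reps p. f v \<noteq> 0) \<and> (\<forall>q\<in>P. (\<exists>v\<in>reps q. f v \<noteq> 0) \<longrightarrow> q \<in> U))"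
  (is "?l \<longleftrightarrow> ?r")
proof
  assume ?l
  then show ?r unfolding coord_open_def by blast
next
  assume r: ?r
  \<comment> \<open>The largest possible set of equations: all functions whose nonvanishing locus
    lies in \<open>U\<close>.\<close>
  define T where "T = {f. (\<exists>d. f \<in> H d) \<and> (\<forall>q\<in>P. (\<exists>v\<in>reps q. f v \<noteq> 0) \<longrightarrow> q \<in> U)}"
  have "U = P - {p \<in> P. \<forall>f\<in>T. \<forall>v\<in>reps p. f v = 0}"
  proof (intro equalityI subsetI)
    fix p assume p: "p \<in> U"
    then obtain d f where "f \<in> H d" "\<exists>v\<in>reps p. f v \<noteq> 0" "f \<in> T"
      using r unfolding T_def by blast
    then show "p \<in> P - {p \<in> P. \<forall>f\<in>T. \<forall>v\<in>reps p. f v = 0}" using r p by blast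
  qed (auto simp: T_def)
  moreover have "T \<subseteq> (\<Union>d. H d)" by (auto simp: T_def)
  ultimately show ?l unfolding coord_open_def by blast
qed

lemma coord_open_basic:
  "f \<in> H d \<Longrightarrow> coord_open P reps H {p \<in> P. \<exists>v\<in>reps p. f v \<noteq> 0}"
  unfolding coord_open_iff by blast

text \<open>Source of the morphisms that are constructed explicitly. Nonvanishing must not depend on
  the representative (\<open>homog\<close>), because the lift \<open>\<Theta>\<close> may reach only
  some of the representatives of \<open>\<theta> p\<close>.\<close>

lemma coord_morphism:
  assumes maps: "\<theta> ` P \<subseteq> P'"
    and lift: "\<And>p v. p \<in> P \<Longrightarrow> v \<in> reps p \<Longrightarrow> \<Theta> v \<in> reps' (\<theta> p)"
    and nonempty: "\<And>p. p \<in> P \<Longrightarrow> reps p \<noteq> {}"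
    and pull: "\<And>d f. f \<in> H' d \<Longrightarrow> (\<lambda>v. f (\<Theta> v)) \<in> H d"
    and homog: "\<And>d f q w w'. f \<in> H' d \<Longrightarrow> q \<in> P' \<Longrightarrow> w \<in> reps' q \<Longrightarrow> w' \<in> reps' q \<Longrightarrow>
      f w \<noteq> 0 \<Longrightarrow> f w' \<noteq> 0"
  shows "morphism (coord_variety P reps H) (coord_variety P' reps' H') \<theta>"
proof -
  have nz: "(\<exists>w\<in>reps' (\<theta> p). f w \<noteq> 0) \<longleftrightarrow> (\<exists>v\<in>reps p. f (\<Theta> v) \<noteq> 0)" if "p \<in> P" "f \<in> H' d" for p f d
    using that homog[OF that(2), of "\<theta> p"] lift[OF that(1)] nonempty[OF that(1)] maps by blast
  have opn: "coord_open P reps H {p \<in> P. \<theta> p \<in> V}" if V: "coord_open P' reps' H' V" for V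
    unfolding coord_open_iff
  proof (intro conjI ballI)
    fix p assume "p \<in> {p \<in> P. \<theta> p \<in> V}"
    then have p: "p \<in> P" "\<theta> p \<in> V" by auto
    from V p(2) obtain d f where f: "f \<in> H' d" "\<exists>w\<in>reps' (\<theta> p). f w \<noteq> 0"
      "\<forall>q\<in>P'. (\<exists>w\<in>reps' q. f w \<noteq> 0) \<longrightarrow> q \<in> V" unfolding coord_open_iff by meson
    have "\<forall>q\<in>P. (\<exists>v\<in>reps q. f (\<Theta> v) \<noteq> 0) \<longrightarrow> q \<in> {p \<in> P. \<theta> p \<in> V}"
      using f nz maps by blast
    then show "\<exists>d. \<exists>f\<in>H d. (\<exists>v\<in>reps p. f v \<noteq> 0) \<and>
        (\<forall>q\<in>P. (\<exists>v\<in>reps q. f v \<noteq> 0) \<longrightarrow> q \<in> {p \<in> P. \<theta> p \<in> V})"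
      using pull[OF f(1)] f(2) nz[OF p(1) f(1)] by (intro exI[of _ d] bexI[of _ "\<lambda>v. f (\<Theta> v)"]) auto
  qed auto
  have reg: "regular (coord_variety P reps H) {p \<in> P. \<theta> p \<in> V} (\<lambda>p. f (\<theta> p))"
    if V: "coord_open P' reps' H' V" and f: "regular (coord_variety P' reps' H') V f" for V f
    unfolding coord_variety_def variety.simps
  proof
    fix p assume "p \<in> {p \<in> P. \<theta> p \<in> V}"
    then have p: "p \<in> P" "\<theta> p \<in> V" by auto
    from f p(2) obtain W d g h where W: "coord_open P' reps' H' W" "\<theta> p \<in> W" "W \<subseteq> V"
      and gh: "g \<in> H' d" "h \<in> H' d" "\<forall>q\<in>W. \<forall>v\<in>reps' q. h v \<noteq> 0 \<and> f q = g v / h v"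
      unfolding coord_variety_def variety.simps by meson
    have "coord_open P reps H {p \<in> P. \<theta> p \<in> W}" "p \<in> {p \<in> P. \<theta> p \<in> W}"
      "{p \<in> P. \<theta> p \<in> W} \<subseteq> {p \<in> P. \<theta> p \<in> V}"
      using opn[OF W(1)] W p by auto
    moreover have "\<forall>q\<in>{p \<in> P. \<theta> p \<in> W}. \<forall>v\<in>reps q. h (\<Theta> v) \<noteq> 0 \<and> f (\<theta> q) = g (\<Theta> v) / h (\<Theta> v)"
      using gh(3) lift by blast
    ultimately show "\<exists>W d g h. coord_open P reps H W \<and> p \<in> W \<and> W \<subseteq> {p \<in> P. \<theta> p \<in> V} \<and>
        g \<in> H d \<and> h \<in> H d \<and> (\<forall>q\<in>W. \<forall>v\<in>reps q. h v \<noteq> 0 \<and> f (\<theta> q) = g v / h v)"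
      using pull[OF gh(1)] pull[OF gh(2)] by blast
  qed
  show ?thesis unfolding morphism_def points_simps zopen_coord using maps opn reg by blast
qed

lemma forms_homogeneous: "f \<in> forms k d \<Longrightarrow> f (c *\<^sub>c v) = c ^ d * f v"
  unfolding forms_monspan
proof (induction rule: monspan_induct)
  case (add a e g)
  have "monom_fun k a (c *\<^sub>c v) = c ^ d * monom_fun k a v"
    using add(1) by (simp add: monom_fun_def power_mult_distrib prod.distrib power_sum[symmetric])
  then show ?case unfolding add(2) by (simp only: algebra_simps)
qed simp

lemma mixed_forms_homogeneous: "f \<in> mixed_forms m k d \<Longrightarrow> f (x, c *\<^sub>c v) = c ^ d * f (x, v)"
  unfolding mixed_forms_monspan
proof (induction rule: monspan_induct)
  case (add ab e g)
  obtain a b where ab: "ab = (a, b)" by fastforce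
  have "monom_fun k b (c *\<^sub>c v) = c ^ d * monom_fun k b v"
    using add(1) by (simp add: ab monom_fun_def power_mult_distrib prod.distrib power_sum[symmetric])
  then show ?case unfolding ab add(2) prod.case by (simp only: algebra_simps)
qed simp

lemma proj_homogeneous:
  assumes "f \<in> forms k d" "L \<in> proj_points n" "w \<in> L - {\<lambda>_. 0}" "w' \<in> L - {\<lambda>_. 0}" "f w \<noteq> 0"
  shows "f w' \<noteq> 0"
proof -
  obtain v where "L = line v" "v \<noteq> 0" using proj_points_cases[OF assms(2)] by metis
  then have "line w = line w'" using assms line_of_mem unfolding zero_coords by auto
  then obtain c where c: "w = c *\<^sub>c w'" using line_eqD by metis
  then have "c ^ d * f w' \<noteq> 0" using assms(1,5) forms_homogeneous by metis
  then show ?thesis by simp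
qed

lemma proj_reps_nonempty: "L \<in> proj_points n \<Longrightarrow> L - {\<lambda>_. 0} \<noteq> {}"
  unfolding zero_coords using in_line by (auto elim!: proj_points_cases)

lemma proj_open_basic:
  assumes "zopen (proj n) U" "line v \<in> U" "v \<in> coord_space (Suc n)" "v \<noteq> 0"
  shows "\<exists>f\<in>polys (Suc n). f v \<noteq> 0 \<and> (\<forall>w\<in>coord_space (Suc n). w \<noteq> 0 \<longrightarrow> f w \<noteq> 0 \<longrightarrow> line w \<in> U)"
proof -
  obtain d f where f: "f \<in> forms (Suc n) d" "\<exists>w\<in>line v - {\<lambda>_. 0}. f w \<noteq> 0"
    "\<forall>q\<in>proj_points n. (\<exists>w\<in>q - {\<lambda>_. 0}. f w \<noteq> 0) \<longrightarrow> q \<in> U"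
    using assms(1)[unfolded proj_def zopen_coord coord_open_iff] assms(2) by blast
  have "v \<in> line v - {\<lambda>_. 0}" using in_line assms(4) zero_coords by auto
  then have "f v \<noteq> 0" using proj_homogeneous[OF f(1) line_in_proj[OF assms(3,4)]] f(2) by metis
  moreover have "line w \<in> U" if "w \<in> coord_space (Suc n)" "w \<noteq> 0" "f w \<noteq> 0" for w
    using f(3) line_in_proj[OF that(1,2)] in_line that zero_coords by auto
  ultimately show ?thesis using forms_polys[OF f(1)] by blast
qed

definition trunc :: "nat \<Rightarrow> coords \<Rightarrow> coords" where "trunc k v = (\<lambda>i. if i < k then v i else 0)"

lemma trunc_in: "trunc k v \<in> coord_space k" by (auto simp: trunc_def coord_space_def)

lemma polys_trunc: "f \<in> polys k \<Longrightarrow> f (trunc k v) = f v"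
  by (erule polys_cong) (simp add: trunc_def)

text \<open>Irreducibility of projective space: two nonempty open sets contain nonvanishing loci of
  polynomials, and a product of nonzero polynomials is nonzero.\<close>

lemma proj_open_dense:
  assumes "zopen (proj n) U" "U \<noteq> {}" shows "dense_in (proj n) U"
  unfolding dense_in_def
proof (intro allI impI, elim conjE)
  fix U' assume U': "zopen (proj n) U'" "U' \<noteq> {}"
  obtain L L' where L: "L \<in> U" "L' \<in> U'" using assms(2) U'(2) by blast
  obtain v where v: "v \<in> coord_space (Suc n)" "v \<noteq> 0" "L = line v"
    using L(1) zopen_subset_proj[OF assms(1)] by (auto elim: proj_points_cases)
  obtain v' where v': "v' \<in> coord_space (Suc n)" "v' \<noteq> 0" "L' = line v'"
    using L(2) zopen_subset_proj[OF U'(1)] by (auto elim: proj_points_cases)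
  obtain f where f: "f \<in> polys (Suc n)" "f v \<noteq> 0"
    "\<forall>w\<in>coord_space (Suc n). w \<noteq> 0 \<longrightarrow> f w \<noteq> 0 \<longrightarrow> line w \<in> U"
    using proj_open_basic[OF assms(1) _ v(1,2)] v L by blast
  obtain f' where f': "f' \<in> polys (Suc n)" "f' v' \<noteq> 0"
    "\<forall>w\<in>coord_space (Suc n). w \<noteq> 0 \<longrightarrow> f' w \<noteq> 0 \<longrightarrow> line w \<in> U'"
    using proj_open_basic[OF U'(1) _ v'(1,2)] v' L by blast
  have "ev (Abs_mpoly f) v \<noteq> 0" "ev (Abs_mpoly f') v' \<noteq> 0"
    using f f' by (simp_all add: ev_Abs_mpoly)
  moreover have "ev (Var 0) (\<lambda>_. 1) \<noteq> 0" by simp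
  ultimately have "Abs_mpoly f \<noteq> 0" "Abs_mpoly f' \<noteq> 0" "Var 0 \<noteq> 0"
    using zero_mpoly.rep_eq by metis+
  \<comment> \<open>The extra factor \<open>Var 0\<close> makes the first coordinate of the point
    found nonzero, so that it spans a line.\<close>
  then have "Abs_mpoly f * Abs_mpoly f' * Var 0 \<noteq> 0" by simp
  then obtain z where "ev (Abs_mpoly f * Abs_mpoly f' * Var 0) z \<noteq> 0"
    using mpoly_eqI[of "Abs_mpoly f * Abs_mpoly f' * Var 0" 0] unfolding zero_mpoly.rep_eq by blast
  then have z: "f z \<noteq> 0" "f' z \<noteq> 0" "z 0 \<noteq> 0" using f f' by (auto simp: ev_Abs_mpoly)
  let ?w = "trunc (Suc n) z"
  have "?w 0 \<noteq> 0" using z(3) by (simp add: trunc_def)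
  then have "?w \<noteq> 0" by auto
  moreover have "f ?w \<noteq> 0" "f' ?w \<noteq> 0" using z f f' by (simp_all add: polys_trunc)
  ultimately have "line ?w \<in> U" "line ?w \<in> U'" using f(3) f'(3) trunc_in by blast+
  then show "U' \<inter> U \<noteq> {}" by blast
qed

section \<open>Polynomial representatives of morphisms to projective space\<close>

abbreviation pvec :: "nat \<Rightarrow> (nat \<Rightarrow> mpoly) \<Rightarrow> coords \<Rightarrow> coords" where
  "pvec k g z \<equiv> (\<lambda>i. if i < k then ev (g i) z else 0)"

lemma ev_join_mixed:
  assumes "f \<in> mixed_forms m k d" "x \<in> coord_space m" "v \<in> coord_space k"
  shows "ev (Abs_mpoly (\<lambda>z. f (split_coords m k z))) (join_coords m x v) = f (x, v)"
  using ev_Abs_mpoly[OF mixed_forms_flatten[OF assms(1)]] split_join[OF assms(2,3)] by simp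

text \<open>Ratios of coordinates on a standard chart are regular functions; pulled back along
  \<open>\<theta>\<close> they become quotients of polynomials near the given point. Multiplying by
  all denominators gives homogeneous coordinates of the image, valid where the product
  \<open>F\<close> of the functions cutting out the neighbourhoods does not vanish.\<close>

lemma local_rep:
  assumes \<theta>: "morphism (affine_proj m n) (proj n) (\<lambda>(x, L). \<theta> x L)"
    and x0: "x0 \<in> coord_space m" and v0: "v0 \<in> coord_space (Suc n)" "v0 \<noteq> 0"
  shows "\<exists>F\<in>mp (m + Suc n). \<exists>g. (\<forall>i. g i \<in> mp (m + Suc n)) \<and> ev F (join_coords m x0 v0) \<noteq> 0 \<and>
    (\<forall>x\<in>coord_space m. \<forall>v\<in>coord_space (Suc n). v \<noteq> 0 \<longrightarrow> ev F (join_coords m x v) \<noteq> 0 \<longrightarrow>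
      pvec (Suc n) g (join_coords m x v) \<noteq> 0 \<and> \<theta> x (line v) = line (pvec (Suc n) g (join_coords m x v)))"
proof -
  let ?N = "m + Suc n"
  have \<theta>P: "\<theta> x L \<in> proj_points n" if "x \<in> coord_space m" "L \<in> proj_points n" for x L
    using \<theta> that unfolding morphism_def points_simps by auto
  obtain w where w: "w \<in> coord_space (Suc n)" "w \<noteq> 0" "\<theta> x0 (line v0) = line w"
    using proj_points_cases[OF \<theta>P[OF x0 line_in_proj[OF v0]]] by metis
  obtain i where i: "i < Suc n" "w i \<noteq> 0" using coord_space_nonzero[OF w(1,2)] by blast
  define V where "V = {L \<in> proj_points n. \<exists>v\<in>L - {\<lambda>_. 0}. v i \<noteq> 0}"
  have V: "zopen (proj n) V"
    unfolding V_def proj_def zopen_coord by (rule coord_open_basic[of _ _ 1]) (rule forms_var[OF i(1)])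
  have Vi: "u i \<noteq> 0" if "L \<in> V" "u \<in> L - {\<lambda>_. 0}" for L u
    using that proj_homogeneous[OF forms_var[OF i(1)]] unfolding V_def by blast
  \<comment> \<open>The ratio of coordinate \<open>j\<close> to coordinate \<open>i\<close>; on the
    chart \<open>V\<close> it does not depend on the chosen vector of the line.\<close>
  define r where "r j L = (let v = SOME v. v \<in> L - {\<lambda>_. 0} in v j / v i)" for j and L :: "coords set"
  have r: "r j L = u j / u i" if L: "L \<in> V" and u: "u \<in> L - {\<lambda>_. 0}" for j L u
  proof -
    let ?s = "SOME v. v \<in> L - {\<lambda>_. 0}"
    have s: "?s \<in> L - {\<lambda>_. 0}" using u someI[of "\<lambda>v. v \<in> L - {\<lambda>_. 0}" u] by fast
    obtain y where y: "L = line y" "y \<noteq> 0" using L unfolding V_def by (auto elim: proj_points_cases)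
    have "line ?s = line u" using line_of_mem y s u unfolding zero_coords by (metis Diff_iff singletonI)
    then obtain c where c: "u = c *\<^sub>c ?s" using line_eqD by blast
    moreover have "c \<noteq> 0" using c u zero_coords by auto
    ultimately show ?thesis unfolding r_def Let_def by simp
  qed
  have rreg: "regular (proj n) V (r j)" if "j < Suc n" for j
    unfolding proj_def coord_variety_def variety.simps
  proof
    fix p assume p: "p \<in> V"
    have "\<forall>q\<in>V. \<forall>v\<in>q - {\<lambda>_. 0}. v i \<noteq> 0 \<and> r j q = v j / v i" using r Vi by blast
    then show "\<exists>W d g h. coord_open (proj_points n) (\<lambda>L. L - {\<lambda>_. 0}) (forms (Suc n)) W \<and> p \<in> W \<and>
        W \<subseteq> V \<and> g \<in> forms (Suc n) d \<and> h \<in> forms (Suc n) d \<and>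
        (\<forall>q\<in>W. \<forall>v\<in>q - {\<lambda>_. 0}. h v \<noteq> 0 \<and> r j q = g v / h v)"
      using V[unfolded proj_def zopen_coord] p forms_var[OF i(1)] forms_var[OF that] by blast
  qed
  let ?reps = "\<lambda>(x, L). {x} \<times> (L - {\<lambda>_. 0 :: Qbar})"
  let ?p0 = "(x0, line v0)"
  have p0V: "?p0 \<in> {p \<in> coord_space m \<times> proj_points n. (case p of (x, L) \<Rightarrow> \<theta> x L) \<in> V}"
    using x0 line_in_proj[OF v0] w i in_line[of w] line_in_proj[OF w(1,2)] unfolding V_def
    by (auto simp: zero_coords)
  \<comment> \<open>Local data for the single ratio \<open>j\<close>: a quotient
    \<open>g / h\<close> valid where \<open>F\<close> does not vanish. The neighbourhoods for
    different \<open>j\<close> may differ, so their functions are multiplied below.\<close>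
  define Q where "Q j F g h \<longleftrightarrow> F \<in> mp ?N \<and> g \<in> mp ?N \<and> h \<in> mp ?N \<and> ev F (join_coords m x0 v0) \<noteq> 0 \<and>
    (\<forall>x\<in>coord_space m. \<forall>v\<in>coord_space (Suc n). v \<noteq> 0 \<longrightarrow> ev F (join_coords m x v) \<noteq> 0 \<longrightarrow>
      \<theta> x (line v) \<in> V \<and> ev h (join_coords m x v) \<noteq> 0 \<and>
      r j (\<theta> x (line v)) = ev g (join_coords m x v) / ev h (join_coords m x v))" for j F g h
  have "\<exists>F g h. Q j F g h" if j: "j < Suc n" for j
  proof -
    have "regular (affine_proj m n) {p \<in> coord_space m \<times> proj_points n. (case p of (x, L) \<Rightarrow> \<theta> x L) \<in> V}
        (\<lambda>p. r j (case p of (x, L) \<Rightarrow> \<theta> x L))"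
      using \<theta> V rreg[OF j] unfolding morphism_def points_simps by blast
    then obtain W d g h where W: "coord_open (coord_space m \<times> proj_points n) ?reps (mixed_forms m (Suc n)) W"
      "?p0 \<in> W" "W \<subseteq> {p \<in> coord_space m \<times> proj_points n. (case p of (x, L) \<Rightarrow> \<theta> x L) \<in> V}"
      and gh: "g \<in> mixed_forms m (Suc n) d" "h \<in> mixed_forms m (Suc n) d"
      "\<forall>q\<in>W. \<forall>v\<in>?reps q. h v \<noteq> 0 \<and> r j (case q of (x, L) \<Rightarrow> \<theta> x L) = g v / h v"
      using p0V unfolding affine_proj_def coord_variety_def variety.simps by meson
    obtain e F where F: "F \<in> mixed_forms m (Suc n) e" "\<exists>v\<in>?reps ?p0. F v \<noteq> 0"
      "\<forall>q\<in>coord_space m \<times> proj_points n. (\<exists>v\<in>?reps q. F v \<noteq> 0) \<longrightarrow> q \<in> W"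
      using W(1,2) unfolding coord_open_iff by meson
    obtain u where u: "u \<in> line v0" "u \<noteq> 0" "F (x0, u) \<noteq> 0" using F(2) by (auto simp: zero_coords)
    obtain c where c: "u = c *\<^sub>c v0" using u by (auto simp: line_def')
    have c0: "c \<noteq> 0" using c u by auto
    have F0: "F (x0, v0) \<noteq> 0" using u(3) mixed_forms_homogeneous[OF F(1), of x0 c v0] c by auto
    let ?fl = "\<lambda>f. Abs_mpoly (\<lambda>z. f (split_coords m (Suc n) z))"
    have mp: "?fl F \<in> mp ?N" "?fl g \<in> mp ?N" "?fl h \<in> mp ?N"
      by (rule Abs_mpoly_in_mp, rule mixed_forms_flatten, fact F(1) gh(1,2))+
    have main: "\<theta> x (line v) \<in> V \<and> h (x, v) \<noteq> 0 \<and> r j (\<theta> x (line v)) = g (x, v) / h (x, v)"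
      if x: "x \<in> coord_space m" and v: "v \<in> coord_space (Suc n)" "v \<noteq> 0" "F (x, v) \<noteq> 0" for x v
    proof -
      have rep: "(x, v) \<in> ?reps (x, line v)" using in_line v by (auto simp: zero_coords)
      then have xW: "(x, line v) \<in> W" using F(3) x line_in_proj[OF v(1,2)] v(3) by blast
      show ?thesis using bspec[OF bspec[OF gh(3) xW] rep] W(3) xW by auto
    qed
    show ?thesis
      unfolding Q_def using mp F0 main ev_join_mixed[OF F(1)] ev_join_mixed[OF gh(1)] ev_join_mixed[OF gh(2)] x0 v0
      by - (rule exI[of _ "?fl F"], rule exI[of _ "?fl g"], rule exI[of _ "?fl h"], simp)
  qed
  then obtain F g h where "\<And>j. j < Suc n \<Longrightarrow> Q j (F j) (g j) (h j)" by metis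
  note Q = this[unfolded Q_def]
  have F: "F j \<in> mp ?N" and g: "g j \<in> mp ?N" and h: "h j \<in> mp ?N"
    and F0: "ev (F j) (join_coords m x0 v0) \<noteq> 0" if "j < Suc n" for j using Q[OF that] by blast+
  have Fgh: "\<theta> x (line v) \<in> V \<and> ev (h j) (join_coords m x v) \<noteq> 0 \<and>
      r j (\<theta> x (line v)) = ev (g j) (join_coords m x v) / ev (h j) (join_coords m x v)"
    if "j < Suc n" "x \<in> coord_space m" "v \<in> coord_space (Suc n)" "v \<noteq> 0"
      "ev (F j) (join_coords m x v) \<noteq> 0" for j x v
    using Q[OF that(1)] that by blast
  have prod_mp: "(\<Prod>k\<in>K. f k) \<in> mp ?N" if "\<And>k. k \<in> K \<Longrightarrow> f k \<in> mp ?N" for K and f :: "nat \<Rightarrow> mpoly"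
    using that by (induction K rule: infinite_finite_induct)
      (auto intro: subdomainD(6)[OF subdomain_mp] subdomainD(2)[OF subdomain_mp])
  \<comment> \<open>Numerator of the ratio \<open>j\<close> over the common denominator, the product
    of all \<open>h k\<close>.\<close>
  define G where "G j = (if j < Suc n then g j * (\<Prod>k\<in>{..<Suc n} - {j}. h k) else 0)" for j
  define FF where "FF = (\<Prod>k<Suc n. F k)"
  have "FF \<in> mp ?N" unfolding FF_def by (rule prod_mp) (use F in auto)
  moreover have "G j \<in> mp ?N" for j
  proof (cases "j < Suc n")
    case True
    have "(\<Prod>k\<in>{..<Suc n} - {j}. h k) \<in> mp ?N" by (rule prod_mp) (use h in auto)
    then show ?thesis using True subdomainD(6)[OF subdomain_mp g[OF True]] by (simp add: G_def)
  qed (simp add: G_def subdomainD(1)[OF subdomain_mp])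
  moreover have "ev FF (join_coords m x0 v0) \<noteq> 0" unfolding FF_def using F0 by simp
  moreover have "pvec (Suc n) G (join_coords m x v) \<noteq> 0 \<and>
      \<theta> x (line v) = line (pvec (Suc n) G (join_coords m x v))"
    if x: "x \<in> coord_space m" and v: "v \<in> coord_space (Suc n)" "v \<noteq> 0"
      and nz: "ev FF (join_coords m x v) \<noteq> 0" for x v
  proof -
    let ?z = "join_coords m x v"
    have nzk: "ev (F k) ?z \<noteq> 0" if "k < Suc n" for k using nz that unfolding FF_def ev_prod by (metis finite_lessThan lessThan_iff prod_zero)
    have hk: "ev (h k) ?z \<noteq> 0" if "k < Suc n" for k using Fgh[OF that x v nzk[OF that]] by blast
    have tV: "\<theta> x (line v) \<in> V" using Fgh[OF _ x v nzk] by blast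
    then obtain y where y: "y \<in> coord_space (Suc n)" "y \<noteq> 0" "\<theta> x (line v) = line y"
      using proj_points_cases[of "\<theta> x (line v)" n] by (auto simp: V_def)
    have yi: "y i \<noteq> 0" using Vi[OF tV, of y] y in_line by (auto simp: zero_coords)
    define c where "c = (\<Prod>k<Suc n. ev (h k) ?z) / y i"
    have c: "c \<noteq> 0" unfolding c_def using hk yi by auto
    have "pvec (Suc n) G ?z = c *\<^sub>c y"
    proof
      fix j show "pvec (Suc n) G ?z j = (c *\<^sub>c y) j"
      proof (cases "j < Suc n")
        case True
        have "y j / y i = ev (g j) ?z / ev (h j) ?z"
          using Fgh[OF True x v nzk[OF True]] r[OF tV, of y j] y in_line by (auto simp: zero_coords)
        then have "ev (g j) ?z = ev (h j) ?z * y j / y i" using hk[OF True] yi by (simp add: field_simps)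
        moreover have "(\<Prod>k<Suc n. ev (h k) ?z) = ev (h j) ?z * (\<Prod>k\<in>{..<Suc n} - {j}. ev (h k) ?z)"
          using True by (intro prod.remove) auto
        ultimately show ?thesis using True by (simp add: G_def c_def mult_ac)
      next
        case False
        then show ?thesis using y(1) by (simp add: coord_space_def)
      qed
    qed
    moreover have "c *\<^sub>c y \<noteq> 0"
      using c yi by (metis mult_eq_0_iff smul_apply zero_fun_apply)
    ultimately show ?thesis using y(3) line_smul[OF c] by simp
  qed
  ultimately show ?thesis by blast
qed

lemma join_split:
  "i < m + k \<Longrightarrow> join_coords m (fst (split_coords m k z)) (snd (split_coords m k z)) i = z i"
  by (auto simp: join_coords_def split_coords_def)

text \<open>Dividing a local representation by its common factors makes it valid everywhere.\<close>

theorem global_rep: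
  assumes \<theta>: "morphism (affine_proj m n) (proj n) (\<lambda>(x, L). \<theta> x L)"
  shows "\<exists>g. (\<forall>i. g i \<in> mp (m + Suc n)) \<and>
    (\<forall>x\<in>coord_space m. \<forall>v\<in>coord_space (Suc n). v \<noteq> 0 \<longrightarrow>
      pvec (Suc n) g (join_coords m x v) \<noteq> 0 \<and> \<theta> x (line v) = line (pvec (Suc n) g (join_coords m x v)))"
proof -
  let ?N = "m + Suc n" let ?I = "{..<Suc n}"
  have x0: "(0 :: coords) \<in> coord_space m" by (rule coord_space_closed)
  have v0: "unit_vec 0 \<in> coord_space (Suc n)" "unit_vec 0 \<noteq> 0"
    using unit_vec_in[of 0 "Suc n"] by (auto simp: unit_vec_def fun_eq_iff)
  obtain F g where F: "F \<in> mp ?N" "ev F (join_coords m 0 (unit_vec 0)) \<noteq> 0" and g: "\<And>i. g i \<in> mp ?N"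
    and Fg: "\<And>x v. x \<in> coord_space m \<Longrightarrow> v \<in> coord_space (Suc n) \<Longrightarrow> v \<noteq> 0 \<Longrightarrow>
      ev F (join_coords m x v) \<noteq> 0 \<Longrightarrow> pvec (Suc n) g (join_coords m x v) \<noteq> 0 \<and>
        \<theta> x (line v) = line (pvec (Suc n) g (join_coords m x v))"
    using local_rep[OF \<theta> x0 v0] by blast
  obtain k where k: "k < Suc n" "ev (g k) (join_coords m 0 (unit_vec 0)) \<noteq> 0"
    using Fg[OF x0 v0 F(2)] by (auto simp: fun_eq_iff split: if_splits)
  have gk: "g k \<noteq> 0" using k by auto
  obtain c g' where c: "c \<in> mp ?N" "c \<noteq> 0" and g': "\<And>i. i < Suc n \<Longrightarrow> g' i \<in> mp ?N \<and> g i = c * g' i"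
    and coprime: "\<And>p. prime_in (mp ?N) p \<Longrightarrow> \<exists>i\<in>?I. \<not> dvd_in (mp ?N) p (g' i)"
    using coprime_tuple[OF factorial_in_mp, of ?I g ?N k] g k(1) gk by (metis lessThan_iff)
  have g'k: "g' k \<noteq> 0" using g'[OF k(1)] gk by auto
  have main: "pvec (Suc n) g' (join_coords m x v) \<noteq> 0 \<and> \<theta> x (line v) = line (pvec (Suc n) g' (join_coords m x v))"
    if x: "x \<in> coord_space m" and v: "v \<in> coord_space (Suc n)" "v \<noteq> 0" for x v
  proof -
    let ?z = "join_coords m x v"
    obtain E h where E: "E \<in> mp ?N" "ev E ?z \<noteq> 0" and h: "\<And>i. h i \<in> mp ?N"
      and Eh: "\<And>x v. x \<in> coord_space m \<Longrightarrow> v \<in> coord_space (Suc n) \<Longrightarrow> v \<noteq> 0 \<Longrightarrow>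
      ev E (join_coords m x v) \<noteq> 0 \<Longrightarrow> pvec (Suc n) h (join_coords m x v) \<noteq> 0 \<and>
        \<theta> x (line v) = line (pvec (Suc n) h (join_coords m x v))"
      using local_rep[OF \<theta> x v] by blast
    have "g' i * h j = g' j * h i" if i: "i \<in> ?I" and j: "j \<in> ?I" for i j
    proof -
      \<comment> \<open>Where \<open>F\<close> and \<open>E\<close> are nonzero both tuples
        represent \<open>\<theta>\<close>, hence are proportional. Variable \<open>m\<close> is the
        first homogeneous coordinate; requiring it to be nonzero keeps the vector nonzero. The three
        factors are then cancelled in the domain of polynomials.\<close>
      have "F * E * Var m * (g i * h j - g j * h i) = 0"
      proof (rule mpoly_eqI)
        fix y
        define x' v' where "x' = fst (split_coords m (Suc n) y)" and "v' = snd (split_coords m (Suc n) y)"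
        have in_cs: "x' \<in> coord_space m" "v' \<in> coord_space (Suc n)"
          unfolding x'_def v'_def by (rule split_coords_in)+
        have y: "ev p y = ev p (join_coords m x' v')" if "p \<in> mp ?N" for p
        proof (rule polys_cong[where f = "ev p" and k = ?N and v = y and w = "join_coords m x' v'"])
          show "ev p \<in> polys ?N" using that by (simp only: mp_def mem_Collect_eq)
          fix i assume "i < ?N"
          then show "y i = join_coords m x' v' i" unfolding x'_def v'_def by (rule join_split[symmetric])
        qed
        show "ev (F * E * Var m * (g i * h j - g j * h i)) y = ev 0 y"
        proof (cases "ev F y \<noteq> 0 \<and> ev E y \<noteq> 0 \<and> y m \<noteq> 0")
          case True
          have "v' 0 = y m" by (simp add: v'_def split_coords_def)
          then have "v' \<noteq> 0" using True by auto
          then have "line (pvec (Suc n) g (join_coords m x' v')) = line (pvec (Suc n) h (join_coords m x' v'))"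
            using Fg[OF in_cs] Eh[OF in_cs] True y[OF F(1)] y[OF E(1)] by auto
          then obtain a where a: "pvec (Suc n) h (join_coords m x' v') = a *\<^sub>c pvec (Suc n) g (join_coords m x' v')"
            using line_eqD by blast
          have "ev (h l) y = a * ev (g l) y" if "l < Suc n" for l
            using fun_cong[OF a, of l] that y[OF g] y[OF h] by simp
          then show ?thesis using i j by simp
        qed auto
      qed
      moreover have "F \<noteq> 0" "E \<noteq> 0" using F E by auto
      moreover have "Var m \<noteq> 0"
      proof
        assume "Var m = 0"
        then have "ev (Var m) (\<lambda>_. 1) = ev 0 (\<lambda>_. 1)" by simp
        then show False by simp
      qed
      ultimately have "g i * h j = g j * h i" by simp
      then have "c * (g' i * h j) = c * (g' j * h i)" using g' i j by (simp add: mult.assoc)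
      then show ?thesis using c(2) by simp
    qed
    then obtain e where e: "e \<in> mp ?N" "\<And>i. i \<in> ?I \<Longrightarrow> h i = e * g' i"
      using proportional_to_coprime_tuple[OF factorial_in_mp, of ?I g' ?N h k] g' h k(1) g'k coprime
      by (metis lessThan_iff)
    have eq: "pvec (Suc n) h ?z = ev e ?z *\<^sub>c pvec (Suc n) g' ?z"
      using e(2) by (auto simp: fun_eq_iff)
    \<comment> \<open>The tuple \<open>h\<close> is nonzero at the given point and equals
      \<open>e\<close> times \<open>g'\<close>, so the reduced tuple cannot vanish there
      either.\<close>
    have "ev e ?z \<noteq> 0 \<and> pvec (Suc n) g' ?z \<noteq> 0"
      using Eh[OF x v E(2)] unfolding eq smul_eq_0_iff by blast
    then show ?thesis using Eh[OF x v E(2)] line_smul[of "ev e ?z" "pvec (Suc n) g' ?z"] unfolding eq by simp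
  qed
  define G where "G i = (if i < Suc n then g' i else 0)" for i
  have "pvec (Suc n) G z = pvec (Suc n) g' z" for z by (auto simp: G_def fun_eq_iff)
  then have "pvec (Suc n) G (join_coords m x v) \<noteq> 0 \<and> \<theta> x (line v) = line (pvec (Suc n) G (join_coords m x v))"
    if "x \<in> coord_space m" "v \<in> coord_space (Suc n)" "v \<noteq> 0" for x v
    using main[OF that] by simp
  moreover have "G i \<in> mp ?N" for i
    using g' subdomainD(1)[OF subdomain_mp] by (cases "i < Suc n") (simp_all add: G_def)
  ultimately show ?thesis by blast
qed

text \<open>Lifts of families of self-maps of projective space to the cone. Homogeneity in
  \<open>v\<close> is not built in; it has to be derived.\<close>

definition poly_family :: "nat \<Rightarrow> nat \<Rightarrow> (coords \<Rightarrow> coords \<Rightarrow> coords) \<Rightarrow> bool" where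
  "poly_family m k G \<longleftrightarrow> (\<forall>x\<in>coord_space m. \<forall>v\<in>coord_space k. G x v \<in> coord_space k) \<and>
    (\<forall>i. \<exists>f\<in>polys (m + k). \<forall>x\<in>coord_space m. \<forall>v\<in>coord_space k. G x v i = f (join_coords m x v))"

definition poly_curve :: "(Qbar \<Rightarrow> coords) \<Rightarrow> bool" where
  "poly_curve c \<longleftrightarrow> (\<forall>i. \<exists>p. \<forall>t. c t i = poly p t)"

lemma polys_curve:
  assumes "f \<in> polys k" "poly_curve c" shows "\<exists>p. \<forall>t. f (c t) = poly p t"
proof -
  obtain q where q: "\<And>i t. c t i = poly (q i) t" using assms(2) unfolding poly_curve_def by metis
  from assms(1) show ?thesis unfolding polys_monspan
  proof (induction rule: monspan_induct)
    case zero
    show ?case by (intro exI[of _ 0]) simp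
  next
    case (add e a g)
    then obtain p where "\<forall>t. g (c t) = poly p t" by blast
    then show ?case
      by (intro exI[of _ "smult a (\<Prod>i<k. q i ^ e i) + p"]) (simp add: monom_fun_def poly_prod q[symmetric])
  qed
qed

lemma poly_curve_line: "poly_curve (\<lambda>t. v + t *\<^sub>c w)"
  unfolding poly_curve_def
proof
  fix i show "\<exists>p. \<forall>t. (v + t *\<^sub>c w) i = poly p t" by (intro exI[of _ "[:v i, w i:]"]) simp
qed

lemma poly_curve_scale: "poly_curve (\<lambda>t. t *\<^sub>c w)"
  using poly_curve_line[of 0 w] by simp

lemma poly_curve_const: "poly_curve (\<lambda>t. w)"
  using poly_curve_line[of w 0] by simp

lemma poly_family_curve:
  assumes G: "poly_family m k G" and c: "poly_curve c" "poly_curve d"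
    and in_cs: "\<And>t. c t \<in> coord_space m" "\<And>t. d t \<in> coord_space k"
  shows "poly_curve (\<lambda>t. G (c t) (d t))"
  unfolding poly_curve_def
proof
  fix i
  obtain f where f: "f \<in> polys (m + k)"
    "\<And>x v. x \<in> coord_space m \<Longrightarrow> v \<in> coord_space k \<Longrightarrow> G x v i = f (join_coords m x v)"
    using G unfolding poly_family_def by metis
  have "\<exists>p. \<forall>t. join_coords m (c t) (d t) j = poly p t" for j
    using c unfolding poly_curve_def join_coords_def by (cases "j < m") auto
  then have "poly_curve (\<lambda>t. join_coords m (c t) (d t))"
    unfolding poly_curve_def by blast
  then show "\<exists>p. \<forall>t. G (c t) (d t) i = poly p t"
    using polys_curve[OF f(1)] f(2)[OF in_cs] by simp
qed

text \<open>Linear independence of two vectors, expressed by a nonvanishing two by two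
  minor.\<close>

definition independent2 :: "coords \<Rightarrow> coords \<Rightarrow> bool" where
  "independent2 v w \<longleftrightarrow> (\<exists>i j. v i * w j \<noteq> v j * w i)"

lemma nowhere_zero_poly_const:
  fixes p :: "Qbar poly"
  assumes "\<And>t. poly p t \<noteq> 0" shows "poly p s = poly p t"
proof -
  have "degree p = 0" using alg_closed_imp_poly_has_root[of p] assms by fastforce
  then show ?thesis by (metis degree_eq_zeroE poly_pCons poly_0 mult_zero_right)
qed

text \<open>The scalar by which a composite of two mutually inverse families acts is a polynomial
  without zeros along every line that avoids \<open>v = 0\<close>, hence constant.\<close>

lemma inverse_families_scalar_line:
  assumes G: "poly_family m k G" and G': "poly_family m k G'"
    and comp: "\<And>x v. x \<in> coord_space m \<Longrightarrow> v \<in> coord_space k \<Longrightarrow> v \<noteq> 0 \<Longrightarrow>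
      \<exists>c. c \<noteq> 0 \<and> G' x (G x v) = c *\<^sub>c v"
    and x: "x \<in> coord_space m" "x' \<in> coord_space m"
    and v: "v \<in> coord_space k" "v' \<in> coord_space k" "independent2 v v'"
    and ab: "G' x (G x v) = a *\<^sub>c v" "G' x' (G x' v') = b *\<^sub>c v'"
  shows "a = b"
proof -
  define cx where "cx t = x + t *\<^sub>c (x' - x)" for t
  define cv where "cv t = v + t *\<^sub>c (v' - v)" for t
  obtain i j where ij: "v i * v' j \<noteq> v j * v' i" using v(3) by (auto simp: independent2_def)
  define D where "D = v i * v' j - v j * v' i"
  have D: "D \<noteq> 0" using ij by (simp add: D_def)
  \<comment> \<open>A linear form in the coordinates \<open>i\<close> and \<open>j\<close> with
    value 1 on the whole line from \<open>v\<close> to \<open>v'\<close>. It shows that the line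
    misses the origin, and it reads off the scalar by which the composite acts.\<close>
  define lam where "lam u = ((v' j - v j) * u i - (v' i - v i) * u j) / D" for u
  have lamV: "lam (cv t) = 1" for t
  proof -
    have "(v' j - v j) * cv t i - (v' i - v i) * cv t j = D"
      by (simp add: cv_def D_def algebra_simps)
    then show ?thesis using D by (simp add: lam_def)
  qed
  have lam_smul: "lam (c *\<^sub>c u) = c * lam u" for c u by (simp add: lam_def algebra_simps diff_divide_distrib)
  have XV: "cx t \<in> coord_space m" "cv t \<in> coord_space k" for t
    unfolding cx_def cv_def using x v by (simp_all add: coord_space_closed)
  have Vn: "cv t \<noteq> 0" for t
  proof
    assume "cv t = 0"
    then have "lam (cv t) = 0" by (simp add: lam_def)
    then show False using lamV by simp
  qed
  have GXV: "G (cx t) (cv t) \<in> coord_space k" for t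
    using G XV unfolding poly_family_def by blast
  have "poly_curve (\<lambda>t. G' (cx t) (G (cx t) (cv t)))"
    unfolding cx_def cv_def
    by (intro poly_family_curve[OF G'] poly_family_curve[OF G] poly_curve_line XV[unfolded cx_def cv_def] GXV[unfolded cx_def cv_def])
  then obtain q where q: "\<And>i t. G' (cx t) (G (cx t) (cv t)) i = poly (q i) t"
    unfolding poly_curve_def by metis
  define p where "p = smult (inverse D) (smult (v' j - v j) (q i) - smult (v' i - v i) (q j))"
  have p: "poly p t = lam (G' (cx t) (G (cx t) (cv t)))" for t
    by (simp add: p_def lam_def q field_simps)
  have "poly p t \<noteq> 0" for t
  proof -
    obtain c where "c \<noteq> 0" "G' (cx t) (G (cx t) (cv t)) = c *\<^sub>c cv t" using comp[OF XV Vn] by blast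
    then show ?thesis by (simp add: p lam_smul lamV)
  qed
  then have "poly p 0 = poly p 1" by (rule nowhere_zero_poly_const)
  moreover have "poly p 0 = a" "poly p 1 = b"
    using ab lamV[of 0] lamV[of 1] by (simp_all add: p cx_def cv_def lam_smul)
  ultimately show ?thesis by simp
qed

text \<open>The comparison along a line works for independent vectors only, so
  \<open>unit_vec 0\<close> and \<open>v\<close> are compared through a vector \<open>u\<close>
  independent of both; it exists because \<open>k > 1\<close>.\<close>

lemma inverse_families_scalar:
  assumes G: "poly_family m k G" and G': "poly_family m k G'" and k: "k > 1"
    and comp: "\<And>x v. x \<in> coord_space m \<Longrightarrow> v \<in> coord_space k \<Longrightarrow> v \<noteq> 0 \<Longrightarrow>
      \<exists>c. c \<noteq> 0 \<and> G' x (G x v) = c *\<^sub>c v"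
  shows "\<exists>c. c \<noteq> 0 \<and> (\<forall>x\<in>coord_space m. \<forall>v\<in>coord_space k. v \<noteq> 0 \<longrightarrow> G' x (G x v) = c *\<^sub>c v)"
proof -
  have x0: "(0 :: coords) \<in> coord_space m" by (rule coord_space_closed)
  have v0: "unit_vec 0 \<in> coord_space k" "unit_vec 0 \<noteq> 0"
    using unit_vec_in[of 0 k] k by (auto simp: unit_vec_def fun_eq_iff)
  obtain c where c: "c \<noteq> 0" "G' 0 (G 0 (unit_vec 0)) = c *\<^sub>c unit_vec 0" using comp[OF x0 v0] by blast
  have step: "a = b"
    if "x \<in> coord_space m" "x' \<in> coord_space m" "v \<in> coord_space k" "v' \<in> coord_space k" "independent2 v v'"
      "G' x (G x v) = a *\<^sub>c v" "G' x' (G x' v') = b *\<^sub>c v'" for x x' v v' a b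
    using inverse_families_scalar_line[OF G G' comp that] .
  have "G' x (G x v) = c *\<^sub>c v" if x: "x \<in> coord_space m" and v: "v \<in> coord_space k" "v \<noteq> 0" for x v
  proof -
    obtain a where a: "G' x (G x v) = a *\<^sub>c v" using comp[OF x v] by blast
    obtain u where u: "u \<in> coord_space k" "independent2 (unit_vec 0) u" "independent2 u v"
    proof (cases "independent2 (unit_vec 0) v")
      case True
      then obtain i j where ij: "unit_vec 0 i * v j \<noteq> unit_vec 0 j * v i" by (auto simp: independent2_def)
      then have "unit_vec 0 i * (unit_vec 0 + v) j \<noteq> unit_vec 0 j * (unit_vec 0 + v) i"
        "(unit_vec 0 + v) i * v j \<noteq> (unit_vec 0 + v) j * v i"
        by (simp_all add: algebra_simps)
      then have "independent2 (unit_vec 0) (unit_vec 0 + v)" "independent2 (unit_vec 0 + v) v"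
        unfolding independent2_def by blast+
      then show ?thesis using that[of "unit_vec 0 + v"] v0 v coord_space_closed by blast
    next
      case False
      then have "v j = unit_vec 0 j * v 0" for j
      proof -
        have "unit_vec 0 0 * v j = unit_vec 0 j * v 0" using False unfolding independent2_def by blast
        then show ?thesis by (simp add: unit_vec_def[of 0])
      qed
      then have "v 0 \<noteq> 0" using v(2) by (metis ext mult_zero_right zero_fun_apply)
      then have "unit_vec 0 0 * unit_vec 1 1 \<noteq> unit_vec 0 1 * unit_vec 1 0"
        "unit_vec 1 0 * v 1 \<noteq> unit_vec 1 1 * v 0"
        by (simp_all add: unit_vec_def)
      then have "independent2 (unit_vec 0) (unit_vec 1)" "independent2 (unit_vec 1) v"
        unfolding independent2_def by blast+
      then show ?thesis using that[of "unit_vec 1"] unit_vec_in[OF k] by blast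
    qed
    have "u \<noteq> 0" using u(3) by (auto simp: independent2_def)
    then obtain b where b: "G' 0 (G 0 u) = b *\<^sub>c u" using comp[OF x0 u(1)] by blast
    have "c = b" using step[OF x0 x0 v0(1) u(1,2) c(2) b] by blast
    moreover have "b = a" using step[OF x0 x u(1) v(1) u(3) b a] by blast
    ultimately show ?thesis using a by simp
  qed
  then show ?thesis using c by blast
qed

text \<open>The form \<open>l\<close> is the homogeneous part of degree 1 of \<open>f\<close>. It
  turns homogeneity of degree 1 into linearity, and it makes derivatives at the origin linear in the
  direction.\<close>

lemma poly_scaling_linear:
  assumes "f \<in> polys k"
  shows "\<exists>l. \<forall>v. \<exists>p. (\<forall>t. f (t *\<^sub>c v) = poly p t) \<and> coeff p 1 = (\<Sum>i<k. l i * v i)"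
  using assms unfolding polys_monspan
proof (induction rule: monspan_induct)
  case zero
  show ?case by (intro exI[of _ "\<lambda>_. 0"] allI exI[of _ 0]) simp
next
  case (add a c g)
  then obtain l where l: "\<And>v. \<exists>p. (\<forall>t. g (t *\<^sub>c v) = poly p t) \<and> coeff p 1 = (\<Sum>i<k. l i * v i)" by blast
  define d where "d = (\<Sum>i<k. a i)"
  have scale: "monom_fun k a (t *\<^sub>c v) = monom_fun k a v * t ^ d" for t v
    by (simp add: monom_fun_def d_def power_mult_distrib prod.distrib power_sum mult.commute)
  define e where "e i = (if d = 1 \<and> a i = 1 then c else 0)" for i
  have lin: "(if d = 1 then c * monom_fun k a v else 0) = (\<Sum>i<k. e i * v i)" for v
  proof (cases "d = 1")
    case True
    then have "sum a {..<k} = Suc 0" by (simp add: d_def)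
    then obtain i where i: "i < k" "a i = 1" and n: "\<And>b. b < k \<Longrightarrow> i \<noteq> b \<Longrightarrow> a b = 0"
      unfolding sum_eq_Suc0_iff[OF finite_lessThan] by auto
    have "monom_fun k a v = (\<Prod>j<k. if j = i then v i else 1)"
      unfolding monom_fun_def using i n by (intro prod.cong) auto
    then have "monom_fun k a v = v i" using i by simp
    moreover have "(\<Sum>j<k. e j * v j) = (\<Sum>j<k. if j = i then c * v i else 0)"
      using i n True by (intro sum.cong) (auto simp: e_def)
    ultimately show ?thesis using True i by simp
  qed (simp add: e_def)
  have "\<exists>p. (\<forall>t. c * monom_fun k a (t *\<^sub>c v) + g (t *\<^sub>c v) = poly p t) \<and>
      coeff p 1 = (\<Sum>i<k. (e i + l i) * v i)" for v
  proof -
    have sum: "(\<Sum>i<k. (e i + l i) * v i) = (\<Sum>i<k. e i * v i) + (\<Sum>i<k. l i * v i)"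
      by (simp only: distrib_right sum.distrib)
    obtain p where p: "\<forall>t. g (t *\<^sub>c v) = poly p t" "coeff p 1 = (\<Sum>i<k. l i * v i)" using l by blast
    show ?thesis
      by (intro exI[of _ "monom (c * monom_fun k a v) d + p"] conjI allI)
        (use p lin[of v] in \<open>auto simp: sum scale poly_monom\<close>)
  qed
  then show ?case by (intro exI[of _ "\<lambda>i. e i + l i"] allI)
qed

text \<open>A polynomial bijection preserving the lines through the origin scales each of them by a
  polynomial with a polynomial left inverse, that is, linearly; hence it is linear.\<close>

lemma inverse_families_linear:
  assumes G: "poly_family m k G" and G': "poly_family m k G'"
    and nonzero: "\<And>x v. x \<in> coord_space m \<Longrightarrow> v \<in> coord_space k \<Longrightarrow> v \<noteq> 0 \<Longrightarrow> G x v \<noteq> 0"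
    and lines: "\<And>x v a. x \<in> coord_space m \<Longrightarrow> v \<in> coord_space k \<Longrightarrow> v \<noteq> 0 \<Longrightarrow> a \<noteq> 0 \<Longrightarrow>
      \<exists>b. G x (a *\<^sub>c v) = b *\<^sub>c G x v"
    and lines': "\<And>x v a. x \<in> coord_space m \<Longrightarrow> v \<in> coord_space k \<Longrightarrow> v \<noteq> 0 \<Longrightarrow> a \<noteq> 0 \<Longrightarrow>
      \<exists>b. G' x (a *\<^sub>c v) = b *\<^sub>c G' x v"
    and c: "c \<noteq> 0" "\<And>x v. x \<in> coord_space m \<Longrightarrow> v \<in> coord_space k \<Longrightarrow> v \<noteq> 0 \<Longrightarrow> G' x (G x v) = c *\<^sub>c v"
    and x: "x \<in> coord_space m" and v: "v \<in> coord_space k"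
  shows "G x v = (\<Sum>j<k. v j *\<^sub>c G x (unit_vec j))"
proof -
  have inG: "G x v \<in> coord_space k" "G' x v \<in> coord_space k" if "v \<in> coord_space k" for v
    using G G' x that unfolding poly_family_def by blast+
  have nzs: "a *\<^sub>c v \<noteq> 0" if "a \<noteq> 0" "v \<noteq> 0" for a v
    using that by (auto simp: fun_eq_iff)
  have hom: "G x (t *\<^sub>c v) = t *\<^sub>c G x v" if v: "v \<in> coord_space k" "v \<noteq> 0" for t v
  proof -
    let ?w = "G x v"
    have w: "?w \<in> coord_space k" "?w \<noteq> 0" using inG nonzero x v by blast+
    obtain i where i: "?w i \<noteq> 0" using w(2) by (auto simp: fun_eq_iff)
    obtain j where j: "v j \<noteq> 0" using v(2) by (auto simp: fun_eq_iff)
    have "poly_curve (\<lambda>t. G x (t *\<^sub>c v))" "poly_curve (\<lambda>t. G' x (t *\<^sub>c ?w))"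
      by (intro poly_family_curve[OF G] poly_family_curve[OF G'] poly_curve_const poly_curve_scale x
          coord_space_closed v w)+
    then obtain p q where p: "\<And>i t. G x (t *\<^sub>c v) i = poly (p i) t" and q: "\<And>i t. G' x (t *\<^sub>c ?w) i = poly (q i) t"
      unfolding poly_curve_def by metis
    \<comment> \<open>\<open>P\<close> is the scalar by which \<open>G x\<close> moves along the
      line through \<open>v\<close>, read off in a coordinate \<open>i\<close> where the image is
      nonzero. \<open>Q\<close> does the same for \<open>G'\<close> along the line through the
      image, up to the constant \<open>c\<close>.\<close>
    define P where "P = smult (inverse (?w i)) (p i)"
    define Q where "Q = smult (inverse (c * v j)) (q j)"
    have P: "G x (t *\<^sub>c v) = poly P t *\<^sub>c ?w" if t: "t \<noteq> 0" for t
    proof -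
      obtain b where b: "G x (t *\<^sub>c v) = b *\<^sub>c ?w" using lines[OF x v t] by blast
      then have "poly P t = b" using p[of t i] i by (simp add: P_def field_simps)
      then show ?thesis using b by simp
    qed
    have Q: "G' x (t *\<^sub>c ?w) = (poly Q t * c) *\<^sub>c v" if t: "t \<noteq> 0" for t
    proof -
      obtain b where b: "G' x (t *\<^sub>c ?w) = b *\<^sub>c c *\<^sub>c v" using lines'[OF x w t] c(2)[OF x v] by metis
      then have "poly Q t = b" using q[of t j] j c(1) by (simp add: Q_def field_simps)
      then show ?thesis using b by simp
    qed
    have P0: "poly P t \<noteq> 0" if "t \<noteq> 0" for t
      using P[OF that] nonzero[OF x coord_space_closed(3)[OF v(1)] nzs[OF that v(2)]] by auto
    have QP: "poly (pcompose Q P) t = poly [:0, 1:] t" if "t \<noteq> 0" for t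
    proof -
      have "(c * t) *\<^sub>c v = G' x (G x (t *\<^sub>c v))"
        using c(2)[OF x coord_space_closed(3)[OF v(1)] nzs[OF that v(2)]] by simp
      also have "\<dots> = (poly Q (poly P t) * c) *\<^sub>c v" using P[OF that] Q[OF P0[OF that]] by simp
      finally have "(c * t) *\<^sub>c v = (poly Q (poly P t) * c) *\<^sub>c v" .
      from fun_cong[OF this, of j] have "poly Q (poly P t) = t" using j c(1) by simp
      then show ?thesis by (simp add: poly_pcompose)
    qed
    \<comment> \<open>The factor \<open>[:0, 1:]\<close> absorbs the excluded value
      \<open>t = 0\<close>.\<close>
    have "poly ((pcompose Q P - [:0, 1:]) * [:0, 1:]) t = 0" for t
      using QP[of t] by (cases "t = 0") auto
    then have "(pcompose Q P - [:0, 1:]) * [:0, 1:] = 0" using poly_all_0_iff_0 by blast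
    then have "pcompose Q P = [:0, 1:]" by simp
    \<comment> \<open>A polynomial with a polynomial left inverse has degree 1. Having no zero
      outside 0 and the value 1 at 1, \<open>P\<close> is the identity.\<close>
    then have "degree Q * degree P = 1" using degree_pcompose[of Q P] by simp
    then have "degree P = 1" by simp
    then obtain a b where ab: "P = [:b, a:]" "a \<noteq> 0" by (metis degree1_coeffs)
    have "b = 0" using P0[of "- b / a"] ab by (auto simp: field_simps)
    moreover have "poly P 1 = 1" using i fun_cong[OF P[of 1], of i] by simp
    ultimately have "poly P t = t" for t using ab by simp
    then have *: "G x (t *\<^sub>c v) = t *\<^sub>c ?w" if "t \<noteq> 0" for t using P[OF that] by simp
    show ?thesis
    proof (cases "t = 0")
      case True
      have "G x (0 *\<^sub>c v) l = 0" for l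
      proof -
        have "poly ((p l - [:0, ?w l:]) * [:0, 1:]) s = 0" for s
          using fun_cong[OF *[of s], of l] p[of s l] by (cases "s = 0") auto
        then have "(p l - [:0, ?w l:]) * [:0, 1:] = 0" using poly_all_0_iff_0 by blast
        then have "p l = [:0, ?w l:]" by simp
        then show ?thesis using p[of 0 l] by simp
      qed
      then show ?thesis using True by (auto simp: fun_eq_iff)
    qed (rule *)
  qed
  show ?thesis
  proof
    fix i
    obtain f where f: "f \<in> polys (m + k)"
      "\<And>v. v \<in> coord_space k \<Longrightarrow> G x v i = f (join_coords m x v)"
      using G x unfolding poly_family_def by metis
    define g where "g v = f (join_coords m x v)" for v
    have "g \<in> polys k" unfolding g_def
    proof (rule polys_subst[OF f(1)])
      fix i assume "i < m + k"
      then show "(\<lambda>v. join_coords m x v i) \<in> polys k"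
        by (cases "i < m") (auto simp: join_coords_def intro: polys_const polys_var)
    qed
    \<comment> \<open>Being homogeneous of degree 1, a coordinate of \<open>G x\<close> coincides
      with its linear part.\<close>
    then obtain l where l: "\<And>v. \<exists>p. (\<forall>t. g (t *\<^sub>c v) = poly p t) \<and> coeff p 1 = (\<Sum>i<k. l i * v i)"
      using poly_scaling_linear by blast
    have lin: "G x v i = (\<Sum>j<k. l j * v j)" if v: "v \<in> coord_space k" "v \<noteq> 0" for v
    proof -
      obtain p where p: "\<And>t. g (t *\<^sub>c v) = poly p t" "coeff p 1 = (\<Sum>i<k. l i * v i)" using l by blast
      have "poly p t = poly [:0, G x v i:] t" for t
        using p(1)[of t] f(2)[OF coord_space_closed(3)[OF v(1)], of t] hom[OF v, of t]
        by (simp add: g_def)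
      then have "p = [:0, G x v i:]" using poly_eq_poly_eq_iff by blast
      then show ?thesis using p(2) by simp
    qed
    show "G x v i = (\<Sum>j<k. v j *\<^sub>c G x (unit_vec j)) i"
    proof (cases "v = 0")
      case False
      have "G x (unit_vec j) i = l j" if "j < k" for j
      proof -
        have "unit_vec j \<noteq> 0" by (auto simp: unit_vec_def fun_eq_iff)
        then have "G x (unit_vec j) i = (\<Sum>h<k. l h * unit_vec j h)" using lin[OF unit_vec_in[OF that]] by simp
        also have "\<dots> = (\<Sum>h<k. if h = j then l j else 0)" by (intro sum.cong) (auto simp: unit_vec_def)
        also have "\<dots> = l j" using that by simp
        finally show ?thesis .
      qed
      then show ?thesis using lin[OF v False] by (simp add: sum_coords_apply mult.commute)
    next
      case True
      show ?thesis
      proof (cases "k = 0")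
        case True
        then have "G x v = 0" using inG(1)[OF v] by (auto simp: coord_space_def)
        then show ?thesis using True by simp
      next
        case False
        have "unit_vec 0 \<noteq> 0" by (auto simp: unit_vec_def fun_eq_iff)
        then have "G x 0 = 0" using hom[of "unit_vec 0" 0] unit_vec_in[of 0 k] False by simp
        then show ?thesis using \<open>v = 0\<close> by (simp add: sum_coords_apply)
      qed
    qed
  qed
qed

section \<open>Linearity of families and actions\<close>

lemma poly_family_in: "poly_family m k G \<Longrightarrow> x \<in> coord_space m \<Longrightarrow> v \<in> coord_space k \<Longrightarrow> G x v \<in> coord_space k"
  by (simp add: poly_family_def)

text \<open>The change of parameter \<open>a\<close> accommodates rescaled and constant parameters
  as well as pairs of parameters coded as one vector.\<close>

lemma poly_family_comp:
  assumes G: "poly_family m k G" and H: "poly_family m' k H"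
    and par: "\<And>z. z \<in> coord_space m' \<Longrightarrow> a z \<in> coord_space m" "\<And>i. i < m \<Longrightarrow> (\<lambda>z. a z i) \<in> polys m'"
  shows "poly_family m' k (\<lambda>z v. G (a z) (H z v))"
  unfolding poly_family_def
proof (intro conjI ballI allI)
  fix i
  obtain f where f: "f \<in> polys (m + k)"
    "\<And>x v. x \<in> coord_space m \<Longrightarrow> v \<in> coord_space k \<Longrightarrow> G x v i = f (join_coords m x v)"
    using G unfolding poly_family_def by metis
  obtain h where h: "\<And>j. h j \<in> polys (m' + k)"
    "\<And>j x v. x \<in> coord_space m' \<Longrightarrow> v \<in> coord_space k \<Longrightarrow> H x v j = h j (join_coords m' x v)"
    using H unfolding poly_family_def by metis
  define F where "F y = f (\<lambda>j. if j < m then a y j else h (j - m) y)" for y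
  have "F \<in> polys (m' + k)" unfolding F_def
  proof (rule polys_subst[OF f(1)])
    fix j assume "j < m + k"
    show "(\<lambda>y. if j < m then a y j else h (j - m) y) \<in> polys (m' + k)"
      using par(2)[of j] polys_mono[of m' "m' + k"] h(1) by (cases "j < m") auto
  qed
  moreover have "G (a z) (H z v) i = F (join_coords m' z v)"
    if z: "z \<in> coord_space m'" and v: "v \<in> coord_space k" for z v
  proof -
    have "G (a z) (H z v) i = f (join_coords m (a z) (H z v))"
      using f(2) par(1)[OF z] poly_family_in[OF H z v] by simp
    also have "join_coords m (a z) (H z v) =
        (\<lambda>j. if j < m then a (join_coords m' z v) j else h (j - m) (join_coords m' z v))"
    proof
      fix j
      have "a z j = a (join_coords m' z v) j" if "j < m"
        by (rule polys_cong[OF par(2)[OF that]]) (simp add: join_coords_def)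
      then show "join_coords m (a z) (H z v) j =
          (if j < m then a (join_coords m' z v) j else h (j - m) (join_coords m' z v))"
        using h(2)[OF z v] by (simp add: join_coords_def[of m])
    qed
    finally show ?thesis by (simp add: F_def)
  qed
  ultimately show "\<exists>f\<in>polys (m' + k). \<forall>z\<in>coord_space m'. \<forall>v\<in>coord_space k. G (a z) (H z v) i = f (join_coords m' z v)"
    by blast
qed (use poly_family_in[OF G par(1) poly_family_in[OF H]] in auto)

lemma poly_family_id: "poly_family m k (\<lambda>x v. v)"
  unfolding poly_family_def
proof (intro conjI ballI allI)
  fix i
  show "\<exists>f\<in>polys (m + k). \<forall>x\<in>coord_space m. \<forall>v\<in>coord_space k. v i = f (join_coords m x v)"
  proof (cases "i < k")
    case True
    then show ?thesis
      by (intro bexI[of _ "\<lambda>z. z (m + i)"]) (auto simp: join_coords_def intro: polys_var)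
  next
    case False
    then show ?thesis
      by (intro bexI[of _ "\<lambda>z. 0"]) (auto simp: coord_space_def intro: polys_const)
  qed
qed

lemma poly_family_scale:
  assumes "poly_family m k G" shows "poly_family m k (\<lambda>x v. a *\<^sub>c G x v)"
  unfolding poly_family_def
proof (intro conjI ballI allI)
  fix i
  obtain f where f: "f \<in> polys (m + k)"
    "\<And>x v. x \<in> coord_space m \<Longrightarrow> v \<in> coord_space k \<Longrightarrow> G x v i = f (join_coords m x v)"
    using assms unfolding poly_family_def by metis
  then show "\<exists>f\<in>polys (m + k). \<forall>x\<in>coord_space m. \<forall>v\<in>coord_space k. (a *\<^sub>c G x v) i = f (join_coords m x v)"
    by (intro bexI[of _ "\<lambda>z. a * f z"]) (auto intro: polys_scale)
qed (use poly_family_in[OF assms] coord_space_closed in auto)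

lemma global_family:
  assumes "morphism (affine_proj m n) (proj n) (\<lambda>(x, L). \<theta> x L)"
  obtains G where "poly_family m (Suc n) G"
    "\<And>x v. x \<in> coord_space m \<Longrightarrow> v \<in> coord_space (Suc n) \<Longrightarrow> v \<noteq> 0 \<Longrightarrow>
      G x v \<noteq> 0 \<and> \<theta> x (line v) = line (G x v)"
proof -
  obtain g where g: "\<And>i. g i \<in> mp (m + Suc n)"
    and rep: "\<And>x v. x \<in> coord_space m \<Longrightarrow> v \<in> coord_space (Suc n) \<Longrightarrow> v \<noteq> 0 \<Longrightarrow>
      pvec (Suc n) g (join_coords m x v) \<noteq> 0 \<and> \<theta> x (line v) = line (pvec (Suc n) g (join_coords m x v))"
    using global_rep[OF assms] by blast
  have "(\<lambda>z. pvec (Suc n) g z i) \<in> polys (m + Suc n)" for i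
    using g[of i] polys_const[of 0] unfolding mp_def by (cases "i < Suc n") auto
  then have "\<exists>f\<in>polys (m + Suc n). \<forall>x\<in>coord_space m. \<forall>v\<in>coord_space (Suc n).
      pvec (Suc n) g (join_coords m x v) i = f (join_coords m x v)" for i
    by (intro bexI[of _ "\<lambda>z. pvec (Suc n) g z i"]) simp_all
  then have "poly_family m (Suc n) (\<lambda>x v. pvec (Suc n) g (join_coords m x v))"
    unfolding poly_family_def by (auto simp: coord_space_def)
  then show thesis using that rep by blast
qed

definition linear_on :: "nat \<Rightarrow> (coords \<Rightarrow> coords) \<Rightarrow> bool" where
  "linear_on k f \<longleftrightarrow> (\<forall>u\<in>coord_space k. \<forall>w\<in>coord_space k. f (u + w) = f u + f w) \<and>
    (\<forall>c. \<forall>u\<in>coord_space k. f (c *\<^sub>c u) = c *\<^sub>c f u)"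

lemma linear_onD:
  assumes "linear_on k f"
  shows "u \<in> coord_space k \<Longrightarrow> w \<in> coord_space k \<Longrightarrow> f (u + w) = f u + f w"
    "u \<in> coord_space k \<Longrightarrow> f (c *\<^sub>c u) = c *\<^sub>c f u" "f 0 = 0"
proof -
  show "u \<in> coord_space k \<Longrightarrow> w \<in> coord_space k \<Longrightarrow> f (u + w) = f u + f w"
    and s: "u \<in> coord_space k \<Longrightarrow> f (c *\<^sub>c u) = c *\<^sub>c f u" for u c
    using assms by (auto simp: linear_on_def)
  show "f 0 = 0" using s[of 0 0] coord_space_closed(1) by simp
qed

lemma coord_space_sum: "(\<And>i. i \<in> A \<Longrightarrow> f i \<in> coord_space k) \<Longrightarrow> sum f A \<in> coord_space k"
  by (induction A rule: infinite_finite_induct) (auto intro: coord_space_closed)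

lemma linear_on_sum:
  assumes "linear_on k f" "\<And>i. i \<in> A \<Longrightarrow> g i \<in> coord_space k"
  shows "f (\<Sum>i\<in>A. c i *\<^sub>c g i) = (\<Sum>i\<in>A. c i *\<^sub>c f (g i))"
  using assms(2)
proof (induction A rule: infinite_finite_induct)
  case (insert x F)
  have "c x *\<^sub>c g x \<in> coord_space k" "(\<Sum>i\<in>F. c i *\<^sub>c g i) \<in> coord_space k"
    using insert.prems by (auto intro!: coord_space_sum coord_space_closed(3))
  then have "f (c x *\<^sub>c g x + (\<Sum>i\<in>F. c i *\<^sub>c g i)) = c x *\<^sub>c f (g x) + f (\<Sum>i\<in>F. c i *\<^sub>c g i)"
    using linear_onD(1,2)[OF assms(1)] insert.prems by (metis insertI1)
  also have "f (\<Sum>i\<in>F. c i *\<^sub>c g i) = (\<Sum>i\<in>F. c i *\<^sub>c f (g i))"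
    using insert.IH insert.prems by blast
  finally show ?case unfolding sum.insert[OF insert(1,2)] .
qed (use linear_onD[OF assms(1)] in auto)

lemma linear_on_expand:
  "linear_on k f \<Longrightarrow> v \<in> coord_space k \<Longrightarrow> f v = (\<Sum>j<k. v j *\<^sub>c f (unit_vec j))"
  using linear_on_sum[of k f "{..<k}" unit_vec v] coord_space_expand[of v k] unit_vec_in by auto

lemma linear_on_diff: "linear_on k f \<Longrightarrow> u \<in> coord_space k \<Longrightarrow> w \<in> coord_space k \<Longrightarrow> f (u - w) = f u - f w"
  using linear_onD(1)[of k f "u - w" w] coord_space_closed(5)[of u k w] by (simp add: algebra_simps)

lemma linear_on_inv:
  assumes lin: "linear_on k f" and bij: "bij_betw f (coord_space k) (coord_space k)"
  shows "linear_on k (inv_into (coord_space k) f)"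
proof -
  let ?g = "inv_into (coord_space k) f"
  have g: "?g v \<in> coord_space k" "f (?g v) = v" if "v \<in> coord_space k" for v
    using bij that by (auto simp: bij_betw_def inv_into_into f_inv_into_f)
  have e: "?g (f v) = v" if "v \<in> coord_space k" for v
    using bij that by (simp add: bij_betw_def)
  have "?g (u + w) = ?g u + ?g w" if "u \<in> coord_space k" "w \<in> coord_space k" for u w
    using e[of "?g u + ?g w"] g that linear_onD(1)[OF lin, of "?g u" "?g w"] coord_space_closed(2) by simp
  moreover have "?g (c *\<^sub>c u) = c *\<^sub>c ?g u" if "u \<in> coord_space k" for u c
    using e[of "c *\<^sub>c ?g u"] g that linear_onD(2)[OF lin, of "?g u"] coord_space_closed(3) by simp
  ultimately show ?thesis by (simp add: linear_on_def)
qed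

lemma family_linear_on:
  assumes "\<And>v. v \<in> coord_space k \<Longrightarrow> f v = (\<Sum>j<k. v j *\<^sub>c a j)"
  shows "linear_on k f"
  unfolding linear_on_def
  using assms by (auto simp: coord_space_closed fun_eq_iff sum_coords_apply distrib_right sum.distrib
      sum_distrib_left mult.assoc)

text \<open>A left inverse at the rescaled parameter suffices: \<open>s = -1\<close> with the same
  family serves for actions, \<open>s = 1\<close> with the inverse map for automorphisms.\<close>

theorem linear_family:
  assumes \<theta>: "morphism (affine_proj m n) (proj n) (\<lambda>(x, L). \<theta> x L)"
    and \<theta>': "morphism (affine_proj m n) (proj n) (\<lambda>(x, L). \<theta>' x L)"
    and inv: "\<And>x L. x \<in> coord_space m \<Longrightarrow> L \<in> proj_points n \<Longrightarrow> \<theta>' (s *\<^sub>c x) (\<theta> x L) = L"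
    and n: "n > 0"
  obtains G where "poly_family m (Suc n) G" "\<And>x. x \<in> coord_space m \<Longrightarrow> linear_on (Suc n) (G x)"
    "\<And>x v. x \<in> coord_space m \<Longrightarrow> v \<in> coord_space (Suc n) \<Longrightarrow> v \<noteq> 0 \<Longrightarrow>
      G x v \<noteq> 0 \<and> \<theta> x (line v) = line (G x v)"
proof -
  obtain G where G: "poly_family m (Suc n) G"
    and Gr: "\<And>x v. x \<in> coord_space m \<Longrightarrow> v \<in> coord_space (Suc n) \<Longrightarrow> v \<noteq> 0 \<Longrightarrow>
      G x v \<noteq> 0 \<and> \<theta> x (line v) = line (G x v)" using global_family[OF \<theta>] by blast
  obtain H where H: "poly_family m (Suc n) H"
    and Hr: "\<And>x v. x \<in> coord_space m \<Longrightarrow> v \<in> coord_space (Suc n) \<Longrightarrow> v \<noteq> 0 \<Longrightarrow>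
      H x v \<noteq> 0 \<and> \<theta>' x (line v) = line (H x v)" using global_family[OF \<theta>'] by blast
  define G' where "G' x v = H (s *\<^sub>c x) v" for x v
  have G': "poly_family m (Suc n) G'" unfolding G'_def
    by (rule poly_family_comp[OF H poly_family_id])
      (auto intro: coord_space_closed polys_scale polys_var)
  have G'r: "G' x v \<noteq> 0 \<and> \<theta>' (s *\<^sub>c x) (line v) = line (G' x v)"
    if "x \<in> coord_space m" "v \<in> coord_space (Suc n)" "v \<noteq> 0" for x v
    unfolding G'_def using Hr that coord_space_closed(3) by blast
  have comp: "\<exists>c. c \<noteq> 0 \<and> G' x (G x v) = c *\<^sub>c v"
    if x: "x \<in> coord_space m" and v: "v \<in> coord_space (Suc n)" "v \<noteq> 0" for x v
  proof -
    have in_cs: "G x v \<in> coord_space (Suc n)" using poly_family_in[OF G x v(1)] .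
    have "line v = line (G' x (G x v))"
      using inv[OF x line_in_proj[OF v]] Gr[OF x v] G'r[OF x in_cs] by auto
    then obtain c where c: "G' x (G x v) = c *\<^sub>c v" using line_eqD by blast
    moreover have "G' x (G x v) \<noteq> 0" using Gr[OF x v] G'r[OF x in_cs] by blast
    ultimately show ?thesis using smul_eq_0_iff by metis
  qed
  have "Suc n > 1" using n by simp
  from inverse_families_scalar[OF G G' this comp]
  obtain c where c: "c \<noteq> 0" "\<And>x v. x \<in> coord_space m \<Longrightarrow> v \<in> coord_space (Suc n) \<Longrightarrow> v \<noteq> 0 \<Longrightarrow> G' x (G x v) = c *\<^sub>c v"
    by blast
  have lines: "\<exists>b. K x (a *\<^sub>c v) = b *\<^sub>c K x v"
    if K: "\<And>v. v \<in> coord_space (Suc n) \<Longrightarrow> v \<noteq> 0 \<Longrightarrow> T (line v) = line (K x v)"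
      and v: "v \<in> coord_space (Suc n)" "v \<noteq> 0" "a \<noteq> 0" for K :: "coords \<Rightarrow> coords \<Rightarrow> coords" and T x a v
  proof -
    have "line (K x v) = line (K x (a *\<^sub>c v))"
      using K[OF v(1,2)] K[OF coord_space_closed(3)[OF v(1)], of a] v line_smul[OF v(3), of v]
      by (auto simp: smul_eq_0_iff)
    then show ?thesis by (rule line_eqD)
  qed
  have "linear_on (Suc n) (G x)" if x: "x \<in> coord_space m" for x
  proof (rule family_linear_on)
    fix v assume v: "v \<in> coord_space (Suc n)"
    show "G x v = (\<Sum>j<Suc n. v j *\<^sub>c G x (unit_vec j))"
    proof (rule inverse_families_linear[OF G G' _ _ _ c x v])
      show "G y w \<noteq> 0" if "y \<in> coord_space m" "w \<in> coord_space (Suc n)" "w \<noteq> 0" for y w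
        using Gr that by blast
      show "\<exists>b. G y (a *\<^sub>c w) = b *\<^sub>c G y w"
        if "y \<in> coord_space m" "w \<in> coord_space (Suc n)" "w \<noteq> 0" "a \<noteq> 0" for y w a
        using lines[of "\<theta> y" G y w a] Gr that by blast
      show "\<exists>b. G' y (a *\<^sub>c w) = b *\<^sub>c G' y w"
        if "y \<in> coord_space m" "w \<in> coord_space (Suc n)" "w \<noteq> 0" "a \<noteq> 0" for y w a
        using lines[of "\<theta>' (s *\<^sub>c y)" G' y w a] G'r that by blast
    qed
  qed
  then show thesis using that G Gr by blast
qed

lemma proj_points_0: "L \<in> proj_points 0 \<Longrightarrow> L' \<in> proj_points 0 \<Longrightarrow> L = L'"
proof -
  have "L = line (unit_vec 0)" if L: "L \<in> proj_points 0" for L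
  proof -
    obtain v where v: "v \<in> coord_space (Suc 0)" "v \<noteq> 0" "L = line v" using proj_points_cases[OF L] .
    have "v = v 0 *\<^sub>c unit_vec 0" using v(1) by (auto simp: fun_eq_iff unit_vec_def coord_space_def)
    then show ?thesis using v(2,3) line_smul smul_eq_0_iff by metis
  qed
  then show "L \<in> proj_points 0 \<Longrightarrow> L' \<in> proj_points 0 \<Longrightarrow> L = L'" by metis
qed

text \<open>The cocycle of a projective representation of a vector group is a nowhere vanishing
  polynomial, hence trivial after normalisation at the origin.\<close>

theorem linear_action:
  assumes act: "morphism (affine_proj m n) (proj n) (\<lambda>(x, L). act x L)"
    and act0: "\<And>L. L \<in> proj_points n \<Longrightarrow> act 0 L = L"
    and act_add: "\<And>x y L. x \<in> coord_space m \<Longrightarrow> y \<in> coord_space m \<Longrightarrow> L \<in> proj_points n \<Longrightarrow>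
      act (x + y) L = act x (act y L)"
  obtains B where "poly_family m (Suc n) B" "\<And>x. x \<in> coord_space m \<Longrightarrow> linear_on (Suc n) (B x)"
    "\<And>v. v \<in> coord_space (Suc n) \<Longrightarrow> B 0 v = v"
    "\<And>x y v. x \<in> coord_space m \<Longrightarrow> y \<in> coord_space m \<Longrightarrow> v \<in> coord_space (Suc n) \<Longrightarrow> B (x + y) v = B x (B y v)"
    "\<And>x v. x \<in> coord_space m \<Longrightarrow> v \<in> coord_space (Suc n) \<Longrightarrow> v \<noteq> 0 \<Longrightarrow> act x (line v) = line (B x v)"
proof (cases "n = 0")
  case True
  have "act x (line v) = line v" if "x \<in> coord_space m" "v \<in> coord_space (Suc n)" "v \<noteq> 0" for x v
    using act that line_in_proj[OF that(2,3)] True unfolding morphism_def points_simps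
    by (intro proj_points_0) auto
  then show thesis using that[of "\<lambda>x v. v"] poly_family_id by (simp add: linear_on_def)
next
  case False
  let ?k = "Suc n"
  have neg: "(-1) *\<^sub>c x = - x" for x by (auto simp: fun_eq_iff)
  have inv: "act ((-1) *\<^sub>c x) (act x L) = L" if "x \<in> coord_space m" "L \<in> proj_points n" for x L
    using act_add[of "- x" x L] act0 that coord_space_closed(4) unfolding neg by simp
  obtain G where G: "poly_family m ?k G" "\<And>x. x \<in> coord_space m \<Longrightarrow> linear_on ?k (G x)"
    and Gr: "\<And>x v. x \<in> coord_space m \<Longrightarrow> v \<in> coord_space ?k \<Longrightarrow> v \<noteq> 0 \<Longrightarrow>
      G x v \<noteq> 0 \<and> act x (line v) = line (G x v)"
    using linear_family[OF act act inv] False by (metis gr0I)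
  have k1: "?k > 1" using False by simp
  have z: "(0 :: coords) \<in> coord_space j" for j by (rule coord_space_closed)
  \<comment> \<open>At the origin of the group \<open>G\<close> represents the identity of
    projective space, hence acts by one scalar \<open>c\<close>; dividing by it normalises the
    representation.\<close>
  have "poly_family m ?k (\<lambda>x. G 0)"
    by (rule poly_family_comp[OF G(1) poly_family_id]) (auto intro: z polys_const)
  moreover have "\<exists>c. c \<noteq> 0 \<and> G 0 v = c *\<^sub>c v" if "v \<in> coord_space ?k" "v \<noteq> 0" for v
  proof -
    have "line v = line (G 0 v)" using Gr[OF z that] act0[OF line_in_proj[OF that]] by simp
    then show ?thesis using line_eqD Gr[OF z that] smul_eq_0_iff by metis
  qed
  ultimately obtain c where c: "c \<noteq> 0" "\<And>v. v \<in> coord_space ?k \<Longrightarrow> v \<noteq> 0 \<Longrightarrow> G 0 v = c *\<^sub>c v"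
    using inverse_families_scalar[of m ?k "\<lambda>x v. v" "\<lambda>x. G 0", OF poly_family_id _ k1] z by blast
  define B where "B x v = inverse c *\<^sub>c G x v" for x v
  have B: "poly_family m ?k B" unfolding B_def by (rule poly_family_scale[OF G(1)])
  have lin: "linear_on ?k (B x)" if "x \<in> coord_space m" for x
    using G(2)[OF that] by (auto simp: B_def linear_on_def fun_eq_iff algebra_simps)
  have B0: "B 0 v = v" if "v \<in> coord_space ?k" for v
    using c(2)[OF that] c(1) linear_onD(3)[OF lin[OF z]] by (cases "v = 0") (auto simp: B_def)
  have Br: "B x v \<noteq> 0 \<and> act x (line v) = line (B x v)"
    if "x \<in> coord_space m" "v \<in> coord_space ?k" "v \<noteq> 0" for x v
    using Gr[OF that] c(1) line_smul[of "inverse c" "G x v"] by (simp add: B_def smul_eq_0_iff)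
  have Bin: "B x v \<in> coord_space ?k" if "x \<in> coord_space m" "v \<in> coord_space ?k" for x v
    using poly_family_in[OF B that] .
  \<comment> \<open>A pair of group elements is coded as one parameter vector of length
    \<open>m + m\<close>, so that the cocycle becomes the scalar belonging to one pair of
    families.\<close>
  define fs where "fs z = trunc m z" for z
  define sn where "sn z = trunc m (\<lambda>i. z (m + i))" for z :: coords
  have fs: "fs z \<in> coord_space m" "sn z \<in> coord_space m" for z
    unfolding fs_def sn_def by (rule trunc_in)+
  have pf: "(\<lambda>z. fs z i) \<in> polys (m + m)" "(\<lambda>z. sn z i) \<in> polys (m + m)" if "i < m" for i
    using that by (auto simp: fs_def sn_def trunc_def intro: polys_var)
  have P1: "poly_family (m + m) ?k (\<lambda>z v. B (fs z + sn z) v)"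
    by (rule poly_family_comp[OF B poly_family_id]) (use fs pf in \<open>auto intro: coord_space_closed polys_add\<close>)
  have neg_polys: "(\<lambda>z. - f z) \<in> polys (m + m)" if "f \<in> polys (m + m)" for f
    using polys_scale[OF that, of "-1"] by simp
  have P2: "poly_family (m + m) ?k (\<lambda>z v. B (- sn z) (B (- fs z) v))"
    by (rule poly_family_comp[OF B poly_family_comp[OF B poly_family_id]])
      (use fs pf neg_polys in \<open>auto intro: coord_space_closed\<close>)
  have comp: "\<exists>c. c \<noteq> 0 \<and> B (- sn z) (B (- fs z) (B (fs z + sn z) v)) = c *\<^sub>c v"
    if v: "v \<in> coord_space ?k" "v \<noteq> 0" for z v
  proof -
    let ?u = "B (fs z + sn z) v"
    have in_cs: "fs z + sn z \<in> coord_space m" "- fs z \<in> coord_space m" "- sn z \<in> coord_space m"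
      using fs by (auto intro: coord_space_closed)
    have u: "?u \<in> coord_space ?k" "?u \<noteq> 0" using Bin Br in_cs v by blast+
    have w: "B (- fs z) ?u \<in> coord_space ?k" "B (- fs z) ?u \<noteq> 0" using Bin Br in_cs u by blast+
    have pp: "act x L \<in> proj_points n" if "x \<in> coord_space m" "L \<in> proj_points n" for x L
      using act that unfolding morphism_def points_simps by auto
    have L: "line v \<in> proj_points n" using line_in_proj v by blast
    have "line (B (- sn z) (B (- fs z) ?u)) = act (- sn z) (act (- fs z) (act (fs z + sn z) (line v)))"
      using Br in_cs u v w by simp
    also have "act (- fs z) (act (fs z + sn z) (line v)) = act (sn z) (line v)"
      using act_add[OF in_cs(2,1) L] by simp
    also have "act (- sn z) (act (sn z) (line v)) = line v"
      using act_add[OF in_cs(3) fs(2)[of z] L] act0[OF L] by simp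
    finally have "line v = line (B (- sn z) (B (- fs z) ?u))" ..
    then obtain c where "B (- sn z) (B (- fs z) ?u) = c *\<^sub>c v" using line_eqD by blast
    moreover have "B (- sn z) (B (- fs z) ?u) \<noteq> 0" using Br in_cs w by blast
    ultimately show ?thesis using smul_eq_0_iff by metis
  qed
  obtain d where d: "\<And>z v. z \<in> coord_space (m + m) \<Longrightarrow> v \<in> coord_space ?k \<Longrightarrow> v \<noteq> 0 \<Longrightarrow>
      B (- sn z) (B (- fs z) (B (fs z + sn z) v)) = d *\<^sub>c v"
    using inverse_families_scalar[OF P1 P2 k1 comp] by blast
  \<comment> \<open>Both group elements are set to zero, where \<open>B\<close> is the
    identity.\<close>
  have "d = 1"
  proof -
    have u: "unit_vec 0 \<in> coord_space ?k" "unit_vec 0 \<noteq> 0"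
      using unit_vec_in[of 0 ?k] by (auto simp: unit_vec_def fun_eq_iff)
    have "fs 0 = 0" "sn 0 = 0" by (auto simp: fs_def sn_def trunc_def fun_eq_iff)
    then have "d *\<^sub>c unit_vec 0 = unit_vec 0" using d[OF z u] B0[OF u(1)] by simp
    from fun_cong[OF this, of 0] show ?thesis by (simp add: unit_vec_def)
  qed
  have key: "B (- y) (B (- x) (B (x + y) v)) = v"
    if x: "x \<in> coord_space m" and y: "y \<in> coord_space m" and v: "v \<in> coord_space ?k" for x y v
  proof (cases "v = 0")
    case True
    have "x + y \<in> coord_space m" "- x \<in> coord_space m" "- y \<in> coord_space m"
      using x y by (auto intro: coord_space_closed)
    then show ?thesis using True linear_onD(3)[OF lin] by simp
  next
    case False
    have "fs (join_coords m x y) = x" "sn (join_coords m x y) = y"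
      using x y by (auto simp: fs_def sn_def trunc_def join_coords_def coord_space_def fun_eq_iff)
    moreover have "join_coords m x y \<in> coord_space (m + m)"
      using y by (auto simp: join_coords_def coord_space_def)
    ultimately show ?thesis using d[of "join_coords m x y" v] v False \<open>d = 1\<close> by simp
  qed
  have inv2: "B x (B (- x) v) = v" if "x \<in> coord_space m" "v \<in> coord_space ?k" for x v
    using key[of "- x" 0 v] B0 Bin z that coord_space_closed(4) by simp
  have "B (x + y) v = B x (B y v)"
    if x: "x \<in> coord_space m" and y: "y \<in> coord_space m" and v: "v \<in> coord_space ?k" for x y v
  proof -
    have u: "B (x + y) v \<in> coord_space ?k" using Bin x y v coord_space_closed(2) by blast
    then have "B y v = B (- x) (B (x + y) v)"
      using inv2[OF y Bin[OF coord_space_closed(4)[OF x] u]] key[OF x y v] by simp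
    then show ?thesis using inv2[OF x u] by simp
  qed
  then show thesis using that[OF B lin B0] Br by blast
qed

section \<open>Dimension, independence and linear forms in coordinate spaces\<close>

interpretation cv: vector_space smul
  by unfold_locales (auto simp: fun_eq_iff algebra_simps)

interpretation cvq: vector_space_pair smul "(*) :: Qbar \<Rightarrow> Qbar \<Rightarrow> Qbar"
  by unfold_locales (auto simp: algebra_simps)

lemma coord_space_subspace: "cv.subspace (coord_space k)"
  by (auto simp: cv.subspace_def intro: coord_space_closed)

lemma coord_space_span: "cv.span (unit_vec ` {..<k}) = coord_space k"
proof
  show "cv.span (unit_vec ` {..<k}) \<subseteq> coord_space k"
    by (rule cv.span_minimal[OF _ coord_space_subspace]) (auto intro: unit_vec_in)
  show "coord_space k \<subseteq> cv.span (unit_vec ` {..<k})"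
  proof
    fix v assume "v \<in> coord_space k"
    then have "v = (\<Sum>j<k. v j *\<^sub>c unit_vec j)" by (rule coord_space_expand)
    also have "\<dots> \<in> cv.span (unit_vec ` {..<k})"
      by (intro cv.span_sum cv.span_scale cv.span_base) auto
    finally show "v \<in> cv.span (unit_vec ` {..<k})" .
  qed
qed

lemma independent_card_le:
  assumes "cv.independent B" "B \<subseteq> cv.span C" "finite C"
  shows "finite B" "card B \<le> card C"
  using cv.independent_span_bound[OF assms(3,1,2)] by auto

lemma subspace_basis:
  assumes "cv.subspace U" "U \<subseteq> coord_space k"
  obtains B where "B \<subseteq> U" "finite B" "cv.independent B" "cv.span B = U" "card B = cv.dim U" "card B \<le> k"
proof -
  obtain B where B: "B \<subseteq> U" "cv.independent B" "U \<subseteq> cv.span B" "card B = cv.dim U"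
    using cv.basis_exists by blast
  have "B \<subseteq> cv.span (unit_vec ` {..<k})" using B assms unfolding coord_space_span by blast
  from independent_card_le[OF B(2) this]
  have "finite B" "card B \<le> card (unit_vec ` {..<k})" by auto
  moreover have "card (unit_vec ` {..<k}) \<le> k" using card_image_le[of "{..<k}" unit_vec] by simp
  moreover have "cv.span B = U" using B(1,3) cv.span_minimal[OF B(1) assms(1)] by blast
  ultimately show thesis using that B by simp
qed

lemma dim_less:
  assumes U: "cv.subspace U" and W: "cv.subspace W" "W \<subseteq> coord_space k" and "U \<subset> W"
  shows "cv.dim U < cv.dim W"
proof -
  have "U \<subseteq> coord_space k" using assms by blast
  from subspace_basis[OF U this] obtain B where B: "B \<subseteq> U" "finite B" "cv.independent B" "cv.span B = U" "card B = cv.dim U" "card B \<le> k"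
    .
  obtain C where C: "C \<subseteq> W" "finite C" "cv.independent C" "cv.span C = W" "card C = cv.dim W" "card C \<le> k"
    using subspace_basis[OF W] .
  obtain w where w: "w \<in> W" "w \<notin> U" using assms by blast
  have "cv.independent (insert w B)" using B w by (simp add: cv.independent_insert)
  moreover have "insert w B \<subseteq> cv.span C" using w B C assms by blast
  ultimately have "card (insert w B) \<le> card C" using independent_card_le C by blast
  moreover have "w \<notin> B" using w B by blast
  ultimately show ?thesis using B C by simp
qed

lemma dim_le:
  assumes U: "cv.subspace U" and W: "cv.subspace W" "W \<subseteq> coord_space k" and "U \<subseteq> W"
  shows "cv.dim U \<le> cv.dim W"
  using dim_less[OF U W] assms(4) by (cases "U = W") (auto simp: psubset_eq)

lemma independent_family:
  fixes n :: nat
  assumes "\<And>c. (\<Sum>j<n. c j *\<^sub>c w j) = 0 \<Longrightarrow> \<forall>j<n. c j = 0"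
  shows "inj_on w {..<n}" "cv.independent (w ` {..<n})"
proof -
  show inj: "inj_on w {..<n}"
  proof (rule inj_onI, rule ccontr)
    fix i j assume ij: "i \<in> {..<n}" "j \<in> {..<n}" "w i = w j" "i \<noteq> j"
    define c where "c h = (if h = i then 1 else if h = j then -1 else 0 :: Qbar)" for h
    have "(\<Sum>h<n. c h *\<^sub>c w h) = (\<Sum>h\<in>{i, j}. c h *\<^sub>c w h)"
      using ij by (intro sum.mono_neutral_right) (auto simp: c_def)
    also have "\<dots> = 0" using ij by (auto simp: c_def fun_eq_iff)
    finally show False using assms[of c] ij(1) by (auto simp: c_def)
  qed
  show "cv.independent (w ` {..<n})"
  proof (rule cv.independent_if_scalars_zero)
    fix f x assume "(\<Sum>x\<in>w ` {..<n}. f x *\<^sub>c x) = 0" "x \<in> w ` {..<n}"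
    then show "f x = 0" using assms[of "\<lambda>j. f (w j)"] inj by (auto simp: sum.reindex)
  qed simp
qed

lemma span_family:
  fixes n :: nat
  assumes "v \<in> cv.span (w ` {..<n})" "inj_on w {..<n}"
  shows "\<exists>c. v = (\<Sum>j<n. c j *\<^sub>c w j)"
proof -
  obtain u where "v = (\<Sum>x\<in>w ` {..<n}. u x *\<^sub>c x)"
    using assms(1) by (subst (asm) cv.span_finite) auto
  then show ?thesis using assms(2) by (intro exI[of _ "\<lambda>j. u (w j)"]) (simp add: sum.reindex)
qed

lemma independent_family_spans:
  fixes n :: nat
  assumes ind: "\<And>c. (\<Sum>j<n. c j *\<^sub>c w j) = 0 \<Longrightarrow> \<forall>j<n. c j = 0"
    and W: "cv.subspace W" "W \<subseteq> coord_space k" "cv.dim W \<le> n" and w: "\<And>j. j < n \<Longrightarrow> w j \<in> W"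
    and v: "v \<in> W"
  shows "\<exists>c. v = (\<Sum>j<n. c j *\<^sub>c w j)"
proof -
  let ?U = "cv.span (w ` {..<n})"
  have sub: "?U \<subseteq> W" by (rule cv.span_minimal[OF _ W(1)]) (use w in auto)
  have "cv.dim ?U = card (w ` {..<n})"
    by (intro cv.dim_eq_card) (use independent_family[OF ind] in \<open>auto simp: cv.span_span\<close>)
  then have "cv.dim ?U = n" using independent_family(1)[OF ind] by (simp add: card_image)
  then have "?U = W" using dim_less[OF cv.subspace_span W(1,2), of "w ` {..<n}"] sub W(3) by fastforce
  then show ?thesis using span_family v independent_family(1)[OF ind] by blast
qed

lemma independent_unit_vec: "(\<Sum>j<k. c j *\<^sub>c unit_vec j) = 0 \<Longrightarrow> \<forall>j<k. c j = 0"
proof (intro allI impI)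
  fix j assume z: "(\<Sum>j<k. c j *\<^sub>c unit_vec j) = 0" and j: "j < k"
  have "(\<Sum>h<k. c h *\<^sub>c unit_vec h) j = (\<Sum>h<k. if h = j then c j else 0)"
    unfolding sum_coords_apply by (intro sum.cong) (auto simp: unit_vec_def)
  then show "c j = 0" using z j by simp
qed

lemma dim_coord_space: "cv.dim (coord_space k) = k"
proof -
  have "cv.dim (coord_space k) = card (unit_vec ` {..<k})"
    using independent_family(2)[OF independent_unit_vec] coord_space_span
    by (intro cv.dim_eq_card) (auto simp: cv.span_eq_iff[THEN iffD2, OF coord_space_subspace])
  then show ?thesis using independent_family(1)[OF independent_unit_vec] by (simp add: card_image)
qed

lemma linear_inj_bij:
  assumes lin: "linear_on k f" and maps: "\<And>v. v \<in> coord_space k \<Longrightarrow> f v \<in> coord_space k"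
    and inj: "\<And>v. v \<in> coord_space k \<Longrightarrow> f v = 0 \<Longrightarrow> v = 0"
  shows "bij_betw f (coord_space k) (coord_space k)"
  unfolding bij_betw_def
proof (intro conjI equalityI)
  show "inj_on f (coord_space k)"
  proof (rule inj_onI)
    fix u v assume uv: "u \<in> coord_space k" "v \<in> coord_space k" "f u = f v"
    then have "f (u - v) = 0" using linear_on_diff[OF lin uv(1,2)] by simp
    then have "u - v = 0" using inj[of "u - v"] coord_space_closed(5)[OF uv(1,2)] by blast
    then show "u = v" by simp
  qed
  have comb: "(\<Sum>j<k. c j *\<^sub>c f (unit_vec j)) = f (\<Sum>j<k. c j *\<^sub>c unit_vec j)" for c
    using linear_on_sum[OF lin, of "{..<k}" unit_vec c] unit_vec_in by auto
  have in_cs: "(\<Sum>j<k. c j *\<^sub>c unit_vec j) \<in> coord_space k" for c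
    by (intro coord_space_sum coord_space_closed(3) unit_vec_in) auto
  show "coord_space k \<subseteq> f ` coord_space k"
  proof
    fix v assume "v \<in> coord_space k"
    moreover have "\<forall>j<k. c j = 0" if "(\<Sum>j<k. c j *\<^sub>c f (unit_vec j)) = 0" for c
      using that inj[OF in_cs] independent_unit_vec unfolding comb by blast
    ultimately obtain c where "v = (\<Sum>j<k. c j *\<^sub>c f (unit_vec j))"
      using independent_family_spans[OF _ coord_space_subspace subset_refl, where n = k and w = "\<lambda>j. f (unit_vec j)"]
        maps unit_vec_in unfolding dim_coord_space by blast
    then show "v \<in> f ` coord_space k" unfolding comb using in_cs by blast
  qed
qed (use maps in auto)

text \<open>A basis of \<open>U\<close> is extended by \<open>w\<close>, and the form is prescribed
  on it. Its use: a proper subspace misses a nonempty open set of projective space, the complement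
  of a hyperplane.\<close>

lemma separating_form:
  assumes U: "cv.subspace U" "U \<subseteq> coord_space k" and w: "w \<in> coord_space k" "w \<notin> U"
  shows "\<exists>a. (\<forall>u\<in>U. (\<Sum>i<k. a i * u i) = 0) \<and> (\<Sum>i<k. a i * w i) = 1"
proof -
  obtain B where B: "B \<subseteq> U" "finite B" "cv.independent B" "cv.span B = U" "card B = cv.dim U" "card B \<le> k"
    using subspace_basis[OF U] .
  have "cv.independent (insert w B)" using B w by (simp add: cv.independent_insert)
  then obtain g where g: "Vector_Spaces.linear smul (*) g" "\<forall>x\<in>insert w B. g x = (if x = w then 1 else 0 :: Qbar)"
    using cvq.linear_independent_extend[of "insert w B" "\<lambda>x. if x = w then 1 else 0"] by blast
  interpret g: Vector_Spaces.linear smul "(*)" g by (rule g(1))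
  have "g u = 0" if "u \<in> U" for u
  proof -
    have "g x = 0" if "x \<in> B" for x using g(2) that B w by auto
    then show ?thesis using that B(4) g.eq_0_on_span by blast
  qed
  moreover have "g v = (\<Sum>i<k. g (unit_vec i) * v i)" if "v \<in> coord_space k" for v
    by (subst coord_space_expand[OF that]) (simp only: g.sum g.scale mult.commute)
  ultimately have "\<forall>u\<in>U. (\<Sum>i<k. g (unit_vec i) * u i) = 0" "(\<Sum>i<k. g (unit_vec i) * w i) = g w"
    using U(2) w(1) by (auto simp: subset_iff)
  moreover have "g w = 1" using g(2) by simp
  ultimately show ?thesis by (intro exI[of _ "\<lambda>i. g (unit_vec i)"]) simp
qed

lemma morphism_snd: "morphism (affine_proj m n) (proj n) snd"
  unfolding affine_proj_def proj_def
proof (rule coord_morphism[where \<Theta> = snd])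
  show "snd ` (coord_space m \<times> proj_points n) \<subseteq> proj_points n" by auto
  show "snd v \<in> snd p - {\<lambda>_. 0}" if "v \<in> (\<lambda>(x, L). {x} \<times> (L - {\<lambda>_. 0})) p" for p v using that by auto
  show "(\<lambda>(x, L). {x} \<times> (L - {\<lambda>_. 0})) p \<noteq> {}" if "p \<in> coord_space m \<times> proj_points n" for p
    using that proj_reps_nonempty by auto
  show "(\<lambda>p. f (snd p)) \<in> mixed_forms m (Suc n) d" if "f \<in> forms (Suc n) d" for d f
    by (rule forms_subst[OF that, where C = "mixed_forms m (Suc n)" and g = "\<lambda>i p. snd p i"])
      (fact mixed_forms_zero mixed_forms_const mixed_forms_add mixed_forms_mult mixed_forms_v)+
  show "f w' \<noteq> 0" if "f \<in> forms (Suc n) d" "q \<in> proj_points n" "w \<in> q - {\<lambda>_. 0}"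
    "w' \<in> q - {\<lambda>_. 0}" "f w \<noteq> 0" for d f q w w'
    using proj_homogeneous[OF that] .
qed

text \<open>An automorphism is a family over the parameter space of dimension 0, with the inverse
  automorphism as inverse family; composing with the projection \<open>snd\<close> makes it a
  morphism of two arguments.\<close>

theorem linear_automorphism:
  assumes j: "variety_iso (proj n) (proj n) j"
  obtains J where "linear_on (Suc n) J" "bij_betw J (coord_space (Suc n)) (coord_space (Suc n))"
    "\<And>v. v \<in> coord_space (Suc n) \<Longrightarrow> v \<noteq> 0 \<Longrightarrow> j (line v) = line (J v)"
proof (cases "n = 0")
  case True
  have "j (line v) = line v" if "v \<in> coord_space (Suc n)" "v \<noteq> 0" for v
    using j that line_in_proj[OF that] True unfolding variety_iso_def morphism_def points_simps
    by (intro proj_points_0) auto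
  then show thesis using that[of "\<lambda>v. v"] by (simp add: linear_on_def bij_betw_def)
next
  case False
  obtain j' where j': "morphism (proj n) (proj n) j" "morphism (proj n) (proj n) j'"
    "\<forall>L\<in>proj_points n. j' (j L) = L"
    using j unfolding variety_iso_def points_simps by blast
  have "morphism (affine_proj 0 n) (proj n) (\<lambda>(x, L). i L)" if "morphism (proj n) (proj n) i" for i
  proof -
    have "(\<lambda>(x, L). i L) = (\<lambda>p :: coords \<times> _. i (snd p))" by auto
    then show ?thesis using morphism_comp[OF morphism_snd that, of 0] by simp
  qed
  note m = this[OF j'(1)] this[OF j'(2)]
  have z: "(0 :: coords) \<in> coord_space i" for i by (rule coord_space_closed)
  obtain G where G: "poly_family 0 (Suc n) G" "\<And>x. x \<in> coord_space 0 \<Longrightarrow> linear_on (Suc n) (G x)"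
    "\<And>x v. x \<in> coord_space 0 \<Longrightarrow> v \<in> coord_space (Suc n) \<Longrightarrow> v \<noteq> 0 \<Longrightarrow> G x v \<noteq> 0 \<and> j (line v) = line (G x v)"
    using linear_family[of 0 n "\<lambda>x. j" "\<lambda>x. j'" 1, OF m] j'(3) False by (metis gr0I)
  have "bij_betw (G 0) (coord_space (Suc n)) (coord_space (Suc n))"
    using G z poly_family_in[OF G(1) z] by (intro linear_inj_bij) blast+
  then show thesis using that[OF G(2)[OF z]] G(3)[OF z] by blast
qed

section \<open>Algebra structures on the coordinate space\<close>

declare smul_apply [simp del] plus_fun_apply [simp del] minus_apply [simp del] uminus_apply [simp del]
  zero_fun_apply [simp del]

text \<open>A commutative algebra structure on the coordinate space. Multiplication is total and
  truncates its arguments, so that its laws need no membership conditions.\<close>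

locale coord_algebra =
  fixes l :: nat and mul :: "coords \<Rightarrow> coords \<Rightarrow> coords" (infixl \<open>\<star>\<close> 70) and e :: coords
  assumes mul_in [simp]: "u \<star> v \<in> coord_space l"
    and mul_assoc: "(u \<star> v) \<star> w = u \<star> (v \<star> w)"
    and mul_comm: "u \<star> v = v \<star> u"
    and mul_add_left: "(u + v) \<star> w = u \<star> w + v \<star> w"
    and mul_smul_left: "(c *\<^sub>c u) \<star> w = c *\<^sub>c (u \<star> w)"
    and unit_in [simp]: "e \<in> coord_space l"
    and unit_mul_trunc: "e \<star> u = trunc l u"
begin

abbreviation "V \<equiv> coord_space l"

lemma trunc_id: "u \<in> coord_space k \<Longrightarrow> trunc k u = u"
  by (auto simp: trunc_def coord_space_def)

lemma unit_mul [simp]: "u \<in> V \<Longrightarrow> e \<star> u = u" "u \<in> V \<Longrightarrow> u \<star> e = u"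
  using mul_comm by (simp_all add: unit_mul_trunc trunc_id)

lemma mul_left_comm: "u \<star> (v \<star> w) = v \<star> (u \<star> w)"
  by (metis mul_assoc mul_comm)

lemmas mul_ac = mul_assoc mul_comm mul_left_comm

lemma mul_add_right: "w \<star> (u + v) = w \<star> u + w \<star> v"
  using mul_add_left mul_comm by metis

lemma mul_smul_right: "w \<star> (c *\<^sub>c u) = c *\<^sub>c (w \<star> u)"
  using mul_smul_left mul_comm by metis

lemma mul_zero [simp]: "0 \<star> u = 0" "u \<star> 0 = 0"
  using mul_smul_left[of 0 0 u] mul_comm[of u 0] by simp_all

lemma mul_minus_left: "(- u) \<star> w = - (u \<star> w)"
  using mul_add_left[of u "- u" w] by (simp add: eq_neg_iff_add_eq_0 add.commute)

lemma mul_diff_left: "(u - v) \<star> w = u \<star> w - v \<star> w"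
  using mul_add_left[of u "- v" w] mul_minus_left[of v w] by simp

lemma mul_diff_right: "w \<star> (u - v) = w \<star> u - w \<star> v"
  using mul_diff_left mul_comm by metis

lemma mul_sum_left: "sum f A \<star> w = (\<Sum>i\<in>A. f i \<star> w)"
  by (induction A rule: infinite_finite_induct) (simp_all only: sum.infinite sum.empty mul_zero sum.insert mul_add_left not_False_eq_True if_False)

lemma mul_sum_right: "w \<star> sum f A = (\<Sum>i\<in>A. w \<star> f i)"
  using mul_sum_left[of f A w] mul_comm by simp

section \<open>Powers, nilpotent elements and the exponential\<close>

primrec pw :: "coords \<Rightarrow> nat \<Rightarrow> coords" where
  "pw s 0 = e" | "pw s (Suc n) = s \<star> pw s n"

lemma pw_in [simp]: "pw s n \<in> V" by (cases n) auto

lemma pw_add: "pw s (m + n) = pw s m \<star> pw s n"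
  by (induction m) (simp_all add: mul_assoc)

lemma pw_mul: "pw (s \<star> t) n = pw s n \<star> pw t n"
  by (induction n) (simp_all add: mul_ac)

lemma pw_smul: "pw (c *\<^sub>c s) n = c ^ n *\<^sub>c pw s n"
  by (induction n) (simp_all add: mul_smul_left mul_smul_right mult.commute)

lemma pw_zero_mono: "pw s n = 0 \<Longrightarrow> n \<le> m \<Longrightarrow> pw s m = 0"
  using pw_add[of s n "m - n"] by simp

text \<open>Divided powers \<open>s^n / n!\<close>; in terms of them the binomial theorem has no
  coefficients.\<close>

definition dp :: "coords \<Rightarrow> nat \<Rightarrow> coords" where "dp s n = inverse (fact n) *\<^sub>c pw s n"

lemma dp_in [simp]: "dp s n \<in> V" by (simp add: dp_def coord_space_closed)

lemma dp_Suc: "s \<star> dp s n = of_nat (Suc n) *\<^sub>c dp s (Suc n)"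
  unfolding dp_def mul_smul_right pw.simps smul_simps fact_Suc
  by (simp del: of_nat_Suc)

lemma dp_0: "dp s 0 = e" by (simp add: dp_def)

lemma dp_eq_0_iff: "dp s n = 0 \<longleftrightarrow> pw s n = 0"
  by (simp add: dp_def smul_eq_0_iff)

lemma smul_add_left: "(c + d) *\<^sub>c v = c *\<^sub>c v + d *\<^sub>c v" by (rule cv.scale_left_distrib)

text \<open>Multiplication by \<open>s\<close> raises the first index and by \<open>t\<close> the
  second, each time with the raised index as factor; in total degree \<open>n + 1\<close> the two
  factors add up to \<open>n + 1\<close>.\<close>

lemma dp_add: "dp (s + t) n = (\<Sum>i\<le>n. dp s i \<star> dp t (n - i))"
proof (induction n)
  case 0
  show ?case by (simp add: dp_0)
next
  case (Suc n)
  let ?T = "\<lambda>i. dp s i \<star> dp t (Suc n - i)"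
  have 1: "s \<star> (dp s i \<star> dp t (n - i)) = of_nat (Suc i) *\<^sub>c ?T (Suc i)" for i
    using dp_Suc[of s i] by (simp add: mul_assoc[symmetric] mul_smul_left)
  have 2: "t \<star> (dp s i \<star> dp t (n - i)) = of_nat (Suc n - i) *\<^sub>c ?T i" if "i \<le> n" for i
    using dp_Suc[of t "n - i"] that by (simp add: mul_left_comm[of t] mul_smul_right Suc_diff_le)
  have "of_nat (Suc n) *\<^sub>c dp (s + t) (Suc n) = (s + t) \<star> dp (s + t) n" by (simp only: dp_Suc)
  also have "\<dots> = (\<Sum>i\<le>n. of_nat (Suc i) *\<^sub>c ?T (Suc i)) + (\<Sum>i\<le>n. of_nat (Suc n - i) *\<^sub>c ?T i)"
    unfolding Suc.IH mul_add_left mul_sum_right sum.distrib[symmetric] using 1 2 by (simp del: of_nat_Suc)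
  also have "(\<Sum>i\<le>n. of_nat (Suc i) *\<^sub>c ?T (Suc i)) = (\<Sum>i\<le>Suc n. of_nat i *\<^sub>c ?T i)"
    by (subst sum.atMost_Suc_shift) simp
  also have "(\<Sum>i\<le>n. of_nat (Suc n - i) *\<^sub>c ?T i) = (\<Sum>i\<le>Suc n. of_nat (Suc n - i) *\<^sub>c ?T i)"
    by simp
  also have "(\<Sum>i\<le>Suc n. of_nat i *\<^sub>c ?T i) + (\<Sum>i\<le>Suc n. of_nat (Suc n - i) *\<^sub>c ?T i) =
      (\<Sum>i\<le>Suc n. of_nat (Suc n) *\<^sub>c ?T i)"
    unfolding sum.distrib[symmetric] smul_add_left[symmetric] of_nat_add[symmetric]
    by (intro sum.cong) auto
  also have "\<dots> = of_nat (Suc n) *\<^sub>c (\<Sum>i\<le>Suc n. ?T i)" by (simp only: cv.scale_sum_right)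
  finally show ?case by (simp only: cv.scale_cancel_left of_nat_eq_0_iff) simp
qed

definition nil :: "coords \<Rightarrow> bool" where "nil s \<longleftrightarrow> s \<in> V \<and> (\<exists>n. pw s n = 0)"

lemma nil_in: "nil s \<Longrightarrow> s \<in> V" by (simp add: nil_def)

lemma nil_add: assumes "nil s" "nil t" shows "nil (s + t)"
proof -
  obtain a b where ab: "pw s a = 0" "pw t b = 0" using assms by (auto simp: nil_def)
  \<comment> \<open>In total degree \<open>a + b\<close> either the exponent of \<open>s\<close>
    reaches \<open>a\<close> or that of \<open>t\<close> reaches \<open>b\<close>.\<close>
  have "dp s i \<star> dp t (a + b - i) = 0" for i
  proof (cases "a \<le> i")
    case True
    then have "dp s i = 0" using pw_zero_mono[OF ab(1)] by (simp add: dp_eq_0_iff)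
    then show ?thesis by simp
  next
    case False
    then have "dp t (a + b - i) = 0" using pw_zero_mono[OF ab(2)] by (simp add: dp_eq_0_iff)
    then show ?thesis by simp
  qed
  then have "dp (s + t) (a + b) = 0" unfolding dp_add by simp
  then show ?thesis using assms by (auto simp: nil_def dp_eq_0_iff coord_space_closed)
qed

lemma nil_smul: "nil s \<Longrightarrow> nil (c *\<^sub>c s)"
  by (auto simp: nil_def pw_smul coord_space_closed)

lemma nil_minus: "nil s \<Longrightarrow> nil (- s)"
  using nil_smul[of s "-1"] by (simp add: cv.scale_minus_left)

lemma nil_zero: "nil 0"
  unfolding nil_def using coord_space_closed(1) by (auto intro: exI[of _ 1])

lemma nil_diff: "nil s \<Longrightarrow> nil t \<Longrightarrow> nil (s - t)"
  using nil_add[OF _ nil_minus] by fastforce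

lemma nil_mul: "nil s \<Longrightarrow> nil (v \<star> s)"
  unfolding nil_def pw_mul by (metis mul_in mul_zero(2))

lemma nil_sum: "(\<And>i. i \<in> A \<Longrightarrow> nil (f i)) \<Longrightarrow> nil (sum f A)"
  by (induction A rule: infinite_finite_induct) (auto intro: nil_zero nil_add)

lemma nil_subspace: "cv.subspace (Collect nil)"
  by (auto simp: cv.subspace_def intro: nil_zero nil_add nil_smul)

text \<open>The subspaces \<open>s\<^sup>k V\<close> decrease strictly until they vanish.\<close>

lemma pw_bound: assumes "nil s" shows "pw s l = 0"
proof -
  define U where "U k = (\<lambda>v. pw s k \<star> v) ` V" for k
  have sub: "cv.subspace (U k)" for k
    unfolding cv.subspace_def U_def
  proof (intro conjI ballI allI)
    show "0 \<in> (\<star>) (pw s k) ` V" using coord_space_closed(1)[of l] by (auto intro: image_eqI[of _ _ 0])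
    fix x c assume "x \<in> (\<star>) (pw s k) ` V"
    then obtain v where v: "v \<in> V" "x = pw s k \<star> v" by blast
    then show "c *\<^sub>c x \<in> (\<star>) (pw s k) ` V"
      using coord_space_closed(3) by (auto simp: mul_smul_right[symmetric])
    fix y assume "y \<in> (\<star>) (pw s k) ` V"
    then obtain w where "w \<in> V" "y = pw s k \<star> w" by blast
    then show "x + y \<in> (\<star>) (pw s k) ` V"
      using v coord_space_closed(2) by (auto simp: mul_add_right[symmetric])
  qed
  have UV: "U k \<subseteq> V" for k by (auto simp: U_def)
  have step: "U (Suc k) = (\<lambda>v. s \<star> v) ` U k" for k
    by (auto simp: U_def mul_assoc image_iff)
  have dec: "U (Suc k) \<subseteq> U k" for k
  proof
    fix x assume "x \<in> U (Suc k)"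
    then obtain v where "v \<in> V" "x = pw s k \<star> (s \<star> v)" by (auto simp: U_def mul_ac)
    then show "x \<in> U k" by (auto simp: U_def)
  qed
  have "cv.dim (U k) + k \<le> l \<or> U k = {0}" for k
  proof (induction k)
    case 0
    have "U 0 \<subseteq> V" by (rule UV)
    then have "cv.dim (U 0) \<le> l"
      using dim_le[OF sub coord_space_subspace subset_refl, of 0 l] unfolding dim_coord_space by blast
    then show ?case by simp
  next
    case (Suc k)
    show ?case
    proof (cases "U (Suc k) = {0}")
      case ne: False
      have "U k \<noteq> {0}"
      proof
        assume "U k = {0}"
        then show False using ne step[of k] by simp
      qed
      \<comment> \<open>One repetition would make the sequence constant from then on, whereas
        nilpotence makes it reach zero.\<close>
      moreover have "U (Suc k) \<noteq> U k"
      proof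
        assume eq: "U (Suc k) = U k"
        have "U (k + j) = U k" for j
          by (induction j) (use eq step in simp_all)
        moreover obtain a where a: "pw s a = 0" using assms by (auto simp: nil_def)
        have "pw s (k + a) = 0" using pw_zero_mono[OF a] by simp
        then have "U (k + a) = {0}" using coord_space_closed(1)[of l] by (auto simp: U_def)
        ultimately show False using \<open>U k \<noteq> {0}\<close> by simp
      qed
      ultimately have "cv.dim (U (Suc k)) < cv.dim (U k)"
        using dim_less[OF sub sub UV, of "Suc k" k] dec[of k] by blast
      then show ?thesis using Suc \<open>U k \<noteq> {0}\<close> by simp
    qed simp
  qed
  from this[of l] have "cv.dim (U l) = 0 \<or> U l = {0}" by auto
  then have "U l = {0}"
  proof
    assume z: "cv.dim (U l) = 0"
    show ?thesis
    proof (rule ccontr)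
      assume "U l \<noteq> {0}"
      moreover have "0 \<in> U l" using sub by (simp add: cv.subspace_def)
      ultimately have "cv.dim {0} < cv.dim (U l)"
        by (intro dim_less[OF _ sub UV]) (auto simp: cv.subspace_def)
      then show False using z by simp
    qed
  qed
  moreover have "pw s l \<star> e \<in> U l" unfolding U_def by (rule imageI) simp
  ultimately show ?thesis by simp
qed

text \<open>Same range of summation as in \<open>nilpotent_exp\<close>, so that the two agree term
  by term. For computations it is replaced by an initial segment up to a vanishing power, see
  \<open>nexp_eq\<close>.\<close>

definition nexp :: "coords \<Rightarrow> coords" where "nexp s = (\<Sum>n | pw s n \<noteq> 0. dp s n)"

lemma nexp_eq: assumes "pw s K = 0" shows "nexp s = (\<Sum>n<K. dp s n)"
  unfolding nexp_def
proof (rule sum.mono_neutral_left)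
  show "{n. pw s n \<noteq> 0} \<subseteq> {..<K}" using pw_zero_mono[OF assms] by (auto simp: not_less[symmetric])
qed (auto simp: dp_eq_0_iff)

lemma nexp_in [simp]: "nexp s \<in> V"
  unfolding nexp_def by (rule coord_space_sum) simp

lemma nexp_zero [simp]: "nexp 0 = e"
  using nexp_eq[of 0 1] by (simp add: dp_0)

lemma nexp_add: assumes "nil s" "nil t" shows "nexp (s + t) = nexp s \<star> nexp t"
proof -
  \<comment> \<open>If \<open>i + j\<close> is at least \<open>2 l\<close>, one of the two indices
    is at least \<open>l\<close>; the terms of the square outside the triangle therefore
    vanish.\<close>
  let ?N = "l + l"
  have 0: "dp s i \<star> dp t j = 0" if "?N \<le> i + j" for i j
  proof (cases "l \<le> i")
    case True
    then have "dp s i = 0" using pw_zero_mono[OF pw_bound[OF assms(1)]] by (simp add: dp_eq_0_iff)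
    then show ?thesis by simp
  next
    case False
    then have "dp t j = 0" using pw_zero_mono[OF pw_bound[OF assms(2)]] that by (simp add: dp_eq_0_iff)
    then show ?thesis by simp
  qed
  have z: "pw s ?N = 0" "pw t ?N = 0" "pw (s + t) ?N = 0"
    using pw_zero_mono[OF pw_bound] assms nil_add by auto
  have "nexp s \<star> nexp t = (\<Sum>i<?N. dp s i \<star> nexp t)"
    unfolding nexp_eq[OF z(1)] by (rule mul_sum_left)
  also have "\<dots> = (\<Sum>i<?N. \<Sum>j<?N. dp s i \<star> dp t j)"
    unfolding nexp_eq[OF z(2)] mul_sum_right by (rule refl)
  also have "\<dots> = (\<Sum>(i, j)\<in>{..<?N} \<times> {..<?N}. dp s i \<star> dp t j)" by (rule sum.cartesian_product)
  also have "\<dots> = (\<Sum>(i, j)\<in>{(i, j). i + j < ?N}. dp s i \<star> dp t j)"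
  proof (rule sum.mono_neutral_right)
    show "\<forall>p\<in>{..<?N} \<times> {..<?N} - {(i, j). i + j < ?N}. (case p of (i, j) \<Rightarrow> dp s i \<star> dp t j) = 0"
      using 0 by auto
  qed auto
  also have "\<dots> = (\<Sum>k<?N. \<Sum>i\<le>k. dp s i \<star> dp t (k - i))" by (rule sum.triangle_reindex)
  also have "\<dots> = nexp (s + t)" unfolding nexp_eq[OF z(3)] dp_add by (rule refl)
  finally show ?thesis ..
qed

lemma nexp_minus: "nil s \<Longrightarrow> nexp s \<star> nexp (- s) = e"
  using nexp_add[OF _ nil_minus, of s s] by simp

text \<open>Isolates the linear term. From it follow that exponentials are unipotent, that only zero
  is sent to the unit, and that logarithms can be approximated.\<close>

lemma nexp_second_order: assumes "nil s" shows "\<exists>q\<in>V. nexp s = e + s + s \<star> s \<star> q"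
proof -
  have "pw s (Suc (Suc l)) = 0" using pw_zero_mono[OF pw_bound[OF assms]] by simp
  then have "nexp s = (\<Sum>n<Suc (Suc l). dp s n)" by (rule nexp_eq)
  also have "\<dots> = dp s 0 + (dp s 1 + (\<Sum>n<l. dp s (Suc (Suc n))))"
    unfolding sum.lessThan_Suc_shift by simp
  also have "dp s 1 = s" using nil_in[OF assms] by (simp add: dp_def)
  also have "(\<Sum>n<l. dp s (Suc (Suc n))) = s \<star> s \<star> (\<Sum>n<l. inverse (fact (Suc (Suc n))) *\<^sub>c pw s n)"
    unfolding mul_sum_right by (simp only: dp_def pw.simps mul_smul_right mul_assoc)
  finally have "nexp s = e + s + s \<star> s \<star> (\<Sum>n<l. inverse (fact (Suc (Suc n))) *\<^sub>c pw s n)"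
    by (simp only: dp_0 add.assoc)
  moreover have "(\<Sum>n<l. inverse (fact (Suc (Suc n))) *\<^sub>c pw s n) \<in> V"
    by (intro coord_space_sum coord_space_closed(3) pw_in)
  ultimately show ?thesis by blast
qed

lemma geometric: "(e - t) \<star> (\<Sum>k<K. pw t k) = e - pw t K" if "t \<in> V"
proof (induction K)
  case (Suc K)
  have "(e - t) \<star> (\<Sum>k<Suc K. pw t k) = (e - t) \<star> (\<Sum>k<K. pw t k) + (e - t) \<star> pw t K"
    unfolding sum.lessThan_Suc mul_add_right by (rule refl)
  also have "\<dots> = e - pw t (Suc K)" unfolding Suc.IH mul_diff_left[of e t "pw t K"] by simp
  finally show ?case .
qed simp

lemma unipotent_inverse: assumes "nil s" shows "\<exists>u\<in>V. (e + s) \<star> u = e"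
proof -
  have "pw (- s) l = 0" using pw_bound[OF nil_minus[OF assms]] .
  then have "(e - (- s)) \<star> (\<Sum>k<l. pw (- s) k) = e"
    using geometric[of "- s" l] nil_in[OF nil_minus[OF assms]] by simp
  then show ?thesis by (intro bexI[of _ "\<Sum>k<l. pw (- s) k"] coord_space_sum) simp_all
qed

text \<open>If the exponential of \<open>s\<close> is the unit, then \<open>s\<close> times a
  unipotent element vanishes, and unipotent elements are invertible.\<close>

lemma nexp_eq_unit: assumes "nil s" "nexp s = e" shows "s = 0"
proof -
  obtain q where q: "nexp s = e + s + s \<star> s \<star> q" using nexp_second_order[OF assms(1)] by blast
  have "s \<star> (e + s \<star> q) = s + s \<star> s \<star> q" using nil_in[OF assms(1)] by (simp add: mul_add_right mul_assoc)
  also have "\<dots> = 0" using q assms(2) by (simp add: add.assoc)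
  finally have z: "s \<star> (e + s \<star> q) = 0" .
  have "nil (s \<star> q)" using nil_mul[OF assms(1), of q] by (simp add: mul_comm)
  then obtain u where "(e + s \<star> q) \<star> u = e" using unipotent_inverse by blast
  then have "s = s \<star> (e + s \<star> q) \<star> u" using nil_in[OF assms(1)] by (simp add: mul_assoc)
  then show ?thesis using z by simp
qed

text \<open>Surjectivity of the exponential: the error of an approximate logarithm can be squared.\<close>

lemma nexp_surj: assumes w: "nil w" shows "\<exists>s. nil s \<and> nexp s = e + w"
proof -
  have "\<exists>s q. nil s \<and> (e + w) \<star> nexp (- s) = e + pw w (Suc k) \<star> q" for k
  proof (induction k)
    case 0
    have "(e + w) \<star> nexp (- 0) = e + pw w (Suc 0) \<star> e"
      using nil_in[OF w] by (simp add: coord_space_closed)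
    then show ?case using nil_zero by blast
  next
    case (Suc k)
    then obtain s q where s: "nil s" "(e + w) \<star> nexp (- s) = e + pw w (Suc k) \<star> q" by blast
    define r where "r = pw w (Suc k) \<star> q"
    have r: "r \<in> V" "nil r"
    proof -
      have "r = (pw w k \<star> q) \<star> w" by (simp add: r_def mul_ac)
      then show "nil r" using nil_mul[OF w] by simp
    qed (simp add: r_def)
    obtain p where p: "nexp (- r) = e + (- r) + (- r) \<star> (- r) \<star> p"
      using nexp_second_order[OF nil_minus[OF r(2)]] by blast
    have "- (s + r) = - s + - r" by simp
    then have "(e + w) \<star> nexp (- (s + r)) = ((e + w) \<star> nexp (- s)) \<star> nexp (- r)"
      using nexp_add[OF nil_minus[OF s(1)] nil_minus[OF r(2)]] by (simp add: mul_assoc)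
    also have "\<dots> = (e + r) \<star> nexp (- r)" using s by (simp add: r_def)
    also have "\<dots> = (e + r) \<star> (e - r + r \<star> r \<star> p)"
    proof -
      have "(- r) \<star> (- r) = r \<star> r" by (simp only: mul_minus_left mul_comm[of r "- r"] minus_minus)
      then show ?thesis using p by simp
    qed
    also have "\<dots> = e + r \<star> r \<star> (p + r \<star> p - e)"
    proof -
      have 1: "(e + r) \<star> (e - r) = e - r \<star> r" using r by (simp add: mul_add_left mul_diff_right)
      have 2: "(e + r) \<star> (r \<star> r \<star> p) = r \<star> r \<star> p + r \<star> r \<star> (r \<star> p)"
        unfolding mul_add_left by (simp add: mul_ac)
      have 3: "r \<star> r \<star> (p + r \<star> p - e) = r \<star> r \<star> p + r \<star> r \<star> (r \<star> p) - r \<star> r"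
        by (simp only: mul_diff_right mul_add_right unit_mul mul_in)
      show ?thesis unfolding mul_add_right[of "e + r"] 1 2 3 by simp
    qed
    \<comment> \<open>The square of the error contains the power \<open>2 k + 2\<close> of
      \<open>w\<close>; recording the power \<open>k + 2\<close> is enough for the
      induction.\<close>
    also have "r \<star> r \<star> (p + r \<star> p - e) = pw w (Suc (Suc k)) \<star> (pw w k \<star> q \<star> q \<star> (p + r \<star> p - e))"
    proof -
      have "r \<star> r = pw w (Suc (Suc k)) \<star> (pw w k \<star> q \<star> q)" by (simp add: r_def mul_ac)
      then show ?thesis by (simp only: mul_assoc)
    qed
    finally show ?case using nil_add[OF s(1) r(2)] by blast
  qed
  from this[of l] obtain s q where s: "nil s" "(e + w) \<star> nexp (- s) = e + pw w (Suc l) \<star> q" by blast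
  have "pw w (Suc l) = 0" using pw_bound[OF w] by simp
  then have *: "(e + w) \<star> nexp (- s) = e" using s by simp
  have "nexp s = ((e + w) \<star> nexp (- s)) \<star> nexp s" unfolding * by simp
  also have "\<dots> = (e + w) \<star> (nexp s \<star> nexp (- s))" by (simp add: mul_ac)
  also have "\<dots> = e + w" using nexp_minus[OF s(1)] nil_in[OF w] by (simp add: coord_space_closed)
  finally show ?thesis using s by blast
qed

lemma mul_trunc: "trunc l u \<star> v = u \<star> v"
proof -
  have "trunc l u \<star> v = (e \<star> u) \<star> v" by (simp only: unit_mul_trunc)
  also have "\<dots> = e \<star> (u \<star> v)" by (rule mul_assoc)
  finally show ?thesis by simp
qed

lemma mul_expand: "u \<star> v = (\<Sum>a<l. \<Sum>b<l. (u a * v b) *\<^sub>c (unit_vec a \<star> unit_vec b))"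
proof -
  have "u \<star> v = trunc l u \<star> trunc l v" using mul_trunc mul_comm by metis
  also have "trunc l u = (\<Sum>a<l. u a *\<^sub>c unit_vec a)"
    by (subst coord_space_expand[OF trunc_in]) (simp add: trunc_def)
  also have "trunc l v = (\<Sum>a<l. v a *\<^sub>c unit_vec a)"
    by (subst coord_space_expand[OF trunc_in]) (simp add: trunc_def)
  finally have "u \<star> v = (\<Sum>b<l. \<Sum>a<l. (v b * u a) *\<^sub>c (unit_vec a \<star> unit_vec b))"
    unfolding mul_sum_left mul_sum_right by (simp only: mul_smul_left mul_smul_right smul_simps)
  then show ?thesis by (subst sum.swap) (simp only: mult.commute)
qed

lemma mul_polys:
  assumes "\<And>i. (\<lambda>x. f x i) \<in> polys m" "\<And>i. (\<lambda>x. g x i) \<in> polys m"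
  shows "(\<lambda>x. (f x \<star> g x) i) \<in> polys m"
proof -
  have eq: "(f x \<star> g x) i = (\<Sum>a<l. \<Sum>b<l. f x a * g x b * (unit_vec a \<star> unit_vec b) i)" for x
    by (subst mul_expand) (simp only: sum_coords_apply smul_apply)
  show ?thesis unfolding eq by (intro polys_sum polys_mult polys_const assms)
qed

lemma dp_polys: "(\<And>i. (\<lambda>x. f x i) \<in> polys m) \<Longrightarrow> (\<lambda>x. dp (f x) n i) \<in> polys m"
proof -
  assume f: "\<And>i. (\<lambda>x. f x i) \<in> polys m"
  have "(\<lambda>x. pw (f x) n i) \<in> polys m" for i
  proof (induction n arbitrary: i)
    case 0
    show ?case unfolding pw.simps by (rule polys_const)
  next
    case (Suc n)
    show ?case unfolding pw.simps by (rule mul_polys[OF f Suc.IH])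
  qed
  then show ?thesis unfolding dp_def smul_apply by (rule polys_scale)
qed

end

section \<open>Exponential actions\<close>

lemma polys_mixed: "f \<in> polys m \<Longrightarrow> (\<lambda>p. f (fst p)) \<in> mixed_forms m k 0"
  unfolding polys_monspan
proof (induction rule: monspan_induct)
  case zero
  show ?case by (rule mixed_forms_zero)
next
  case (add a c g)
  have "(\<lambda>p. monom_fun m a (\<lambda>i. fst p i)) \<in> (\<lambda>_. mixed_forms m k 0) (1 * (\<Sum>i<m. a i))"
  proof (rule monom_fun_subst)
    show "(\<lambda>p. f p * g p) \<in> mixed_forms m k 0" if "f \<in> mixed_forms m k 0" "g \<in> mixed_forms m k 0" for f g
      using mixed_forms_mult[OF that] by simp
  qed (auto intro: mixed_forms_const mixed_forms_x)
  then have "(\<lambda>p. c * monom_fun m a (fst p)) \<in> mixed_forms m k 0"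
    using mixed_forms_mult[OF mixed_forms_const] by fastforce
  then show ?case using mixed_forms_add[OF _ add(2)] by fast
qed

lemma dense_in_mono: "dense_in M A \<Longrightarrow> A \<subseteq> B \<Longrightarrow> dense_in M B"
  unfolding dense_in_def by blast

lemma linear_image_line: "linear_on k f \<Longrightarrow> v \<in> coord_space k \<Longrightarrow> f ` line v = line (f v)"
  unfolding line_def' using linear_onD(2)[of k f v] by (auto simp: image_iff) metis

lemma linear_variety_iso_affine:
  assumes "linear_on k f" "bij_betw f (coord_space k) (coord_space k)"
  shows "variety_iso (affine k) (affine k) f"
proof -
  have m: "morphism (affine k) (affine k) f"
    if lin: "linear_on k f" and bij: "bij_betw f (coord_space k) (coord_space k)" for f
    unfolding affine_def
  \<comment> \<open>Written through its matrix the map is polynomial on all sequences, whereas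
    \<open>f\<close> itself is constrained on the coordinate space only.\<close>
  proof (rule coord_morphism[where \<Theta> = "\<lambda>v. \<Sum>j<k. v j *\<^sub>c f (unit_vec j)"])
    show "f ` coord_space k \<subseteq> coord_space k" using bij by (simp add: bij_betw_def)
    show "(\<Sum>j<k. v j *\<^sub>c f (unit_vec j)) \<in> {f p}" if "p \<in> coord_space k" "v \<in> {p}" for p v
      using linear_on_expand[OF lin that(1)] that(2) by simp
    show "(\<lambda>v. g (\<Sum>j<k. v j *\<^sub>c f (unit_vec j))) \<in> polys k" if "g \<in> polys k" for g d
    proof -
      have "(\<lambda>v. g (\<lambda>i. \<Sum>j<k. v j * f (unit_vec j) i)) \<in> polys k"
        by (rule polys_subst[OF that]) (intro polys_sum polys_mult polys_const polys_var, simp)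
      moreover have "(\<Sum>j<k. v j *\<^sub>c f (unit_vec j)) = (\<lambda>i. \<Sum>j<k. v j * f (unit_vec j) i)" for v
        by (simp add: fun_eq_iff sum_coords_apply smul_apply)
      ultimately show ?thesis by simp
    qed
  qed auto
  have inv: "inv_into (coord_space k) f (f x) = x" "f (inv_into (coord_space k) f x) = x" if "x \<in> coord_space k" for x
    using assms(2) that by (auto simp: bij_betw_def f_inv_into_f)
  show ?thesis unfolding variety_iso_def points_simps
    using m[OF assms] m[OF linear_on_inv[OF assms] bij_betw_inv_into[OF assms(2)]] inv by blast
qed

lemma linear_variety_iso_proj:
  assumes "linear_on (Suc n) f" "bij_betw f (coord_space (Suc n)) (coord_space (Suc n))"
  shows "variety_iso (proj n) (proj n) (\<lambda>L. f ` L)"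
proof -
  let ?k = "Suc n"
  have nz: "f v \<in> coord_space ?k" "f v \<noteq> 0"
    if "linear_on ?k f" "bij_betw f (coord_space ?k) (coord_space ?k)" "v \<in> coord_space ?k" "v \<noteq> 0" for f v
    using that linear_onD(3)[OF that(1)] coord_space_closed(1)[of ?k] by (auto simp: bij_betw_def inj_on_def)
  have m: "morphism (proj n) (proj n) (\<lambda>L. f ` L)"
    if lin: "linear_on ?k f" and bij: "bij_betw f (coord_space ?k) (coord_space ?k)" for f
    unfolding proj_def
  proof (rule coord_morphism[where \<Theta> = "\<lambda>v. \<Sum>j<?k. v j *\<^sub>c f (unit_vec j)"])
    show "(\<lambda>L. f ` L) ` proj_points n \<subseteq> proj_points n"
    proof (rule image_subsetI)
      fix L assume "L \<in> proj_points n"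
      then obtain v where "v \<in> coord_space ?k" "v \<noteq> 0" "L = line v" by (rule proj_points_cases)
      then show "f ` L \<in> proj_points n"
        using nz[OF lin bij] linear_image_line[OF lin] line_in_proj by metis
    qed
    show "(\<Sum>j<?k. v j *\<^sub>c f (unit_vec j)) \<in> f ` p - {\<lambda>_. 0}"
      if p: "p \<in> proj_points n" and v: "v \<in> p - {\<lambda>_. 0}" for p v
    proof -
      have "v \<in> coord_space ?k" using p v line_coord_space by (auto elim!: proj_points_cases)
      then have "(\<Sum>j<?k. v j *\<^sub>c f (unit_vec j)) = f v" "f v \<noteq> 0"
        using linear_on_expand[OF lin, of v] nz(2)[OF lin bij] v by (auto simp: zero_coords)
      then show ?thesis using v by (simp only: zero_coords) blast
    qed
    show "p - {\<lambda>_. 0} \<noteq> {}" if "p \<in> proj_points n" for p using proj_reps_nonempty[OF that] .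
    show "(\<lambda>v. g (\<Sum>j<?k. v j *\<^sub>c f (unit_vec j))) \<in> forms ?k d" if "g \<in> forms ?k d" for g d
    proof -
      have lin_form: "(\<lambda>v. \<Sum>j<?k. v j * f (unit_vec j) i) \<in> forms ?k 1" for i
        using forms_mult[OF forms_var forms_const] by (intro forms_sum) fastforce
      have "(\<lambda>v. g (\<lambda>i. \<Sum>j<?k. v j * f (unit_vec j) i)) \<in> forms ?k d"
        by (rule forms_subst[OF that, where C = "forms ?k", OF forms_zero forms_const forms_add forms_mult lin_form])
      moreover have "(\<Sum>j<?k. v j *\<^sub>c f (unit_vec j)) = (\<lambda>i. \<Sum>j<?k. v j * f (unit_vec j) i)" for v
        by (rule ext) (simp only: sum_coords_apply smul_apply)
      ultimately show ?thesis by simp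
    qed
    show "g w' \<noteq> 0" if "g \<in> forms ?k d" "q \<in> proj_points n" "w \<in> q - {\<lambda>_. 0}" "w' \<in> q - {\<lambda>_. 0}" "g w \<noteq> 0"
      for d g q w w' using proj_homogeneous[OF that] .
  qed
  let ?g = "inv_into (coord_space ?k) f"
  have inv: "?g ` f ` L = L" "f ` ?g ` L = L" if "L \<in> proj_points n" for L
  proof -
    have "L \<subseteq> coord_space ?k" using that line_coord_space by (auto elim!: proj_points_cases)
    moreover have "?g (f v) = v" "f (?g v) = v" if "v \<in> coord_space ?k" for v
      using assms(2) that by (auto simp: bij_betw_def f_inv_into_f)
    ultimately show "?g ` f ` L = L" "f ` ?g ` L = L"
      unfolding image_image by (auto simp: subset_iff image_iff)
  qed
  show ?thesis unfolding variety_iso_def points_simps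
    using m[OF assms] m[OF linear_on_inv[OF assms] bij_betw_inv_into[OF assms(2)]] inv
    by (intro conjI exI[of _ "\<lambda>L. ?g ` L"]) simp_all
qed

text \<open>The eigenvalues of \<open>unit_vec j\<close> and \<open>unit_vec 0\<close> both agree
  with that of their sum.\<close>

lemma linear_scalar:
  assumes lin: "linear_on k T" and k: "k > 0" and eigen: "\<And>v. v \<in> coord_space k \<Longrightarrow> \<exists>c. T v = c *\<^sub>c v"
  shows "\<exists>c. \<forall>v\<in>coord_space k. T v = c *\<^sub>c v"
proof -
  obtain c where c: "\<And>j. j < k \<Longrightarrow> T (unit_vec j) = c j *\<^sub>c unit_vec j"
    using eigen[OF unit_vec_in] by metis
  have c0: "c j = c 0" if j: "j < k" for j
  proof (cases "j = 0")
    case False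
    have in_cs: "unit_vec j \<in> coord_space k" "unit_vec 0 \<in> coord_space k" using unit_vec_in j k by blast+
    obtain a where "T (unit_vec j + unit_vec 0) = a *\<^sub>c (unit_vec j + unit_vec 0)"
      using eigen[OF coord_space_closed(2)[OF in_cs]] by blast
    then have *: "c j *\<^sub>c unit_vec j + c 0 *\<^sub>c unit_vec 0 = a *\<^sub>c (unit_vec j + unit_vec 0)"
      using linear_onD(1)[OF lin in_cs] c j k by simp
    from fun_cong[OF *, of j] have "c j = a"
      using False by (simp add: smul_apply plus_fun_apply unit_vec_def)
    moreover from fun_cong[OF *, of 0] have "c 0 = a"
      using False by (simp add: smul_apply plus_fun_apply unit_vec_def)
    ultimately show ?thesis by simp
  qed simp
  have "T v = c 0 *\<^sub>c v" if v: "v \<in> coord_space k" for v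
  proof -
    have "T v = (\<Sum>j<k. v j *\<^sub>c T (unit_vec j))" by (rule linear_on_expand[OF lin v])
    also have "\<dots> = (\<Sum>j<k. c 0 *\<^sub>c v j *\<^sub>c unit_vec j)"
    proof (intro sum.cong refl)
      fix j assume "j \<in> {..<k}"
      then have "T (unit_vec j) = c 0 *\<^sub>c unit_vec j" using c[of j] c0[of j] by (simp only: lessThan_iff)
      then show "v j *\<^sub>c T (unit_vec j) = c 0 *\<^sub>c v j *\<^sub>c unit_vec j"
        by (simp only: smul_simps(4) mult.commute[of "v j"])
    qed
    also have "\<dots> = c 0 *\<^sub>c (\<Sum>j<k. v j *\<^sub>c unit_vec j)" by (simp only: cv.scale_sum_right)
    also have "\<dots> = c 0 *\<^sub>c v" using coord_space_expand[OF v] by simp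
    finally show ?thesis .
  qed
  then show ?thesis by blast
qed

text \<open>Locality as a condition on elements instead of ideals: every element is a scalar plus a
  nilpotent one, so the residue field is the base field.\<close>

locale local_coord_algebra = coord_algebra +
  assumes unit_nonzero: "e \<noteq> 0"
    and decomp: "v \<in> coord_space l \<Longrightarrow> \<exists>c. nil (v - c *\<^sub>c e)"
begin

lemma not_nil_unit: "\<not> nil e"
proof
  assume "nil e"
  moreover have "pw e n = e" for n by (induction n) simp_all
  ultimately show False using unit_nonzero by (auto simp: nil_def)
qed

definition residue :: "coords \<Rightarrow> Qbar" where "residue v = (THE c. nil (v - c *\<^sub>c e))"

lemma residue_unique: "nil (v - c *\<^sub>c e) \<Longrightarrow> nil (v - d *\<^sub>c e) \<Longrightarrow> c = d"
proof (rule ccontr)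
  assume *: "nil (v - c *\<^sub>c e)" "nil (v - d *\<^sub>c e)" "c \<noteq> d"
  have "(v - d *\<^sub>c e) - (v - c *\<^sub>c e) = (c - d) *\<^sub>c e" by (simp add: cv.scale_left_diff_distrib)
  then have "nil ((c - d) *\<^sub>c e)" using nil_diff[OF *(2,1)] by simp
  then have "nil (inverse (c - d) *\<^sub>c (c - d) *\<^sub>c e)" by (rule nil_smul)
  then show False using not_nil_unit *(3) by simp
qed

lemma residue_eqI: "nil (v - c *\<^sub>c e) \<Longrightarrow> residue v = c"
  unfolding residue_def using residue_unique by blast

lemma nil_residue: "v \<in> V \<Longrightarrow> nil (v - residue v *\<^sub>c e)"
  using decomp[of v] residue_eqI by metis

lemma nil_iff_residue: "v \<in> V \<Longrightarrow> nil v \<longleftrightarrow> residue v = 0"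
  using nil_residue[of v] residue_eqI[of v 0] by auto

lemma residue_linear:
  shows "u \<in> V \<Longrightarrow> v \<in> V \<Longrightarrow> residue (u + v) = residue u + residue v"
    and "u \<in> V \<Longrightarrow> residue (c *\<^sub>c u) = c * residue u"
proof -
  assume u: "u \<in> V"
  show "residue (c *\<^sub>c u) = c * residue u"
    using nil_smul[OF nil_residue[OF u], of c] by (intro residue_eqI) (simp add: cv.scale_right_diff_distrib)
  assume v: "v \<in> V"
  have "(u - residue u *\<^sub>c e) + (v - residue v *\<^sub>c e) = (u + v) - (residue u + residue v) *\<^sub>c e"
    by (simp add: cv.scale_left_distrib)
  then have "nil ((u + v) - (residue u + residue v) *\<^sub>c e)"
    using nil_add[OF nil_residue[OF u] nil_residue[OF v]] by (simp only:)
  then show "residue (u + v) = residue u + residue v" by (rule residue_eqI)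
qed

text \<open>In this form the invertible elements are the complement of the zero locus of a linear
  form, which makes them an open set of projective space.\<close>

lemma residue_form: "v \<in> V \<Longrightarrow> residue v = (\<Sum>j<l. residue (unit_vec j) * v j)"
proof -
  assume v: "v \<in> V"
  have "residue (\<Sum>j\<in>A. v j *\<^sub>c unit_vec j) = (\<Sum>j\<in>A. residue (unit_vec j) * v j)" if "A \<subseteq> {..<l}" for A
  proof -
    have "finite A" using that finite_subset by blast
    then show ?thesis using that
    proof (induction A rule: finite_induct)
      case empty
      show ?case using nil_iff_residue[OF coord_space_closed(1)] nil_zero by simp
    next
      case (insert x F)
      have "x < l" "F \<subseteq> {..<l}" using insert.prems by auto
      then have in_cs: "unit_vec x \<in> V" "(\<Sum>j\<in>F. v j *\<^sub>c unit_vec j) \<in> V"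
        by (auto intro!: unit_vec_in coord_space_sum coord_space_closed(3))
      show ?case unfolding sum.insert[OF insert(1,2)]
        residue_linear(1)[OF coord_space_closed(3)[OF in_cs(1)] in_cs(2)] residue_linear(2)[OF in_cs(1)]
        insert.IH[OF \<open>F \<subseteq> {..<l}\<close>] by (simp only: mult.commute)
    qed
  qed
  from this[of "{..<l}"] show ?thesis using coord_space_expand[OF v] by simp
qed

lemma inverse_exists: assumes "v \<in> V" "\<not> nil v" shows "\<exists>w\<in>V. v \<star> w = e"
proof -
  define c where "c = residue v"
  have c: "c \<noteq> 0" using nil_iff_residue assms by (simp add: c_def)
  have "nil (inverse c *\<^sub>c (v - c *\<^sub>c e))" using nil_smul[OF nil_residue[OF assms(1)]] by (simp add: c_def)
  then obtain u where u: "u \<in> V" "(e + inverse c *\<^sub>c (v - c *\<^sub>c e)) \<star> u = e" using unipotent_inverse by blast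
  have "e + inverse c *\<^sub>c (v - c *\<^sub>c e) = inverse c *\<^sub>c v" using c by (simp add: cv.scale_right_diff_distrib)
  then have "v \<star> (inverse c *\<^sub>c u) = e" using u by (simp add: mul_smul_left mul_smul_right)
  then show ?thesis using u coord_space_closed(3) by blast
qed

lemma nexp_cancel: "nil s \<Longrightarrow> v \<in> V \<Longrightarrow> nexp s \<star> v = 0 \<Longrightarrow> v = 0"
proof -
  assume s: "nil s" "v \<in> V" "nexp s \<star> v = 0"
  have "v = nexp (- s) \<star> (nexp s \<star> v)"
    using nexp_minus[OF s(1)] s(2) by (simp add: mul_assoc[symmetric] mul_comm[of "nexp (- s)"])
  then show "v = 0" using s by simp
qed

lemma nexp_unipotent: assumes "nil s" shows "nil (nexp s - e)"
proof -
  obtain q where "nexp s = e + s + s \<star> s \<star> q" using nexp_second_order[OF assms] by blast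
  then have "nexp s - e = s + (s \<star> q) \<star> s" by (simp add: add.assoc mul_ac)
  then show ?thesis using nil_add[OF assms nil_mul[OF assms]] by simp
qed

end

text \<open>\<open>S\<close> is a basis of the nilpotent elements, which form the maximal ideal;
  their dimension \<open>n\<close> is one less than that of the algebra.\<close>

locale based_coord_algebra = local_coord_algebra "Suc n" mul e
  for n :: nat and mul (infixl \<open>\<star>\<close> 70) and e +
  fixes S :: "nat \<Rightarrow> coords"
  assumes basis_nil: "i < n \<Longrightarrow> nil (S i)"
    and basis_independent: "(\<Sum>i<n. x i *\<^sub>c S i) = 0 \<Longrightarrow> \<forall>i<n. x i = 0"
    and basis_span: "nil s \<Longrightarrow> \<exists>x. s = (\<Sum>i<n. x i *\<^sub>c S i)"
begin

definition comb :: "coords \<Rightarrow> coords" where "comb x = (\<Sum>i<n. x i *\<^sub>c S i)"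

definition eact :: "coords \<Rightarrow> coords set \<Rightarrow> coords set" where
  "eact x L = (\<lambda>v. nexp (comb x) \<star> v) ` L"

lemma comb_nil [simp]: "nil (comb x)"
  unfolding comb_def by (rule nil_sum) (auto intro: nil_smul basis_nil)

lemma comb_add: "comb (x + y) = comb x + comb y"
  unfolding comb_def plus_fun_apply cv.scale_left_distrib sum.distrib by (rule refl)

lemma comb_smul: "comb (c *\<^sub>c x) = c *\<^sub>c comb x"
  unfolding comb_def cv.scale_sum_right by (simp only: smul_apply[of c x] smul_simps)

lemma comb_zero [simp]: "comb 0 = 0" using comb_smul[of 0 0] by simp

lemma comb_eq_0: "x \<in> coord_space n \<Longrightarrow> comb x = 0 \<Longrightarrow> x = 0"
  using basis_independent[of x] coord_space_eqI[OF _ coord_space_closed(1), of x n]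
  unfolding comb_def by (auto simp: zero_fun_apply)

lemma comb_surj: assumes "nil s" shows "\<exists>x\<in>coord_space n. s = comb x"
proof -
  obtain x where "s = (\<Sum>i<n. x i *\<^sub>c S i)" using basis_span[OF assms] by blast
  then have "s = comb (trunc n x)" unfolding comb_def by (simp add: trunc_def)
  then show ?thesis using trunc_in by blast
qed

lemma eact_line: "eact x (line v) = line (nexp (comb x) \<star> v)"
  unfolding eact_def line_def' by (auto simp: mul_smul_right image_iff) (metis mul_smul_right)

lemma comb_polys: "(\<lambda>x. comb x i) \<in> polys n"
  unfolding comb_def sum_coords_apply smul_apply
  by (intro polys_sum polys_mult polys_const polys_var) simp

lemma nexp_comb_polys: "(\<lambda>x. nexp (comb x) i) \<in> polys n"
proof -
  have "nexp (comb x) = (\<Sum>k<Suc n. dp (comb x) k)" for x by (rule nexp_eq[OF pw_bound]) simp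
  then have eq: "nexp (comb x) i = (\<Sum>k<Suc n. dp (comb x) k i)" for x by (simp only: sum_coords_apply)
  show ?thesis unfolding eq by (intro polys_sum dp_polys comb_polys)
qed

lemma eact_morphism: "morphism (affine_proj n n) (proj n) (\<lambda>(x, L). eact x L)"
  unfolding affine_proj_def proj_def
\<comment> \<open>The lift is linear in \<open>v\<close> with coefficients polynomial in
  \<open>x\<close>, since the exponential series stops at a fixed power; it therefore preserves the
  degree in \<open>v\<close>.\<close>
proof (rule coord_morphism[where \<Theta> = "\<lambda>(x, v). \<Sum>j<Suc n. v j *\<^sub>c (nexp (comb x) \<star> unit_vec j)"])
  have eq: "(\<Sum>j<Suc n. v j *\<^sub>c (nexp (comb x) \<star> unit_vec j)) = nexp (comb x) \<star> v" if "v \<in> V" for x v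
    unfolding mul_smul_right[symmetric] mul_sum_right[symmetric] using coord_space_expand[OF that] by simp
  show "(\<lambda>(x, L). eact x L) ` (coord_space n \<times> proj_points n) \<subseteq> proj_points n"
  proof (rule image_subsetI)
    fix p assume "p \<in> coord_space n \<times> proj_points n"
    then obtain x v where p: "p = (x, line v)" "v \<in> V" "v \<noteq> 0" by (auto elim!: proj_points_cases)
    have "nexp (comb x) \<star> v \<noteq> 0" using nexp_cancel[OF comb_nil p(2)] p(3) by blast
    then show "(case p of (x, L) \<Rightarrow> eact x L) \<in> proj_points n"
      using line_in_proj[OF mul_in] by (simp add: p eact_line)
  qed
  show "(case v of (x, v) \<Rightarrow> \<Sum>j<Suc n. v j *\<^sub>c (nexp (comb x) \<star> unit_vec j)) \<in> (case p of (x, L) \<Rightarrow> eact x L) - {\<lambda>_. 0}"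
    if pv: "p \<in> coord_space n \<times> proj_points n" "v \<in> (case p of (x, L) \<Rightarrow> {x} \<times> (L - {\<lambda>_. 0}))" for p v
  proof -
    obtain x L w where p: "p = (x, L)" "v = (x, w)" "L \<in> proj_points n" "w \<in> L" "w \<noteq> 0"
      using pv by (cases p) (auto simp: zero_coords)
    have w: "w \<in> V" using p(3,4) line_coord_space by (auto elim!: proj_points_cases)
    have "nexp (comb x) \<star> w \<noteq> 0" using nexp_cancel[OF comb_nil w] p(5) by blast
    then show ?thesis using p(4) eq[OF w] by (auto simp: p(1,2) eact_def zero_coords)
  qed
  show "(case p of (x, L) \<Rightarrow> {x} \<times> (L - {\<lambda>_. 0})) \<noteq> {}" if "p \<in> coord_space n \<times> proj_points n" for p
    using that proj_reps_nonempty by auto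
  show "(\<lambda>v. f (case v of (x, v) \<Rightarrow> \<Sum>j<Suc n. v j *\<^sub>c (nexp (comb x) \<star> unit_vec j))) \<in> mixed_forms n (Suc n) d"
    if f: "f \<in> forms (Suc n) d" for f d
  proof -
    define g where "g i p = (\<Sum>j<Suc n. snd p j * (nexp (comb (fst p)) \<star> unit_vec j) i)" for i and p :: "coords \<times> coords"
    have "(\<lambda>x. (nexp (comb x) \<star> unit_vec j) i) \<in> polys n" for i j
      by (rule mul_polys[OF nexp_comb_polys]) (rule polys_const)
    then have g1: "g i \<in> mixed_forms n (Suc n) 1" for i
      unfolding g_def using mixed_forms_mult[OF mixed_forms_v polys_mixed]
      by (intro mixed_forms_sum) fastforce
    have "(\<lambda>p. f (\<lambda>i. g i p)) \<in> mixed_forms n (Suc n) d"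
      by (rule forms_subst[OF f, where C = "mixed_forms n (Suc n)", OF mixed_forms_zero mixed_forms_const
          mixed_forms_add mixed_forms_mult g1])
    moreover have "(case p of (x, v) \<Rightarrow> \<Sum>j<Suc n. v j *\<^sub>c (nexp (comb x) \<star> unit_vec j)) = (\<lambda>i. g i p)" for p
      by (simp only: case_prod_beta fun_eq_iff sum_coords_apply smul_apply g_def) simp
    ultimately show ?thesis by simp
  qed
  show "f w' \<noteq> 0" if "f \<in> forms (Suc n) d" "q \<in> proj_points n" "w \<in> q - {\<lambda>_. 0}"
    "w' \<in> q - {\<lambda>_. 0}" "f w \<noteq> 0" for d f q w w'
    using proj_homogeneous[OF that] .
qed

text \<open>Lines spanned by invertible elements. This open set witnesses both genericity
  conditions: the orbit of each of its points contains all of it.\<close>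

definition unit_points :: "coords set set" where
  "unit_points = {L \<in> proj_points n. \<exists>v\<in>L - {\<lambda>_. 0}. (\<Sum>j<Suc n. residue (unit_vec j) * v j) \<noteq> 0}"

lemma unit_points_open: "zopen (proj n) unit_points"
proof -
  have "(\<lambda>v. \<Sum>j<Suc n. residue (unit_vec j) * v j) \<in> forms (Suc n) 1"
    using forms_mult[OF forms_const forms_var] by (intro forms_sum) fastforce
  then show ?thesis unfolding unit_points_def proj_def zopen_coord by (rule coord_open_basic)
qed

lemma unit_points_iff: "v \<in> V \<Longrightarrow> v \<noteq> 0 \<Longrightarrow> line v \<in> unit_points \<longleftrightarrow> \<not> nil v"
proof -
  assume v: "v \<in> V" "v \<noteq> 0"
  have "(\<Sum>j<Suc n. residue (unit_vec j) * (c *\<^sub>c v) j) = c * residue v" for c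
    using residue_form[OF coord_space_closed(3)[OF v(1)]] residue_linear(2)[OF v(1)] by metis
  note form = this
  have "line v \<in> unit_points \<longleftrightarrow> residue v \<noteq> 0"
  proof
    assume "line v \<in> unit_points"
    then obtain w where "w \<in> line v" "(\<Sum>j<Suc n. residue (unit_vec j) * w j) \<noteq> 0"
      unfolding unit_points_def by blast
    moreover from this obtain c where "w = c *\<^sub>c v" unfolding line_def' by blast
    ultimately show "residue v \<noteq> 0" using form[of c] by auto
  next
    assume "residue v \<noteq> 0"
    then have "(\<Sum>j<Suc n. residue (unit_vec j) * v j) \<noteq> 0" using form[of 1] by simp
    then show "line v \<in> unit_points"
      unfolding unit_points_def zero_coords using line_in_proj[OF v] in_line v(2) by blast
  qed
  then show ?thesis using nil_iff_residue[OF v(1)] by simp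
qed

lemma unit_points_dense: "dense_in (proj n) unit_points"
  using proj_open_dense[OF unit_points_open] unit_points_iff[OF unit_in unit_nonzero] not_nil_unit by blast

lemma unit_points_cases:
  assumes "L \<in> unit_points" obtains v where "v \<in> V" "v \<noteq> 0" "\<not> nil v" "L = line v"
proof -
  have "L \<in> proj_points n" using assms by (simp add: unit_points_def)
  then obtain v where v: "v \<in> V" "v \<noteq> 0" "L = line v" by (rule proj_points_cases)
  then show thesis using that unit_points_iff assms by blast
qed

theorem eact_structure: "eact \<in> Ga_structures n n"
  unfolding Ga_structures_def mem_Collect_eq points_simps
proof (intro conjI ballI)
  show "morphism (affine_proj n n) (proj n) (\<lambda>(x, L). eact x L)" by (rule eact_morphism)
  fix L assume L: "L \<in> proj_points n"
  then have LV: "L \<subseteq> V" using line_coord_space by (auto elim!: proj_points_cases)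
  show "eact (\<lambda>_. 0) L = L" unfolding zero_coords eact_def using LV by (auto simp: subset_iff image_iff)
next
  fix x y L
  show "eact (vadd x y) L = eact x (eact y L)"
  proof -
    have "vadd x y = x + y" by (simp add: plus_fun_def)
    then show ?thesis by (simp only: eact_def image_image comb_add nexp_add[OF comb_nil comb_nil] mul_assoc)
  qed
next
  have "{x \<in> coord_space n. eact x L = L} = {\<lambda>_. 0}" if unit_pt: "L \<in> unit_points" for L
  proof -
    obtain v where v: "v \<in> V" "v \<noteq> 0" "\<not> nil v" "L = line v" using unit_points_cases[OF unit_pt] .
    obtain w where w: "w \<in> V" "v \<star> w = e" using inverse_exists[OF v(1,3)] by blast
    have "x = 0" if x: "x \<in> coord_space n" "eact x L = L" for x
    proof -
      have "line v = line (nexp (comb x) \<star> v)" using x(2) unfolding v(4) eact_line by simp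
      then obtain c where "nexp (comb x) \<star> v = c *\<^sub>c v" using line_eqD by blast
      then have "nexp (comb x) \<star> v \<star> w = c *\<^sub>c (v \<star> w)" by (simp only: mul_smul_left)
      then have c: "nexp (comb x) = c *\<^sub>c e" using w(2) by (simp add: mul_assoc)
      \<comment> \<open>An exponential has residue 1, while \<open>c\<close> times the unit has
        residue \<open>c\<close>.\<close>
      have "nil (c *\<^sub>c e - 1 *\<^sub>c e)" using nexp_unipotent[OF comb_nil, of x] c by simp
      moreover have "nil (c *\<^sub>c e - c *\<^sub>c e)" using nil_zero by simp
      ultimately have "c = 1" using residue_unique by blast
      then have "comb x = 0" using nexp_eq_unit[OF comb_nil] c by simp
      then show ?thesis using comb_eq_0 x(1) by blast
    qed
    moreover have "eact 0 L = L" unfolding v(4) eact_line using v(1) by simp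
    ultimately show ?thesis unfolding zero_coords using coord_space_closed(1) by blast
  qed
  then show "generically (proj n) (\<lambda>L. {x \<in> coord_space n. eact x L = L} = {\<lambda>_. 0})"
    unfolding generically_def using unit_points_open unit_points_dense by blast
  have "dense_in (proj n) ((\<lambda>x. eact x L) ` coord_space n)" if unit_pt: "L \<in> unit_points" for L
  proof -
    obtain v where v: "v \<in> V" "v \<noteq> 0" "\<not> nil v" "L = line v" using unit_points_cases[OF unit_pt] .
    obtain w where w: "w \<in> V" "v \<star> w = e" using inverse_exists[OF v(1,3)] by blast
    have "unit_points \<subseteq> (\<lambda>x. eact x L) ` coord_space n"
    proof
      fix L' assume unit_pt': "L' \<in> unit_points"
      obtain u where u: "u \<in> V" "u \<noteq> 0" "\<not> nil u" "L' = line u" using unit_points_cases[OF unit_pt'] .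
      \<comment> \<open>The quotient of \<open>u\<close> by \<open>v\<close>; divided by its residue
        it is unipotent, hence an exponential, and lines do not see the residue.\<close>
      define r where "r = u \<star> w"
      have ru: "r \<star> v = u" using w u by (simp add: r_def mul_assoc mul_comm[of w])
      have "\<not> nil r" using u(3) nil_mul[of r v] ru by (auto simp: mul_comm)
      then have c: "residue r \<noteq> 0" using nil_iff_residue[of r] by (simp add: r_def)
      let ?c = "inverse (residue r)"
      have "nil (?c *\<^sub>c (r - residue r *\<^sub>c e))" by (intro nil_smul nil_residue) (simp add: r_def)
      then obtain s where s: "nil s" "nexp s = e + ?c *\<^sub>c (r - residue r *\<^sub>c e)" using nexp_surj by blast
      then have "nexp s = ?c *\<^sub>c r" using c by (simp add: cv.scale_right_diff_distrib)
      moreover obtain x where x: "x \<in> coord_space n" "s = comb x" using comb_surj[OF s(1)] by blast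
      ultimately have "eact x L = line (?c *\<^sub>c u)" unfolding v(4) eact_line by (simp add: mul_smul_left ru)
      then have "L' = eact x L" using line_smul c u(4) by simp
      then show "L' \<in> (\<lambda>x. eact x L) ` coord_space n" using x by blast
    qed
    then show ?thesis by (rule dense_in_mono[OF unit_points_dense])
  qed
  then show "generically (proj n) (\<lambda>L. dense_in (proj n) ((\<lambda>x. eact x L) ` coord_space n))"
    unfolding generically_def using unit_points_open unit_points_dense by blast
qed

end

section \<open>Equivalences and classification of actions\<close>

lemma unit_vec_nonzero: "unit_vec i \<noteq> 0"
proof
  assume "unit_vec i = 0"
  from fun_cong[OF this, of i] show False by (simp add: unit_vec_def zero_fun_apply)
qed

definition coord_algebra_iso ::
    "nat \<Rightarrow> (coords \<Rightarrow> coords \<Rightarrow> coords) \<Rightarrow> coords \<Rightarrow> (coords \<Rightarrow> coords \<Rightarrow> coords) \<Rightarrow> coords \<Rightarrow> (coords \<Rightarrow> coords) \<Rightarrow> bool" where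
  "coord_algebra_iso l mul1 e1 mul2 e2 h \<longleftrightarrow> linear_on l h \<and> bij_betw h (coord_space l) (coord_space l) \<and>
     (\<forall>u\<in>coord_space l. \<forall>v\<in>coord_space l. h (mul1 u v) = mul2 (h u) (h v)) \<and> h e1 = e2"

text \<open>An isomorphism preserves nilpotent elements and commutes with the exponential. Read in
  the bases \<open>S1\<close> and \<open>S2\<close> of the nilpotent elements it is the group
  automorphism \<open>\<alpha>\<close>, and its effect on lines is the isomorphism of projective
  spaces.\<close>

theorem iso_imp_equiv:
  assumes A1: "based_coord_algebra n mul1 e1 S1" and A2: "based_coord_algebra n mul2 e2 S2"
    and iso: "coord_algebra_iso (Suc n) mul1 e1 mul2 e2 h"
  shows "(based_coord_algebra.eact n mul1 e1 S1, based_coord_algebra.eact n mul2 e2 S2) \<in> Ga_equiv n n"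
proof -
  interpret A1: based_coord_algebra n mul1 e1 S1 by (rule A1)
  interpret A2: based_coord_algebra n mul2 e2 S2 by (rule A2)
  let ?k = "Suc n"
  have lin: "linear_on ?k h" and bij: "bij_betw h (coord_space ?k) (coord_space ?k)"
    and mult: "\<And>u v. u \<in> coord_space ?k \<Longrightarrow> v \<in> coord_space ?k \<Longrightarrow> h (mul1 u v) = mul2 (h u) (h v)" and unit: "h e1 = e2"
    using iso by (auto simp: coord_algebra_iso_def)
  have hin: "h v \<in> coord_space ?k" if "v \<in> coord_space ?k" for v using bij that by (auto simp: bij_betw_def)
  have hinj: "v = 0" if "v \<in> coord_space ?k" "h v = 0" for v
    using bij that linear_onD(3)[OF lin] coord_space_closed(1)[of ?k] unfolding bij_betw_def by (metis inj_onD)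
  have pw: "h (A1.pw s i) = A2.pw (h s) i" if "s \<in> coord_space ?k" for s i
    by (induction i) (simp_all add: unit mult that)
  have nil: "A2.nil (h s)" if s: "A1.nil s" for s
  proof -
    obtain i where "A1.pw s i = 0" using s by (auto simp: A1.nil_def)
    then have "A2.pw (h s) i = 0" using pw[OF A1.nil_in[OF s], of i] linear_onD(3)[OF lin] by simp
    then show ?thesis using hin[OF A1.nil_in[OF s]] by (auto simp: A2.nil_def)
  qed
  have exp: "h (A1.nexp s) = A2.nexp (h s)" if s: "A1.nil s" for s
  proof -
    have "h (A1.nexp s) = h (\<Sum>i<?k. inverse (fact i) *\<^sub>c A1.pw s i)"
      by (simp only: A1.nexp_eq[OF A1.pw_bound[OF s]] A1.dp_def)
    also have "\<dots> = (\<Sum>i<?k. inverse (fact i) *\<^sub>c h (A1.pw s i))"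
      by (rule linear_on_sum[OF lin]) simp
    also have "\<dots> = A2.nexp (h s)"
      unfolding A2.nexp_eq[OF A2.pw_bound[OF nil[OF s]]] A2.dp_def pw[OF A1.nil_in[OF s]] by (rule refl)
    finally show ?thesis .
  qed
  define \<alpha> where "\<alpha> x = (SOME y. y \<in> coord_space n \<and> h (A1.comb x) = A2.comb y)" for x
  have \<alpha>: "\<alpha> x \<in> coord_space n \<and> h (A1.comb x) = A2.comb (\<alpha> x)" for x
  proof -
    have "\<exists>y. y \<in> coord_space n \<and> h (A1.comb x) = A2.comb y"
      using A2.comb_surj[OF nil[OF A1.comb_nil]] by blast
    from someI_ex[OF this] show ?thesis by (simp only: \<alpha>_def)
  qed
  have \<alpha>eq: "\<alpha> x = y" if "y \<in> coord_space n" "h (A1.comb x) = A2.comb y" for x y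
  proof -
    have "A2.comb (\<alpha> x - y) + A2.comb y = A2.comb (\<alpha> x)" unfolding A2.comb_add[symmetric] by simp
    then have "A2.comb (\<alpha> x - y) = 0" using \<alpha>[of x] that by simp
    then have "\<alpha> x - y = 0" using A2.comb_eq_0 coord_space_closed(5)[of "\<alpha> x" n y] \<alpha>[of x] that(1) by blast
    then show ?thesis by simp
  qed
  have add: "\<alpha> (x + y) = \<alpha> x + \<alpha> y" for x y
  proof (rule \<alpha>eq)
    show "\<alpha> x + \<alpha> y \<in> coord_space n" using \<alpha> coord_space_closed(2) by blast
    have "h (A1.comb (x + y)) = h (A1.comb x) + h (A1.comb y)"
      unfolding A1.comb_add by (rule linear_onD(1)[OF lin]) (simp_all add: A1.nil_in)
    then show "h (A1.comb (x + y)) = A2.comb (\<alpha> x + \<alpha> y)" using \<alpha> by (simp only: A2.comb_add)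
  qed
  have lin\<alpha>: "linear_on n \<alpha>"
    unfolding linear_on_def
  proof (intro conjI ballI allI add)
    fix c x
    show "\<alpha> (c *\<^sub>c x) = c *\<^sub>c \<alpha> x"
    proof (rule \<alpha>eq)
      show "c *\<^sub>c \<alpha> x \<in> coord_space n" using \<alpha> coord_space_closed(3) by blast
      have "h (A1.comb (c *\<^sub>c x)) = c *\<^sub>c h (A1.comb x)"
        unfolding A1.comb_smul by (rule linear_onD(2)[OF lin]) (simp add: A1.nil_in)
      then show "h (A1.comb (c *\<^sub>c x)) = A2.comb (c *\<^sub>c \<alpha> x)" using \<alpha> by (simp only: A2.comb_smul)
    qed
  qed
  have "bij_betw \<alpha> (coord_space n) (coord_space n)"
  proof (rule linear_inj_bij[OF lin\<alpha>])
    fix x assume x: "x \<in> coord_space n" "\<alpha> x = 0"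
    then have "h (A1.comb x) = 0" using \<alpha>[of x] by simp
    then have "A1.comb x = 0" using hinj A1.nil_in[OF A1.comb_nil] by blast
    then show "x = 0" using A1.comb_eq_0 x by blast
  qed (use \<alpha> in blast)
  then have iso\<alpha>: "variety_iso (affine n) (affine n) \<alpha>" by (rule linear_variety_iso_affine[OF lin\<alpha>])
  have "Ga_aut n \<alpha>"
    unfolding Ga_aut_def using iso\<alpha> add by (simp add: plus_fun_def)
  moreover have "variety_iso (proj n) (proj n) (\<lambda>L. h ` L)" by (rule linear_variety_iso_proj[OF lin bij])
  moreover have "h ` A1.eact x L = A2.eact (\<alpha> x) (h ` L)" if L: "L \<in> proj_points n" for x L
  proof -
    have LV: "L \<subseteq> coord_space ?k" using L line_coord_space by (auto elim!: proj_points_cases)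
    have "h (mul1 (A1.nexp (A1.comb x)) v) = mul2 (A2.nexp (A2.comb (\<alpha> x))) (h v)" if "v \<in> L" for v
      using mult[OF A1.nexp_in] exp[OF A1.comb_nil] \<alpha>[of x] LV that by auto
    then show ?thesis unfolding A1.eact_def A2.eact_def image_image by (intro image_cong) auto
  qed
  ultimately show ?thesis
    unfolding Ga_equiv_def points_simps using A1.eact_structure A2.eact_structure by blast
qed

text \<open>An equivariant projective isomorphism conjugates exponentials, and hence, comparing
  coefficients of \<open>t\<close> in \<open>exp (t s)\<close>, all multiplications of the first algebra into
  multiplications of the second.\<close>

theorem equiv_imp_iso:
  assumes A1: "based_coord_algebra n mul1 e1 S1" and A2: "based_coord_algebra n mul2 e2 S2"
    and equ: "(based_coord_algebra.eact n mul1 e1 S1, based_coord_algebra.eact n mul2 e2 S2) \<in> Ga_equiv n n"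
  shows "\<exists>h. coord_algebra_iso (Suc n) mul1 e1 mul2 e2 h"
proof -
  interpret A1: based_coord_algebra n mul1 e1 S1 by (rule A1)
  interpret A2: based_coord_algebra n mul2 e2 S2 by (rule A2)
  let ?k = "Suc n" let ?V = "coord_space (Suc n)"
  obtain \<alpha> j where \<alpha>: "Ga_aut n \<alpha>" and j: "variety_iso (proj n) (proj n) j"
    and eq: "\<And>x L. x \<in> coord_space n \<Longrightarrow> L \<in> proj_points n \<Longrightarrow> j (A1.eact x L) = A2.eact (\<alpha> x) (j L)"
    using equ unfolding Ga_equiv_def points_simps by blast
  obtain J where J: "linear_on ?k J" "bij_betw J ?V ?V"
    and Jr: "\<And>v. v \<in> ?V \<Longrightarrow> v \<noteq> 0 \<Longrightarrow> j (line v) = line (J v)"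
    by (rule linear_automorphism[OF j]) blast
  define I where "I = inv_into ?V J"
  have I: "linear_on ?k I" unfolding I_def by (rule linear_on_inv[OF J])
  have Jin: "J v \<in> ?V" if "v \<in> ?V" for v using J(2) that by (auto simp: bij_betw_def)
  have Iin: "I v \<in> ?V" and JI: "J (I v) = v" if "v \<in> ?V" for v
    using J(2) that unfolding I_def by (auto simp: bij_betw_def inv_into_into f_inv_into_f)
  have IJ: "I (J v) = v" if "v \<in> ?V" for v using J(2) that unfolding I_def by (simp add: bij_betw_def)
  have Jnz: "J v \<noteq> 0" if "v \<in> ?V" "v \<noteq> 0" for v
    using IJ[OF that(1)] that(2) linear_onD(3)[OF I] by metis
  have exps: "\<exists>a\<in>?V. \<forall>v\<in>?V. J (mul1 (A1.nexp s) v) = mul2 a (J v)" if s: "A1.nil s" for s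
  proof -
    obtain x where x: "x \<in> coord_space n" "s = A1.comb x" using A1.comb_surj[OF s] by blast
    define t where "t = A2.comb (\<alpha> x)"
    have t: "A2.nil t" by (simp add: t_def)
    \<comment> \<open>Equivariance says that \<open>J\<close> turns multiplication by
      \<open>nexp s\<close> into multiplication by \<open>nexp t\<close> up to a scalar that might
      depend on the line. \<open>T\<close> is the quotient of the two; it maps every vector to a
      multiple of itself, so the scalar is the same for all lines.\<close>
    define T where "T w = mul2 (A2.nexp (- t)) (J (mul1 (A1.nexp s) (I w)))" for w
    have lin: "linear_on ?k T"
      unfolding linear_on_def
    proof (intro conjI ballI allI)
      fix u w assume uw: "u \<in> ?V" "w \<in> ?V"
      show "T (u + w) = T u + T w"
        unfolding T_def linear_onD(1)[OF I uw] A1.mul_add_right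
          linear_onD(1)[OF J(1) A1.mul_in A1.mul_in] A2.mul_add_right by (rule refl)
    next
      fix c u assume u: "u \<in> ?V"
      show "T (c *\<^sub>c u) = c *\<^sub>c T u"
        unfolding T_def linear_onD(2)[OF I u] A1.mul_smul_right
          linear_onD(2)[OF J(1) A1.mul_in] A2.mul_smul_right by (rule refl)
    qed
    have "\<exists>c. T w = c *\<^sub>c w" if w: "w \<in> ?V" for w
    proof (cases "w = 0")
      case True
      then show ?thesis using linear_onD(3)[OF lin] by auto
    next
      case False
      have Iw: "I w \<in> ?V" "I w \<noteq> 0" using Iin[OF w] JI[OF w] False linear_onD(3)[OF J(1)] by metis+
      have nz: "mul1 (A1.nexp s) (I w) \<noteq> 0" using A1.nexp_cancel[OF s Iw(1)] Iw(2) by blast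
      have "line (J (mul1 (A1.nexp s) (I w))) = j (A1.eact x (line (I w)))"
        unfolding A1.eact_line x(2)[symmetric] using Jr[OF A1.mul_in nz] by simp
      also have "\<dots> = A2.eact (\<alpha> x) (line w)"
        using eq[OF x(1) line_in_proj[OF Iw]] Jr[OF Iw] JI[OF w] by simp
      also have "\<dots> = line (mul2 (A2.nexp t) w)" unfolding A2.eact_line t_def by (rule refl)
      finally obtain c where "J (mul1 (A1.nexp s) (I w)) = c *\<^sub>c mul2 (A2.nexp t) w"
        using line_eqD by metis
      then have "T w = c *\<^sub>c mul2 (mul2 (A2.nexp t) (A2.nexp (- t))) w"
        unfolding T_def by (simp only: A2.mul_smul_right A2.mul_ac)
      then show ?thesis using A2.nexp_minus[OF t] w by auto
    qed
    then obtain c where c: "\<And>w. w \<in> ?V \<Longrightarrow> T w = c *\<^sub>c w" using linear_scalar[OF lin] by blast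
    have "J (mul1 (A1.nexp s) v) = mul2 (c *\<^sub>c A2.nexp t) (J v)" if v: "v \<in> ?V" for v
    proof -
      let ?u = "J (mul1 (A1.nexp s) v)"
      have "mul2 (A2.nexp (- t)) ?u = c *\<^sub>c J v" using c[OF Jin[OF v]] IJ[OF v] by (simp only: T_def)
      then have "mul2 (A2.nexp t) (mul2 (A2.nexp (- t)) ?u) = mul2 (c *\<^sub>c A2.nexp t) (J v)"
        by (simp only: A2.mul_smul_right A2.mul_smul_left)
      then show ?thesis using A2.nexp_minus[OF t] Jin[OF A1.mul_in]
        by (simp only: A2.mul_assoc[symmetric] A2.unit_mul)
    qed
    then show ?thesis using coord_space_closed(3)[OF A2.nexp_in] by blast
  qed
  \<comment> \<open>\<open>J\<close> sends \<open>v0\<close> to the unit of the second algebra.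
    Multiplying by \<open>v0\<close> before applying \<open>J\<close> therefore gives a map that
    sends unit to unit.\<close>
  define v0 where "v0 = I e2"
  have v0: "v0 \<in> ?V" "J v0 = e2" unfolding v0_def using Iin JI A2.unit_in by auto
  \<comment> \<open>Defect of the multiplicativity to be shown. It is linear in \<open>s\<close>,
    and it vanishes on exponentials because the factor \<open>a\<close> found above is its own value
    at \<open>v0\<close>.\<close>
  define D where "D v s = J (mul1 s v) - mul2 (J (mul1 s v0)) (J v)" for v s
  have D_lin: "linear_on ?k (D v)" for v
    unfolding linear_on_def
  proof (intro conjI ballI allI)
    fix u w
    show "D v (u + w) = D v u + D v w"
      unfolding D_def A1.mul_add_left linear_onD(1)[OF J(1) A1.mul_in A1.mul_in] A2.mul_add_left
      by (simp add: algebra_simps)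
  next
    fix c u
    show "D v (c *\<^sub>c u) = c *\<^sub>c D v u"
      unfolding D_def A1.mul_smul_left linear_onD(2)[OF J(1) A1.mul_in] A2.mul_smul_left
      by (simp only: cv.scale_right_diff_distrib)
  qed
  have D_exp: "D v (A1.nexp s) = 0" if s: "A1.nil s" and v: "v \<in> ?V" for s v
  proof -
    obtain a where a: "a \<in> ?V" "\<forall>v\<in>?V. J (mul1 (A1.nexp s) v) = mul2 a (J v)" using exps[OF s] by blast
    then have "J (mul1 (A1.nexp s) v0) = a" using v0 by simp
    then show ?thesis using a v by (simp add: D_def)
  qed
  have D_nil: "D v s = 0" if s: "A1.nil s" and v: "v \<in> ?V" for s v
  proof
    fix i
    \<comment> \<open>The values of \<open>p\<close> are the coordinates of
      \<open>D v (nexp (t *\<^sub>c s))\<close>, all zero, so its coefficient of \<open>t\<close>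
      vanishes. The index runs up to the dimension, one more than the exponential requires, so that
      1 occurs also for \<open>n = 0\<close>.\<close>
    define p where "p = (\<Sum>m<Suc ?k. monom (D v (A1.dp s m) i) m)"
    have "poly p t = 0" for t
    proof -
      have ts: "A1.nil (t *\<^sub>c s)" using A1.nil_smul[OF s] .
      have z: "A1.pw (t *\<^sub>c s) (Suc ?k) = 0" by (rule A1.pw_zero_mono[OF A1.pw_bound[OF ts]]) simp
      have "A1.dp (t *\<^sub>c s) m = (t ^ m) *\<^sub>c A1.dp s m" for m
        unfolding A1.dp_def A1.pw_smul smul_simps(4) by (simp only: mult.commute)
      then have "A1.nexp (t *\<^sub>c s) = (\<Sum>m<Suc ?k. (t ^ m) *\<^sub>c A1.dp s m)"
        unfolding A1.nexp_eq[OF z] by (intro sum.cong refl)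
      moreover have "D v (\<Sum>m<Suc ?k. (t ^ m) *\<^sub>c A1.dp s m) = (\<Sum>m<Suc ?k. (t ^ m) *\<^sub>c D v (A1.dp s m))"
        by (rule linear_on_sum[OF D_lin]) (rule A1.dp_in)
      ultimately have "(\<Sum>m<Suc ?k. (t ^ m) *\<^sub>c D v (A1.dp s m)) = 0"
        using D_exp[OF ts v] by (simp only:)
      from fun_cong[OF this, of i] show ?thesis
        by (simp only: p_def poly_sum poly_monom sum_coords_apply smul_apply zero_fun_apply mult.commute)
    qed
    then have "p = 0" using poly_all_0_iff_0 by blast
    moreover have "coeff p 1 = D v (A1.dp s 1) i"
      unfolding p_def coeff_sum by (simp del: sum.lessThan_Suc)
    ultimately show "D v s i = 0 i" using A1.nil_in[OF s] by (simp add: A1.dp_def zero_fun_apply)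
  qed
  have D_all: "D v r = 0" if r: "r \<in> ?V" and v: "v \<in> ?V" for r v
  proof -
    let ?c = "A1.residue r"
    have "D v e1 = 0" using v v0 Jin by (simp add: D_def)
    then have "D v (?c *\<^sub>c e1) = 0" using linear_onD(2)[OF D_lin A1.unit_in, of v ?c] by simp
    moreover have "D v (r - ?c *\<^sub>c e1) = 0" using D_nil[OF A1.nil_residue[OF r] v] .
    ultimately show ?thesis
      using linear_on_diff[OF D_lin r coord_space_closed(3)[OF A1.unit_in], of v ?c] by simp
  qed
  define h where "h r = J (mul1 r v0)" for r
  have key: "J (mul1 r v) = mul2 (h r) (J v)" if "r \<in> ?V" "v \<in> ?V" for r v
    using D_all[OF that] by (simp add: D_def h_def)
  have hlin: "linear_on ?k h"
    unfolding linear_on_def h_def A1.mul_add_left A1.mul_smul_left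
    using linear_onD(1,2)[OF J(1)] by simp
  have hin: "h r \<in> ?V" for r unfolding h_def by (rule Jin) simp
  have "bij_betw h ?V ?V"
  proof (rule linear_inj_bij[OF hlin hin])
    fix r assume r: "r \<in> ?V" "h r = 0"
    then have "J (mul1 r e1) = 0" using key[OF r(1) A1.unit_in] by simp
    then show "r = 0" using Jnz[OF r(1)] r(1) by auto
  qed
  moreover have "h (mul1 u v) = mul2 (h u) (h v)" if "u \<in> ?V" "v \<in> ?V" for u v
  proof -
    have "h (mul1 u v) = J (mul1 u (mul1 v v0))" by (simp only: h_def A1.mul_assoc)
    also have "\<dots> = mul2 (h u) (J (mul1 v v0))" by (rule key[OF that(1) A1.mul_in])
    finally show ?thesis by (simp only: h_def)
  qed
  moreover have "h e1 = e2" using v0 by (simp add: h_def)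
  ultimately show ?thesis unfolding coord_algebra_iso_def using hlin by blast
qed

text \<open>Let \<open>d m\<close> be the Taylor coefficients of \<open>f\<close> at 0.
  Differentiating \<open>f (s + t) = f s \<star> f t\<close> in \<open>s\<close> at 0 gives a linear
  differential equation, whose solution has \<open>d m\<close> as divided powers of
  \<open>d 1\<close>. As \<open>f\<close> is polynomial, these vanish eventually and
  \<open>d 1\<close> is nilpotent.\<close>

lemma (in coord_algebra) one_parameter_group:
  assumes curve: "poly_curve f" and f_in: "\<And>t. f t \<in> V" and f0: "f 0 = e"
    and f_add: "\<And>s t. f (s + t) = f s \<star> f t"
  shows "\<exists>d. nil d \<and> f 1 = nexp d \<and> (\<forall>i p. (\<forall>t. f t i = poly p t) \<longrightarrow> d i = coeff p 1)"
proof -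
  obtain p where p: "\<And>i t. f t i = poly (p i) t" using curve unfolding poly_curve_def by metis
  have pz: "p i = 0" if "i \<ge> l" for i
  proof -
    have "poly (p i) t = 0" for t using p[of t i] f_in[of t] that by (simp add: coord_space_def)
    then show ?thesis using poly_all_0_iff_0 by blast
  qed
  \<comment> \<open>A strict common bound on the degrees of all coordinate polynomials; the Taylor
    coefficients vanish from index \<open>K\<close> on.\<close>
  define K where "K = Suc (\<Sum>i<l. degree (p i))"
  have deg: "degree (p i) < K" for i
  proof (cases "i < l")
    case True
    then have "degree (p i) \<le> (\<Sum>i<l. degree (p i))" by (intro member_le_sum) auto
    then show ?thesis by (simp add: K_def)
  qed (simp add: pz K_def)
  define d where "d m = (\<lambda>i. coeff (p i) m)" for m
  have d_in: "d m \<in> V" for m by (auto simp: d_def coord_space_def pz)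
  have dz: "d m = 0" if "m \<ge> K" for m
  proof
    fix i
    have "degree (p i) < m" using deg[of i] that by simp
    then show "d m i = 0 i" by (simp add: d_def zero_fun_apply coeff_eq_0)
  qed
  have f_sum: "f t = (\<Sum>m<K. (t ^ m) *\<^sub>c d m)" for t
  proof
    fix i
    have "poly (p i) t = (\<Sum>m<K. coeff (p i) m * t ^ m)"
      unfolding poly_altdef using deg[of i] coeff_eq_0[of "p i"]
      by (intro sum.mono_neutral_left) auto
    then show "f t i = (\<Sum>m<K. (t ^ m) *\<^sub>c d m) i"
      by (simp only: p sum_coords_apply smul_apply d_def mult.commute)
  qed
  have rec: "d 1 \<star> d m = of_nat (Suc m) *\<^sub>c d (Suc m)" for m
  proof
    fix i
    have "poly (pderiv (p i)) t = poly (\<Sum>m<K. monom ((d 1 \<star> d m) i) m) t" for t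
    proof -
      \<comment> \<open>Expansion of coordinate \<open>i\<close> of \<open>f (s + t)\<close> in
        powers of \<open>s\<close>; computing its derivative at 0 in two ways gives the differential
        equation.\<close>
      define q where "q = (\<Sum>m<K. monom ((d m \<star> f t) i) m)"
      have "poly (pcompose (p i) [:t, 1:]) s = poly q s" for s
      proof -
        have "f (s + t) = (\<Sum>m<K. (s ^ m) *\<^sub>c (d m \<star> f t))"
          unfolding f_add f_sum[of s] mul_sum_left mul_smul_left by (rule refl)
        then have "poly (p i) (s + t) = (\<Sum>m<K. (s ^ m) *\<^sub>c (d m \<star> f t)) i" using p by metis
        then show ?thesis
          by (simp add: poly_pcompose q_def poly_sum poly_monom sum_coords_apply smul_apply mult.commute add.commute)
      qed
      then have "pcompose (p i) [:t, 1:] = q" using poly_eq_poly_eq_iff by blast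
      then have "poly (pderiv (pcompose (p i) [:t, 1:])) 0 = poly (pderiv q) 0" by simp
      moreover have "poly (pderiv q) 0 = coeff q 1" by (simp add: poly_0_coeff_0 coeff_pderiv)
      moreover have "coeff q 1 = (d 1 \<star> f t) i"
      \<comment> \<open>With \<open>K = 1\<close> the index 1 lies outside the sum, but then
        \<open>d 1\<close> vanishes.\<close>
      proof (cases "K = 1")
        case True
        then have "d 1 = 0" using dz by simp
        then show ?thesis using True by (simp add: q_def coeff_sum zero_fun_apply)
      next
        case False
        have "coeff q 1 = (\<Sum>m<K. if m = 1 then (d m \<star> f t) i else 0)"
          unfolding q_def coeff_sum by (intro sum.cong) auto
        also have "\<dots> = (d 1 \<star> f t) i"
        proof -
          have "1 < K" using False unfolding K_def by linarith
          then show ?thesis by simp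
        qed
        finally show ?thesis .
      qed
      moreover have "(d 1 \<star> f t) i = (\<Sum>m<K. (t ^ m) *\<^sub>c (d 1 \<star> d m)) i"
        unfolding f_sum[of t] mul_sum_right mul_smul_right by (rule refl)
      ultimately show ?thesis
        by (simp add: pderiv_pcompose poly_pcompose pderiv_pCons poly_sum poly_monom sum_coords_apply smul_apply mult.commute)
    qed
    then have *: "pderiv (p i) = (\<Sum>m<K. monom ((d 1 \<star> d m) i) m)" using poly_eq_poly_eq_iff by blast
    have "of_nat (Suc m) * coeff (p i) (Suc m) = (if m < K then (d 1 \<star> d m) i else 0)"
      using arg_cong[OF *, of "\<lambda>q. coeff q m"] by (simp add: coeff_pderiv coeff_sum)
    also have "\<dots> = (d 1 \<star> d m) i" using dz[of m] by (simp add: zero_fun_apply)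
    finally show "(d 1 \<star> d m) i = (of_nat (Suc m) *\<^sub>c d (Suc m)) i"
      by (simp only: smul_apply d_def[of "Suc m"])
  qed
  have d0: "d 0 = e"
  proof
    fix i show "d 0 i = e i" using p[of 0 i] by (simp add: f0 d_def poly_0_coeff_0)
  qed
  have dd: "d m = dp (d 1) m" for m
  proof (induction m)
    case 0
    show ?case by (simp only: d0 dp_0)
  next
    case (Suc m)
    have "of_nat (Suc m) *\<^sub>c d (Suc m) = of_nat (Suc m) *\<^sub>c dp (d 1) (Suc m)"
      using rec[of m] dp_Suc[of "d 1" m] Suc.IH by simp
    then show ?case unfolding cv.scale_cancel_left of_nat_eq_0_iff by simp
  qed
  have pwz: "pw (d 1) K = 0" using dd[of K] dz[of K] dp_eq_0_iff by simp
  then have "nil (d 1)" using d_in by (auto simp: nil_def)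
  moreover have "f 1 = nexp (d 1)"
    unfolding nexp_eq[OF pwz] f_sum[of 1] power_one smul_simps(1) dd[symmetric] by (rule refl)
  moreover have "d 1 i = coeff q 1" if "\<forall>t. f t i = poly q t" for i q
  proof -
    have "poly (p i) t = poly q t" for t using that p[of t i] by simp
    then have "p i = q" using poly_eq_poly_eq_iff by blast
    then show ?thesis by (simp add: d_def)
  qed
  ultimately show ?thesis by blast
qed

text \<open>The vector \<open>v0\<close> on a generic line becomes the unit. Multiplication by
  \<open>a\<close> is the operator of the commutant that sends \<open>v0\<close> to
  \<open>a\<close>, and the group acts by multiplication by \<open>B x v0\<close>.\<close>

theorem structure_is_eact:
  assumes act: "act \<in> Ga_structures n n"
  shows "\<exists>mul e S. based_coord_algebra n mul e S \<and>
    (\<forall>x\<in>coord_space n. \<forall>L\<in>proj_points n. act x L = based_coord_algebra.eact n mul e S x L)"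
proof -
  let ?k = "Suc n" let ?V = "coord_space (Suc n)" let ?W = "coord_space n"
  have mor: "morphism (affine_proj n n) (proj n) (\<lambda>(x, L). act x L)"
    and act0: "\<And>L. L \<in> proj_points n \<Longrightarrow> act 0 L = L"
    and act_add: "\<And>x y L. x \<in> ?W \<Longrightarrow> y \<in> ?W \<Longrightarrow> L \<in> proj_points n \<Longrightarrow> act (x + y) L = act x (act y L)"
    and gen1: "generically (proj n) (\<lambda>L. {x \<in> ?W. act x L = L} = {0})"
    and gen2: "generically (proj n) (\<lambda>L. dense_in (proj n) ((\<lambda>x. act x L) ` ?W))"
    using act unfolding Ga_structures_def mem_Collect_eq points_simps zero_coords plus_fun_def by blast+
  have "\<exists>B. poly_family n ?k B \<and> (\<forall>x\<in>?W. linear_on ?k (B x)) \<and> (\<forall>v\<in>?V. B 0 v = v) \<and>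
      (\<forall>x\<in>?W. \<forall>y\<in>?W. \<forall>v\<in>?V. B (x + y) v = B x (B y v)) \<and>
      (\<forall>x\<in>?W. \<forall>v\<in>?V. v \<noteq> 0 \<longrightarrow> act x (line v) = line (B x v))"
  proof (rule linear_action[OF mor act0 act_add])
    fix B
    assume a: "poly_family n ?k B" "\<And>x. x \<in> ?W \<Longrightarrow> linear_on ?k (B x)" "\<And>v. v \<in> ?V \<Longrightarrow> B 0 v = v"
      "\<And>x y v. x \<in> ?W \<Longrightarrow> y \<in> ?W \<Longrightarrow> v \<in> ?V \<Longrightarrow> B (x + y) v = B x (B y v)"
      "\<And>x v. x \<in> ?W \<Longrightarrow> v \<in> ?V \<Longrightarrow> v \<noteq> 0 \<Longrightarrow> act x (line v) = line (B x v)"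
    show ?thesis by (intro exI[of _ B] conjI ballI impI) (rule a; assumption)+
  qed
  then obtain B where B: "poly_family n ?k B" and Blin': "\<forall>x\<in>?W. linear_on ?k (B x)"
    and B0': "\<forall>v\<in>?V. B 0 v = v"
    and Badd': "\<forall>x\<in>?W. \<forall>y\<in>?W. \<forall>v\<in>?V. B (x + y) v = B x (B y v)"
    and Br': "\<forall>x\<in>?W. \<forall>v\<in>?V. v \<noteq> 0 \<longrightarrow> act x (line v) = line (B x v)"
    by (elim exE conjE)
  note Blin = Blin'[rule_format] and B0 = B0'[rule_format] and Badd = Badd'[rule_format] and Br = Br'[rule_format]
  have Bin: "B x v \<in> ?V" if "x \<in> ?W" "v \<in> ?V" for x v using poly_family_in[OF B that] .
  have z: "(0 :: coords) \<in> coord_space m" for m by (rule coord_space_closed)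
  \<comment> \<open>Density provides points because projective space is itself a nonempty open set,
    here the nonvanishing locus of the constant 1.\<close>
  have ne: "\<exists>L. L \<in> U \<inter> U'" if U: "dense_in (proj n) U" "zopen (proj n) U'" "dense_in (proj n) U'" for U U'
  proof -
    have "zopen (proj n) {L \<in> proj_points n. \<exists>v\<in>L - {\<lambda>_. 0}. (1 :: Qbar) \<noteq> 0}"
      unfolding proj_def zopen_coord by (rule coord_open_basic[of "\<lambda>_. 1" _ 0]) (rule forms_const)
    moreover have "line (unit_vec 0) \<in> {L \<in> proj_points n. \<exists>v\<in>L - {\<lambda>_. 0}. (1 :: Qbar) \<noteq> 0}"
    proof -
      have "unit_vec 0 \<in> ?V" "unit_vec 0 \<noteq> 0" using unit_vec_in[of 0 ?k] unit_vec_nonzero by simp_all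
      then have "line (unit_vec 0) \<in> proj_points n" "unit_vec 0 \<in> line (unit_vec 0) - {\<lambda>_. 0}"
        using line_in_proj in_line by (simp_all add: zero_coords)
      moreover have "(1 :: Qbar) \<noteq> 0" by simp
      ultimately show ?thesis by blast
    qed
    ultimately have "U' \<noteq> {}" using U(3) unfolding dense_in_def by blast
    then show ?thesis using U(1,2) unfolding dense_in_def by blast
  qed
  obtain U1 U2 where U: "zopen (proj n) U1" "dense_in (proj n) U1" "zopen (proj n) U2" "dense_in (proj n) U2"
    and U1: "\<forall>L\<in>U1. {x \<in> ?W. act x L = L} = {0}"
    and U2: "\<forall>L\<in>U2. dense_in (proj n) ((\<lambda>x. act x L) ` ?W)"
    using gen1 gen2 unfolding generically_def by blast
  obtain L0 where L0: "L0 \<in> U1" "L0 \<in> U2" using ne[OF U(2,3,4)] by blast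
  have "L0 \<in> proj_points n" using L0(1) zopen_subset_proj[OF U(1)] by (auto simp: points_simps)
  then obtain v0 where v0: "v0 \<in> ?V" "v0 \<noteq> 0" "L0 = line v0" by (rule proj_points_cases)
  have stab: "x = 0" if "x \<in> ?W" "B x v0 = v0" for x
  proof -
    have "act x L0 = L0" using Br[OF that(1) v0(1,2)] that(2) v0(3) by simp
    then show ?thesis using U1 L0(1) that(1) by blast
  qed
  have dense: "dense_in (proj n) ((\<lambda>x. act x L0) ` ?W)" using U2 L0(2) by blast
  \<comment> \<open>An orbit inside a proper subspace would miss the complement of a hyperplane,
    against density. Below this serves as an induction principle: a linear condition that holds on
    the orbit of \<open>v0\<close> holds on the whole space.\<close>
  have cyc: "?V \<subseteq> Y" if Y: "cv.subspace Y" "\<And>x. x \<in> ?W \<Longrightarrow> B x v0 \<in> Y" for Y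
  proof (rule ccontr)
    assume "\<not> ?V \<subseteq> Y"
    then obtain w where w: "w \<in> ?V" "w \<notin> Y \<inter> ?V" by blast
    obtain a where a: "\<And>u. u \<in> Y \<inter> ?V \<Longrightarrow> (\<Sum>i<?k. a i * u i) = 0" "(\<Sum>i<?k. a i * w i) = 1"
      using separating_form[OF cv.subspace_inter[OF Y(1) coord_space_subspace] _ w] by blast
    define Q where "Q = {L \<in> proj_points n. \<exists>v\<in>L - {\<lambda>_. 0}. (\<Sum>i<?k. a i * v i) \<noteq> 0}"
    have "(\<lambda>v. \<Sum>i<?k. a i * v i) \<in> forms ?k 1"
      using forms_mult[OF forms_const forms_var] by (intro forms_sum) fastforce
    then have "zopen (proj n) Q" unfolding Q_def proj_def zopen_coord by (rule coord_open_basic)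
    moreover have "line w \<in> Q"
    proof -
      have "0 \<in> Y" using Y(1) unfolding cv.subspace_def by blast
      then have "w \<noteq> 0" using w by blast
      then have "line w \<in> proj_points n" "w \<in> line w - {\<lambda>_. 0}"
        using line_in_proj[OF w(1)] in_line by (simp_all add: zero_coords)
      moreover have "(\<Sum>i<?k. a i * w i) \<noteq> 0" using a(2) by simp
      ultimately show ?thesis unfolding Q_def by blast
    qed
    ultimately obtain x where x: "x \<in> ?W" "act x L0 \<in> Q" using dense unfolding dense_in_def by blast
    have "act x L0 = line (B x v0)" using Br[OF x(1) v0(1,2)] v0(3) by simp
    then obtain c where c: "(\<Sum>i<?k. a i * (c *\<^sub>c B x v0) i) \<noteq> 0"
      using x(2) unfolding Q_def line_def' by auto
    moreover have "c *\<^sub>c B x v0 \<in> Y \<inter> ?V"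
      using Y(1) Y(2)[OF x(1)] Bin[OF x(1) v0(1)] by (auto simp: cv.subspace_def coord_space_closed)
    ultimately show False using a(1) by blast
  qed
  define comm where "comm A \<longleftrightarrow> linear_on ?k A \<and> (\<forall>v\<in>?V. A v \<in> ?V) \<and>
    (\<forall>x\<in>?W. \<forall>v\<in>?V. A (B x v) = B x (A v))" for A
  have commD: "linear_on ?k A" "\<And>v. v \<in> ?V \<Longrightarrow> A v \<in> ?V"
    "\<And>x v. x \<in> ?W \<Longrightarrow> v \<in> ?V \<Longrightarrow> A (B x v) = B x (A v)" if "comm A" for A
    using that by (auto simp: comm_def)
  have comm_unique: "A v = A' v" if A: "comm A" and A': "comm A'" and eq: "A v0 = A' v0" and v: "v \<in> ?V" for A A' v
  proof -
    have "?V \<subseteq> {v \<in> ?V. A v = A' v}"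
    proof (rule cyc)
      show "cv.subspace {v \<in> ?V. A v = A' v}"
        using linear_onD[OF commD(1)[OF A]] linear_onD[OF commD(1)[OF A']]
        unfolding cv.subspace_def by (auto intro: coord_space_closed)
      show "B x v0 \<in> {v \<in> ?V. A v = A' v}" if "x \<in> ?W" for x
        using Bin[OF that v0(1)] commD(3)[OF A that v0(1)] commD(3)[OF A' that v0(1)] eq by simp
    qed
    then show ?thesis using v by blast
  qed
  have comm_B: "comm (B x)" if x: "x \<in> ?W" for x
  proof -
    have "B x (B y v) = B y (B x v)" if "y \<in> ?W" "v \<in> ?V" for y v
      using Badd[OF x that] Badd[OF that(1) x that(2)] by (simp add: add.commute)
    then show ?thesis unfolding comm_def using Blin[OF x] Bin[OF x] by blast
  qed
  have comm_comp: "comm (\<lambda>v. A (A' v))" if A: "comm A" and A': "comm A'" for A A'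
    using commD[OF A] commD[OF A'] linear_onD[OF commD(1)[OF A]] linear_onD[OF commD(1)[OF A']]
    unfolding comm_def linear_on_def by simp
  have comm_add: "comm (\<lambda>v. A v + A' v)" if A: "comm A" and A': "comm A'" for A A'
    unfolding comm_def linear_on_def
  proof (intro conjI ballI allI)
    fix u w assume uw: "u \<in> ?V" "w \<in> ?V"
    show "A (u + w) + A' (u + w) = (A u + A' u) + (A w + A' w)"
      unfolding linear_onD(1)[OF commD(1)[OF A] uw] linear_onD(1)[OF commD(1)[OF A'] uw]
      by (simp only: add.assoc add.left_commute)
  next
    fix c u assume u: "u \<in> ?V"
    show "A (c *\<^sub>c u) + A' (c *\<^sub>c u) = c *\<^sub>c (A u + A' u)"
      unfolding linear_onD(2)[OF commD(1)[OF A] u] linear_onD(2)[OF commD(1)[OF A'] u]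
      by (simp only: cv.scale_right_distrib)
  next
    fix v assume v: "v \<in> ?V"
    show "A v + A' v \<in> ?V" using commD(2)[OF A v] commD(2)[OF A' v] by (rule coord_space_closed)
  next
    fix x v assume xv: "x \<in> ?W" "v \<in> ?V"
    show "A (B x v) + A' (B x v) = B x (A v + A' v)"
      unfolding commD(3)[OF A xv] commD(3)[OF A' xv]
        linear_onD(1)[OF Blin[OF xv(1)] commD(2)[OF A xv(2)] commD(2)[OF A' xv(2)]] by (rule refl)
  qed
  have comm_smul: "comm (\<lambda>v. c *\<^sub>c A v)" if A: "comm A" for A c
    unfolding comm_def linear_on_def
  proof (intro conjI ballI allI)
    fix u w assume uw: "u \<in> ?V" "w \<in> ?V"
    show "c *\<^sub>c A (u + w) = c *\<^sub>c A u + c *\<^sub>c A w"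
      unfolding linear_onD(1)[OF commD(1)[OF A] uw] by (rule cv.scale_right_distrib)
  next
    fix d u assume u: "u \<in> ?V"
    show "c *\<^sub>c A (d *\<^sub>c u) = d *\<^sub>c c *\<^sub>c A u"
      unfolding linear_onD(2)[OF commD(1)[OF A] u] smul_simps(4) by (simp only: mult.commute)
  next
    fix v assume v: "v \<in> ?V"
    show "c *\<^sub>c A v \<in> ?V" using commD(2)[OF A v] by (rule coord_space_closed)
  next
    fix x v assume xv: "x \<in> ?W" "v \<in> ?V"
    show "c *\<^sub>c A (B x v) = B x (c *\<^sub>c A v)"
      unfolding commD(3)[OF A xv] linear_onD(2)[OF Blin[OF xv(1)] commD(2)[OF A xv(2)]] by (rule refl)
  qed
  \<comment> \<open>Commuting with the whole commutant is carried along, so that the span argument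
    also yields commutativity of the multiplication.\<close>
  define good where "good a A \<longleftrightarrow> comm A \<and> A v0 = a \<and> (\<forall>A'. comm A' \<longrightarrow> (\<forall>v\<in>?V. A (A' v) = A' (A v)))" for a A
  have "?V \<subseteq> {a. \<exists>A. good a A}"
  proof (rule cyc)
    have comm0: "comm (\<lambda>v. 0)"
      unfolding comm_def linear_on_def using z linear_onD(3)[OF Blin] by auto
    have "good 0 (\<lambda>v. 0)"
      unfolding good_def using comm0 linear_onD(3)[OF commD(1)] by simp
    moreover have "good (a + b) (\<lambda>v. A v + A' v)" if "good a A" "good b A'" for a b A A'
      using that comm_add linear_onD(1)[OF commD(1)] commD(2) unfolding good_def by simp
    moreover have "good (c *\<^sub>c a) (\<lambda>v. c *\<^sub>c A v)" if "good a A" for a c A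
      using that comm_smul linear_onD(2)[OF commD(1)] commD(2) unfolding good_def by simp
    ultimately show "cv.subspace {a. \<exists>A. good a A}" unfolding cv.subspace_def by blast
    show "B x v0 \<in> {a. \<exists>A. good a A}" if "x \<in> ?W" for x
      using comm_B[OF that] commD(3) that unfolding good_def by auto
  qed
  then obtain op where op: "\<And>a. a \<in> ?V \<Longrightarrow> good a (op a)" unfolding subset_iff mem_Collect_eq by metis
  have opD: "comm (op a)" "op a v0 = a" "\<And>A v. comm A \<Longrightarrow> v \<in> ?V \<Longrightarrow> op a (A v) = A (op a v)"
    if "a \<in> ?V" for a using op[OF that] unfolding good_def by blast+
  have op_eq: "op a v = A v" if "comm A" "A v0 = a" "a \<in> ?V" "v \<in> ?V" for a A v
    using comm_unique[OF opD(1)[OF that(3)] that(1)] opD(2)[OF that(3)] that(2,4) by simp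
  define mul where "mul u w = op (trunc ?k u) (trunc ?k w)" for u w
  have tr: "trunc ?k u \<in> ?V" for u by (rule trunc_in)
  have trid: "trunc ?k u = u" if "u \<in> ?V" for u using that by (auto simp: trunc_def coord_space_def)
  have mul_in: "mul u w \<in> ?V" for u w unfolding mul_def using commD(2)[OF opD(1)[OF tr] tr] .
  have comm_id: "comm (\<lambda>v. v)" unfolding comm_def linear_on_def by simp
  have tr_add: "trunc ?k (u + w) = trunc ?k u + trunc ?k w" for u w
    by (auto simp: trunc_def plus_fun_apply fun_eq_iff)
  have tr_smul: "trunc ?k (c *\<^sub>c w) = c *\<^sub>c trunc ?k w" for c w
    by (auto simp: trunc_def smul_apply fun_eq_iff)
  interpret coord_algebra ?k mul v0
  proof
    fix u v w :: coords and c :: Qbar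
    show "mul u v \<in> ?V" by (rule mul_in)
    let ?u = "trunc ?k u" and ?v = "trunc ?k v" and ?w = "trunc ?k w"
    have uv: "mul x y = op (trunc ?k x) (trunc ?k y)" for x y by (rule mul_def)
    have "mul (mul u v) w = op (mul u v) ?w" using uv[of "mul u v" w] trid[OF mul_in] by metis
    then have "mul (mul u v) w = op (op ?u ?v) ?w" using uv[of u v] by metis
    also have "\<dots> = op ?u (op ?v ?w)"
      using comm_comp[OF opD(1)[OF tr] opD(1)[OF tr]] opD(2)[OF tr] commD(2)[OF opD(1)[OF tr] tr]
      by (intro op_eq[of "\<lambda>x. op ?u (op ?v x)"]) (simp_all add: tr)
    also have "\<dots> = op ?u (mul v w)" using uv[of v w] by metis
    also have "\<dots> = mul u (mul v w)" using uv[of u "mul v w"] trid[OF mul_in] by metis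
    finally show "mul (mul u v) w = mul u (mul v w)" .
    have "op ?u (op ?v v0) = op ?v (op ?u v0)" by (rule opD(3)[OF tr opD(1)[OF tr] v0(1)])
    then show "mul u v = mul v u" unfolding mul_def using opD(2)[OF tr] by simp
    show "mul (u + v) w = mul u w + mul v w"
      unfolding mul_def tr_add
      by (rule op_eq[OF comm_add[OF opD(1)[OF tr] opD(1)[OF tr]]]) (simp_all add: opD(2)[OF tr] tr coord_space_closed)
    show "mul (c *\<^sub>c u) w = c *\<^sub>c mul u w"
      unfolding mul_def tr_smul
      by (rule op_eq[OF comm_smul[OF opD(1)[OF tr]]]) (simp_all add: opD(2)[OF tr] tr coord_space_closed)
    show "v0 \<in> ?V" by (rule v0)
    show "mul v0 u = ?u" unfolding mul_def trid[OF v0(1)] by (rule op_eq[OF comm_id refl v0(1) tr])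
  qed
  have B_mul: "B x w = mul (B x v0) w" if "x \<in> ?W" "w \<in> ?V" for x w
    unfolding mul_def trid[OF Bin[OF that(1) v0(1)]] trid[OF that(2)]
    using op_eq[OF comm_B[OF that(1)] refl Bin[OF that(1) v0(1)] that(2)] by simp
  \<comment> \<open>Restricted to the multiples of \<open>x\<close>, the representation is a
    polynomial one-parameter group with value \<open>B x v0\<close> at 1; \<open>d\<close> is its
    derivative at 0.\<close>
  have "\<exists>d. nil d \<and> B x v0 = nexp d \<and> (\<forall>i p. (\<forall>t. B (t *\<^sub>c x) v0 i = poly p t) \<longrightarrow> d i = coeff p 1)"
    if x: "x \<in> ?W" for x
  proof -
    have tx: "t *\<^sub>c x \<in> ?W" for t using coord_space_closed(3)[OF x] .
    have curve: "poly_curve (\<lambda>t. B (t *\<^sub>c x) v0)"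
      by (rule poly_family_curve[OF B poly_curve_scale poly_curve_const tx v0(1)])
    have add: "B ((s + t) *\<^sub>c x) v0 = mul (B (s *\<^sub>c x) v0) (B (t *\<^sub>c x) v0)" for s t
      unfolding cv.scale_left_distrib Badd[OF tx tx v0(1)] by (rule B_mul[OF tx Bin[OF tx v0(1)]])
    show ?thesis
      using one_parameter_group[OF curve Bin[OF tx v0(1)] _ add] B0[OF v0(1)] by simp
  qed
  then obtain N where N: "\<And>x. x \<in> ?W \<Longrightarrow> nil (N x)" "\<And>x. x \<in> ?W \<Longrightarrow> B x v0 = nexp (N x)"
    and Nc: "\<And>x i p. x \<in> ?W \<Longrightarrow> (\<forall>t. B (t *\<^sub>c x) v0 i = poly p t) \<Longrightarrow> N x i = coeff p 1"
    by metis
  \<comment> \<open>\<open>N x\<close> is the part of degree 1 of the polynomial map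
    \<open>x \<mapsto> B x v0\<close>, hence linear in \<open>x\<close>.\<close>
  have N_comb: "N x = (\<Sum>j<n. x j *\<^sub>c N (unit_vec j))" if x: "x \<in> ?W" for x
  proof
    fix i
    obtain f where f: "f \<in> polys (n + ?k)" "\<And>x v. x \<in> ?W \<Longrightarrow> v \<in> ?V \<Longrightarrow> B x v i = f (join_coords n x v)"
      using B unfolding poly_family_def by metis
    define g where "g x = f (join_coords n x v0)" for x
    have "g \<in> polys n" unfolding g_def
    proof (rule polys_subst[OF f(1)])
      fix m assume "m < n + ?k"
      show "(\<lambda>x. join_coords n x v0 m) \<in> polys n"
        by (cases "m < n") (auto simp: join_coords_def intro: polys_const polys_var)
    qed
    then obtain a where a: "\<And>v. \<exists>p. (\<forall>t. g (t *\<^sub>c v) = poly p t) \<and> coeff p 1 = (\<Sum>j<n. a j * v j)"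
      using poly_scaling_linear by blast
    have lin: "N y i = (\<Sum>j<n. a j * y j)" if y: "y \<in> ?W" for y
    proof -
      obtain p where p: "\<forall>t. g (t *\<^sub>c y) = poly p t" "coeff p 1 = (\<Sum>j<n. a j * y j)" using a by blast
      then have "\<forall>t. B (t *\<^sub>c y) v0 i = poly p t" using f(2)[OF coord_space_closed(3)[OF y] v0(1)] by (simp add: g_def)
      then show ?thesis using Nc[OF y] p(2) by metis
    qed
    have "N (unit_vec j) i = a j" if "j < n" for j
    proof -
      have "N (unit_vec j) i = (\<Sum>m<n. a m * unit_vec j m)" by (rule lin[OF unit_vec_in[OF that]])
      also have "\<dots> = (\<Sum>m<n. if m = j then a j else 0)" by (intro sum.cong) (auto simp: unit_vec_def)
      also have "\<dots> = a j" using that by simp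
      finally show ?thesis .
    qed
    then show "N x i = (\<Sum>j<n. x j *\<^sub>c N (unit_vec j)) i"
      using lin[OF x] by (simp add: sum_coords_apply smul_apply mult.commute)
  qed
  \<comment> \<open>Elements of the orbit are exponentials, hence unipotent; as the orbit spans,
    every element is a scalar plus a nilpotent one.\<close>
  have "?V \<subseteq> {v. \<exists>c. nil (v - c *\<^sub>c v0)}"
  proof (rule cyc)
    have "nil (0 - 0 *\<^sub>c v0)" using nil_zero by simp
    moreover have "nil (u + w - (c + d) *\<^sub>c v0)" if "nil (u - c *\<^sub>c v0)" "nil (w - d *\<^sub>c v0)" for u w c d
    proof -
      have "u + w - (c + d) *\<^sub>c v0 = (u - c *\<^sub>c v0) + (w - d *\<^sub>c v0)"
        by (simp add: cv.scale_left_distrib)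
      then show ?thesis using nil_add[OF that] by (simp only:)
    qed
    moreover have "nil (a *\<^sub>c u - (a * c) *\<^sub>c v0)" if "nil (u - c *\<^sub>c v0)" for u a c
      using nil_smul[OF that, of a] by (simp add: cv.scale_right_diff_distrib)
    ultimately show "cv.subspace {v. \<exists>c. nil (v - c *\<^sub>c v0)}" unfolding cv.subspace_def mem_Collect_eq by blast
    show "B x v0 \<in> {v. \<exists>c. nil (v - c *\<^sub>c v0)}" if x: "x \<in> ?W" for x
    proof -
      obtain q where q: "nexp (N x) = v0 + N x + mul (mul (N x) (N x)) q"
        using nexp_second_order[OF N(1)[OF x]] by blast
      have "B x v0 - 1 *\<^sub>c v0 = N x + mul (mul (N x) q) (N x)"
        using N(2)[OF x] q by (simp add: add.assoc mul_ac)
      then have "nil (B x v0 - 1 *\<^sub>c v0)" using nil_add[OF N(1)[OF x] nil_mul[OF N(1)[OF x]]] by simp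
      then show ?thesis by blast
    qed
  qed
  then interpret local_coord_algebra ?k mul v0
    using v0(2) by unfold_locales blast+
  define S where "S j = N (unit_vec j)" for j
  have tr_comb: "(\<Sum>i<n. x i *\<^sub>c S i) = N (trunc n x)" for x
    unfolding N_comb[OF trunc_in] S_def by (intro sum.cong refl) (simp add: trunc_def)
  \<comment> \<open>A vanishing combination gives a group element that fixes \<open>v0\<close>, and
    the stabilizer of the generic line is trivial.\<close>
  have indep: "\<forall>i<n. x i = 0" if "(\<Sum>i<n. x i *\<^sub>c S i) = 0" for x
  proof -
    have "N (trunc n x) = 0" using that tr_comb by simp
    then have "B (trunc n x) v0 = v0" using N(2)[OF trunc_in] by simp
    then have "trunc n x = 0" using stab trunc_in by blast
    then show ?thesis by (auto simp: trunc_def fun_eq_iff zero_fun_apply split: if_splits)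
  qed
  have Snil: "nil (S i)" if "i < n" for i using N(1)[OF unit_vec_in[OF that]] by (simp add: S_def)
  \<comment> \<open>The unit is not nilpotent, so the nilpotent elements have dimension at most
    \<open>n\<close>; the \<open>n\<close> independent ones found above then span them.\<close>
  have "cv.dim (Collect nil) < cv.dim ?V"
    using not_nil_unit nil_in v0(1) by (intro dim_less[OF nil_subspace coord_space_subspace]) auto
  then have dim: "cv.dim (Collect nil) \<le> n" unfolding dim_coord_space by simp
  interpret based_coord_algebra n mul v0 S
  proof
    show "\<exists>x. s = (\<Sum>i<n. x i *\<^sub>c S i)" if "nil s" for s
      by (rule independent_family_spans[OF indep nil_subspace _ dim]) (use nil_in Snil that in auto)
  qed (use indep Snil in auto)
  have "act x L = eact x L" if x: "x \<in> ?W" and L: "L \<in> proj_points n" for x L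
  proof -
    obtain v where v: "v \<in> ?V" "v \<noteq> 0" "L = line v" by (rule proj_points_cases[OF L])
    have "comb x = N x" using N_comb[OF x] by (simp only: comb_def S_def)
    then have "eact x L = line (B x v)" unfolding v(3) eact_line B_mul[OF x v(1)] N(2)[OF x] by simp
    then show ?thesis using Br[OF x v(1,2)] v(3) by simp
  qed
  then show ?thesis using based_coord_algebra_axioms by blast
qed

section \<open>Ideals of local algebras\<close>

text \<open>\<open>M\<close> stands for the maximal ideal of a local ring in coordinates: maximality
  makes it prime, and its uniqueness makes all elements outside it invertible. It will turn out to
  consist of the nilpotent elements.\<close>

locale prime_in_coord_algebra = coord_algebra +
  fixes M :: "coords set"
  assumes M_subspace: "cv.subspace M" and M_sub: "M \<subseteq> coord_space l"
    and M_ideal: "u \<in> M \<Longrightarrow> u \<star> v \<in> M" and M_proper: "e \<notin> M"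
    and M_prime: "u \<in> coord_space l \<Longrightarrow> v \<in> coord_space l \<Longrightarrow> u \<star> v \<in> M \<Longrightarrow> u \<in> M \<or> v \<in> M"
    and M_units: "u \<in> coord_space l \<Longrightarrow> u \<notin> M \<Longrightarrow> \<exists>w\<in>coord_space l. u \<star> w = e"
begin

definition peval :: "coords \<Rightarrow> Qbar poly \<Rightarrow> coords" where
  "peval r p = (\<Sum>i\<le>degree p. coeff p i *\<^sub>c pw r i)"

lemma peval_bound: "degree p \<le> n \<Longrightarrow> peval r p = (\<Sum>i\<le>n. coeff p i *\<^sub>c pw r i)"
  unfolding peval_def by (rule sum.mono_neutral_left) (auto simp: coeff_eq_0)

lemma peval_in: "peval r p \<in> V"
  unfolding peval_def by (intro coord_space_sum coord_space_closed(3) pw_in)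

lemma peval_zero: "peval r 0 = 0" by (simp add: peval_def)

lemma peval_pCons: "peval r (pCons a p) = a *\<^sub>c e + r \<star> peval r p"
proof -
  have "peval r (pCons a p) = (\<Sum>i\<le>Suc (degree p). coeff (pCons a p) i *\<^sub>c pw r i)"
    by (rule peval_bound) (rule degree_pCons_le)
  also have "\<dots> = a *\<^sub>c e + (\<Sum>i\<le>degree p. coeff p i *\<^sub>c (r \<star> pw r i))"
    by (simp only: sum.atMost_Suc_shift coeff_pCons_0 coeff_pCons_Suc pw.simps)
  also have "(\<Sum>i\<le>degree p. coeff p i *\<^sub>c (r \<star> pw r i)) = r \<star> peval r p"
    unfolding peval_def mul_sum_right mul_smul_right by (rule refl)
  finally show ?thesis .
qed

lemma peval_add: "peval r (p + q) = peval r p + peval r q"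
proof -
  let ?n = "max (degree p) (degree q)"
  have "degree (p + q) \<le> ?n" by (rule degree_add_le_max)
  then have "peval r (p + q) = (\<Sum>i\<le>?n. coeff (p + q) i *\<^sub>c pw r i)" by (rule peval_bound)
  also have "\<dots> = (\<Sum>i\<le>?n. coeff p i *\<^sub>c pw r i) + (\<Sum>i\<le>?n. coeff q i *\<^sub>c pw r i)"
    unfolding coeff_add cv.scale_left_distrib sum.distrib by (rule refl)
  finally show ?thesis using peval_bound[of p ?n r] peval_bound[of q ?n r] by simp
qed

lemma peval_smult: "peval r (smult a p) = a *\<^sub>c peval r p"
proof -
  have "peval r (smult a p) = (\<Sum>i\<le>degree p. coeff (smult a p) i *\<^sub>c pw r i)"
    by (rule peval_bound) (rule degree_smult_le)
  then show ?thesis unfolding peval_def cv.scale_sum_right by simp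
qed

lemma peval_linear_factor: "peval r ([:- a, 1:] * q) = (r - a *\<^sub>c e) \<star> peval r q"
proof -
  have "[:- a, 1:] * q = smult (- a) q + pCons 0 q" by simp
  then have "peval r ([:- a, 1:] * q) = (- a) *\<^sub>c peval r q + r \<star> peval r q"
    by (simp only: peval_add peval_smult peval_pCons cv.scale_zero_left add_0_left)
  also have "\<dots> = r \<star> peval r q - a *\<^sub>c peval r q" by (simp add: cv.scale_minus_left)
  also have "\<dots> = (r - a *\<^sub>c e) \<star> peval r q"
    using peval_in by (simp add: mul_diff_left mul_smul_left)
  finally show ?thesis .
qed

text \<open>The \<open>l + 1\<close> powers of \<open>r\<close> with exponents from 0 to
  \<open>l\<close> lie in a space of dimension \<open>l\<close>.\<close>

lemma annihilating_poly: "\<exists>p. p \<noteq> 0 \<and> peval r p = 0"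
proof (rule ccontr)
  assume n: "\<not> ?thesis"
  have "\<forall>j<Suc l. c j = 0" if z: "(\<Sum>j<Suc l. c j *\<^sub>c pw r j) = 0" for c
  proof -
    define p where "p = (\<Sum>j\<le>l. monom (c j) j)"
    have c: "coeff p j = (if j \<le> l then c j else 0)" for j by (simp add: p_def coeff_sum)
    have "degree p \<le> l" by (rule degree_le) (simp add: c)
    then have "peval r p = (\<Sum>j\<le>l. coeff p j *\<^sub>c pw r j)" by (rule peval_bound)
    also have "\<dots> = (\<Sum>j<Suc l. c j *\<^sub>c pw r j)" unfolding lessThan_Suc_atMost by (intro sum.cong) (auto simp: c)
    finally have "p = 0" using n z by auto
    then have "coeff p j = 0" for j by simp
    then show ?thesis using c by (metis less_Suc_eq_le)
  qed
  from independent_family[OF this] have "cv.independent (pw r ` {..<Suc l})" "card (pw r ` {..<Suc l}) = Suc l"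
    by (auto simp: card_image)
  moreover have "pw r ` {..<Suc l} \<subseteq> cv.span (unit_vec ` {..<l})"
    unfolding coord_space_span using pw_in by blast
  ultimately have "Suc l \<le> card (unit_vec ` {..<l})" using independent_card_le by (metis finite_imageI finite_lessThan)
  moreover have "card (unit_vec ` {..<l}) \<le> l" using card_image_le[of "{..<l}" unit_vec] by simp
  ultimately show False by simp
qed

text \<open>Over the algebraically closed field an annihilating polynomial splits into linear
  factors, and since \<open>M\<close> is prime the value at \<open>r\<close> of one of them lies in
  \<open>M\<close>.\<close>

lemma residue_exists: assumes r: "r \<in> V" shows "\<exists>a. r - a *\<^sub>c e \<in> M"
proof -
  have "\<exists>a. r - a *\<^sub>c e \<in> M" if "p \<noteq> 0" "peval r p \<in> M" for p
    using that
  proof (induction "degree p" arbitrary: p rule: less_induct)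
    case less
    show ?case
    proof (cases "degree p = 0")
      case True
      then obtain a where a: "p = [:a:]" using degree_eq_zeroE by blast
      have "a *\<^sub>c e \<in> M" using less(3) unfolding a peval_pCons peval_zero by simp
      then have "inverse a *\<^sub>c a *\<^sub>c e \<in> M" using M_subspace unfolding cv.subspace_def by blast
      then show ?thesis using a less(2) M_proper by simp
    next
      case False
      then obtain a where "poly p a = 0" using alg_closed_imp_poly_has_root[of p] by auto
      then obtain q where q: "p = [:- a, 1:] * q" by (metis dvdE poly_eq_0_iff_dvd)
      have q0: "q \<noteq> 0" using q less(2) by auto
      have "degree p = Suc (degree q)" unfolding q using q0 by (subst degree_mult_eq) auto
      moreover have "r - a *\<^sub>c e \<in> M \<or> peval r q \<in> M"
        using less(3) M_prime[OF _ peval_in] r unfolding q peval_linear_factor by (simp add: coord_space_closed)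
      ultimately show ?thesis using less(1)[of q] q0 by auto
    qed
  qed
  moreover obtain p where "p \<noteq> 0" "peval r p = 0" using annihilating_poly by blast
  moreover have "0 \<in> M" using M_subspace unfolding cv.subspace_def by blast
  ultimately show ?thesis by metis
qed

text \<open>Factors of the variable are split off from an annihilating polynomial of
  \<open>s\<close> until the constant coefficient is nonzero. The value of what remains is outside
  \<open>M\<close>, hence invertible, so a power of \<open>s\<close> vanishes.\<close>

lemma M_nil: assumes s: "s \<in> M" shows "nil s"
proof -
  have sV: "s \<in> V" using s M_sub by blast
  have "\<exists>k. pw s k = 0" if "p \<noteq> 0" "pw s k \<star> peval s p = 0" for p k
    using that
  proof (induction p arbitrary: k)
    case 0
    then show ?case by simp
  next
    case (pCons a q)
    show ?case
    proof (cases "a = 0")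
      case True
      then have "q \<noteq> 0" using pCons by simp
      moreover have "pw s (Suc k) \<star> peval s q = 0"
        using pCons(4) True unfolding peval_pCons by (simp add: mul_ac)
      ultimately show ?thesis using pCons(2) by blast
    next
      case False
      have "a *\<^sub>c e + s \<star> peval s q \<notin> M"
      proof
        assume "a *\<^sub>c e + s \<star> peval s q \<in> M"
        then have "(a *\<^sub>c e + s \<star> peval s q) - s \<star> peval s q \<in> M"
          by (rule cv.subspace_diff[OF M_subspace]) (rule M_ideal[OF s])
        then have "a *\<^sub>c e \<in> M" by simp
        from cv.subspace_scale[OF M_subspace this, of "inverse a"] show False using False M_proper by simp
      qed
      then obtain w where "w \<in> V" "(a *\<^sub>c e + s \<star> peval s q) \<star> w = e"
        using M_units[of "a *\<^sub>c e + s \<star> peval s q"] by (auto simp: coord_space_closed)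
      then have "pw s k = pw s k \<star> ((a *\<^sub>c e + s \<star> peval s q) \<star> w)" by simp
      also have "\<dots> = 0" using pCons(4) unfolding peval_pCons by (simp add: mul_assoc[symmetric])
      finally show ?thesis by blast
    qed
  qed
  moreover obtain p where "p \<noteq> 0" "peval s p = 0" using annihilating_poly by blast
  ultimately have "\<exists>k. pw s k = 0" by (metis mul_zero(2))
  then show ?thesis using sV by (simp add: nil_def)
qed

lemma M_eq_nil: "M = Collect nil"
proof (intro equalityI subsetI)
  fix s assume "s \<in> Collect nil"
  then obtain k where s: "s \<in> V" "pw s k = 0" by (auto simp: nil_def)
  have "s \<in> M" if "pw s k \<in> M" for k
    using that by (induction k) (use M_proper M_prime[OF s(1) pw_in] in auto)
  then show "s \<in> M" using s(2) M_subspace unfolding cv.subspace_def by metis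
qed (use M_nil in auto)

lemma local_from_prime: "local_coord_algebra l mul e"
proof
  show "e \<noteq> 0" using M_proper M_subspace unfolding cv.subspace_def by auto
  show "\<exists>c. nil (v - c *\<^sub>c e)" if "v \<in> V" for v using residue_exists[OF that] M_eq_nil by blast
qed

end

section \<open>Dimension of the nilradical and composition series\<close>

context local_coord_algebra
begin

definition mul_ideal :: "coords set \<Rightarrow> bool" where
  "mul_ideal U \<longleftrightarrow> cv.subspace U \<and> U \<subseteq> V \<and> (\<forall>u\<in>U. \<forall>v. v \<star> u \<in> U)"

lemma l_pos: "l > 0"
  using unit_nonzero unit_in coord_space_nonzero by (metis not_gr_zero not_less_zero)

lemma dim_nil: "cv.dim (Collect nil) = l - 1"
proof -
  have sub: "Collect nil \<subseteq> V" using nil_in by blast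
  obtain B where B: "B \<subseteq> Collect nil" "finite B" "cv.independent B" "cv.span B = Collect nil"
    "card B = cv.dim (Collect nil)" "card B \<le> l"
    using subspace_basis[OF nil_subspace sub] .
  have "cv.dim (Collect nil) < l"
    using dim_less[OF nil_subspace coord_space_subspace subset_refl, of l] sub not_nil_unit unit_in
    unfolding dim_coord_space by blast
  moreover have "V \<subseteq> cv.span (insert e B)"
  proof
    fix v assume v: "v \<in> V"
    have "v - residue v *\<^sub>c e \<in> cv.span B" unfolding B(4) using nil_residue[OF v] by simp
    then have "v - residue v *\<^sub>c e \<in> cv.span (insert e B)" using cv.span_mono[of B "insert e B"] by blast
    moreover have "residue v *\<^sub>c e \<in> cv.span (insert e B)" by (intro cv.span_scale cv.span_base) simp
    ultimately have "(v - residue v *\<^sub>c e) + residue v *\<^sub>c e \<in> cv.span (insert e B)" by (rule cv.span_add)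
    then show "v \<in> cv.span (insert e B)" by simp
  qed
  then have "card (unit_vec ` {..<l}) \<le> card (insert e B)"
    using B(2) independent_card_le(2)[OF independent_family(2)[OF independent_unit_vec[of _ l]]]
      cv.span_superset[of "unit_vec ` {..<l}"] unfolding coord_space_span by blast
  then have "l \<le> Suc (card B)"
    using independent_family(1)[OF independent_unit_vec[of _ l]] card_insert_le_m1[of "Suc (card B)" B e] B(2)
    by (simp add: card_image card_insert_if split: if_splits)
  ultimately show ?thesis using B(5) by linarith
qed

text \<open>A generator \<open>w\<close> outside \<open>U\<close> whose multiples span the smallest space is annihilated
  modulo \<open>U\<close> by the nilpotent elements.\<close>

lemma mul_ideal_extend:
  assumes U: "mul_ideal U" "U \<noteq> V"
  shows "\<exists>U'. mul_ideal U' \<and> U \<subset> U' \<and> cv.dim U' = Suc (cv.dim U)"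
proof -
  have Us: "cv.subspace U" "U \<subseteq> V" and Um: "\<And>u v. u \<in> U \<Longrightarrow> v \<star> u \<in> U"
    using U(1) by (auto simp: mul_ideal_def)
  define P where "P w = (\<lambda>v. v \<star> w) ` V" for w
  have P_sub: "cv.subspace (P w)" for w
  proof -
    have "v \<star> w + v' \<star> w \<in> P w" if "v \<in> V" "v' \<in> V" for v v'
      unfolding P_def mul_add_left[symmetric] using that by (intro imageI coord_space_closed)
    moreover have "c *\<^sub>c (v \<star> w) \<in> P w" if "v \<in> V" for v c
      unfolding P_def mul_smul_left[symmetric] using that by (intro imageI coord_space_closed)
    moreover have "0 \<star> w \<in> P w" unfolding P_def by (intro imageI coord_space_closed)
    ultimately show ?thesis unfolding cv.subspace_def by (auto simp: P_def)
  qed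
  have PV: "P w \<subseteq> V" for w by (auto simp: P_def)
  obtain w0 where "w0 \<in> V" "w0 \<notin> U" using U Us by blast
  then obtain w where w: "w \<in> V" "w \<notin> U"
    and min: "\<And>w'. w' \<in> V \<Longrightarrow> w' \<notin> U \<Longrightarrow> cv.dim (P w) \<le> cv.dim (P w')"
    using ex_has_least_nat[of "\<lambda>w. w \<in> V \<and> w \<notin> U" w0 "\<lambda>w. cv.dim (P w)"] by blast
  have ann: "s \<star> w \<in> U" if s: "nil s" for s
  proof (rule ccontr)
    assume n: "s \<star> w \<notin> U"
    have "P (s \<star> w) \<subseteq> P w"
    proof
      fix x assume "x \<in> P (s \<star> w)"
      then obtain v where "x = (v \<star> s) \<star> w" unfolding P_def by (auto simp: mul_assoc)
      then show "x \<in> P w" unfolding P_def by (intro image_eqI[of _ _ "v \<star> s"]) auto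
    qed
    \<comment> \<open>If \<open>w\<close> were a multiple of \<open>s \<star> w\<close>, an
      invertible element of the form \<open>e\<close> minus a nilpotent one would annihilate
      \<open>w\<close>. So \<open>s \<star> w\<close> has a smaller space of multiples than
      \<open>w\<close>, against minimality.\<close>
    moreover have "w \<notin> P (s \<star> w)"
    proof
      assume "w \<in> P (s \<star> w)"
      then obtain v where v: "w = v \<star> (s \<star> w)" unfolding P_def by blast
      have "nil (- (v \<star> s))" using nil_minus[OF nil_mul[OF s]] .
      then obtain u where u: "u \<in> V" "(e + - (v \<star> s)) \<star> u = e" using unipotent_inverse by blast
      have "(e + - (v \<star> s)) \<star> w = w - v \<star> (s \<star> w)" using w(1) by (simp only: mul_add_left mul_minus_left unit_mul mul_assoc) simp
      then have "(e + - (v \<star> s)) \<star> w = 0" using v by simp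
      then have "u \<star> ((e + - (v \<star> s)) \<star> w) = 0" by simp
      then have "((e + - (v \<star> s)) \<star> u) \<star> w = 0" by (simp only: mul_ac)
      then have "w = 0" using u(2) w(1) by simp
      then show False using w(2) Us(1) by (simp add: cv.subspace_def)
    qed
    moreover have "w \<in> P w" unfolding P_def using w(1) by (intro image_eqI[of _ _ e]) auto
    ultimately have "cv.dim (P (s \<star> w)) < cv.dim (P w)" by (intro dim_less[OF P_sub P_sub PV]) blast
    then show False using min[OF _ n] by simp
  qed
  obtain B where B: "B \<subseteq> U" "finite B" "cv.independent B" "cv.span B = U" "card B = cv.dim U" "card B \<le> l"
    using subspace_basis[OF Us] .
  \<comment> \<open>Modulo \<open>U\<close>, multiplying \<open>w\<close> by \<open>v\<close> is the
    same as multiplying it by the residue of \<open>v\<close>; adding the single vector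
    \<open>w\<close> therefore yields an ideal.\<close>
  define U' where "U' = cv.span (insert w B)"
  have ind: "cv.independent (insert w B)" using B w by (simp add: cv.independent_insert)
  have wB: "w \<notin> B" using w B by blast
  have U'V: "U' \<subseteq> V" unfolding U'_def using w B Us by (intro cv.span_minimal coord_space_subspace) auto
  have UU': "U \<subseteq> U'" unfolding U'_def B(4)[symmetric] by (rule cv.span_mono) auto
  have wU': "w \<in> U'" unfolding U'_def by (rule cv.span_base) simp
  have U'_sub: "cv.subspace U'" unfolding U'_def by (rule cv.subspace_span)
  have "v \<star> u \<in> U'" if u: "u \<in> U'" for u v
  proof -
    have "U' \<subseteq> {u. v \<star> u \<in> U'}"
    unfolding U'_def
    proof (rule cv.span_minimal)
      fix x
      show "insert w B \<subseteq> {u. v \<star> u \<in> cv.span (insert w B)}"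
      proof
        fix x assume "x \<in> insert w B"
        then consider "x = w" | "x \<in> U" using B(1) by blast
        then have "v \<star> x \<in> U'"
        proof cases
          case 1
          have t: "v \<star> w = trunc l v \<star> w" by (simp only: mul_trunc)
          let ?c = "residue (trunc l v)"
          have "trunc l v \<star> w = ?c *\<^sub>c w + (trunc l v - ?c *\<^sub>c e) \<star> w"
            using w(1) by (simp add: mul_diff_left mul_smul_left)
          moreover have "(trunc l v - ?c *\<^sub>c e) \<star> w \<in> U'" using ann[OF nil_residue[OF trunc_in]] UU' by blast
          moreover have "?c *\<^sub>c w \<in> U'" using wU' by (rule cv.subspace_scale[OF U'_sub])
          ultimately show ?thesis using 1 t cv.subspace_add[OF U'_sub] by simp
        next
          case 2
          then show ?thesis using Um UU' by blast
        qed
        then show "x \<in> {u. v \<star> u \<in> cv.span (insert w B)}" by (simp add: U'_def)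
      qed
      show "cv.subspace {u. v \<star> u \<in> cv.span (insert w B)}"
        using cv.subspace_span[of "insert w B"] unfolding cv.subspace_def
        by (auto simp: mul_add_right mul_smul_right)
    qed
    then show ?thesis using u by blast
  qed
  then have "mul_ideal U'" unfolding mul_ideal_def using U'_sub U'V by blast
  moreover have "cv.dim U' = card (insert w B)"
    unfolding U'_def by (intro cv.dim_eq_card ind) (simp add: cv.span_span)
  then have "cv.dim U' = Suc (cv.dim U)" using wB B(2,5) by simp
  ultimately show ?thesis using UU' wU' w(2) by blast
qed

text \<open>The chain starts at the zero ideal and gains one dimension in each step until dimension
  \<open>l\<close> is reached; it bounds the length from below.\<close>

lemma mul_ideal_chain: "\<exists>I. \<forall>i\<le>l. mul_ideal (I i) \<and> (i < l \<longrightarrow> I i \<subset> I (Suc i))"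
proof -
  have zero: "mul_ideal {0}" unfolding mul_ideal_def cv.subspace_def using coord_space_closed(1) by auto
  have "\<exists>I. (\<forall>i\<le>k. mul_ideal (I i) \<and> (i < k \<longrightarrow> I i \<subset> I (Suc i))) \<and> cv.dim (I k) = k" if "k \<le> l" for k
    using that
  proof (induction k)
    case 0
    have "cv.dim {0} = 0" using cv.dim_eq_card[of "{}" "{0}"] by (simp add: cv.span_empty cv.independent_empty cv.span_zero cv.span_eq_iff[THEN iffD2] cv.subspace_def)
    then show ?case using zero by (intro exI[of _ "\<lambda>_. {0}"]) simp
  next
    case (Suc k)
    then obtain I where I: "\<forall>i\<le>k. mul_ideal (I i) \<and> (i < k \<longrightarrow> I i \<subset> I (Suc i))" "cv.dim (I k) = k" by auto
    have "I k \<noteq> V" using I(2) Suc(2) dim_coord_space[of l] by auto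
    then obtain U' where U': "mul_ideal U'" "I k \<subset> U'" "cv.dim U' = Suc k"
      using mul_ideal_extend[of "I k"] I by auto
    have "mul_ideal ((I(Suc k := U')) i)" if "i \<le> Suc k" for i using that I(1) U'(1) by (auto simp: le_Suc_eq)
    moreover have "(I(Suc k := U')) i \<subset> (I(Suc k := U')) (Suc i)" if "i < Suc k" for i
    proof (cases "i = k")
      case True
      then show ?thesis using U'(2) by simp
    next
      case False
      then have "i < k" using that by simp
      then show ?thesis using I(1) by simp
    qed
    ultimately show ?case using U'(3) by (intro exI[of _ "I(Suc k := U')"]) simp
  qed
  from this[of l] show ?thesis by auto
qed

end

section \<open>Algebras in linear coordinates\<close>

locale qbar_algebra =
  fixes R :: "(Qbar, 'a) module" (structure)
  assumes alg: "algebra (ring_of_type_algebra :: Qbar ring) R"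
begin

sublocale A: algebra "ring_of_type_algebra :: Qbar ring" R by (rule alg)

lemma smult_simps:
  shows smult_in [simp]: "r \<in> carrier R \<Longrightarrow> c \<odot> r \<in> carrier R"
    and smult_smult: "r \<in> carrier R \<Longrightarrow> c \<odot> (d \<odot> r) = (c * d) \<odot> r"
    and smult_add_left: "r \<in> carrier R \<Longrightarrow> (c + d) \<odot> r = c \<odot> r \<oplus> d \<odot> r"
    and smult_add_right: "r \<in> carrier R \<Longrightarrow> s \<in> carrier R \<Longrightarrow> c \<odot> (r \<oplus> s) = c \<odot> r \<oplus> c \<odot> s"
    and smult_1 [simp]: "r \<in> carrier R \<Longrightarrow> 1 \<odot> r = r"
    and smult_mult_left: "r \<in> carrier R \<Longrightarrow> s \<in> carrier R \<Longrightarrow> (c \<odot> r) \<otimes> s = c \<odot> (r \<otimes> s)"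
  using A.smult_closed[of c r] A.smult_assoc1[of c d r] A.smult_l_distr[of c d r]
    A.smult_r_distr[of c r s] A.smult_one[of r] A.smult_assoc2[of c r s]
  by (simp_all add: ring_of_type_algebra_def)

lemma smult_0: "r \<in> carrier R \<Longrightarrow> 0 \<odot> r = \<zero>"
proof -
  assume r: "r \<in> carrier R"
  have "0 \<odot> r \<oplus> 0 \<odot> r = 0 \<odot> r \<oplus> \<zero>" using smult_add_left[OF r, of 0 0] r by simp
  then show ?thesis using A.add.l_cancel[of "0 \<odot> r" "0 \<odot> r" \<zero>] r by simp
qed

lemma smult_minus_1: "r \<in> carrier R \<Longrightarrow> (- 1) \<odot> r = \<ominus> r"
proof -
  assume r: "r \<in> carrier R"
  have "r \<oplus> (- 1) \<odot> r = \<zero>" using smult_add_left[OF r, of 1 "- 1"] smult_0[OF r] r by simp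
  then show ?thesis using A.minus_equality[of "(- 1) \<odot> r" r] r by (simp add: A.a_comm)
qed

lemma scalars_mult: "r \<in> carrier R \<Longrightarrow> (c \<odot> \<one>) \<otimes> r = c \<odot> r"
  by (simp add: smult_mult_left)

lemma line_extension_iff:
  assumes "v \<in> carrier R"
  shows "u \<in> A.line_extension (scalars R) v E \<longleftrightarrow> (\<exists>c. \<exists>w\<in>E. u = c \<odot> v \<oplus> w)"
proof
  assume "u \<in> A.line_extension (scalars R) v E"
  then obtain k w where kw: "k \<in> scalars R" "w \<in> E" "u = k \<otimes> v \<oplus> w"
    unfolding A.line_extension_mem_iff by blast
  then obtain c where "k = c \<odot> \<one>" unfolding scalars_def by blast
  then show "\<exists>c. \<exists>w\<in>E. u = c \<odot> v \<oplus> w" using kw scalars_mult[OF assms] by metis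
next
  assume "\<exists>c. \<exists>w\<in>E. u = c \<odot> v \<oplus> w"
  then obtain c w where cw: "w \<in> E" "u = c \<odot> v \<oplus> w" by blast
  have "u = (c \<odot> \<one>) \<otimes> v \<oplus> w" using cw scalars_mult[OF assms] by simp
  moreover have "c \<odot> \<one> \<in> scalars R" unfolding scalars_def by blast
  ultimately show "u \<in> A.line_extension (scalars R) v E" unfolding A.line_extension_mem_iff using cw(1) by blast
qed

text \<open>The coordinates follow the inductive construction of the dimension: the vector
  \<open>v\<close> added in a step receives the next coordinate, of index \<open>n\<close>.\<close>

lemma dimension_imp_coords:
  "A.dimension d K E \<Longrightarrow> K = scalars R \<Longrightarrow>
    E \<subseteq> carrier R \<and> (\<exists>\<chi>. bij_betw \<chi> (coord_space d) E \<and>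
      (\<forall>u\<in>coord_space d. \<forall>w\<in>coord_space d. \<chi> (u + w) = \<chi> u \<oplus> \<chi> w) \<and>
      (\<forall>c. \<forall>u\<in>coord_space d. \<chi> (c *\<^sub>c u) = c \<odot> \<chi> u))"
proof (induction rule: A.dimension.induct)
  case (zero_dim K)
  have 0: "coord_space 0 = {0 :: coords}" by (auto simp: coord_space_def zero_coords[symmetric])
  have "c \<odot> \<zero> = \<zero>" for c
    using smult_smult[of \<zero> c 0] smult_0[of \<zero>] by simp
  then show ?case unfolding 0 by (intro conjI exI[of _ "\<lambda>_. \<zero>"]) (auto simp: bij_betw_def)
next
  case (Suc_dim v E n K)
  then obtain \<chi> where E: "E \<subseteq> carrier R" and \<chi>: "bij_betw \<chi> (coord_space n) E"
    "\<And>u w. u \<in> coord_space n \<Longrightarrow> w \<in> coord_space n \<Longrightarrow> \<chi> (u + w) = \<chi> u \<oplus> \<chi> w"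
    "\<And>c u. u \<in> coord_space n \<Longrightarrow> \<chi> (c *\<^sub>c u) = c \<odot> \<chi> u"
    by blast
  have \<chi>E: "\<chi> u \<in> E" if "u \<in> coord_space n" for u using \<chi>(1) that by (auto simp: bij_betw_def)
  then have \<chi>R: "\<chi> u \<in> carrier R" if "u \<in> coord_space n" for u using that E by blast
  define \<eta> where "\<eta> u = u n \<odot> v \<oplus> \<chi> (trunc n u)" for u
  have tr: "trunc n u \<in> coord_space n" for u by (rule trunc_in)
  have tr_add: "trunc n (u + w) = trunc n u + trunc n w" and tr_smul: "trunc n (c *\<^sub>c u) = c *\<^sub>c trunc n u" for u w c
    by (auto simp: trunc_def plus_fun_apply smul_apply fun_eq_iff)
  have add: "\<eta> (u + w) = \<eta> u \<oplus> \<eta> w" for u w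
    unfolding \<eta>_def tr_add \<chi>(2)[OF tr tr] plus_fun_apply smult_add_left[OF Suc_dim(1)]
    using \<chi>R[OF tr] Suc_dim(1) by (simp add: A.a_ac)
  have scale: "\<eta> (c *\<^sub>c u) = c \<odot> \<eta> u" for c u
    unfolding \<eta>_def tr_smul \<chi>(3)[OF tr] smul_apply
    using \<chi>R[OF tr] Suc_dim(1) by (simp add: smult_add_right smult_smult)
  have \<eta>R: "\<eta> u \<in> carrier R" for u unfolding \<eta>_def using \<chi>R[OF tr] Suc_dim(1) by simp
  have \<chi>0: "\<chi> 0 = \<zero>" using \<chi>(3)[of 0 0] smult_0[OF \<chi>R] coord_space_closed(1) by simp
  have ker: "u = 0" if u: "u \<in> coord_space (Suc n)" "\<eta> u = \<zero>" for u
  proof -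
    \<comment> \<open>Otherwise \<open>v\<close> would be a scalar multiple of an element of
      \<open>E\<close>, hence lie in \<open>E\<close>.\<close>
    have "u n = 0"
    proof (rule ccontr)
      assume n: "u n \<noteq> 0"
      let ?w = "\<chi> (trunc n u)"
      have w: "?w \<in> carrier R" using \<chi>R[OF tr] .
      have "u n \<odot> v = \<ominus> ?w"
        using u(2) Suc_dim(1) w A.minus_equality[of "u n \<odot> v" ?w] by (simp add: \<eta>_def)
      then have "u n \<odot> v = (- 1) \<odot> ?w" using smult_minus_1[OF w] by simp
      then have "inverse (u n) \<odot> (u n \<odot> v) = (inverse (u n) * (- 1)) \<odot> ?w"
        by (simp only: smult_smult[OF w])
      moreover have "inverse (u n) \<odot> (u n \<odot> v) = v"
        using smult_smult[OF Suc_dim(1)] n Suc_dim(1) by simp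
      ultimately have "v = \<chi> ((inverse (u n) * (- 1)) *\<^sub>c trunc n u)"
        by (simp only: \<chi>(3)[OF tr])
      then show False using \<chi>E coord_space_closed(3)[OF tr] Suc_dim(2) by metis
    qed
    have u': "trunc n u = u"
    proof
      fix i
      consider "i < n" | "i = n" | "i \<ge> Suc n" by linarith
      then show "trunc n u i = u i"
        using u(1) \<open>u n = 0\<close> by cases (auto simp: trunc_def coord_space_def)
    qed
    then have "\<chi> u = \<chi> 0" using u(2) \<open>u n = 0\<close> smult_0[OF Suc_dim(1)] \<chi>R[OF tr, of u] \<chi>0 by (simp add: \<eta>_def)
    then show ?thesis using \<chi>(1) u' tr[of u] coord_space_closed(1) unfolding bij_betw_def by (metis inj_onD)
  qed
  have inj: "inj_on \<eta> (coord_space (Suc n))"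
  proof (rule inj_onI)
    fix u w assume uw: "u \<in> coord_space (Suc n)" "w \<in> coord_space (Suc n)" "\<eta> u = \<eta> w"
    have "\<eta> (u + (- 1) *\<^sub>c w) = \<eta> w \<oplus> (- 1) \<odot> \<eta> w" unfolding add scale uw(3) by (rule refl)
    also have "\<dots> = \<zero>" using smult_minus_1[OF \<eta>R] \<eta>R by (simp add: A.r_neg)
    finally have "u + (- 1) *\<^sub>c w = 0"
      by (rule ker[rotated]) (intro coord_space_closed uw)
    then show "u = w" by (simp add: cv.scale_minus_left)
  qed
  have img: "\<eta> ` coord_space (Suc n) = A.line_extension K v E"
  proof (intro equalityI subsetI)
    fix r assume "r \<in> \<eta> ` coord_space (Suc n)"
    then show "r \<in> A.line_extension K v E"
      unfolding Suc_dim(5) line_extension_iff[OF Suc_dim(1)] \<eta>_def using \<chi>E[OF tr] by blast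
  next
    fix r assume "r \<in> A.line_extension K v E"
    then obtain c w where r: "w \<in> E" "r = c \<odot> v \<oplus> w"
      unfolding Suc_dim(5) line_extension_iff[OF Suc_dim(1)] by blast
    obtain u where u: "u \<in> coord_space n" "w = \<chi> u" using r(1) \<chi>(1) by (auto simp: bij_betw_def)
    let ?u = "u(n := c)"
    have "trunc n ?u = u" using u(1) by (auto simp: trunc_def coord_space_def fun_eq_iff)
    then have "r = \<eta> ?u" using r u by (simp add: \<eta>_def)
    moreover have "?u \<in> coord_space (Suc n)" using u(1) by (auto simp: coord_space_def)
    ultimately show "r \<in> \<eta> ` coord_space (Suc n)" by blast
  qed
  have "A.line_extension K v E \<subseteq> carrier R" unfolding img[symmetric] using \<eta>R by blast
  then show ?case using inj img add scale by (auto simp: bij_betw_def)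
qed

lemma finite_dimension_imp_coords:
  assumes "A.finite_dimension (scalars R) (carrier R)"
  shows "\<exists>d \<psi>. linear_coords d R \<psi>"
proof -
  obtain d where "A.dimension d (scalars R) (carrier R)" using assms by (auto simp: A.finite_dimension_def)
  from dimension_imp_coords[OF this refl] obtain \<chi> where
    \<chi>: "bij_betw \<chi> (coord_space d) (carrier R)"
      "\<And>u w. u \<in> coord_space d \<Longrightarrow> w \<in> coord_space d \<Longrightarrow> \<chi> (u + w) = \<chi> u \<oplus> \<chi> w"
      "\<And>c u. u \<in> coord_space d \<Longrightarrow> \<chi> (c *\<^sub>c u) = c \<odot> \<chi> u" by blast
  let ?\<psi> = "inv_into (coord_space d) \<chi>"
  have \<psi>: "?\<psi> r \<in> coord_space d" "\<chi> (?\<psi> r) = r" if "r \<in> carrier R" for r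
    using \<chi>(1) that by (auto simp: bij_betw_def inv_into_into f_inv_into_f)
  have inv: "?\<psi> (\<chi> u) = u" if "u \<in> coord_space d" for u
    using \<chi>(1) that by (simp add: bij_betw_def)
  have "?\<psi> (r \<oplus> s) = ?\<psi> r + ?\<psi> s" if "r \<in> carrier R" "s \<in> carrier R" for r s
    using inv[of "?\<psi> r + ?\<psi> s"] \<chi>(2)[of "?\<psi> r" "?\<psi> s"] \<psi> that coord_space_closed(2) by simp
  moreover have "?\<psi> (c \<odot> r) = c *\<^sub>c ?\<psi> r" if "r \<in> carrier R" for c r
    using inv[of "c *\<^sub>c ?\<psi> r"] \<chi>(3)[of "?\<psi> r" c] \<psi> that coord_space_closed(3) by simp
  ultimately have "linear_coords d R ?\<psi>"
    unfolding linear_coords_def using bij_betw_inv_into[OF \<chi>(1)] by (simp add: plus_fun_def smul_def)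
  then show ?thesis by blast
qed

end

section \<open>Algebras carried over to coordinates, ideals and their dimensions\<close>

locale coordinatized_algebra = qbar_algebra R for R :: "(Qbar, 'a) module" (structure) +
  fixes l :: nat and \<psi> :: "'a \<Rightarrow> coords"
  assumes coords: "linear_coords l R \<psi>"
begin

definition \<chi> :: "coords \<Rightarrow> 'a" where "\<chi> = inv_into (carrier R) \<psi>"

definition cmul :: "coords \<Rightarrow> coords \<Rightarrow> coords" where
  "cmul u w = \<psi> (\<chi> (trunc l u) \<otimes> \<chi> (trunc l w))"

lemma \<psi>_bij: "bij_betw \<psi> (carrier R) (coord_space l)"
  using coords by (simp add: linear_coords_def)

lemma \<psi>_in [simp]: "r \<in> carrier R \<Longrightarrow> \<psi> r \<in> coord_space l"
  using \<psi>_bij by (auto simp: bij_betw_def)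

lemma \<chi>_in [simp]: "v \<in> coord_space l \<Longrightarrow> \<chi> v \<in> carrier R"
  using \<psi>_bij by (auto simp: \<chi>_def bij_betw_def inv_into_into)

lemma \<psi>_\<chi> [simp]: "v \<in> coord_space l \<Longrightarrow> \<psi> (\<chi> v) = v"
  using \<psi>_bij by (auto simp: \<chi>_def bij_betw_def f_inv_into_f)

lemma \<chi>_\<psi> [simp]: "r \<in> carrier R \<Longrightarrow> \<chi> (\<psi> r) = r"
  using \<psi>_bij by (simp add: \<chi>_def bij_betw_def)

lemma \<psi>_add: "r \<in> carrier R \<Longrightarrow> s \<in> carrier R \<Longrightarrow> \<psi> (r \<oplus> s) = \<psi> r + \<psi> s"
  using coords by (simp add: linear_coords_def plus_fun_def)

lemma \<psi>_smult: "r \<in> carrier R \<Longrightarrow> \<psi> (c \<odot> r) = c *\<^sub>c \<psi> r"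
  using coords by (simp add: linear_coords_def smul_def)

lemma \<psi>_zero: "\<psi> \<zero> = 0"
  using \<psi>_smult[of \<zero> 0] smult_0[of \<zero>] by simp

lemma \<psi>_inj: "r \<in> carrier R \<Longrightarrow> s \<in> carrier R \<Longrightarrow> \<psi> r = \<psi> s \<Longrightarrow> r = s"
  using \<chi>_\<psi> by metis

lemma \<psi>_eq_0: "r \<in> carrier R \<Longrightarrow> \<psi> r = 0 \<longleftrightarrow> r = \<zero>"
  using \<psi>_inj[of r \<zero>] \<psi>_zero by auto

lemma trunc_\<psi> [simp]: "r \<in> carrier R \<Longrightarrow> trunc l (\<psi> r) = \<psi> r"
  using \<psi>_in[of r] by (auto simp: trunc_def coord_space_def fun_eq_iff)

lemma cmul_\<psi>: "r \<in> carrier R \<Longrightarrow> s \<in> carrier R \<Longrightarrow> cmul (\<psi> r) (\<psi> s) = \<psi> (r \<otimes> s)"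
  by (simp add: cmul_def)

sublocale C: coord_algebra l cmul "\<psi> \<one>"
proof
  fix u v w :: coords and c :: Qbar
  define r s t where "r = \<chi> (trunc l u)" and "s = \<chi> (trunc l v)" and "t = \<chi> (trunc l w)"
  have rst: "r \<in> carrier R" "s \<in> carrier R" "t \<in> carrier R" "\<psi> r = trunc l u" "\<psi> s = trunc l v" "\<psi> t = trunc l w"
    unfolding r_def s_def t_def using trunc_in by simp_all
  have uv: "cmul u v = \<psi> (r \<otimes> s)" "cmul v u = \<psi> (s \<otimes> r)" "cmul u w = \<psi> (r \<otimes> t)" "cmul v w = \<psi> (s \<otimes> t)"
    unfolding cmul_def r_def s_def t_def by (rule refl)+
  have 1: "cmul (\<psi> x) w = \<psi> (x \<otimes> t)" "cmul u (\<psi> x) = \<psi> (r \<otimes> x)" if "x \<in> carrier R" for x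
    using that rst by (simp_all add: cmul_def r_def t_def)
  show "cmul u v \<in> coord_space l" using uv rst by simp
  show "cmul (cmul u v) w = cmul u (cmul v w)" unfolding uv using rst by (simp add: 1 A.m_assoc)
  show "cmul u v = cmul v u" unfolding uv using rst by (simp add: A.m_comm)
  have "trunc l (u + v) = \<psi> (r \<oplus> s)" using rst by (simp add: \<psi>_add) (auto simp: trunc_def plus_fun_apply fun_eq_iff)
  then have "cmul (u + v) w = \<psi> ((r \<oplus> s) \<otimes> t)" unfolding cmul_def using rst by (simp add: t_def)
  then show "cmul (u + v) w = cmul u w + cmul v w" unfolding uv using rst by (simp add: A.l_distr \<psi>_add)
  have "trunc l (c *\<^sub>c u) = \<psi> (c \<odot> r)" using rst by (simp add: \<psi>_smult) (auto simp: trunc_def smul_apply fun_eq_iff)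
  then have "cmul (c *\<^sub>c u) w = \<psi> ((c \<odot> r) \<otimes> t)" unfolding cmul_def using rst by (simp add: t_def)
  then show "cmul (c *\<^sub>c u) w = c *\<^sub>c cmul u w" unfolding uv using rst by (simp add: smult_mult_left \<psi>_smult)
  show "\<psi> \<one> \<in> coord_space l" by simp
  show "cmul (\<psi> \<one>) u = trunc l u" using rst by (simp add: cmul_def r_def)
qed

lemma \<psi>_pow: "r \<in> carrier R \<Longrightarrow> \<psi> (r [^] (k :: nat)) = C.pw (\<psi> r) k"
  by (induction k) (simp_all add: A.m_comm cmul_\<psi>[symmetric])

lemma ideal_image:
  assumes "ideal J R"
  shows "cv.subspace (\<psi> ` J)" "\<psi> ` J \<subseteq> coord_space l" "u \<in> \<psi> ` J \<Longrightarrow> cmul v u \<in> \<psi> ` J"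
proof -
  interpret J: ideal J R by (rule assms)
  have JR: "r \<in> carrier R" if "r \<in> J" for r using that by (rule J.Icarr)
  have smult: "c \<odot> r \<in> J" if "r \<in> J" for c r
    using J.I_l_closed[OF that, of "c \<odot> \<one>"] scalars_mult[OF JR[OF that]] by simp
  show "\<psi> ` J \<subseteq> coord_space l" using JR by auto
  show "cv.subspace (\<psi> ` J)"
    unfolding cv.subspace_def
  proof (intro conjI ballI allI)
    show "0 \<in> \<psi> ` J" using \<psi>_zero J.zero_closed by (metis imageI)
    fix x assume "x \<in> \<psi> ` J"
    then obtain r where r: "r \<in> J" "x = \<psi> r" by blast
    show "c *\<^sub>c x \<in> \<psi> ` J" for c using r smult[OF r(1)] \<psi>_smult[OF JR[OF r(1)]] by (metis imageI)
    fix y assume "y \<in> \<psi> ` J"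
    then obtain s where s: "s \<in> J" "y = \<psi> s" by blast
    then show "x + y \<in> \<psi> ` J" using r J.a_closed[OF r(1) s(1)] \<psi>_add[OF JR[OF r(1)] JR[OF s(1)]] by (metis imageI)
  qed
  show "cmul v u \<in> \<psi> ` J" if u: "u \<in> \<psi> ` J" for u v
  proof -
    obtain r where r: "r \<in> J" "u = \<psi> r" using u by blast
    have "cmul v u = \<psi> (\<chi> (trunc l v) \<otimes> r)" using r JR by (simp add: cmul_def)
    moreover have "\<chi> (trunc l v) \<otimes> r \<in> J" using J.I_l_closed[OF r(1)] trunc_in \<chi>_in by blast
    ultimately show ?thesis by blast
  qed
qed

lemma ideal_preimage:
  assumes U: "cv.subspace U" "U \<subseteq> coord_space l" and m: "\<And>u v. u \<in> U \<Longrightarrow> cmul v u \<in> U"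
  shows "ideal (\<chi> ` U) R"
proof (rule idealI)
  show "ring R" by (rule cring.axioms(1)[OF algebra.axioms(2)[OF alg]])
  have UR: "\<chi> u \<in> carrier R" "\<psi> (\<chi> u) = u" if "u \<in> U" for u using that U(2) by auto
  have mem: "r \<in> \<chi> ` U" if "r \<in> carrier R" "\<psi> r \<in> U" for r using that by (metis \<chi>_\<psi> imageI)
  show "subgroup (\<chi> ` U) (add_monoid R)"
  proof (rule A.add.subgroupI)
    show "\<chi> ` U \<subseteq> carrier R" using UR by auto
    show "\<chi> ` U \<noteq> {}" using U(1) by (auto simp: cv.subspace_def)
    fix a assume "a \<in> \<chi> ` U"
    then obtain u where u: "u \<in> U" "a = \<chi> u" by blast
    have "\<psi> ((- 1) \<odot> a) \<in> U"
      using u UR \<psi>_smult[OF UR(1)[OF u(1)], of "- 1"] cv.subspace_scale[OF U(1) u(1), of "- 1"] by simp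
    then show "\<ominus> a \<in> \<chi> ` U" using mem[of "(- 1) \<odot> a"] smult_minus_1 u UR by simp
    fix b assume "b \<in> \<chi> ` U"
    then obtain w where w: "w \<in> U" "b = \<chi> w" by blast
    have "\<psi> (a \<oplus> b) \<in> U" using u w UR \<psi>_add[OF UR(1)[OF u(1)] UR(1)[OF w(1)]] cv.subspace_add[OF U(1) u(1) w(1)] by simp
    then show "a \<oplus> b \<in> \<chi> ` U" using mem u w UR by simp
  qed
  fix a x assume "a \<in> \<chi> ` U" and x: "x \<in> carrier R"
  then obtain u where u: "u \<in> U" "a = \<chi> u" by blast
  have "cmul (\<psi> x) (\<psi> a) = \<psi> (x \<otimes> a)" unfolding u(2) by (rule cmul_\<psi>[OF x UR(1)[OF u(1)]])
  then have "\<psi> (x \<otimes> a) \<in> U" using m[OF u(1), of "\<psi> x"] unfolding u(2) UR(2)[OF u(1)] by simp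
  then show xa: "x \<otimes> a \<in> \<chi> ` U" using mem x u UR by simp
  then show "a \<otimes> x \<in> \<chi> ` U" using A.m_comm x u UR by simp
qed

lemma ideal_dim_less:
  assumes "ideal J R" "ideal J' R" "J \<subset> J'"
  shows "cv.dim (\<psi> ` J) < cv.dim (\<psi> ` J')"
proof (rule dim_less[OF ideal_image(1)[OF assms(1)] ideal_image(1,2)[OF assms(2)]])
  have "J' \<subseteq> carrier R" using ideal.Icarr[OF assms(2)] by blast
  then have "inj_on \<psi> J'" using \<psi>_inj by (intro inj_onI) blast
  then show "\<psi> ` J \<subset> \<psi> ` J'" using assms(3) by (rule image_strict_mono)
qed

lemma ideal_dim_le: "ideal J R \<Longrightarrow> cv.dim (\<psi> ` J) \<le> l"
  using dim_le[OF ideal_image(1) coord_space_subspace subset_refl ideal_image(2)] dim_coord_space by metis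

text \<open>The dimensions of ideals are bounded by \<open>l\<close>, so among the proper ideals
  containing \<open>J\<close> there is one of largest dimension; it is maximal.\<close>

lemma proper_ideal_in_maximal:
  assumes "ideal J R" "J \<noteq> carrier R"
  shows "\<exists>I. maximalideal I R \<and> J \<subseteq> I"
proof -
  define P where "P I \<longleftrightarrow> ideal I R \<and> J \<subseteq> I \<and> I \<noteq> carrier R" for I
  have "P J" using assms by (simp add: P_def)
  moreover have "\<forall>I. P I \<longrightarrow> cv.dim (\<psi> ` I) \<le> l" using ideal_dim_le by (simp add: P_def)
  ultimately have "\<exists>I. P I \<and> (\<forall>I'. P I' \<longrightarrow> cv.dim (\<psi> ` I') \<le> cv.dim (\<psi> ` I))"
    by (intro ex_has_greatest_nat[of P J _ "Suc l"]) (auto simp: less_Suc_eq_le)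
  then obtain I where I: "P I" "\<forall>I'. P I' \<longrightarrow> cv.dim (\<psi> ` I') \<le> cv.dim (\<psi> ` I)" by (elim exE conjE)
  have "maximalideal I R"
  proof (rule maximalidealI)
    show "ideal I R" "carrier R \<noteq> I" using I(1) by (auto simp: P_def)
    fix K assume K: "ideal K R" "I \<subseteq> K" "K \<subseteq> carrier R"
    show "K = I \<or> K = carrier R"
    proof (rule ccontr)
      assume n: "\<not> ?thesis"
      then have "P K" using K I(1) by (auto simp: P_def)
      moreover have "I \<subset> K" using K n by blast
      ultimately have "cv.dim (\<psi> ` I) < cv.dim (\<psi> ` K)" using ideal_dim_less[of I K] K(1) I(1) by (simp add: P_def)
      moreover have "cv.dim (\<psi> ` K) \<le> cv.dim (\<psi> ` I)" using I(2) \<open>P K\<close> by (elim allE impE)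
      ultimately show False by simp
    qed
  qed
  then show ?thesis using I(1) by (auto simp: P_def)
qed

theorem local_ring_imp_local:
  assumes "local_ring R"
  shows "local_coord_algebra l cmul (\<psi> \<one>) \<and> \<psi> ` max_ideal R = Collect C.nil"
proof -
  have ex: "\<exists>!I. maximalideal I R" using assms by (simp add: local_ring_def)
  define I where "I = max_ideal R"
  have I: "maximalideal I R" unfolding I_def max_ideal_def using theI'[OF ex] .
  have I_unique: "K = I" if "maximalideal K R" for K using ex I that by blast
  interpret I: maximalideal I R by (rule I)
  have prime: "primeideal I R" by (rule A.maximalideal_prime[OF I])
  have IR: "r \<in> carrier R" if "r \<in> I" for r using that by (rule I.Icarr)
  have one: "\<one> \<notin> I" using I.I_notcarr I.one_imp_carrier by auto
  have memI: "r \<in> I" if "r \<in> carrier R" "\<psi> r \<in> \<psi> ` I" for r using that \<psi>_inj IR by (metis imageE)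
  interpret prime_in_coord_algebra l cmul "\<psi> \<one>" "\<psi> ` I"
  proof
    show "cv.subspace (\<psi> ` I)" "\<psi> ` I \<subseteq> coord_space l" using ideal_image[OF I.is_ideal] by blast+
    show "cmul u v \<in> \<psi> ` I" if "u \<in> \<psi> ` I" for u v
      using ideal_image(3)[OF I.is_ideal that, of v] C.mul_comm by simp
    show "\<psi> \<one> \<notin> \<psi> ` I" using one memI by blast
    show "u \<in> \<psi> ` I \<or> v \<in> \<psi> ` I" if uv: "u \<in> coord_space l" "v \<in> coord_space l" "cmul u v \<in> \<psi> ` I" for u v
    proof -
      have "cmul u v = \<psi> (\<chi> u \<otimes> \<chi> v)" using cmul_\<psi>[of "\<chi> u" "\<chi> v"] uv by simp
      then have "\<chi> u \<otimes> \<chi> v \<in> I"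
        using memI[OF A.m_closed[OF \<chi>_in[OF uv(1)] \<chi>_in[OF uv(2)]]] uv(3) by (simp only:)
      then have "\<chi> u \<in> I \<or> \<chi> v \<in> I" by (rule primeideal.I_prime[OF prime \<chi>_in[OF uv(1)] \<chi>_in[OF uv(2)]])
      then show ?thesis using uv by (metis \<psi>_\<chi> imageI)
    qed
    show "\<exists>w\<in>coord_space l. cmul u w = \<psi> \<one>" if u: "u \<in> coord_space l" "u \<notin> \<psi> ` I" for u
    proof -
      \<comment> \<open>The principal ideal of \<open>u\<close>. If proper, it would lie in the only
        maximal ideal, which does not contain \<open>u\<close>.\<close>
      define P where "P = range (\<lambda>v. cmul v u)"
      have "ideal (\<chi> ` P) R"
      proof (rule ideal_preimage)
        show "P \<subseteq> coord_space l" by (auto simp: P_def)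
        show "cv.subspace P"
          unfolding cv.subspace_def P_def
        proof (intro conjI ballI allI)
          show "0 \<in> range (\<lambda>v. cmul v u)" using C.mul_zero(1)[of u] by (intro range_eqI[of _ _ 0]) simp
          fix x assume "x \<in> range (\<lambda>v. cmul v u)"
          then obtain a where a: "x = cmul a u" by blast
          show "c *\<^sub>c x \<in> range (\<lambda>v. cmul v u)" for c
            unfolding a C.mul_smul_left[symmetric] by (rule rangeI)
          fix y assume "y \<in> range (\<lambda>v. cmul v u)"
          then obtain b where b: "y = cmul b u" by blast
          show "x + y \<in> range (\<lambda>v. cmul v u)"
            unfolding a b C.mul_add_left[symmetric] by (rule rangeI)
        qed
        show "cmul v x \<in> P" if "x \<in> P" for x v
          using that unfolding P_def by (elim rangeE) (simp add: C.mul_assoc[symmetric])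
      qed
      moreover have "u = cmul (\<psi> \<one>) u" using u(1) by simp
      then have "u \<in> P" unfolding P_def by blast
      then have "\<chi> u \<in> \<chi> ` P" by blast
      moreover have "\<chi> u \<notin> I" using u by (metis \<psi>_\<chi> imageI)
      ultimately have "\<chi> ` P = carrier R" using proper_ideal_in_maximal[of "\<chi> ` P"] I_unique by blast
      then obtain v where "\<one> = \<chi> (cmul v u)" unfolding P_def using A.one_closed by blast
      then have "\<psi> \<one> = cmul v u" by simp
      then have "cmul u (trunc l v) = \<psi> \<one>" using C.mul_trunc C.mul_comm by metis
      then show ?thesis using trunc_in by blast
    qed
  qed
  show ?thesis using local_from_prime M_eq_nil by (simp add: I_def)
qed

end

section \<open>Spans, independence and bases in coordinates\<close>

context coordinatized_algebra
begin

lemma \<psi>_smult_add: "r \<in> carrier R \<Longrightarrow> s \<in> carrier R \<Longrightarrow> \<psi> (c \<odot> r \<oplus> s) = c *\<^sub>c \<psi> r + \<psi> s"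
  by (simp add: \<psi>_add \<psi>_smult)

lemma \<psi>_finsum: "(\<And>i. i \<in> I \<Longrightarrow> f i \<in> carrier R) \<Longrightarrow> \<psi> (\<Oplus>i\<in>I. f i) = (\<Sum>i\<in>I. \<psi> (f i))"
proof (induction I rule: infinite_finite_induct)
  case (insert i I)
  then show ?case by (subst A.finsum_insert) (auto simp: \<psi>_add intro!: A.finsum_closed)
qed (simp_all add: \<psi>_zero)

lemma Span_carrier: "set Us \<subseteq> carrier R \<Longrightarrow> A.Span (scalars R) Us \<subseteq> carrier R"
proof (induction Us)
  case (Cons u Us)
  then have u: "u \<in> carrier R" by simp
  have "x \<in> carrier R" if "x \<in> A.line_extension (scalars R) u (A.Span (scalars R) Us)" for x
    using that Cons u unfolding line_extension_iff[OF u] by auto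
  then show ?case by auto
qed simp

lemma Span_iff:
  "set Us \<subseteq> carrier R \<Longrightarrow> x \<in> carrier R \<Longrightarrow>
    x \<in> A.Span (scalars R) Us \<longleftrightarrow> \<psi> x \<in> cv.span (\<psi> ` set Us)"
proof (induction Us arbitrary: x)
  case Nil
  then show ?case by (simp add: \<psi>_eq_0 cv.span_empty)
next
  case (Cons u Us)
  then have u: "u \<in> carrier R" and Us: "set Us \<subseteq> carrier R" by simp_all
  have SR: "A.Span (scalars R) Us \<subseteq> carrier R" by (rule Span_carrier[OF Us])
  have "x \<in> A.Span (scalars R) (u # Us) \<longleftrightarrow> (\<exists>c. \<exists>w\<in>A.Span (scalars R) Us. x = c \<odot> u \<oplus> w)"
    by (simp add: line_extension_iff[OF u])
  also have "\<dots> \<longleftrightarrow> (\<exists>c. \<psi> x - c *\<^sub>c \<psi> u \<in> cv.span (\<psi> ` set Us))"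
  proof (intro ex_cong1 iffI)
    fix c assume "\<exists>w\<in>A.Span (scalars R) Us. x = c \<odot> u \<oplus> w"
    then obtain w where w: "w \<in> A.Span (scalars R) Us" "x = c \<odot> u \<oplus> w" by blast
    then have wR: "w \<in> carrier R" using SR by blast
    have "\<psi> x - c *\<^sub>c \<psi> u = \<psi> w" unfolding w(2) \<psi>_smult_add[OF u wR] by simp
    then show "\<psi> x - c *\<^sub>c \<psi> u \<in> cv.span (\<psi> ` set Us)" using Cons.IH[OF Us wR] w(1) by simp
  next
    fix c assume d: "\<psi> x - c *\<^sub>c \<psi> u \<in> cv.span (\<psi> ` set Us)"
    have V: "\<psi> x - c *\<^sub>c \<psi> u \<in> coord_space l" using Cons.prems(2) u by (intro coord_space_closed \<psi>_in)
    define w where "w = \<chi> (\<psi> x - c *\<^sub>c \<psi> u)"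
    have w: "w \<in> carrier R" "\<psi> w = \<psi> x - c *\<^sub>c \<psi> u" unfolding w_def using \<chi>_in[OF V] \<psi>_\<chi>[OF V] by blast+
    have "w \<in> A.Span (scalars R) Us" using Cons.IH[OF Us w(1)] d w(2) by simp
    moreover have "\<psi> (c \<odot> u \<oplus> w) = \<psi> x" unfolding \<psi>_smult_add[OF u w(1)] w(2) by simp
    then have "x = c \<odot> u \<oplus> w" using \<psi>_inj[of x "c \<odot> u \<oplus> w"] Cons.prems(2) u w(1) by simp
    ultimately show "\<exists>w\<in>A.Span (scalars R) Us. x = c \<odot> u \<oplus> w" by blast
  qed
  finally show ?case by (simp add: cv.span_insert)
qed

lemma independent_iff:
  "set Us \<subseteq> carrier R \<Longrightarrow>
    A.independent (scalars R) Us \<longleftrightarrow> distinct (map \<psi> Us) \<and> cv.independent (\<psi> ` set Us)"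
proof (induction Us)
  case Nil
  then show ?case by (simp add: cv.independent_empty)
next
  case (Cons u Us)
  then have u: "u \<in> carrier R" and Us: "set Us \<subseteq> carrier R" by simp_all
  have "A.independent (scalars R) (u # Us) \<longleftrightarrow> u \<notin> A.Span (scalars R) Us \<and> A.independent (scalars R) Us"
    using A.independent_backwards A.li_Cons[OF u] by blast
  also have "\<dots> \<longleftrightarrow> \<psi> u \<notin> cv.span (\<psi> ` set Us) \<and> distinct (map \<psi> Us) \<and> cv.independent (\<psi> ` set Us)"
    using Span_iff[OF Us u] Cons.IH[OF Us] by simp
  finally show ?case using cv.span_base[of "\<psi> u" "\<psi> ` set Us"] by (auto simp: cv.independent_insert)
qed

lemma \<chi>_add: "u \<in> coord_space l \<Longrightarrow> w \<in> coord_space l \<Longrightarrow> \<chi> (u + w) = \<chi> u \<oplus> \<chi> w"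
  by (rule \<psi>_inj) (simp_all add: \<psi>_add coord_space_closed)

lemma \<chi>_smul: "u \<in> coord_space l \<Longrightarrow> \<chi> (c *\<^sub>c u) = c \<odot> \<chi> u"
  by (rule \<psi>_inj) (simp_all add: \<psi>_smult coord_space_closed)

lemma \<chi>_cmul: "u \<in> coord_space l \<Longrightarrow> w \<in> coord_space l \<Longrightarrow> \<chi> (cmul u w) = \<chi> u \<otimes> \<chi> w"
  using cmul_\<psi>[of "\<chi> u" "\<chi> w"] \<chi>_\<psi>[of "\<chi> u \<otimes> \<chi> w"] by simp

lemma \<chi>_bij: "bij_betw \<chi> (coord_space l) (carrier R)"
  unfolding \<chi>_def by (rule bij_betw_inv_into[OF \<psi>_bij])

lemma basis_list:
  assumes U: "cv.subspace U" "U \<subseteq> coord_space l"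
  shows "\<exists>S. set S \<subseteq> carrier R \<and> A.independent (scalars R) S \<and> A.Span (scalars R) S = \<chi> ` U"
proof -
  obtain B where B: "B \<subseteq> U" "finite B" "cv.independent B" "cv.span B = U" "card B = cv.dim U" "card B \<le> l"
    using subspace_basis[OF U] .
  obtain xs where xs: "set xs = B" "distinct xs" using finite_distinct_list[OF B(2)] by blast
  define S where "S = map \<chi> xs"
  have xsV: "x \<in> coord_space l" if "x \<in> set xs" for x using that xs B(1) U(2) by blast
  have S: "set S \<subseteq> carrier R" using xsV \<chi>_in by (auto simp: S_def)
  have map: "map \<psi> S = xs" unfolding S_def map_map by (rule map_idI) (use xsV in simp)
  then have img: "\<psi> ` set S = B" using xs(1) by (metis list.set_map)
  have "A.independent (scalars R) S" unfolding independent_iff[OF S] map img using xs B by blast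
  moreover have "A.Span (scalars R) S = \<chi> ` U"
  proof (intro Set.set_eqI iffI)
    fix x assume x: "x \<in> A.Span (scalars R) S"
    then have "x \<in> carrier R" using Span_carrier[OF S] by blast
    then show "x \<in> \<chi> ` U" using x Span_iff[OF S] img B(4) by (metis \<chi>_\<psi> imageI)
  next
    fix x assume "x \<in> \<chi> ` U"
    then obtain u where u: "u \<in> U" "x = \<chi> u" by blast
    then have uV: "u \<in> coord_space l" using U(2) by blast
    show "x \<in> A.Span (scalars R) S"
      unfolding u(2) Span_iff[OF S \<chi>_in[OF uV]] \<psi>_\<chi>[OF uV] img B(4) by (rule u(1))
  qed
  ultimately show ?thesis using S by blast
qed

lemma finite_dimensional: "A.finite_dimension (scalars R) (carrier R)"
proof -
  obtain S where "A.independent (scalars R) S" "A.Span (scalars R) S = \<chi> ` coord_space l"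
    using basis_list[OF coord_space_subspace subset_refl] by blast
  moreover have "\<chi> ` coord_space l = carrier R"
  proof (intro equalityI subsetI)
    fix r assume "r \<in> carrier R"
    then show "r \<in> \<chi> ` coord_space l" using \<chi>_\<psi>[of r] \<psi>_in[of r] by (metis imageI)
  qed (use \<chi>_in in blast)
  ultimately show ?thesis using A.dimension_independent[of "scalars R" S] by (auto simp: A.finite_dimension_def)
qed

end

text \<open>Locality is assumed for the algebra in coordinates; that the ring itself is local,
  Artinian and of length \<open>Suc n\<close> is derived, so that algebras constructed in
  coordinates qualify.\<close>

locale local_algebra_coords = coordinatized_algebra R "Suc n" \<psi>
  for R :: "(Qbar, 'a) module" (structure) and n \<psi> +
  assumes local_coords: "local_coord_algebra (Suc n) cmul (\<psi> \<one>)"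
begin

sublocale L: local_coord_algebra "Suc n" cmul "\<psi> \<one>" by (rule local_coords)

lemma nil_ideal: "ideal (\<chi> ` Collect C.nil) R"
  by (rule ideal_preimage[OF C.nil_subspace]) (use C.nil_in C.nil_mul in blast)+

lemma proper_ideal_nil: assumes "ideal K R" "K \<noteq> carrier R" shows "K \<subseteq> \<chi> ` Collect C.nil"
proof
  interpret K: ideal K R by (rule assms)
  fix r assume r: "r \<in> K"
  have rR: "r \<in> carrier R" by (rule K.Icarr[OF r])
  have "C.nil (\<psi> r)"
  proof (rule ccontr)
    assume "\<not> C.nil (\<psi> r)"
    then obtain w where w: "w \<in> coord_space (Suc n)" "cmul (\<psi> r) w = \<psi> \<one>"
      using L.inverse_exists[OF \<psi>_in[OF rR]] by blast
    have "\<psi> (r \<otimes> \<chi> w) = \<psi> \<one>" using cmul_\<psi>[OF rR \<chi>_in[OF w(1)]] w \<psi>_\<chi>[OF w(1)] by simp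
    then have "r \<otimes> \<chi> w = \<one>" using \<psi>_inj[of "r \<otimes> \<chi> w" \<one>] rR \<chi>_in[OF w(1)] by simp
    then have "\<one> \<in> K" using K.I_r_closed[OF r \<chi>_in[OF w(1)]] by simp
    then show False using K.one_imp_carrier assms(2) by blast
  qed
  then show "r \<in> \<chi> ` Collect C.nil" using \<chi>_\<psi>[OF rR] by (metis imageI mem_Collect_eq)
qed

lemma nil_proper: "\<chi> ` Collect C.nil \<noteq> carrier R"
proof
  assume "\<chi> ` Collect C.nil = carrier R"
  then obtain u where u: "C.nil u" "\<one> = \<chi> u" using A.one_closed by blast
  then show False using L.not_nil_unit \<psi>_\<chi>[OF C.nil_in[OF u(1)]] by simp
qed

lemma local_ring: "local_ring R"
  unfolding local_ring_def
proof (intro conjI ex1I)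
  show "cring R" by (rule algebra.axioms(2)[OF alg])
  show "maximalideal (\<chi> ` Collect C.nil) R"
  proof (rule maximalidealI)
    show "ideal (\<chi> ` Collect C.nil) R" by (rule nil_ideal)
    show "carrier R \<noteq> \<chi> ` Collect C.nil" using nil_proper by blast
    show "K = \<chi> ` Collect C.nil \<or> K = carrier R" if "ideal K R" "\<chi> ` Collect C.nil \<subseteq> K" "K \<subseteq> carrier R" for K
      using that proper_ideal_nil by blast
  qed
  fix K assume "maximalideal K R"
  then interpret K: maximalideal K R .
  have "K \<subseteq> \<chi> ` Collect C.nil" using proper_ideal_nil[OF K.is_ideal] K.I_notcarr by blast
  moreover have "\<chi> ` Collect C.nil \<subseteq> carrier R" using C.nil_in \<chi>_in by blast
  ultimately show "K = \<chi> ` Collect C.nil" using K.I_maximal[OF nil_ideal] nil_proper by blast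
qed

lemma max_ideal_image: "\<psi> ` max_ideal R = Collect C.nil"
  using local_ring_imp_local[OF local_ring] by blast

lemma max_ideal_eq: "max_ideal R = \<chi> ` Collect C.nil"
proof -
  have "maximalideal (max_ideal R) R"
    unfolding max_ideal_def by (rule theI') (use local_ring in \<open>simp add: local_ring_def\<close>)
  then interpret I: maximalideal "max_ideal R" R .
  have "\<chi> ` \<psi> ` max_ideal R = max_ideal R"
    unfolding image_image using I.Icarr by (intro Set.set_eqI) (auto simp: image_iff intro!: bexI)
  then show ?thesis using max_ideal_image by simp
qed

lemma artinian: "artinian R"
  unfolding artinian_def
proof
  assume "\<exists>I :: nat \<Rightarrow> 'a set. \<forall>n. ideal (I n) R \<and> I (Suc n) \<subset> I n"
  then obtain I where I: "\<And>n. ideal (I n) R" "\<And>n. I (Suc n) \<subset> I n" by blast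
  have "(cv.dim (\<psi> ` I (Suc i)), cv.dim (\<psi> ` I i)) \<in> less_than" for i
    using ideal_dim_less[OF I(1) I(1) I(2)] by simp
  then have "\<exists>f. \<forall>i. (f (Suc i), f i) \<in> less_than"
    by (intro exI[of _ "\<lambda>i. cv.dim (\<psi> ` I i)"]) blast
  then show False using wf_less_than unfolding wf_iff_no_infinite_down_chain by blast
qed

text \<open>Strict inclusions of ideals raise the dimension, which bounds chains from above; the
  composition series in coordinates attains the bound.\<close>

lemma ring_length: "ring_length R = enat (Suc n)"
  unfolding ring_length_def
proof (rule antisym)
  show "Sup {enat k | k. \<exists>I :: nat \<Rightarrow> 'a set. (\<forall>i\<le>k. ideal (I i) R) \<and> (\<forall>i<k. I i \<subset> I (Suc i))} \<le> enat (Suc n)"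
  proof (rule Sup_least)
    fix x assume "x \<in> {enat k | k. \<exists>I :: nat \<Rightarrow> 'a set. (\<forall>i\<le>k. ideal (I i) R) \<and> (\<forall>i<k. I i \<subset> I (Suc i))}"
    then obtain k I where x: "x = enat k" and I: "\<And>i. i \<le> k \<Longrightarrow> ideal (I i) R" "\<And>i. i < k \<Longrightarrow> I i \<subset> I (Suc i)"
      by blast
    have "i \<le> k \<Longrightarrow> i \<le> cv.dim (\<psi> ` I i)" for i
    proof (induction i)
      case (Suc i)
      then have i: "i < k" "i \<le> k" by simp_all
      have "cv.dim (\<psi> ` I i) < cv.dim (\<psi> ` I (Suc i))"
        by (rule ideal_dim_less[OF I(1)[OF i(2)] I(1)[OF Suc.prems] I(2)[OF i(1)]])
      then show ?case using Suc.IH[OF i(2)] by linarith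
    qed simp
    from this[of k] show "x \<le> enat (Suc n)" using ideal_dim_le[OF I(1)[of k]] x by simp
  qed
  obtain U where "\<forall>i\<le>Suc n. L.mul_ideal (U i) \<and> (i < Suc n \<longrightarrow> U i \<subset> U (Suc i))"
    using L.mul_ideal_chain by (elim exE)
  then have U: "\<And>i. i \<le> Suc n \<Longrightarrow> L.mul_ideal (U i)" "\<And>i. i < Suc n \<Longrightarrow> U i \<subset> U (Suc i)" by simp_all
  have inj: "inj_on \<chi> W" if "W \<subseteq> coord_space (Suc n)" for W
    by (rule inj_onI) (use that \<psi>_\<chi> in \<open>metis subsetD\<close>)
  have "ideal (\<chi> ` U i) R" if "i \<le> Suc n" for i
    using U(1)[OF that] unfolding L.mul_ideal_def by (intro ideal_preimage) blast+
  moreover have "\<chi> ` U i \<subset> \<chi> ` U (Suc i)" if "i < Suc n" for i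
    using U(2)[OF that] inj U(1)[of "Suc i"] that by (intro image_strict_mono) (auto simp: L.mul_ideal_def)
  ultimately show "enat (Suc n) \<le> Sup {enat k | k. \<exists>I :: nat \<Rightarrow> 'a set. (\<forall>i\<le>k. ideal (I i) R) \<and> (\<forall>i<k. I i \<subset> I (Suc i))}"
    by (intro Sup_upper CollectI exI[of _ "Suc n"] conjI refl exI[of _ "\<lambda>i. \<chi> ` U i"]) blast+
qed

lemma artinian_local: "R \<in> artinian_local_algebras (Suc n)"
  unfolding artinian_local_algebras_def
  using alg artinian local_ring finite_dimensional ring_length by blast

lemma max_ideal_basis_exists: "\<exists>S. max_ideal_basis R S"
  using basis_list[OF C.nil_subspace] C.nil_in unfolding max_ideal_basis_def max_ideal_eq by blast

context
  fixes S assumes S: "max_ideal_basis R S"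
begin

lemma max_ideal_basis_facts:
  shows "set S \<subseteq> carrier R" "distinct (map \<psi> S)" "cv.independent (\<psi> ` set S)"
    "cv.span (\<psi> ` set S) = Collect C.nil" "length S = n"
proof -
  have ind: "A.independent (scalars R) S" and Sp: "A.Span (scalars R) S = max_ideal R"
    using S by (auto simp: max_ideal_basis_def)
  have "A.independent (scalars R) Us \<Longrightarrow> set Us \<subseteq> carrier R" for Us
    by (induction Us) (use A.independent_backwards in auto)
  then show SR: "set S \<subseteq> carrier R" using ind .
  then show d: "distinct (map \<psi> S)" "cv.independent (\<psi> ` set S)" using independent_iff ind by blast+
  have sub: "\<psi> ` set S \<subseteq> coord_space (Suc n)" using SR by auto
  have mem: "v \<in> cv.span (\<psi> ` set S) \<longleftrightarrow> C.nil v" if v: "v \<in> coord_space (Suc n)" for v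
  proof -
    have "v \<in> cv.span (\<psi> ` set S) \<longleftrightarrow> \<chi> v \<in> max_ideal R"
      using Span_iff[OF SR \<chi>_in[OF v]] v Sp by simp
    also have "\<dots> \<longleftrightarrow> C.nil v"
    proof
      assume "\<chi> v \<in> max_ideal R"
      then have "\<psi> (\<chi> v) \<in> Collect C.nil" using max_ideal_image by blast
      then show "C.nil v" using v by simp
    qed (simp add: max_ideal_eq)
    finally show ?thesis .
  qed
  have "cv.span (\<psi> ` set S) \<subseteq> coord_space (Suc n)" by (rule cv.span_minimal[OF sub coord_space_subspace])
  then show sp: "cv.span (\<psi> ` set S) = Collect C.nil" using mem C.nil_in by blast
  have "cv.dim (Collect C.nil) = card (\<psi> ` set S)"
    using sp d by (intro cv.dim_eq_card) (simp_all add: sp[symmetric] cv.span_span)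
  then have "n = card (set (map \<psi> S))" using L.dim_nil by simp
  then show "length S = n" using distinct_card[OF d(1)] by simp
qed

lemma image_nth: "(\<lambda>i. \<psi> (S ! i)) ` {..<n} = \<psi> ` set S"
  using max_ideal_basis_facts(5) by (auto simp: set_conv_nth)

lemma inj_nth: "inj_on (\<lambda>i. \<psi> (S ! i)) {..<n}"
  using max_ideal_basis_facts(2,5) by (auto simp: inj_on_def distinct_conv_nth)

lemma based: "based_coord_algebra n cmul (\<psi> \<one>) (\<lambda>i. \<psi> (S ! i))"
proof (intro based_coord_algebra.intro local_coords based_coord_algebra_axioms.intro)
  show "C.nil (\<psi> (S ! i))" if "i < n" for i
    using cv.span_base[of "\<psi> (S ! i)" "\<psi> ` set S"] image_nth that max_ideal_basis_facts(4) by auto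
  show "\<exists>x. s = (\<Sum>i<n. x i *\<^sub>c \<psi> (S ! i))" if "C.nil s" for s
    using span_family[OF _ inj_nth] that max_ideal_basis_facts(4) image_nth by simp
  show "\<forall>i<n. x i = 0" if "(\<Sum>i<n. x i *\<^sub>c \<psi> (S ! i)) = 0" for x
  proof (intro allI impI)
    fix i assume i: "i < n"
    let ?g = "the_inv_into {..<n} (\<lambda>i. \<psi> (S ! i))"
    have g: "?g (\<psi> (S ! j)) = j" if "j < n" for j
      using the_inv_into_f_f[OF inj_nth, of j] that by simp
    have "(\<Sum>b\<in>\<psi> ` set S. x (?g b) *\<^sub>c b) = (\<Sum>j<n. x (?g (\<psi> (S ! j))) *\<^sub>c \<psi> (S ! j))"
      unfolding image_nth[symmetric] by (rule sum.reindex_cong[OF inj_nth]) simp_all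
    also have "\<dots> = 0" using g \<open>_ = 0\<close> by simp
    finally have "x (?g b) = 0" if "b \<in> \<psi> ` set S" for b
      using cv.independentD[OF max_ideal_basis_facts(3) _ subset_refl] that by simp
    then have "x (?g (\<psi> (S ! i))) = 0" using image_nth i by blast
    then show "x i = 0" using g i by simp
  qed
qed

text \<open>The agreement is restricted to genuine points \<open>L\<close>, because outside the
  coordinate space \<open>inv_into\<close> has no prescribed value;
  \<open>Ga_structures_cong\<close> bridges the difference.\<close>

lemma exp_action_eq_eact:
  assumes L: "L \<in> proj_points n"
  shows "exp_action R S \<psi> x L = based_coord_algebra.eact n cmul (\<psi> \<one>) (\<lambda>i. \<psi> (S ! i)) x L"
proof -
  interpret B: based_coord_algebra n cmul "\<psi> \<one>" "\<lambda>i. \<psi> (S ! i)" by (rule based)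
  define s where "s = (\<Oplus>i\<in>{..<length S}. x i \<odot> S ! i)"
  have SR: "S ! i \<in> carrier R" if "i < length S" for i using max_ideal_basis_facts(1) that nth_mem by blast
  have s: "s \<in> carrier R" unfolding s_def using SR by (intro A.finsum_closed) auto
  have \<psi>s: "\<psi> s = B.comb x"
    unfolding s_def B.comb_def using SR max_ideal_basis_facts(5) by (subst \<psi>_finsum) (auto simp: \<psi>_smult)
  have pow: "\<psi> (s [^] k) = C.pw (B.comb x) k" for k :: nat using \<psi>_pow[OF s] \<psi>s by simp
  have eq: "s [^] k \<noteq> \<zero> \<longleftrightarrow> C.pw (B.comb x) k \<noteq> 0" for k :: nat
    using \<psi>_eq_0[of "s [^] k"] s pow by simp
  have E: "nilpotent_exp R s \<in> carrier R" unfolding nilpotent_exp_def using s by (intro A.finsum_closed) auto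
  have \<psi>E: "\<psi> (nilpotent_exp R s) = C.nexp (B.comb x)"
    unfolding nilpotent_exp_def C.nexp_def C.dp_def eq using s pow
    by (subst \<psi>_finsum) (simp_all add: \<psi>_smult)
  have "\<psi> (nilpotent_exp R s \<otimes> \<chi> v) = cmul (C.nexp (B.comb x)) v" if "v \<in> coord_space (Suc n)" for v
    using cmul_\<psi>[OF E \<chi>_in[OF that]] \<psi>E \<psi>_\<chi>[OF that] by simp
  moreover have "L \<subseteq> coord_space (Suc n)"
    using L by (auto simp: proj_points_def line_def coord_space_def)
  ultimately show ?thesis unfolding exp_action_def B.eact_def s_def[symmetric] \<chi>_def[symmetric]
    by (intro image_cong refl) blast
qed

end

end

text \<open>For such an algebra the length equals the dimension, so the number of linear coordinates
  is forced to be the length.\<close>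

lemma artinian_local_coords:
  assumes "R \<in> artinian_local_algebras (Suc n)" "linear_coords l R \<psi>"
  shows "l = Suc n \<and> local_algebra_coords R n \<psi>"
proof -
  have alg: "algebra (ring_of_type_algebra :: Qbar ring) R" and loc: "local_ring R"
    and len: "ring_length R = enat (Suc n)"
    using assms(1) by (auto simp: artinian_local_algebras_def)
  interpret coordinatized_algebra R l \<psi>
    by (intro coordinatized_algebra.intro qbar_algebra.intro coordinatized_algebra_axioms.intro alg assms(2))
  have L: "local_coord_algebra l cmul (\<psi> \<one>\<^bsub>R\<^esub>)" using local_ring_imp_local[OF loc] by blast
  then have "l > 0" by (rule local_coord_algebra.l_pos)
  then obtain m where m: "l = Suc m" by (cases l) auto
  have lac: "local_algebra_coords R m \<psi>"
    using coordinatized_algebra_axioms L unfolding m local_algebra_coords_def local_algebra_coords_axioms_def by blast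
  then have "ring_length R = enat (Suc m)" by (rule local_algebra_coords.ring_length)
  then show ?thesis using len m lac by simp
qed

lemma artinian_local_coords_exist:
  assumes "R \<in> artinian_local_algebras (Suc n)"
  shows "\<exists>\<psi>. linear_coords (Suc n) R \<psi>"
proof -
  have alg: "algebra (ring_of_type_algebra :: Qbar ring) R" and fd: "ring.finite_dimension R (scalars R) (carrier R)"
    using assms by (auto simp: artinian_local_algebras_def)
  interpret qbar_algebra R by (rule qbar_algebra.intro[OF alg])
  obtain d \<psi> where "linear_coords d R \<psi>" using finite_dimension_imp_coords[OF fd] by blast
  then show ?thesis using artinian_local_coords[OF assms] by blast
qed

section \<open>The correspondence\<close>

lemma algebra_iso_rel_iff:
  assumes A: "local_algebra_coords R n \<psi>" and A': "local_algebra_coords R' n \<psi>'"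
  shows "(R, R') \<in> algebra_iso_rel (Suc n) \<longleftrightarrow>
    (\<exists>h. coord_algebra_iso (Suc n) (coordinatized_algebra.cmul R (Suc n) \<psi>) (\<psi> \<one>\<^bsub>R\<^esub>)
      (coordinatized_algebra.cmul R' (Suc n) \<psi>') (\<psi>' \<one>\<^bsub>R'\<^esub>) h)"
proof -
  interpret P: local_algebra_coords R n \<psi> by (rule A)
  interpret Q: local_algebra_coords R' n \<psi>' by (rule A')
  let ?V = "coord_space (Suc n)"
  show ?thesis
  proof
    assume "(R, R') \<in> algebra_iso_rel (Suc n)"
    then obtain f where f: "f \<in> ring_iso R R'" and fs: "\<And>c r. r \<in> carrier R \<Longrightarrow> f (c \<odot>\<^bsub>R\<^esub> r) = c \<odot>\<^bsub>R'\<^esub> f r"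
      by (auto simp: algebra_iso_rel_def)
    have fh: "f \<in> ring_hom R R'" and fb: "bij_betw f (carrier R) (carrier R')" using f by (auto simp: ring_iso_def)
    note fc = ring_hom_closed[OF fh] and fm = ring_hom_mult[OF fh] and fa = ring_hom_add[OF fh] and f1 = ring_hom_one[OF fh]
    define h where "h u = \<psi>' (f (P.\<chi> u))" for u
    have "linear_on (Suc n) h"
      unfolding linear_on_def h_def
      by (simp add: P.\<chi>_add P.\<chi>_smul fa fs fc Q.\<psi>_add Q.\<psi>_smult)
    moreover have "bij_betw h ?V ?V"
      unfolding h_def using bij_betw_trans[OF bij_betw_trans[OF P.\<chi>_bij fb] Q.\<psi>_bij] by (simp add: comp_def)
    moreover have "h (P.cmul u v) = Q.cmul (h u) (h v)" if "u \<in> ?V" "v \<in> ?V" for u v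
      using that by (simp add: h_def P.\<chi>_cmul fm fc Q.cmul_\<psi>)
    moreover have "h (\<psi> \<one>\<^bsub>R\<^esub>) = \<psi>' \<one>\<^bsub>R'\<^esub>" by (simp add: h_def f1)
    ultimately show "\<exists>h. coord_algebra_iso (Suc n) P.cmul (\<psi> \<one>\<^bsub>R\<^esub>) Q.cmul (\<psi>' \<one>\<^bsub>R'\<^esub>) h"
      unfolding coord_algebra_iso_def by blast
  next
    assume "\<exists>h. coord_algebra_iso (Suc n) P.cmul (\<psi> \<one>\<^bsub>R\<^esub>) Q.cmul (\<psi>' \<one>\<^bsub>R'\<^esub>) h"
    then obtain h where lin: "linear_on (Suc n) h" and hb: "bij_betw h ?V ?V"
      and hm: "\<And>u v. u \<in> ?V \<Longrightarrow> v \<in> ?V \<Longrightarrow> h (P.cmul u v) = Q.cmul (h u) (h v)" and h1: "h (\<psi> \<one>\<^bsub>R\<^esub>) = \<psi>' \<one>\<^bsub>R'\<^esub>"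
      by (auto simp: coord_algebra_iso_def)
    have hin: "h u \<in> ?V" if "u \<in> ?V" for u using hb that by (auto simp: bij_betw_def)
    define f where "f r = Q.\<chi> (h (\<psi> r))" for r
    have "f \<in> ring_hom R R'"
    proof (rule ring_hom_memI)
      show "f r \<in> carrier R'" if "r \<in> carrier R" for r using that by (simp add: f_def hin)
      show "f (r \<otimes>\<^bsub>R\<^esub> s) = f r \<otimes>\<^bsub>R'\<^esub> f s" if "r \<in> carrier R" "s \<in> carrier R" for r s
        using that unfolding f_def P.cmul_\<psi>[OF that, symmetric] by (simp add: hm hin Q.\<chi>_cmul)
      show "f (r \<oplus>\<^bsub>R\<^esub> s) = f r \<oplus>\<^bsub>R'\<^esub> f s" if "r \<in> carrier R" "s \<in> carrier R" for r s
        using that by (simp add: f_def P.\<psi>_add linear_onD(1)[OF lin] hin Q.\<chi>_add)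
      show "f \<one>\<^bsub>R\<^esub> = \<one>\<^bsub>R'\<^esub>" by (simp add: f_def h1)
    qed
    moreover have "bij_betw f (carrier R) (carrier R')"
      unfolding f_def using bij_betw_trans[OF bij_betw_trans[OF P.\<psi>_bij hb] Q.\<chi>_bij] by (simp add: comp_def)
    moreover have "f (c \<odot>\<^bsub>R\<^esub> r) = c \<odot>\<^bsub>R'\<^esub> f r" if "r \<in> carrier R" for c r
      using that by (simp add: f_def P.\<psi>_smult linear_onD(2)[OF lin] hin Q.\<chi>_smul)
    ultimately show "(R, R') \<in> algebra_iso_rel (Suc n)"
      unfolding algebra_iso_rel_def ring_iso_def using P.artinian_local Q.artinian_local by blast
  qed
qed

lemma coord_variety_regular_cong:
  assumes r: "regular (coord_variety P reps H) U f" and eq: "\<And>p. p \<in> U \<Longrightarrow> g p = f p"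
  shows "regular (coord_variety P reps H) U g"
proof -
  have "\<exists>W d a b. coord_open P reps H W \<and> p \<in> W \<and> W \<subseteq> U \<and> a \<in> H d \<and> b \<in> H d \<and>
      (\<forall>q\<in>W. \<forall>v\<in>reps q. b v \<noteq> 0 \<and> g q = a v / b v)" if p: "p \<in> U" for p
  proof -
    obtain W d a b where W: "coord_open P reps H W" "p \<in> W" "W \<subseteq> U" and ab: "a \<in> H d" "b \<in> H d"
      and q: "\<forall>q\<in>W. \<forall>v\<in>reps q. b v \<noteq> 0 \<and> f q = a v / b v"
      using r p unfolding coord_variety_def variety.simps by blast
    have "\<forall>q\<in>W. \<forall>v\<in>reps q. b v \<noteq> 0 \<and> g q = a v / b v" using q eq W(3) by (metis subsetD)
    then show ?thesis using W ab by blast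
  qed
  then show ?thesis unfolding coord_variety_def variety.simps by blast
qed

text \<open>Values of an action off its domain are arbitrary, so actions agreeing on the domain have
  to be interchangeable. For the equivalence, maps \<open>\<alpha>\<close> and \<open>j\<close>
  witnessing reflexivity are reused; they stay inside the domain.\<close>

lemma Ga_structures_cong:
  assumes act: "act \<in> Ga_structures m n"
    and eq: "\<And>x L. x \<in> coord_space m \<Longrightarrow> L \<in> proj_points n \<Longrightarrow> act' x L = act x L"
  shows "act' \<in> Ga_structures m n" "(act, act') \<in> Ga_equiv m n"
proof -
  let ?P = "coord_space m \<times> proj_points n" let ?M = "affine_proj m n"
  have PM: "points ?M = ?P" "points (proj n) = proj_points n" by (simp_all add: affine_proj_def proj_def coord_variety_def)
  have 0: "(\<lambda>_. 0) \<in> coord_space m" by (simp add: coord_space_def)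
  have mor: "morphism ?M (proj n) (\<lambda>(x, L). act x L)" and neutral: "\<forall>L\<in>proj_points n. act (\<lambda>_. 0) L = L"
    and add: "\<forall>x\<in>coord_space m. \<forall>y\<in>coord_space m. \<forall>L\<in>proj_points n. act (vadd x y) L = act x (act y L)"
    and stab: "generically (proj n) (\<lambda>L. {x \<in> coord_space m. act x L = L} = {\<lambda>_. 0})"
    and dense: "generically (proj n) (\<lambda>L. dense_in (proj n) ((\<lambda>x. act x L) ` coord_space m))"
    using act unfolding Ga_structures_def PM by blast+
  have act_in: "act x L \<in> proj_points n" if "x \<in> coord_space m" "L \<in> proj_points n" for x L
    using mor that unfolding morphism_def PM by auto
  have eqP: "(case p of (x, L) \<Rightarrow> act' x L) = (case p of (x, L) \<Rightarrow> act x L)" if "p \<in> ?P" for p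
    using that eq by auto
  have pre: "{p \<in> ?P. (case p of (x, L) \<Rightarrow> act' x L) \<in> V} = {p \<in> ?P. (case p of (x, L) \<Rightarrow> act x L) \<in> V}" for V
    using eqP by auto
  have mor': "morphism ?M (proj n) (\<lambda>(x, L). act' x L)"
    unfolding morphism_def PM pre
  proof (intro conjI allI impI)
    show "(\<lambda>(x, L). act' x L) ` ?P \<subseteq> proj_points n" using eq act_in by auto
    fix V assume V: "zopen (proj n) V"
    show "zopen ?M {p \<in> ?P. (case p of (x, L) \<Rightarrow> act x L) \<in> V}"
      using mor V unfolding morphism_def PM by blast
    fix f assume "regular (proj n) V f"
    then have "regular ?M {p \<in> ?P. (case p of (x, L) \<Rightarrow> act x L) \<in> V} (\<lambda>p. f (case p of (x, L) \<Rightarrow> act x L))"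
      using mor V unfolding morphism_def PM by blast
    then show "regular ?M {p \<in> ?P. (case p of (x, L) \<Rightarrow> act x L) \<in> V} (\<lambda>p. f (case p of (x, L) \<Rightarrow> act' x L))"
      unfolding affine_proj_def by (rule coord_variety_regular_cong) (use eqP in auto)
  qed
  have gen: "generically (proj n) P'" if "generically (proj n) P" "\<And>L. L \<in> proj_points n \<Longrightarrow> P L \<Longrightarrow> P' L" for P P'
    using that zopen_subset_proj[of n] unfolding generically_def PM by blast
  have "generically (proj n) (\<lambda>L. {x \<in> coord_space m. act' x L = L} = {\<lambda>_. 0})"
  proof (rule gen[OF stab])
    fix L assume L: "L \<in> proj_points n" and s: "{x \<in> coord_space m. act x L = L} = {\<lambda>_. 0}"
    have "{x \<in> coord_space m. act' x L = L} = {x \<in> coord_space m. act x L = L}" using eq L by auto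
    then show "{x \<in> coord_space m. act' x L = L} = {\<lambda>_. 0}" using s by simp
  qed
  moreover have "generically (proj n) (\<lambda>L. dense_in (proj n) ((\<lambda>x. act' x L) ` coord_space m))"
  proof (rule gen[OF dense])
    fix L assume L: "L \<in> proj_points n" and s: "dense_in (proj n) ((\<lambda>x. act x L) ` coord_space m)"
    have "(\<lambda>x. act' x L) ` coord_space m = (\<lambda>x. act x L) ` coord_space m" by (rule image_cong) (use eq L in auto)
    then show "dense_in (proj n) ((\<lambda>x. act' x L) ` coord_space m)" using s by simp
  qed
  moreover have "\<forall>L\<in>proj_points n. act' (\<lambda>_. 0) L = L" using eq[OF 0] neutral by simp
  moreover have "act' (vadd x y) L = act' x (act' y L)"
    if "x \<in> coord_space m" "y \<in> coord_space m" "L \<in> proj_points n" for x y L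
  proof -
    have "vadd x y \<in> coord_space m" using that by (simp add: coord_space_def)
    then show ?thesis using that eq act_in add by simp
  qed
  ultimately show act': "act' \<in> Ga_structures m n"
    unfolding Ga_structures_def PM using mor' by blast
  have "(act, act) \<in> Ga_equiv m n" using equiv_Ga act by (meson equivE refl_onD)
  then obtain \<alpha> j where \<alpha>: "Ga_aut m \<alpha>" and j: "variety_iso (proj n) (proj n) j"
    and e: "\<And>x L. x \<in> coord_space m \<Longrightarrow> L \<in> proj_points n \<Longrightarrow> j (act x L) = act (\<alpha> x) (j L)"
    unfolding Ga_equiv_def PM by blast
  have "\<alpha> x \<in> coord_space m" if "x \<in> coord_space m" for x
    using \<alpha> that by (auto simp: Ga_aut_def variety_iso_def morphism_def points_affine)
  moreover have "j L \<in> proj_points n" if "L \<in> proj_points n" for L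
  proof -
    have "j ` points (proj n) \<subseteq> points (proj n)" using j by (simp add: variety_iso_def morphism_def)
    then show ?thesis using that by (auto simp: PM)
  qed
  ultimately have "\<forall>x\<in>coord_space m. \<forall>L\<in>proj_points n. j (act x L) = act' (\<alpha> x) (j L)"
    using e eq by simp
  then have "\<exists>\<alpha> j. Ga_aut m \<alpha> \<and> variety_iso (proj n) (proj n) j \<and>
      (\<forall>x\<in>coord_space m. \<forall>L\<in>proj_points n. j (act x L) = act' (\<alpha> x) (j L))"
    using \<alpha> j by (rule_tac exI[of _ \<alpha>], rule_tac exI[of _ j], intro conjI)
  then show "(act, act') \<in> Ga_equiv m n" unfolding Ga_equiv_def PM using act act' by simp
qed

lemma exp_action_structure:
  assumes A: "local_algebra_coords R n \<psi>" and S: "max_ideal_basis R S"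
  shows "exp_action R S \<psi> \<in> Ga_structures n n"
    "(based_coord_algebra.eact n (coordinatized_algebra.cmul R (Suc n) \<psi>) (\<psi> \<one>\<^bsub>R\<^esub>) (\<lambda>i. \<psi> (S ! i)),
      exp_action R S \<psi>) \<in> Ga_equiv n n"
proof -
  interpret P: local_algebra_coords R n \<psi> by (rule A)
  note act = based_coord_algebra.eact_structure[OF P.based[OF S]] and eq = P.exp_action_eq_eact[OF S]
  show "exp_action R S \<psi> \<in> Ga_structures n n" by (rule Ga_structures_cong(1)[OF act eq])
  show "(based_coord_algebra.eact n P.cmul (\<psi> \<one>\<^bsub>R\<^esub>) (\<lambda>i. \<psi> (S ! i)), exp_action R S \<psi>) \<in> Ga_equiv n n"
    by (rule Ga_structures_cong(2)[OF act eq])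
qed

text \<open>The bases and the coordinates are arbitrary on both sides. With \<open>R = R'\<close>
  this gives independence of these choices; in general it gives both well-definedness and
  injectivity of the correspondence.\<close>

lemma exp_action_equiv_iff:
  assumes A: "local_algebra_coords R n \<psi>" "max_ideal_basis R S"
    and A': "local_algebra_coords R' n \<psi>'" "max_ideal_basis R' S'"
  shows "(exp_action R S \<psi>, exp_action R' S' \<psi>') \<in> Ga_equiv n n \<longleftrightarrow> (R, R') \<in> algebra_iso_rel (Suc n)"
proof -
  interpret P: local_algebra_coords R n \<psi> by (rule A)
  interpret Q: local_algebra_coords R' n \<psi>' by (rule A')
  let ?a = "based_coord_algebra.eact n P.cmul (\<psi> \<one>\<^bsub>R\<^esub>) (\<lambda>i. \<psi> (S ! i))"
  let ?b = "based_coord_algebra.eact n Q.cmul (\<psi>' \<one>\<^bsub>R'\<^esub>) (\<lambda>i. \<psi>' (S' ! i))"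
  have sym: "sym (Ga_equiv n n)" and trans: "trans (Ga_equiv n n)" using equiv_Ga by (auto elim: equivE)
  note a = exp_action_structure(2)[OF A] and b = exp_action_structure(2)[OF A']
  have "(exp_action R S \<psi>, exp_action R' S' \<psi>') \<in> Ga_equiv n n \<longleftrightarrow> (?a, ?b) \<in> Ga_equiv n n"
    using a b symD[OF sym a] symD[OF sym b] by (meson trans transD)
  also have "\<dots> \<longleftrightarrow> (\<exists>h. coord_algebra_iso (Suc n) P.cmul (\<psi> \<one>\<^bsub>R\<^esub>) Q.cmul (\<psi>' \<one>\<^bsub>R'\<^esub>) h)"
    using iso_imp_equiv[OF P.based[OF A(2)] Q.based[OF A'(2)]] equiv_imp_iso[OF P.based[OF A(2)] Q.based[OF A'(2)]] by blast
  finally show ?thesis using algebra_iso_rel_iff[OF A(1) A'(1)] by simp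
qed

text \<open>The operations are transported along the injection \<open>\<iota>\<close> into the
  prescribed carrier type, and its inverse \<open>\<psi>\<close> provides the linear
  coordinates.\<close>

lemma algebra_from_coords:
  assumes A: "local_coord_algebra (Suc n) mul e" and inj: "inj_on (\<iota> :: coords \<Rightarrow> 'a) (coord_space (Suc n))"
  shows "\<exists>(R :: (Qbar, 'a) module) \<psi>. local_algebra_coords R n \<psi> \<and>
    coordinatized_algebra.cmul R (Suc n) \<psi> = mul \<and> \<psi> \<one>\<^bsub>R\<^esub> = e"
proof -
  interpret M: local_coord_algebra "Suc n" mul e by (rule A)
  let ?V = "coord_space (Suc n)"
  define \<psi> where "\<psi> = inv_into ?V \<iota>"
  have \<psi>: "\<psi> (\<iota> v) = v" if "v \<in> ?V" for v unfolding \<psi>_def by (rule inv_into_f_f[OF inj that])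
  define R :: "(Qbar, 'a) module" where
    "R = \<lparr>carrier = \<iota> ` ?V, monoid.mult = (\<lambda>x y. \<iota> (mul (\<psi> x) (\<psi> y))), one = \<iota> e, ring.zero = \<iota> 0,
      ring.add = (\<lambda>x y. \<iota> (\<psi> x + \<psi> y)), module.smult = (\<lambda>c x. \<iota> (c *\<^sub>c \<psi> x))\<rparr>"
  note closed = coord_space_closed[where k = "Suc n"]
  have ops: "carrier R = \<iota> ` ?V" "\<one>\<^bsub>R\<^esub> = \<iota> e" "\<zero>\<^bsub>R\<^esub> = \<iota> 0"
    "\<And>x y. x \<otimes>\<^bsub>R\<^esub> y = \<iota> (mul (\<psi> x) (\<psi> y))" "\<And>x y. x \<oplus>\<^bsub>R\<^esub> y = \<iota> (\<psi> x + \<psi> y)" "\<And>c x. c \<odot>\<^bsub>R\<^esub> x = \<iota> (c *\<^sub>c \<psi> x)"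
    by (simp_all add: R_def)
  have \<psi>V: "\<psi> x \<in> ?V" "\<iota> (\<psi> x) = x" if "x \<in> \<iota> ` ?V" for x using that \<psi> by auto
  have inR: "\<iota> v \<in> \<iota> ` ?V" if "v \<in> ?V" for v using that by blast
  note ss = \<psi> \<psi>V inR closed
  have cring: "cring R"
  proof (rule cringI)
    show "abelian_group R"
    proof (rule abelian_groupI)
      fix x assume x: "x \<in> carrier R"
      show "\<exists>y\<in>carrier R. y \<oplus>\<^bsub>R\<^esub> x = \<zero>\<^bsub>R\<^esub>"
      proof
        have x': "x \<in> \<iota> ` ?V" using x by (simp add: ops)
        have m: "(- 1) *\<^sub>c \<psi> x \<in> ?V" by (intro closed \<psi>V x')
        show "\<iota> ((- 1) *\<^sub>c \<psi> x) \<in> carrier R" using inR[OF m] by (simp only: ops)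
        have "(- 1) *\<^sub>c \<psi> x + \<psi> x = 0" by simp
        then show "\<iota> ((- 1) *\<^sub>c \<psi> x) \<oplus>\<^bsub>R\<^esub> x = \<zero>\<^bsub>R\<^esub>" unfolding ops \<psi>[OF m] by (rule arg_cong)
      qed
    qed (auto simp: ops ss add.assoc add.commute add.left_commute)
    show "comm_monoid R"
      by (rule comm_monoidI) (auto simp: ops ss M.mul_ac)
  qed (auto simp: ops ss M.mul_add_left)
  have "algebra (ring_of_type_algebra :: Qbar ring) R"
  proof (rule algebraI)
    show "cring (ring_of_type_algebra :: Qbar ring)" by (rule cring_from_type_algebra)
    show "cring R" by (rule cring)
  qed (auto simp: ring_of_type_algebra_def ops ss cv.scale_left_distrib cv.scale_right_distrib M.mul_smul_left)
  moreover have "linear_coords (Suc n) R \<psi>"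
    unfolding linear_coords_def
  proof (intro conjI ballI allI)
    show "bij_betw \<psi> (carrier R) ?V" unfolding \<psi>_def ops by (rule bij_betw_inv_into) (rule inj_on_imp_bij_betw[OF inj])
    fix r s assume "r \<in> carrier R" "s \<in> carrier R"
    then show "\<psi> (r \<oplus>\<^bsub>R\<^esub> s) = vadd (\<psi> r) (\<psi> s)" by (simp add: ops ss) (simp add: plus_fun_def)
  next
    fix c r assume "r \<in> carrier R"
    then show "\<psi> (c \<odot>\<^bsub>R\<^esub> r) = (\<lambda>i. c * \<psi> r i)" by (simp add: ops ss) (simp add: smul_def)
  qed
  ultimately have ca: "coordinatized_algebra R (Suc n) \<psi>"
    by (intro coordinatized_algebra.intro qbar_algebra.intro coordinatized_algebra_axioms.intro)
  then interpret C: coordinatized_algebra R "Suc n" \<psi> .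
  have \<chi>: "C.\<chi> v = \<iota> v" if "v \<in> ?V" for v using C.\<chi>_\<psi>[of "\<iota> v"] that by (simp add: ops ss)
  have "C.cmul u w = mul (trunc (Suc n) u) (trunc (Suc n) w)" for u w
    unfolding C.cmul_def using trunc_in[of "Suc n"] by (simp add: \<chi> ops ss)
  then have cmul: "C.cmul = mul" by (intro ext) (metis M.mul_trunc M.mul_comm)
  have one: "\<psi> \<one>\<^bsub>R\<^esub> = e" by (simp add: ops ss)
  have "local_algebra_coords R n \<psi>"
    by (intro local_algebra_coords.intro ca local_algebra_coords_axioms.intro) (simp add: cmul one A)
  then show ?thesis using cmul one by blast
qed

text \<open>Every algebraic number is a root of one of countably many nonzero rational polynomials,
  each of which has finitely many roots.\<close>

lemma countable_Qbar: "countable (UNIV :: Qbar set)"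
proof -
  have "(UNIV :: Qbar set) = (\<Union>cs\<in>{cs :: rat list. Poly cs \<noteq> 0}. {x. poly (map_poly to_ac (Poly cs)) x = 0})"
  proof (intro equalityI subsetI)
    fix x :: Qbar
    obtain p where p: "p \<noteq> 0" "poly (map_poly to_ac p) x = 0" using alg_closure_algebraic[of x] by blast
    then show "x \<in> (\<Union>cs\<in>{cs :: rat list. Poly cs \<noteq> 0}. {x. poly (map_poly to_ac (Poly cs)) x = 0})"
      by (intro UN_I[of "coeffs p"]) simp_all
  qed simp
  moreover have "countable {x. poly (map_poly to_ac (Poly cs)) x = (0 :: Qbar)}" if "Poly cs \<noteq> 0" for cs :: "rat list"
    using that by (intro countable_finite poly_roots_finite) (simp add: map_poly_eq_0_iff)
  ultimately show ?thesis by (metis (mono_tags, lifting) countable_UN countableI_type mem_Collect_eq)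
qed

text \<open>Countability of the field makes the coordinate space countable, and a countable set
  embeds into every infinite type; this is where the assumption on the carrier type enters.\<close>

lemma coord_space_embedding:
  assumes "infinite (UNIV :: 'a set)"
  shows "\<exists>\<iota> :: coords \<Rightarrow> 'a. inj_on \<iota> (coord_space k)"
proof -
  have "inj_on (\<lambda>v. map v [0..<k]) (coord_space k)"
  proof (rule inj_onI)
    fix v w assume "v \<in> coord_space k" "w \<in> coord_space k" "map v [0..<k] = map w [0..<k]"
    then show "v = w" by (intro coord_space_eqI[of _ k]) auto
  qed
  moreover have "countable ((\<lambda>v. map v [0..<k]) ` coord_space k)"
    using countable_subset[OF subset_UNIV] countable_lists[OF countable_Qbar] by simp
  ultimately have c: "countable (coord_space k)" by (rule countable_image_inj_on[rotated])
  obtain g :: "nat \<Rightarrow> 'a" where g: "inj g" using infinite_countable_subset[OF assms] by (elim exE conjE)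
  have "inj_on (\<lambda>v. g (to_nat_on (coord_space k) v)) (coord_space k)"
    using comp_inj_on[OF inj_on_to_nat_on[OF c] inj_on_subset[OF g subset_UNIV]] by (simp add: comp_def)
  then show ?thesis by blast
qed

theorem proposition2p15:
  fixes l :: nat
  assumes "1 \<le> l"
    and "infinite (UNIV :: 'a set)"
  shows "\<exists>\<Phi>. bij_betw \<Phi>
           ((artinian_local_algebras l :: (Qbar, 'a) module set) // algebra_iso_rel l)
           (Ga_structures (l - 1) (l - 1) // Ga_equiv (l - 1) (l - 1)) \<and>
         (\<forall>R \<in> artinian_local_algebras l. \<forall>S \<psi>.
            max_ideal_basis R S \<and> linear_coords l R \<psi> \<longrightarrow>
            exp_action R S \<psi> \<in> Ga_structures (l - 1) (l - 1) \<and>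
            \<Phi> (algebra_iso_rel l `` {R}) = Ga_equiv (l - 1) (l - 1) `` {exp_action R S \<psi>})"
proof -
  obtain n where l: "l = Suc n" "l - 1 = n" using assms(1) by (cases l) auto
  let ?A = "artinian_local_algebras (Suc n) :: (Qbar, 'a) module set"
  let ?r = "algebra_iso_rel (Suc n) :: ((Qbar, 'a) module \<times> (Qbar, 'a) module) set"
  let ?G = "Ga_structures n n" let ?E = "Ga_equiv n n"
  have lac: "local_algebra_coords R n \<psi>" if "R \<in> ?A" "linear_coords (Suc n) R \<psi>" for R \<psi>
    using artinian_local_coords[OF that] by blast
  have "\<forall>R\<in>?A. \<exists>S. \<exists>\<psi>. max_ideal_basis R S \<and> linear_coords (Suc n) R \<psi>"
    using artinian_local_coords_exist local_algebra_coords.max_ideal_basis_exists lac by metis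
  then obtain \<sigma> where "\<forall>R\<in>?A. \<exists>\<psi>. max_ideal_basis R (\<sigma> R) \<and> linear_coords (Suc n) R \<psi>" by metis
  then obtain \<pi> where "\<forall>R\<in>?A. max_ideal_basis R (\<sigma> R) \<and> linear_coords (Suc n) R (\<pi> R)" by metis
  then have choice: "max_ideal_basis R (\<sigma> R)" "local_algebra_coords R n (\<pi> R)" if "R \<in> ?A" for R
    using that lac by blast+
  \<comment> \<open>One basis and one system of coordinates are fixed for every algebra;
    \<open>F_iff\<close>, which compares with arbitrary ones, removes the dependence on this
    choice.\<close>
  define F where "F R = exp_action R (\<sigma> R) (\<pi> R)" for R
  have F_iff: "(F R, exp_action R' S \<psi>) \<in> ?E \<longleftrightarrow> (R, R') \<in> ?r"
    if "R \<in> ?A" "local_algebra_coords R' n \<psi>" "max_ideal_basis R' S" for R R' S \<psi>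
    unfolding F_def using exp_action_equiv_iff[OF choice(2,1)[OF that(1)] that(2,3)] .
  have FG: "F R \<in> ?G" if "R \<in> ?A" for R
    unfolding F_def using exp_action_structure(1)[OF choice(2,1)[OF that]] .
  have r_refl: "(R, R) \<in> ?r" if "R \<in> ?A" for R
    using equiv_algebra_iso[of "Suc n"] that by (meson equivE refl_onD)
  define \<Phi> where "\<Phi> C = (\<Union>R\<in>C. ?E `` {F R})" for C
  have "congruent ?r (\<lambda>R. ?E `` {F R})"
  proof (rule congruentI)
    fix R R' assume rr: "(R, R') \<in> ?r"
    then have RA: "R \<in> ?A" "R' \<in> ?A" by (auto simp: algebra_iso_rel_def)
    have "(F R, F R') \<in> ?E" using F_iff[OF RA(1) choice(2,1)[OF RA(2)]] rr by (simp add: F_def)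
    then show "?E `` {F R} = ?E `` {F R'}" by (rule equiv_class_eq[OF equiv_Ga])
  qed
  then have \<Phi>: "\<Phi> (?r `` {R}) = ?E `` {F R}" if "R \<in> ?A" for R
    unfolding \<Phi>_def using UN_equiv_class[OF equiv_algebra_iso _ that] by blast
  have "bij_betw \<Phi> (?A // ?r) (?G // ?E)"
  proof (rule bij_betw_imageI)
    show "inj_on \<Phi> (?A // ?r)"
    proof (rule inj_onI)
      fix C C' assume "C \<in> ?A // ?r" "C' \<in> ?A // ?r" and e: "\<Phi> C = \<Phi> C'"
      then obtain R R' where R: "R \<in> ?A" "C = ?r `` {R}" "R' \<in> ?A" "C' = ?r `` {R'}"
        by (auto elim!: quotientE)
      then have "?E `` {F R} = ?E `` {F R'}" using e \<Phi> by simp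
      then have "(F R, F R') \<in> ?E" using eq_equiv_class_iff[OF equiv_Ga FG FG] R by simp
      then have "(R, R') \<in> ?r" using F_iff[OF R(1) choice(2,1)[OF R(3)]] by (simp add: F_def)
      then show "C = C'" using equiv_class_eq[OF equiv_algebra_iso] R by blast
    qed
    show "\<Phi> ` (?A // ?r) = ?G // ?E"
    proof (intro equalityI subsetI)
      fix D assume "D \<in> \<Phi> ` (?A // ?r)"
      then obtain R where "R \<in> ?A" "D = \<Phi> (?r `` {R})" by (auto elim!: quotientE)
      then show "D \<in> ?G // ?E" using \<Phi> FG by (auto intro: quotientI)
    next
      fix D assume "D \<in> ?G // ?E"
      then obtain act where act: "act \<in> ?G" "D = ?E `` {act}" by (auto elim!: quotientE)
      from structure_is_eact[OF act(1)] obtain mul e T where M: "based_coord_algebra n mul e T"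
        and eq: "\<And>x L. x \<in> coord_space n \<Longrightarrow> L \<in> proj_points n \<Longrightarrow> act x L = based_coord_algebra.eact n mul e T x L"
        by (elim exE conjE) blast
      \<comment> \<open>The algebra found on the coordinate space is copied into the type
        \<open>'a\<close>, so that it counts among the algebras being classified.\<close>
      obtain \<iota> :: "coords \<Rightarrow> 'a" where "inj_on \<iota> (coord_space (Suc n))"
        using coord_space_embedding[OF assms(2)] by blast
      from algebra_from_coords[OF based_coord_algebra.axioms(1)[OF M] this]
      obtain R :: "(Qbar, 'a) module" and \<psi> where R: "local_algebra_coords R n \<psi>"
        "coordinatized_algebra.cmul R (Suc n) \<psi> = mul" "\<psi> \<one>\<^bsub>R\<^esub> = e" by (elim exE conjE)
      have RA: "R \<in> ?A" by (rule local_algebra_coords.artinian_local[OF R(1)])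
      obtain S where S: "max_ideal_basis R S" using choice(1)[OF RA] by blast
      \<comment> \<open>The basis \<open>T\<close> found together with the action and the basis
        \<open>S\<close> of the copied algebra may differ; the identity map of the algebra makes
        their actions equivalent.\<close>
      have "coord_algebra_iso (Suc n) mul e mul e (\<lambda>v. v)"
        by (simp add: coord_algebra_iso_def linear_on_def bij_betw_def)
      then have "(based_coord_algebra.eact n mul e T, based_coord_algebra.eact n mul e (\<lambda>i. \<psi> (S ! i))) \<in> ?E"
        using iso_imp_equiv[OF M] local_algebra_coords.based[OF R(1) S] unfolding R(2,3) by blast
      moreover have "(based_coord_algebra.eact n mul e (\<lambda>i. \<psi> (S ! i)), exp_action R S \<psi>) \<in> ?E"
        using exp_action_structure(2)[OF R(1) S] unfolding R(2,3) .
      moreover have "(based_coord_algebra.eact n mul e T, act) \<in> ?E"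
        by (rule Ga_structures_cong(2)[OF based_coord_algebra.eact_structure[OF M] eq])
      moreover have "(F R, exp_action R S \<psi>) \<in> ?E" using F_iff[OF RA R(1) S] r_refl[OF RA] by simp
      ultimately have "(F R, act) \<in> ?E" using equiv_Ga[of n n] by (meson equivE symD transD)
      then have "D = \<Phi> (?r `` {R})" unfolding \<Phi>[OF RA] act(2) by (rule equiv_class_eq[OF equiv_Ga, symmetric])
      then show "D \<in> \<Phi> ` (?A // ?r)" using quotientI[OF RA] by blast
    qed
  qed
  moreover have "exp_action R S \<psi> \<in> ?G \<and> \<Phi> (?r `` {R}) = ?E `` {exp_action R S \<psi>}"
    if "R \<in> ?A" "max_ideal_basis R S" "linear_coords (Suc n) R \<psi>" for R S \<psi>
  proof -
    note c = lac[OF that(1,3)]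
    have "(F R, exp_action R S \<psi>) \<in> ?E" using F_iff[OF that(1) c that(2)] r_refl[OF that(1)] by simp
    then show ?thesis using \<Phi>[OF that(1)] equiv_class_eq[OF equiv_Ga] exp_action_structure(1)[OF c that(2)] by metis
  qed
  ultimately show ?thesis unfolding l(2) unfolding l(1) by blast
qed

end
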